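(* Let $P$ be a finite naturally labeled poset with $\operatorname{sh}(P)=(\lambda_1,2,1,1,\dots,1)$ (nearly hook shaped). Then $P$ is uniquely determined by $K_P(\mathbf{x})$: if $Q$ is a finite naturally labeled poset with $K_Q(\mathbf{x})=K_P(\mathbf{x})$, then $Q\cong P$.
   Context: A poset $(P,\preceq)$ on ground set $[n]=\{1,\dots,n\}$ is naturally labeled if $x\preceq y$ implies $x\le y$ as integers. For such $P$, the $P$-partition generating function is $K_P(\mathbf{x})=\sum_{\sigma}\prod_{p\in P}x_{\sigma(p)}$, the sum over all maps $\sigma:P\to\mathbb{Z}^+$ with $\sigma(x)\le\sigma(y)$ whenever $x\preceq y$. The shape $\operatorname{sh}(P)$ is the partition $\lambda$ whose conjugate $\lambda'$ satisfies $\lambda'_1+\cdots+\lambda'_i=a_i$ for all $i$, where $a_i$ is the maximum number of elements in a union of $i$ antichains of $P$. *)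

theory Defs
  imports "HOL-Library.FuncSet" "HOL-Library.Multiset" "HOL-Library.Poly_Mapping"
begin

text \<open>A poset on the ground set \<open>{1..n}\<close> is given by its reflexive order relation.\<close>

definition naturally_labeled :: "nat \<Rightarrow> (nat \<times> nat) set \<Rightarrow> bool" where
  "naturally_labeled n P \<longleftrightarrow> partial_order_on {1..n} P \<and> (\<forall>(x, y)\<in>P. x \<le> y)"

definition poset_isomorphic :: "nat \<Rightarrow> (nat \<times> nat) set \<Rightarrow> nat \<Rightarrow> (nat \<times> nat) set \<Rightarrow> bool" where
  "poset_isomorphic m Q n P \<longleftrightarrow>
     (\<exists>f. bij_betw f {1..m} {1..n} \<and>
          (\<forall>x\<in>{1..m}. \<forall>y\<in>{1..m}. (x, y) \<in> Q \<longleftrightarrow> (f x, f y) \<in> P))"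

definition P_partitions :: "nat \<Rightarrow> (nat \<times> nat) set \<Rightarrow> (nat \<Rightarrow> nat) set" where
  "P_partitions n P = {\<sigma> \<in> {1..n} \<rightarrow>\<^sub>E {1..}. \<forall>(x, y)\<in>P. \<sigma> x \<le> \<sigma> y}"

text \<open>A monomial in the variables \<open>x\<^sub>1, x\<^sub>2, \<dots>\<close> is represented by its finitely supported
  exponent function, so multiplication of monomials is addition; a formal power series is
  represented by the function sending each monomial to its coefficient.\<close>

definition sigma_monomial :: "nat \<Rightarrow> (nat \<Rightarrow> nat) \<Rightarrow> (nat \<Rightarrow>\<^sub>0 nat)" where
  "sigma_monomial n \<sigma> = (\<Sum>p\<in>{1..n}. Poly_Mapping.single (\<sigma> p) 1)"

definition K_gf :: "nat \<Rightarrow> (nat \<times> nat) set \<Rightarrow> (nat \<Rightarrow>\<^sub>0 nat) \<Rightarrow> int" where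
  "K_gf n P = (\<lambda>\<mu>. int (card {\<sigma> \<in> P_partitions n P. sigma_monomial n \<sigma> = \<mu>}))"

text \<open>The cardinality in \<^const>\<open>K_gf\<close> is that of a finite set.\<close>

lemma finite_P_partitions_monomial:
  "finite {\<sigma> \<in> P_partitions n P. sigma_monomial n \<sigma> = \<mu>}"
proof (rule finite_subset)
  show "finite ({1..n} \<rightarrow>\<^sub>E Poly_Mapping.keys \<mu>)"
    by (intro finite_PiE) auto
  show "{\<sigma> \<in> P_partitions n P. sigma_monomial n \<sigma> = \<mu>} \<subseteq> {1..n} \<rightarrow>\<^sub>E Poly_Mapping.keys \<mu>"
  proof
    fix \<sigma> assume "\<sigma> \<in> {\<sigma> \<in> P_partitions n P. sigma_monomial n \<sigma> = \<mu>}"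
    then have s: "\<sigma> \<in> {1..n} \<rightarrow>\<^sub>E {1..}" and \<mu>: "\<mu> = sigma_monomial n \<sigma>"
      by (auto simp: P_partitions_def)
    have "\<sigma> p \<in> Poly_Mapping.keys \<mu>" if "p \<in> {1..n}" for p
    proof -
      have "(1::nat) = Poly_Mapping.lookup (Poly_Mapping.single (\<sigma> p) 1) (\<sigma> p)"
        by simp
      also have "\<dots> \<le> (\<Sum>q\<in>{1..n}. Poly_Mapping.lookup (Poly_Mapping.single (\<sigma> q) 1) (\<sigma> p))"
        using that by (intro member_le_sum) auto
      also have "\<dots> = Poly_Mapping.lookup \<mu> (\<sigma> p)"
        by (simp add: \<mu> sigma_monomial_def lookup_sum)
      finally show ?thesis
        by (simp add: in_keys_iff)
    qed
    then show "\<sigma> \<in> {1..n} \<rightarrow>\<^sub>E Poly_Mapping.keys \<mu>"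
      using s by (auto simp: PiE_iff)
  qed
qed

definition antichain :: "nat \<Rightarrow> (nat \<times> nat) set \<Rightarrow> nat set \<Rightarrow> bool" where
  "antichain n P A \<longleftrightarrow> A \<subseteq> {1..n} \<and> (\<forall>x\<in>A. \<forall>y\<in>A. (x, y) \<in> P \<longrightarrow> x = y)"

definition max_antichain_union :: "nat \<Rightarrow> (nat \<times> nat) set \<Rightarrow> nat \<Rightarrow> nat" where
  "max_antichain_union n P i = Max {card (\<Union>j<i. A j) | A. \<forall>j<i. antichain n P (A j)}"

definition is_partition :: "nat list \<Rightarrow> bool" where
  "is_partition lam \<longleftrightarrow> sorted_wrt (\<ge>) lam \<and> (\<forall>x\<in>set lam. 0 < x)"

definition conjugate_part :: "nat list \<Rightarrow> nat \<Rightarrow> nat" where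
  "conjugate_part lam i = length (filter (\<lambda>x. i \<le> x) lam)"

text \<open>The shape is introduced as a relation, so that it can be used without first proving that
  a partition with the defining property exists (a theorem of Greene); it is unique, see
  \<open>has_shape_unique\<close> below.\<close>

definition has_shape :: "nat \<Rightarrow> (nat \<times> nat) set \<Rightarrow> nat list \<Rightarrow> bool" where
  "has_shape n P lam \<longleftrightarrow> is_partition lam \<and>
     (\<forall>i. (\<Sum>j=1..i. conjugate_part lam j) = max_antichain_union n P i)"

lemma finite_antichain_union_cards:
  fixes i :: nat
  shows "finite {card (\<Union>j<i. A j) | A. \<forall>j<i. antichain n P (A j)}"
proof (rule finite_subset)
  show "finite {..n}" by simp
  show "{card (\<Union>j<i. A j) | A. \<forall>j<i. antichain n P (A j)} \<subseteq> {..n}"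
  proof clarsimp
    fix A :: "nat \<Rightarrow> nat set"
    assume "\<forall>j<i. antichain n P (A j)"
    then have "(\<Union>j<i. A j) \<subseteq> {1..n}"
      by (auto simp: antichain_def)
    then show "card (\<Union>j<i. A j) \<le> n"
      using card_mono[of "{1..n}"] by fastforce
  qed
qed

lemma partition_eqI:
  assumes "is_partition lam" "is_partition mu"
    and "\<And>i. i \<ge> 1 \<Longrightarrow> conjugate_part lam i = conjugate_part mu i"
  shows "lam = mu"
proof -
  have c: "conjugate_part xs i = count (mset xs) i + conjugate_part xs (Suc i)" for xs i
    by (induction xs) (auto simp: conjugate_part_def)
  have "mset lam = mset mu"
  proof (rule multiset_eqI)
    fix i show "count (mset lam) i = count (mset mu) i"
    proof (cases "i = 0")
      case True
      then have "i \<notin> set lam" "i \<notin> set mu"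
        using assms(1,2) by (auto simp: is_partition_def)
      then show ?thesis
        by (metis count_eq_zero_iff set_mset_mset)
    next
      case False
      then show ?thesis
        using c[of lam i] c[of mu i] assms(3)[of i] assms(3)[of "Suc i"] by simp
    qed
  qed
  moreover have "sorted (rev lam)" "sorted (rev mu)"
    using assms(1,2) by (simp_all add: is_partition_def sorted_wrt_rev)
  ultimately have "rev lam = rev mu"
    by (metis mset_rev properties_for_sort)
  then show ?thesis by simp
qed

lemma has_shape_unique:
  assumes "has_shape n P lam" "has_shape n P mu"
  shows "lam = mu"
proof (rule partition_eqI)
  show "is_partition lam" "is_partition mu"
    using assms by (auto simp: has_shape_def)
  fix i :: nat assume "i \<ge> 1"
  then obtain k where i: "i = Suc k" by (cases i) auto
  have "(\<Sum>j=1..Suc k. conjugate_part lam j) = (\<Sum>j=1..Suc k. conjugate_part mu j)"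
       "(\<Sum>j=1..k. conjugate_part lam j) = (\<Sum>j=1..k. conjugate_part mu j)"
    using assms by (simp_all only: has_shape_def)
  then show "conjugate_part lam i = conjugate_part mu i"
    by (simp add: i)
qed

end

(* The coefficients of K_P count flags of order ideals with prescribed block sizes; signed sums of
   these also give the flags in which chosen blocks are antichains.  This data determines, for
   every pair i, j, the flag counts of the elements of rank > i and corank > j, the distribution
   of the numbers of elements above and below, and the part below and above the lowest maximum
   antichain A.  For a nearly hook shape, n = l + |A| with l the length of a longest chain; up to
   duality some longest chain contains everything below A, and then P consists of a chain below A,
   a chain above A and one additional element X.  Such posets are described by the positions of X
   and of the elements of A, and the flag counts determine these positions, up to one exceptional
   symmetry that exchanges X with an element of the upper chain. *)
theory Submission
  imports Defs
begin



text \<open>The obstacle is that the number of elements above an element of \<open>A\<close> does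
  not show whether \<open>X\<close> is among them: lying below \<open>X\<close> and entering the
  upper chain one step later gives the same number. Deleting all layers from the top down to the one
  of \<open>X\<close> makes the count blind to \<open>X\<close>, and comparing both counts settles
  the classes of antichain elements one after the other, up to the height of \<open>X\<close>. There
  the comparison ends, and for every lower position two classes are known only by their sum: those
  with \<open>t = \<tau> - 1\<close> not below \<open>X\<close> and those with
  \<open>t = \<tau>\<close> below \<open>X\<close>, where \<open>\<tau>\<close> is the number of
  elements \<open>U j\<close> not above \<open>X\<close>. The missing equation is quadratic: it
  comes from putting single antichain elements back under a truncated poset and counting filters of
  three elements. In the case that this leaves undecided, \<open>X\<close> and
  \<open>U \<tau>\<close> have the same relations to both chains, second moments fix the differences
  of the two class sizes up to a common sign, and the wrong sign is exactly the exchange of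
  \<open>X\<close> with \<open>U \<tau>\<close>.\<close>

section \<open>Flags of order ideals and their duality\<close>

definition down_closed :: "('a \<Rightarrow> 'a \<Rightarrow> bool) \<Rightarrow> 'a set \<Rightarrow> 'a set \<Rightarrow> bool" where
  "down_closed r V I \<longleftrightarrow> I \<subseteq> V \<and> (\<forall>x\<in>I. \<forall>y\<in>V. r y x \<longrightarrow> y \<in> I)"

definition unrelated :: "('a \<Rightarrow> 'a \<Rightarrow> bool) \<Rightarrow> 'a set \<Rightarrow> bool" where
  "unrelated r I \<longleftrightarrow> (\<forall>x\<in>I. \<forall>y\<in>I. \<not> r x y)"

definition blocks :: "('a \<Rightarrow> 'a \<Rightarrow> bool) \<Rightarrow> 'a set \<Rightarrow> nat \<Rightarrow> bool \<Rightarrow> 'a set set" where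
  "blocks r V k b = {I. down_closed r V I \<and> card I = k \<and> (b \<longrightarrow> unrelated r I)}"

text \<open>With all marks \<open>False\<close> this is a coefficient of the generating function:
  the blocks are the fibres of an order-preserving map. A mark \<open>True\<close> forces the fibre
  to be an antichain. The relation stays fixed and only the ground set shrinks, so that layers,
  ideals and filters of one poset can all be treated as ground sets.\<close>

fun flags :: "('a \<Rightarrow> 'a \<Rightarrow> bool) \<Rightarrow> 'a set \<Rightarrow> (nat \<times> bool) list \<Rightarrow> nat" where
  "flags r V [] = (if V = {} then 1 else 0)"
| "flags r V ((k, b) # w) = (\<Sum>I\<in>blocks r V k b. flags r (V - I) w)"

definition flag_equiv :: "('a \<Rightarrow> 'a \<Rightarrow> bool) \<Rightarrow> 'a set \<Rightarrow> ('b \<Rightarrow> 'b \<Rightarrow> bool) \<Rightarrow> 'b set \<Rightarrow> bool" where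
  "flag_equiv r V s W \<longleftrightarrow> (\<forall>w. flags r V w = flags s W w)"

lemma blocks_subset: "I \<in> blocks r V k b \<Longrightarrow> I \<subseteq> V"
  by (auto simp: blocks_def down_closed_def)

lemma finite_blocks [simp]: "finite V \<Longrightarrow> finite (blocks r V k b)"
  by (rule finite_subset[of _ "Pow V"]) (auto dest: blocks_subset)

lemma card_Diff_block: "finite V \<Longrightarrow> I \<in> blocks r V k b \<Longrightarrow> card (V - I) + k = card V"
  using blocks_subset[of I r V k b] card_mono[of V I]
  by (auto simp: blocks_def card_Diff_subset finite_subset)

lemma flags_empty_size: "finite V \<Longrightarrow> flags r V w \<noteq> 0 \<Longrightarrow> card V = sum_list (map fst w)"
proof (induction w arbitrary: V)
  case Nil
  then show ?case by (auto split: if_splits)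
next
  case (Cons a w)
  obtain k b where a: "a = (k, b)" by (cases a)
  from Cons.prems(2) obtain I where I: "I \<in> blocks r V k b" "flags r (V - I) w \<noteq> 0"
    unfolding a using sum.not_neutral_contains_not_neutral by fastforce
  then show ?case
    using Cons.IH[of "V - I"] Cons.prems(1) card_Diff_block[OF Cons.prems(1) I(1)] by (simp add: a)
qed

text \<open>An ideal and a filter disjoint from it do not constrain each other, so they may be
  removed in either order. This allows a flag to be read from its last block, and yields the duality
  of flag counts.\<close>

lemma block_pair_dual:
  "I \<in> blocks r V j c \<and> F \<in> blocks (\<lambda>x y. r y x) (V - I) k b \<longleftrightarrow>
   F \<in> blocks (\<lambda>x y. r y x) V k b \<and> I \<in> blocks r (V - F) j c"
proof -
  have "down_closed r V I \<and> down_closed (\<lambda>x y. r y x) (V - I) F \<longleftrightarrow>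
        down_closed (\<lambda>x y. r y x) V F \<and> down_closed r (V - F) I"
    unfolding down_closed_def by blast
  then show ?thesis
    unfolding blocks_def unrelated_def by blast
qed

lemma flags_snoc:
  assumes "finite V"
  shows "flags r V (w @ [(k, b)]) = (\<Sum>F\<in>blocks (\<lambda>x y. r y x) V k b. flags r (V - F) w)"
  using assms
proof (induction w arbitrary: V)
  case Nil
  have "V - I = {} \<longleftrightarrow> I = V" if "I \<in> blocks q V k b" for I and q :: "'a \<Rightarrow> 'a \<Rightarrow> bool"
    using blocks_subset[OF that] by auto
  then have *: "(\<Sum>I\<in>blocks q V k b. flags r (V - I) []) = (if V \<in> blocks q V k b then 1 else 0)"
    for q :: "'a \<Rightarrow> 'a \<Rightarrow> bool"
    using Nil by (simp add: sum.delta cong: sum.cong)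
  have "V \<in> blocks r V k b \<longleftrightarrow> V \<in> blocks (\<lambda>x y. r y x) V k b"
    by (auto simp: blocks_def down_closed_def unrelated_def)
  then show ?case
    using * by simp
next
  case (Cons a w)
  obtain j c where a: "a = (j, c)" by (cases a)
  have "flags r V ((a # w) @ [(k, b)]) =
        (\<Sum>I\<in>blocks r V j c. \<Sum>F\<in>blocks (\<lambda>x y. r y x) (V - I) k b. flags r (V - I - F) w)"
    using Cons by (simp add: a)
  also have "\<dots> = (\<Sum>(I, F)\<in>(SIGMA I:blocks r V j c. blocks (\<lambda>x y. r y x) (V - I) k b). flags r (V - I - F) w)"
    using Cons.prems by (subst sum.Sigma) auto
  also have "\<dots> = (\<Sum>(F, I)\<in>(SIGMA F:blocks (\<lambda>x y. r y x) V k b. blocks r (V - F) j c). flags r (V - F - I) w)"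
  proof (rule sum.reindex_bij_witness[of _ prod.swap prod.swap])
    fix p assume "p \<in> (SIGMA I:blocks r V j c. blocks (\<lambda>x y. r y x) (V - I) k b)"
    then show "prod.swap p \<in> (SIGMA F:blocks (\<lambda>x y. r y x) V k b. blocks r (V - F) j c)"
      using block_pair_dual[of "fst p" r V j c "snd p" k b] by (cases p) simp
  next
    fix p assume "p \<in> (SIGMA F:blocks (\<lambda>x y. r y x) V k b. blocks r (V - F) j c)"
    then show "prod.swap p \<in> (SIGMA I:blocks r V j c. blocks (\<lambda>x y. r y x) (V - I) k b)"
      using block_pair_dual[of "snd p" r V j c "fst p" k b] by (cases p) simp
  qed (simp_all add: split_beta Un_commute Diff_eq Int_assoc Int_commute[of "- fst p" "- snd p" for p])
  also have "\<dots> = (\<Sum>F\<in>blocks (\<lambda>x y. r y x) V k b. \<Sum>I\<in>blocks r (V - F) j c. flags r (V - F - I) w)"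
    using Cons.prems by (subst sum.Sigma) auto
  finally show ?case by (simp add: a)
qed

lemma flags_dual: "finite V \<Longrightarrow> flags (\<lambda>x y. r y x) V (rev w) = flags r V w"
proof (induction w arbitrary: V)
  case (Cons a w)
  obtain k b where "a = (k, b)" by (cases a)
  then show ?case
    using Cons flags_snoc[of V "(\<lambda>x y. r y x)" "rev w" k b] by simp
qed simp

lemma flag_equiv_dual:
  assumes "flag_equiv r V s W" "finite V" "finite W"
  shows "flag_equiv (\<lambda>x y. r y x) V (\<lambda>x y. s y x) W"
  using assms flags_dual[of V r "rev w" for w] flags_dual[of W s "rev w" for w]
  unfolding flag_equiv_def by (metis rev_rev_ident)

lemma flags_bij:
  assumes "bij_betw f V W" "\<And>x y. x \<in> V \<Longrightarrow> y \<in> V \<Longrightarrow> r x y \<longleftrightarrow> s (f x) (f y)"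
  shows "flags r V w = flags s W w"
  using assms
proof (induction w arbitrary: V W)
  case Nil
  then show ?case by (auto simp: bij_betw_def)
next
  case (Cons a w)
  obtain k b where a: "a = (k, b)" by (cases a)
  have inj: "inj_on f V" and W: "W = f ` V"
    using Cons.prems(1) by (auto simp: bij_betw_def)
  have blk: "f ` I \<in> blocks s W k b \<longleftrightarrow> I \<in> blocks r V k b" if "I \<subseteq> V" for I
  proof -
    have "down_closed s W (f ` I) \<longleftrightarrow> down_closed r V I"
    proof -
      have *: "f y \<in> f ` I \<longleftrightarrow> y \<in> I" if "y \<in> V" for y
        using that \<open>I \<subseteq> V\<close> inj by (simp add: inj_on_image_mem_iff)
      have "(\<forall>x\<in>I. \<forall>y\<in>V. s (f y) (f x) \<longrightarrow> f y \<in> f ` I) \<longleftrightarrow> (\<forall>x\<in>I. \<forall>y\<in>V. r y x \<longrightarrow> y \<in> I)"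
        using Cons.prems(2) * that by (intro ball_cong refl) (auto dest: subsetD)
      then show ?thesis
        using that unfolding down_closed_def W by (simp add: image_mono)
    qed
    moreover have "unrelated s (f ` I) \<longleftrightarrow> unrelated r I"
      using that Cons.prems(2) unfolding unrelated_def by (auto simp: subset_iff)
    moreover have "card (f ` I) = card I"
      using that inj by (meson card_image inj_on_subset)
    ultimately show ?thesis by (simp add: blocks_def)
  qed
  have "flags s W (a # w) = (\<Sum>J\<in>blocks s W k b. flags s (W - J) w)"
    by (simp add: a)
  also have "blocks s W k b = (`) f ` blocks r V k b"
  proof (intro equalityI subsetI)
    fix J assume J: "J \<in> blocks s W k b"
    then obtain I where I: "I \<subseteq> V" "J = f ` I"
      using blocks_subset[OF J] W by (metis subset_imageE)
    then show "J \<in> (`) f ` blocks r V k b"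
      using blk J by auto
  next
    fix J assume "J \<in> (`) f ` blocks r V k b"
    then show "J \<in> blocks s W k b"
      using blk blocks_subset[of _ r V k b] by auto
  qed
  also have "(\<Sum>J\<in>(`) f ` blocks r V k b. flags s (W - J) w) = (\<Sum>I\<in>blocks r V k b. flags s (W - f ` I) w)"
  proof (subst sum.reindex)
    show "inj_on ((`) f) (blocks r V k b)"
      by (rule inj_on_subset[OF inj_on_image_Pow[OF inj]]) (auto dest: blocks_subset)
  qed simp
  also have "\<dots> = (\<Sum>I\<in>blocks r V k b. flags r (V - I) w)"
  proof (rule sum.cong[OF refl])
    fix I assume "I \<in> blocks r V k b"
    then have I: "I \<subseteq> V" by (rule blocks_subset)
    have "bij_betw f (V - I) (W - f ` I)"
      using inj I W by (auto simp: bij_betw_def inj_on_diff inj_on_image_set_diff)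
    then show "flags s (W - f ` I) w = flags r (V - I) w"
      using Cons.IH[of "V - I" "W - f ` I"] Cons.prems(2) by auto
  qed
  finally show ?case by (simp add: a)
qed


section \<open>Signed sums: weak flag counts determine strict ones\<close>

lemma sum_signs_Pow:
  assumes "finite M" "M \<noteq> {}"
  shows "(\<Sum>F\<in>Pow M. (-1) ^ card F) = (0::int)"
proof -
  have "(\<Prod>x\<in>M. (-1::int) + 1) = (\<Sum>F\<in>Pow M. (\<Prod>x\<in>F. -1) * (\<Prod>x\<in>M - F. 1))"
    using assms(1) by (rule prod_add)
  moreover have "card M \<noteq> 0"
    using assms by simp
  ultimately show ?thesis
    by (simp add: power_0_left)
qed

definition tops :: "('a \<Rightarrow> 'a \<Rightarrow> bool) \<Rightarrow> 'a set \<Rightarrow> 'a set" where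
  "tops r V = {x \<in> V. \<forall>y\<in>V. \<not> r x y}"

definition bots :: "('a \<Rightarrow> 'a \<Rightarrow> bool) \<Rightarrow> 'a set \<Rightarrow> 'a set" where
  "bots r V = {x \<in> V. \<forall>y\<in>V. \<not> r y x}"

lemma subset_tops_iff:
  "F \<subseteq> tops r V \<longleftrightarrow> F \<subseteq> V \<and> down_closed r V (V - F) \<and> unrelated r F"
  unfolding tops_def down_closed_def unrelated_def by blast

locale strict_order =
  fixes r :: "'a \<Rightarrow> 'a \<Rightarrow> bool"
  assumes irrefl: "\<not> r x x"
    and trans: "r x y \<Longrightarrow> r y z \<Longrightarrow> r x z"
begin

lemma asym: "r x y \<Longrightarrow> \<not> r y x"
  using irrefl trans by blast

lemma dual: "strict_order (\<lambda>x y. r y x)"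
  using irrefl trans by unfold_locales blast+

lemma ex_above_top:
  assumes "finite V" "x \<in> V"
  shows "\<exists>m\<in>tops r V. m = x \<or> r x m"
  using assms
proof (induction "card {y \<in> V. r x y}" arbitrary: x rule: less_induct)
  case less
  show ?case
  proof (cases "x \<in> tops r V")
    case False
    then obtain y where y: "y \<in> V" "r x y"
      using less.prems by (auto simp: tops_def)
    then have "{z \<in> V. r y z} \<subset> {z \<in> V. r x z}"
      using trans irrefl by blast
    then have "card {z \<in> V. r y z} < card {z \<in> V. r x z}"
      using less.prems by (intro psubset_card_mono) auto
    then show ?thesis
      using less.hyps[of y] y less.prems trans by blast
  qed blast
qed

lemma ex_below_bot:
  assumes "finite V" "x \<in> V"
  shows "\<exists>m\<in>bots r V. m = x \<or> r m x"
proof -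
  interpret d: strict_order "\<lambda>x y. r y x" by (rule dual)
  show ?thesis
    using d.ex_above_top[OF assms] by (simp add: tops_def bots_def)
qed

text \<open>The complements \<open>J - I\<close> range over the subsets of \<open>tops r J\<close>,
  and the signed count of all subsets of a nonempty set vanishes. The condition
  \<open>I \<noteq> {}\<close> excludes only the subset \<open>J\<close> itself, which occurs
  exactly when \<open>J\<close> is an antichain; its missing term is the value 1.\<close>

lemma sum_signs_unrelated:
  assumes "finite J" "J \<noteq> {}"
  shows "(\<Sum>I | down_closed r J I \<and> I \<noteq> {} \<and> unrelated r (J - I). (-1) ^ (card I + 1)) =
         (if unrelated r J then 1 else (0::int))"
proof -
  let ?M = "tops r J"
  have M: "?M \<subseteq> J" "?M \<noteq> {}" "finite ?M"
    using ex_above_top[OF assms(1)] assms by (auto simp: tops_def)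
  have "(\<Sum>I | down_closed r J I \<and> I \<noteq> {} \<and> unrelated r (J - I). (-1) ^ (card I + 1)) =
        (\<Sum>F\<in>Pow ?M - {J}. (-1) ^ (card (J - F) + 1) :: int)"
  proof (rule sum.reindex_bij_witness[of _ "\<lambda>F. J - F" "\<lambda>I. J - I"])
    fix I assume "I \<in> {I. down_closed r J I \<and> I \<noteq> {} \<and> unrelated r (J - I)}"
    then have I: "down_closed r J I" "I \<noteq> {}" "unrelated r (J - I)" "I \<subseteq> J"
      by (auto simp: down_closed_def)
    then have *: "J - (J - I) = I" by auto
    then show "J - (J - I) = I" "J - I \<in> Pow ?M - {J}"
      using I by (auto simp: subset_tops_iff)
    show "(-1) ^ (card (J - (J - I)) + 1) = ((-1) ^ (card I + 1) :: int)"
      by (simp add: *)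
  next
    fix F assume "F \<in> Pow ?M - {J}"
    then have F: "F \<subseteq> tops r J" "F \<noteq> J" by auto
    then have F': "F \<subseteq> J" using M by auto
    then have *: "J - (J - F) = F" by auto
    then show "J - (J - F) = F" "J - F \<in> {I. down_closed r J I \<and> I \<noteq> {} \<and> unrelated r (J - I)}"
      using F F' by (auto simp: subset_tops_iff)
  qed
  also have "\<dots> = (\<Sum>F\<in>Pow ?M - {J}. (-1) ^ (card J + 1) * (-1) ^ card F)"
  proof (rule sum.cong[OF refl])
    fix F assume "F \<in> Pow ?M - {J}"
    then have F: "F \<subseteq> J" using M by auto
    then have "card F \<le> card J" "card (J - F) = card J - card F"
      using assms(1) by (simp_all add: card_mono card_Diff_subset finite_subset)
    then have "card J + 1 + card F = card (J - F) + 1 + 2 * card F"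
      by simp
    then have "(-1) ^ (card J + 1) * (-1) ^ card F = ((-1) ^ (card (J - F) + 1) * (-1) ^ (2 * card F) :: int)"
      by (metis power_add)
    then show "(-1) ^ (card (J - F) + 1) = ((-1) ^ (card J + 1) * (-1) ^ card F :: int)"
      by simp
  qed
  also have "\<dots> = (-1) ^ (card J + 1) * (\<Sum>F\<in>Pow ?M - {J}. (-1) ^ card F)"
    by (simp add: sum_distrib_left)
  also have "(\<Sum>F\<in>Pow ?M - {J}. (-1) ^ card F) = (if unrelated r J then - ((-1) ^ card J) else (0::int))"
  proof (cases "unrelated r J")
    case True
    then have "?M = J" by (auto simp: tops_def unrelated_def)
    then show ?thesis
      using sum_signs_Pow[OF M(3,2)] True M(3) by (simp add: sum_diff1)
  next
    case False
    then have "?M \<noteq> J" by (auto simp: tops_def unrelated_def)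
    then have "Pow ?M - {J} = Pow ?M" using M(1) by auto
    then show ?thesis
      using sum_signs_Pow[OF M(3,2)] False by simp
  qed
  finally show ?thesis
    by (simp flip: power_add)
qed

text \<open>A weak block \<open>I\<close> and the strict block after it merge into an ideal
  \<open>J\<close> of size \<open>k\<close>; for fixed \<open>J\<close>,
  \<open>sum_signs_unrelated\<close> turns the signed sum over all cuts of \<open>J\<close> into the
  indicator that \<open>J\<close> is an antichain. As \<open>j\<close> starts at 1, the strict block
  on the right is shorter.\<close>

lemma flags_strict:
  assumes "finite V" "k \<ge> 1"
  shows "int (flags r V ((k, True) # w)) =
         (\<Sum>j=1..k. (-1) ^ (j + 1) * int (flags r V ((j, False) # (k - j, True) # w)))"
proof -
  let ?D = "{I. down_closed r V I \<and> card I \<in> {1..k}}"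
  let ?g = "\<lambda>I. (-1) ^ (card I + 1) * int (flags r (V - I) ((k - card I, True) # w))"
  have finD: "finite ?D"
    by (rule finite_subset[of _ "Pow V"]) (use assms in \<open>auto simp: down_closed_def\<close>)
  have blk: "blocks r V j False = {I \<in> ?D. card I = j}" if "j \<in> {1..k}" for j
    using that by (auto simp: blocks_def)
  have "(\<Sum>j=1..k. (-1) ^ (j + 1) * int (flags r V ((j, False) # (k - j, True) # w))) =
        (\<Sum>j=1..k. \<Sum>I\<in>{I \<in> ?D. card I = j}. ?g I)"
    by (rule sum.cong) (auto simp: blk sum_distrib_left)
  also have "\<dots> = sum ?g ?D"
    by (rule sum.group) (use finD in auto)
  also have "\<dots> = (\<Sum>I\<in>?D. \<Sum>K\<in>blocks r (V - I) (k - card I) True.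
                     (-1) ^ (card I + 1) * int (flags r (V - I - K) w))"
    by (simp add: sum_distrib_left)
  also have "\<dots> = (\<Sum>(I, K)\<in>(SIGMA I:?D. blocks r (V - I) (k - card I) True).
                     (-1) ^ (card I + 1) * int (flags r (V - I - K) w))"
    using assms(1) finD by (subst sum.Sigma) auto
  also have "\<dots> = (\<Sum>(J, I)\<in>(SIGMA J:blocks r V k False.
                        {I. down_closed r J I \<and> I \<noteq> {} \<and> unrelated r (J - I)}).
                     (-1) ^ (card I + 1) * int (flags r (V - J) w))"
  proof (rule sum.reindex_bij_witness[of _ "\<lambda>(J, I). (I, J - I)" "\<lambda>(I, K). (I \<union> K, I)"], goal_cases)
    case (1 p)
    obtain I K where p: "p = (I, K)" by (cases p)
    have "K \<subseteq> V - I" using 1 p blocks_subset by blast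
    then show ?case by (auto simp: p)
  next
    case (2 p)
    obtain I K where p: "p = (I, K)" by (cases p)
    have I: "down_closed r V I" "1 \<le> card I" "card I \<le> k" and K: "down_closed r (V - I) K"
      "card K = k - card I" "unrelated r K"
      using 2 by (auto simp: p blocks_def)
    then have sub: "I \<subseteq> V" "K \<subseteq> V - I" by (auto simp: down_closed_def)
    then have "finite I" "finite K" using assms(1) by (meson finite_subset finite_Diff)+
    then have "card (I \<union> K) = k"
      using sub I K by (subst card_Un_disjoint) auto
    moreover have "down_closed r V (I \<union> K)" "down_closed r (I \<union> K) I"
      using I(1) K(1) by (auto simp: down_closed_def)
    moreover have "I \<union> K - I = K" using sub by auto
    moreover have "I \<noteq> {}" using I(2) by auto
    ultimately show ?case
      using K(3) by (simp add: p blocks_def)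
  next
    case (3 q)
    obtain J I where q: "q = (J, I)" by (cases q)
    then show ?case using 3 by (auto simp: down_closed_def)
  next
    case (4 q)
    obtain J I where q: "q = (J, I)" by (cases q)
    have J: "down_closed r V J" "card J = k" and I: "down_closed r J I" "I \<noteq> {}" "unrelated r (J - I)"
      using 4 by (auto simp: q blocks_def)
    have sub: "I \<subseteq> J" "J \<subseteq> V" using I J by (auto simp: down_closed_def)
    then have fin: "finite I" "finite J" using assms(1) by (meson finite_subset)+
    have "card I \<le> k" "1 \<le> card I" "card (J - I) = k - card I"
      using fin sub J I by (auto simp: card_mono card_Diff_subset Suc_le_eq card_gt_0_iff)
    moreover have "down_closed r V I" "down_closed r (V - I) (J - I)"
      using I(1) J(1) by (auto simp: down_closed_def)
    ultimately show ?case
      using I by (auto simp: q blocks_def)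
  next
    case (5 p)
    obtain I K where p: "p = (I, K)" by (cases p)
    have "V - (I \<union> K) = V - I - K" by auto
    then show ?case by (simp add: p)
  qed
  also have "\<dots> = (\<Sum>J\<in>blocks r V k False. \<Sum>I | down_closed r J I \<and> I \<noteq> {} \<and> unrelated r (J - I).
                     (-1) ^ (card I + 1) * int (flags r (V - J) w))"
  proof (subst sum.Sigma)
    show "\<forall>J\<in>blocks r V k False. finite {I. down_closed r J I \<and> I \<noteq> {} \<and> unrelated r (J - I)}"
    proof
      fix J assume "J \<in> blocks r V k False"
      then have "finite J" using blocks_subset[of J r V k False] assms(1) by (auto dest: finite_subset)
      then show "finite {I. down_closed r J I \<and> I \<noteq> {} \<and> unrelated r (J - I)}"
        by (rule_tac finite_subset[of _ "Pow J"]) (auto simp: down_closed_def)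
    qed
  qed (use assms in auto)
  also have "\<dots> = (\<Sum>J\<in>blocks r V k False. if unrelated r J then int (flags r (V - J) w) else 0)"
  proof (rule sum.cong[OF refl])
    fix J assume J: "J \<in> blocks r V k False"
    then have "finite J" "J \<noteq> {}"
      using blocks_subset[OF J] assms by (auto simp: blocks_def dest: finite_subset)
    then show "(\<Sum>I | down_closed r J I \<and> I \<noteq> {} \<and> unrelated r (J - I).
                 (-1) ^ (card I + 1) * int (flags r (V - J) w)) =
               (if unrelated r J then int (flags r (V - J) w) else 0)"
      using sum_signs_unrelated[of J] by (subst sum_distrib_right[symmetric]) simp
  qed
  also have "\<dots> = (\<Sum>J\<in>{J \<in> blocks r V k False. unrelated r J}. int (flags r (V - J) w))"
    using assms by (subst sum.inter_filter) auto
  also have "{J \<in> blocks r V k False. unrelated r J} = blocks r V k True"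
    by (auto simp: blocks_def)
  finally show ?thesis by simp
qed

end

text \<open>A prefix only replaces the ground set by smaller ones, so a linear relation between flag
  counts that holds on all finite sets survives behind any prefix.\<close>

lemma flags_prefix:
  fixes c :: "'i \<Rightarrow> int"
  assumes "\<And>V. finite V \<Longrightarrow> int (flags r V w) = (\<Sum>j\<in>S. c j * int (flags r V (w' j)))"
    and "finite V"
  shows "int (flags r V (u @ w)) = (\<Sum>j\<in>S. c j * int (flags r V (u @ w' j)))"
  using assms(2)
proof (induction u arbitrary: V)
  case Nil
  then show ?case using assms(1) by simp
next
  case (Cons a u)
  obtain k b where a: "a = (k, b)" by (cases a)
  have "int (flags r V ((a # u) @ w)) = (\<Sum>I\<in>blocks r V k b. \<Sum>j\<in>S. c j * int (flags r (V - I) (u @ w' j)))"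
    using Cons by (simp add: a)
  also have "\<dots> = (\<Sum>j\<in>S. \<Sum>I\<in>blocks r V k b. c j * int (flags r (V - I) (u @ w' j)))"
    by (rule sum.swap)
  finally show ?case by (simp add: a sum_distrib_left)
qed

lemma blocks_0 [simp]: "finite V \<Longrightarrow> blocks r V 0 b = {{}}"
  by (auto simp: blocks_def down_closed_def unrelated_def dest: finite_subset)

lemma flags_drop_0:
  assumes "finite V"
  shows "flags r V (u @ (0, b) # w) = flags r V (u @ w)"
  using flags_prefix[of r "(0, b) # w" "\<lambda>_. 1" "\<lambda>_. w" "{()}" V u] assms by simp

lemma flag_equivI_weak:
  assumes "strict_order r" "strict_order s" "finite V" "finite W"
    and weak: "\<And>ks. flags r V (map (\<lambda>k. (k, False)) ks) = flags s W (map (\<lambda>k. (k, False)) ks)"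
  shows "flag_equiv r V s W"
proof -
  \<comment> \<open>A strict block of size \<open>k\<close> weighs \<open>Suc k\<close> in the
    measure, so that deleting an empty strict block also makes it smaller.\<close>
  have "flags r V w = flags s W w" for w
  proof (induction "sum_list (map (\<lambda>(k, b). if b then Suc k else 0) w)" arbitrary: w rule: less_induct)
    case less
    show ?case
    proof (cases "\<exists>k. (k, True) \<in> set w")
      case False
      then have "map (\<lambda>k. (k, False)) (map fst w) = w"
        by (induction w) auto
      then show ?thesis using weak[of "map fst w"] by simp
    next
      case True
      then obtain k u v where w: "w = u @ (k, True) # v"
        by (meson split_list)
      show ?thesis
      proof (cases "k = 0")
        case True
        then show ?thesis
          using less[of "u @ v"] assms by (simp add: w flags_drop_0)
      next
        case False
        then have k: "1 \<le> k" by simp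
        have a1: "int (flags r V w) = (\<Sum>j=1..k. (-1) ^ (j + 1) * int (flags r V (u @ (j, False) # (k - j, True) # v)))"
          unfolding w by (rule flags_prefix, rule strict_order.flags_strict) (use assms k in simp_all)
        have a2: "int (flags s W w) = (\<Sum>j=1..k. (-1) ^ (j + 1) * int (flags s W (u @ (j, False) # (k - j, True) # v)))"
          unfolding w
          by (rule flags_prefix, rule strict_order.flags_strict) (use assms k in simp_all)
        have a3: "flags r V (u @ (j, False) # (k - j, True) # v) =
            flags s W (u @ (j, False) # (k - j, True) # v)" if "j \<in> {1..k}" for j
          using that by (intro less) (auto simp: w)
        have "int (flags r V w) = int (flags s W w)"
          unfolding a1 a2 by (rule sum.cong[OF refl]) (simp add: a3)
        then show ?thesis by simp
      qed
    qed
  qed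
  then show ?thesis by (simp add: flag_equiv_def)
qed


section \<open>From the generating function to flag counts\<close>

text \<open>The window of values starts at a variable \<open>j\<close> for the sake of the
  recursion: once the fibre over \<open>j\<close> is removed, a coloring with window starting at
  \<open>Suc j\<close> remains. Extensionality makes restrictions to the complement unique.\<close>

definition colorings :: "('a \<Rightarrow> 'a \<Rightarrow> bool) \<Rightarrow> 'a set \<Rightarrow> nat \<Rightarrow> nat list \<Rightarrow> ('a \<Rightarrow> nat) set" where
  "colorings r V j ks = {\<sigma> \<in> V \<rightarrow>\<^sub>E {j..<j + length ks}. (\<forall>x\<in>V. \<forall>y\<in>V. r x y \<longrightarrow> \<sigma> x \<le> \<sigma> y) \<and>
     (\<forall>i<length ks. card {p \<in> V. \<sigma> p = j + i} = ks ! i)}"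

text \<open>The fibre over the least value is an order ideal, and conversely an ideal in the least
  color can be combined with any coloring of its complement.\<close>

lemma card_colorings:
  assumes "finite V"
  shows "card (colorings r V j ks) = flags r V (map (\<lambda>k. (k, False)) ks)"
  using assms
proof (induction ks arbitrary: V j)
  case Nil
  then show ?case
    by (cases "V = {}") (auto simp: colorings_def PiE_eq_empty_iff)
next
  case (Cons k ks)
  let ?L = "\<lambda>\<sigma>. {p \<in> V. \<sigma> p = j}"
  let ?S = "SIGMA I:blocks r V k False. colorings r (V - I) (Suc j) ks"
  have fin: "finite (colorings r U i ls)" if "finite U" for U i ls
    by (rule finite_subset[of _ "U \<rightarrow>\<^sub>E {i..<i + length ls}"])
       (use that in \<open>auto simp: colorings_def intro!: finite_PiE\<close>)
  have "bij_betw (\<lambda>\<sigma>. (?L \<sigma>, restrict \<sigma> (V - ?L \<sigma>))) (colorings r V j (k # ks)) ?S"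
  proof (rule bij_betw_byWitness[where f' = "\<lambda>(I, \<tau>) p. if p \<in> I then j else \<tau> p"])
    show "\<forall>\<sigma>\<in>colorings r V j (k # ks).
        (case (?L \<sigma>, restrict \<sigma> (V - ?L \<sigma>)) of (I, \<tau>) \<Rightarrow> \<lambda>p. if p \<in> I then j else \<tau> p) = \<sigma>"
      by (auto simp: colorings_def fun_eq_iff PiE_iff extensional_def)
    have lvl: "{p \<in> V. (if p \<in> I then j else \<tau> p) = j} = I"
      if I: "I \<subseteq> V" and t: "\<tau> \<in> V - I \<rightarrow>\<^sub>E {Suc j..<Suc j + length ks}" for I \<tau>
    proof -
      have "\<tau> p \<noteq> j" if p: "p \<in> V - I" for p
        using PiE_mem[OF t p] by auto
      then show ?thesis using I by auto
    qed
    show "\<forall>q\<in>?S. (\<lambda>\<sigma>. (?L \<sigma>, restrict \<sigma> (V - ?L \<sigma>)))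
        (case q of (I, \<tau>) \<Rightarrow> \<lambda>p. if p \<in> I then j else \<tau> p) = q"
    proof
      fix q assume q: "q \<in> ?S"
      obtain I \<tau> where q': "q = (I, \<tau>)" by (cases q)
      have "I \<subseteq> V" "\<tau> \<in> V - I \<rightarrow>\<^sub>E {Suc j..<Suc j + length ks}"
        using q by (auto simp: q' colorings_def dest: blocks_subset)
      then show "(\<lambda>\<sigma>. (?L \<sigma>, restrict \<sigma> (V - ?L \<sigma>))) (case q of (I, \<tau>) \<Rightarrow> \<lambda>p. if p \<in> I then j else \<tau> p) = q"
        using lvl[of I \<tau>] by (auto simp: q' fun_eq_iff PiE_iff extensional_def)
    qed
    show "(\<lambda>\<sigma>. (?L \<sigma>, restrict \<sigma> (V - ?L \<sigma>))) ` colorings r V j (k # ks) \<subseteq> ?S"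
    proof clarsimp
      fix \<sigma> assume s: "\<sigma> \<in> colorings r V j (k # ks)"
      then have ran: "\<And>p. p \<in> V \<Longrightarrow> j \<le> \<sigma> p \<and> \<sigma> p < Suc j + length ks"
        and mon: "\<And>x y. x \<in> V \<Longrightarrow> y \<in> V \<Longrightarrow> r x y \<Longrightarrow> \<sigma> x \<le> \<sigma> y"
        and cnt: "\<And>i. i < Suc (length ks) \<Longrightarrow> card {p \<in> V. \<sigma> p = j + i} = (k # ks) ! i"
        by (auto simp: colorings_def PiE_iff)
      have "?L \<sigma> \<in> blocks r V k False"
        using cnt[of 0] ran mon by (auto simp: blocks_def down_closed_def) (metis le_antisym)
      moreover have "restrict \<sigma> (V - ?L \<sigma>) \<in> colorings r (V - ?L \<sigma>) (Suc j) ks"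
        unfolding colorings_def
      proof (intro CollectI conjI ballI allI impI)
        show "restrict \<sigma> (V - ?L \<sigma>) \<in> V - ?L \<sigma> \<rightarrow>\<^sub>E {Suc j..<Suc j + length ks}"
        proof -
          have "Suc j \<le> \<sigma> p \<and> \<sigma> p < Suc j + length ks" if "p \<in> V - ?L \<sigma>" for p
            using ran[of p] that by auto
          then show ?thesis by (simp add: PiE_iff)
        qed
        fix i assume "i < length ks"
        moreover have "{p \<in> V - ?L \<sigma>. restrict \<sigma> (V - ?L \<sigma>) p = Suc j + i} = {p \<in> V. \<sigma> p = j + Suc i}"
          by auto
        ultimately show "card {p \<in> V - ?L \<sigma>. restrict \<sigma> (V - ?L \<sigma>) p = Suc j + i} = ks ! i"
          using cnt[of "Suc i"] by simp
      qed (use mon in auto)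
      ultimately show "?L \<sigma> \<in> blocks r V k False \<and> restrict \<sigma> (V - ?L \<sigma>) \<in> colorings r (V - ?L \<sigma>) (Suc j) ks"
        by blast
    qed
    show "(\<lambda>(I, \<tau>) p. if p \<in> I then j else \<tau> p) ` ?S \<subseteq> colorings r V j (k # ks)"
    proof clarsimp
      fix I \<tau> assume I: "I \<in> blocks r V k False" and t: "\<tau> \<in> colorings r (V - I) (Suc j) ks"
      have IV: "I \<subseteq> V" using I by (rule blocks_subset)
      have dc: "\<And>x y. x \<in> I \<Longrightarrow> y \<in> V \<Longrightarrow> r y x \<Longrightarrow> y \<in> I" and cI: "card I = k"
        using I by (auto simp: blocks_def down_closed_def)
      have ran: "\<And>p. p \<in> V - I \<Longrightarrow> Suc j \<le> \<tau> p \<and> \<tau> p < Suc j + length ks"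
        and mon: "\<And>x y. x \<in> V - I \<Longrightarrow> y \<in> V - I \<Longrightarrow> r x y \<Longrightarrow> \<tau> x \<le> \<tau> y"
        and cnt: "\<And>i. i < length ks \<Longrightarrow> card {p \<in> V - I. \<tau> p = Suc j + i} = ks ! i"
        and PE: "\<tau> \<in> V - I \<rightarrow>\<^sub>E {Suc j..<Suc j + length ks}"
        using t by (auto simp: colorings_def PiE_iff)
      let ?s = "\<lambda>p. if p \<in> I then j else \<tau> p"
      show "?s \<in> colorings r V j (k # ks)"
        unfolding colorings_def
      proof (intro CollectI conjI ballI allI impI)
        show "?s \<in> V \<rightarrow>\<^sub>E {j..<j + length (k # ks)}"
          using ran PE IV by (force simp: PiE_iff extensional_def)
        fix x y assume xy: "x \<in> V" "y \<in> V" "r x y"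
        show "?s x \<le> ?s y"
          using xy dc[of y x] mon[of x y] ran[of y] by (cases "x \<in> I"; cases "y \<in> I") auto
      next
        fix i assume i: "i < length (k # ks)"
        show "card {p \<in> V. ?s p = j + i} = (k # ks) ! i"
        proof (cases i)
          case 0
          then show ?thesis using lvl[OF IV PE] cI by simp
        next
          case (Suc i')
          have "{p \<in> V. ?s p = j + i} = {p \<in> V - I. \<tau> p = Suc j + i'}"
            using IV by (auto simp: Suc)
          then show ?thesis using cnt[of i'] i by (simp add: Suc)
        qed
      qed
    qed
  qed
  then have "card (colorings r V j (k # ks)) = card ?S"
    by (rule bij_betw_same_card)
  also have "\<dots> = (\<Sum>I\<in>blocks r V k False. card (colorings r (V - I) (Suc j) ks))"
    using Cons.prems fin by (subst card_SigmaI) auto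
  finally show ?case
    using Cons by simp
qed

definition strict_part :: "('a \<times> 'a) set \<Rightarrow> 'a \<Rightarrow> 'a \<Rightarrow> bool" where
  "strict_part P x y \<longleftrightarrow> (x, y) \<in> P \<and> x \<noteq> y"

lemma strict_order_strict_part:
  assumes "naturally_labeled n P"
  shows "strict_order (strict_part P)"
  using assms unfolding naturally_labeled_def partial_order_on_def preorder_on_def
  by unfold_locales (auto simp: strict_part_def dest: transD antisymD)

text \<open>Variables are numbered from 1, hence the \<open>Suc\<close>. Zero exponents may occur
  and correspond to empty blocks.\<close>

definition content_monomial :: "nat list \<Rightarrow> nat \<Rightarrow>\<^sub>0 nat" where
  "content_monomial ks = (\<Sum>i<length ks. Poly_Mapping.single (Suc i) (ks ! i))"

lemma lookup_content_monomial:
  "Poly_Mapping.lookup (content_monomial ks) c =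
     (if 1 \<le> c \<and> c \<le> length ks then ks ! (c - 1) else 0)"
proof -
  have "Poly_Mapping.lookup (content_monomial ks) c = (\<Sum>i<length ks. if Suc i = c then ks ! i else 0)"
    by (simp add: content_monomial_def lookup_sum lookup_single when_def)
  also have "\<dots> = (\<Sum>i<length ks. if i = c - 1 then if c = 0 then 0 else ks ! i else 0)"
    by (rule sum.cong) auto
  also have "\<dots> = (if c - 1 < length ks then if c = 0 then 0 else ks ! (c - 1) else 0)"
    by (subst sum.delta) auto
  finally show ?thesis by auto
qed

lemma lookup_sigma_monomial:
  "Poly_Mapping.lookup (sigma_monomial n \<sigma>) c = card {p \<in> {1..n}. \<sigma> p = c}"
  by (simp add: sigma_monomial_def lookup_sum lookup_single when_def flip: sum.inter_filter)

text \<open>A map with this monomial takes its values in \<open>{1..length ks}\<close>, so it is a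
  coloring whose window starts at 1; reflexive pairs impose no condition, which is why the strict
  part carries the whole information.\<close>

lemma K_gf_content_monomial:
  assumes "naturally_labeled n P"
  shows "K_gf n P (content_monomial ks) = int (flags (strict_part P) {1..n} (map (\<lambda>k. (k, False)) ks))"
proof -
  have refl: "P \<subseteq> {1..n} \<times> {1..n}"
    using assms by (auto simp: naturally_labeled_def partial_order_on_def preorder_on_def)
  have "{\<sigma> \<in> P_partitions n P. sigma_monomial n \<sigma> = content_monomial ks} =
        colorings (strict_part P) {1..n} 1 ks"
  proof (intro equalityI subsetI)
    fix \<sigma> assume s: "\<sigma> \<in> {\<sigma> \<in> P_partitions n P. sigma_monomial n \<sigma> = content_monomial ks}"
    then have PE: "\<sigma> \<in> {1..n} \<rightarrow>\<^sub>E {1..}" and mon: "\<And>x y. (x, y) \<in> P \<Longrightarrow> \<sigma> x \<le> \<sigma> y"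
      by (auto simp: P_partitions_def)
    have cnt: "card {p \<in> {1..n}. \<sigma> p = c} = (if 1 \<le> c \<and> c \<le> length ks then ks ! (c - 1) else 0)" for c
    proof -
      have "Poly_Mapping.lookup (sigma_monomial n \<sigma>) c = Poly_Mapping.lookup (content_monomial ks) c"
        using s by simp
      then show ?thesis by (simp only: lookup_sigma_monomial lookup_content_monomial)
    qed
    have "\<sigma> p \<in> {1..<1 + length ks}" if "p \<in> {1..n}" for p
    proof -
      have "card {q \<in> {1..n}. \<sigma> q = \<sigma> p} \<noteq> 0"
        using that by auto
      then show ?thesis using cnt[of "\<sigma> p"] by (auto split: if_splits)
    qed
    then have "\<sigma> \<in> {1..n} \<rightarrow>\<^sub>E {1..<1 + length ks}"
      using PE by (auto simp: PiE_iff)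
    then show "\<sigma> \<in> colorings (strict_part P) {1..n} 1 ks"
      using mon cnt by (simp add: colorings_def strict_part_def)
  next
    fix \<sigma> assume s: "\<sigma> \<in> colorings (strict_part P) {1..n} 1 ks"
    then have PE: "\<sigma> \<in> {1..n} \<rightarrow>\<^sub>E {1..<1 + length ks}"
      and mon: "\<And>x y. x \<in> {1..n} \<Longrightarrow> y \<in> {1..n} \<Longrightarrow> strict_part P x y \<Longrightarrow> \<sigma> x \<le> \<sigma> y"
      and cnt: "\<And>i. i < length ks \<Longrightarrow> card {p \<in> {1..n}. \<sigma> p = 1 + i} = ks ! i"
      unfolding colorings_def by blast+
    have "Poly_Mapping.lookup (sigma_monomial n \<sigma>) c = Poly_Mapping.lookup (content_monomial ks) c" for c
    proof (cases "1 \<le> c \<and> c \<le> length ks")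
      case True
      then show ?thesis
        using cnt[of "c - 1"] by (auto simp: lookup_sigma_monomial lookup_content_monomial)
    next
      case False
      then have "{p \<in> {1..n}. \<sigma> p = c} = {}"
        using PiE_mem[OF PE] by fastforce
      then show ?thesis
        using False by (simp only: lookup_sigma_monomial lookup_content_monomial) simp
    qed
    then have "sigma_monomial n \<sigma> = content_monomial ks"
      by (simp add: poly_mapping_eq_iff fun_eq_iff)
    moreover have "\<sigma> x \<le> \<sigma> y" if "(x, y) \<in> P" for x y
      using mon[of x y] that refl by (cases "x = y") (auto simp: strict_part_def)
    moreover have "\<sigma> \<in> {1..n} \<rightarrow>\<^sub>E {1..}"
      using PE by (auto simp: PiE_iff)
    ultimately have "\<sigma> \<in> P_partitions n P" "sigma_monomial n \<sigma> = content_monomial ks"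
      by (auto simp: P_partitions_def)
    then show "\<sigma> \<in> {\<sigma> \<in> P_partitions n P. sigma_monomial n \<sigma> = content_monomial ks}"
      by simp
  qed
  then show ?thesis
    by (simp add: K_gf_def card_colorings)
qed

theorem K_gf_eq_flag_equiv:
  assumes "naturally_labeled m Q" "naturally_labeled n P" "K_gf m Q = K_gf n P"
  shows "flag_equiv (strict_part Q) {1..m} (strict_part P) {1..n}"
proof (rule flag_equivI_weak)
  fix ks
  show "flags (strict_part Q) {1..m} (map (\<lambda>k. (k, False)) ks) =
        flags (strict_part P) {1..n} (map (\<lambda>k. (k, False)) ks)"
    using K_gf_content_monomial[OF assms(1), of ks] K_gf_content_monomial[OF assms(2), of ks] assms(3)
    by simp
qed (use assms strict_order_strict_part in auto)


section \<open>Removing minimal and maximal layers; rank and corank\<close>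

lemma subset_bots_iff: "F \<subseteq> bots r V \<longleftrightarrow> down_closed r V F \<and> unrelated r F"
  unfolding bots_def down_closed_def unrelated_def by blast

lemma bots_dual: "bots (\<lambda>x y. r y x) V = tops r V"
  by (simp add: bots_def tops_def)

lemma blocks_True: "blocks r V k True = {I. I \<subseteq> bots r V \<and> card I = k}"
  by (auto simp: blocks_def subset_bots_iff)

lemma finite_bots [simp]: "finite V \<Longrightarrow> finite (bots r V)"
  by (simp add: bots_def)

lemma bots_subset: "bots r V \<subseteq> V"
  by (auto simp: bots_def)

text \<open>An ideal that is an antichain consists of minimal elements, so the largest possible
  strict block is unique.\<close>

lemma flags_bots:
  assumes "finite V"
  shows "flags r V ((card (bots r V), True) # w) = flags r (V - bots r V) w"
proof -
  have "blocks r V (card (bots r V)) True = {bots r V}"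
    unfolding blocks_True using assms card_subset_eq[OF finite_bots[OF assms]] by blast
  then show ?thesis by simp
qed

text \<open>The device by which one element of a layer is kept while the rest of the layer is
  removed; later it puts a single antichain element under the next layer.\<close>

lemma flags_bots_but_one:
  assumes "finite V" "bots r V \<noteq> {}"
  shows "flags r V ((card (bots r V) - 1, True) # w) =
         (\<Sum>q\<in>bots r V. flags r (insert q (V - bots r V)) w)"
proof -
  let ?M = "bots r V"
  have M: "finite ?M" "card ?M \<ge> 1"
    using assms by (auto simp: Suc_le_eq card_gt_0_iff)
  have "blocks r V (card ?M - 1) True = (\<lambda>q. ?M - {q}) ` ?M"
  proof (intro equalityI subsetI)
    fix I assume "I \<in> blocks r V (card ?M - 1) True"
    then have I: "I \<subseteq> ?M" "card I = card ?M - 1"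
      by (auto simp: blocks_True)
    then have "card (?M - I) = 1"
      using M by (simp add: card_Diff_subset finite_subset)
    then obtain q where "?M - I = {q}"
      by (auto simp: card_1_singleton_iff)
    then have "q \<in> ?M" "I = ?M - {q}" using I by auto
    then show "I \<in> (\<lambda>q. ?M - {q}) ` ?M" by blast
  qed (use M in \<open>auto simp: blocks_True\<close>)
  moreover have "inj_on (\<lambda>q. ?M - {q}) ?M"
    by (auto simp: inj_on_def)
  moreover have "V - (?M - {q}) = insert q (V - ?M)" if "q \<in> ?M" for q
    using that bots_subset[of r V] by auto
  ultimately show ?thesis
    by (simp add: sum.reindex)
qed

lemma flags_whole:
  assumes "finite V"
  shows "flags r V [(card V, False)] = 1"
proof -
  have "blocks r V (card V) False = {V}"
    using card_subset_eq[OF assms] by (auto simp: blocks_def down_closed_def)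
  then show ?thesis by simp
qed

lemma flag_equiv_sym: "flag_equiv r V s W \<Longrightarrow> flag_equiv s W r V"
  by (simp add: flag_equiv_def)

lemma flag_equiv_card:
  assumes "flag_equiv r V s W" "finite V" "finite W"
  shows "card V = card W"
proof -
  have "flags s W [(card V, False)] = 1"
    using assms flags_whole[of V r] by (metis flag_equiv_def)
  then show ?thesis
    using flags_empty_size[of W s "[(card V, False)]"] assms by simp
qed

text \<open>Makes the number of minimal elements visible in the flag data, so that
  \<open>flags_bots\<close> can be applied with the same word on both sides of an
  equivalence.\<close>

lemma le_card_bots_iff:
  assumes "finite V" "k \<le> card V"
  shows "k \<le> card (bots r V) \<longleftrightarrow> flags r V [(k, True), (card V - k, False)] \<noteq> 0"
proof
  assume "k \<le> card (bots r V)"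
  then obtain I where I: "I \<subseteq> bots r V" "card I = k"
    using obtain_subset_with_card_n by metis
  then have blk: "I \<in> blocks r V k True" by (simp add: blocks_True)
  have "card (V - I) = card V - k"
    using card_Diff_block[OF assms(1) blk] by simp
  then have "flags r (V - I) [(card V - k, False)] = 1"
    using flags_whole[of "V - I" r] assms by simp
  then show "flags r V [(k, True), (card V - k, False)] \<noteq> 0"
    using sum_pos2[OF finite_blocks[OF assms(1)] blk, of "\<lambda>I. flags r (V - I) [(card V - k, False)]"]
    unfolding flags.simps(2)[of r V] by linarith
next
  assume "flags r V [(k, True), (card V - k, False)] \<noteq> 0"
  then obtain I where "I \<in> blocks r V k True"
    by (metis (no_types, lifting) flags.simps(2) sum.not_neutral_contains_not_neutral)
  then show "k \<le> card (bots r V)"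
    using assms card_mono[of "bots r V" I] by (auto simp: blocks_True)
qed

lemma flag_equiv_bots:
  assumes "flag_equiv r V s W" "finite V" "finite W"
  shows "card (bots r V) = card (bots s W)" "flag_equiv r (V - bots r V) s (W - bots s W)"
proof -
  have "k \<le> card (bots r V) \<longleftrightarrow> k \<le> card (bots s W)" if "k \<le> card V" for k
    using le_card_bots_iff[of V k r] le_card_bots_iff[of W k s] that assms flag_equiv_card[OF assms]
    by (simp add: flag_equiv_def del: flags.simps)
  moreover have "card (bots r V) \<le> card V" "card (bots s W) \<le> card V"
    using card_mono[OF assms(2) bots_subset[of r V]] card_mono[OF assms(3) bots_subset[of s W]]
      flag_equiv_card[OF assms] by simp_all
  ultimately show eq: "card (bots r V) = card (bots s W)"
    by (meson le_antisym le_refl)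
  show "flag_equiv r (V - bots r V) s (W - bots s W)"
    using assms flags_bots[of V r] flags_bots[of W s] eq by (simp add: flag_equiv_def del: flags.simps)
qed

lemma flag_equiv_tops:
  assumes "flag_equiv r V s W" "finite V" "finite W"
  shows "card (tops r V) = card (tops s W)" "flag_equiv r (V - tops r V) s (W - tops s W)"
  using flag_equiv_bots[OF flag_equiv_dual[OF assms]] assms
    flag_equiv_dual[of "\<lambda>x y. r y x" "V - tops r V" "\<lambda>x y. s y x" "W - tops s W"]
  by (simp_all add: bots_dual)

text \<open>A local characterisation of the length of a longest chain that ends in an element;
  explicit rank functions can be checked against it without any chains. For the reversed relation it
  describes the corank.\<close>

definition is_rank :: "('a \<Rightarrow> 'a \<Rightarrow> bool) \<Rightarrow> 'a set \<Rightarrow> ('a \<Rightarrow> nat) \<Rightarrow> bool" where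
  "is_rank r V f \<longleftrightarrow> (\<forall>x\<in>V. 1 \<le> f x) \<and> (\<forall>x\<in>V. \<forall>y\<in>V. r y x \<longrightarrow> f y < f x) \<and>
     (\<forall>x\<in>V. 1 < f x \<longrightarrow> (\<exists>y\<in>V. r y x \<and> f x = Suc (f y)))"

lemma bots_rank:
  assumes "is_rank r V f"
  shows "bots r {x \<in> V. i < f x} = {x \<in> V. f x = Suc i}"
proof (intro equalityI subsetI)
  fix x assume "x \<in> bots r {x \<in> V. i < f x}"
  then have x: "x \<in> V" "i < f x" "\<And>y. y \<in> V \<Longrightarrow> i < f y \<Longrightarrow> \<not> r y x"
    by (auto simp: bots_def)
  have "f x = Suc i"
  proof (rule ccontr)
    assume "f x \<noteq> Suc i"
    then have "Suc i < f x" using x by simp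
    then obtain y where "y \<in> V" "r y x" "f x = Suc (f y)"
      using assms x unfolding is_rank_def by (metis Suc_lessD less_trans_Suc not_less0 gr0I le_less_trans One_nat_def)
    then show False using x(3)[of y] \<open>Suc i < f x\<close> by simp
  qed
  then show "x \<in> {x \<in> V. f x = Suc i}" using x by simp
next
  fix x assume "x \<in> {x \<in> V. f x = Suc i}"
  then show "x \<in> bots r {x \<in> V. i < f x}"
    using assms unfolding bots_def is_rank_def by fastforce
qed

lemma rank_gt_Suc:
  assumes "is_rank r V f"
  shows "{x \<in> V. Suc i < f x} = {x \<in> V. i < f x} - bots r {x \<in> V. i < f x}"
  unfolding bots_rank[OF assms] by auto

lemma flag_equiv_rank_gt:
  assumes "flag_equiv r V s W" "finite V" "finite W" "is_rank r V f" "is_rank s W f'"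
  shows "flag_equiv r {x \<in> V. i < f x} s {x \<in> W. i < f' x}"
proof (induction i)
  case 0
  have "{x \<in> V. 0 < f x} = V" "{x \<in> W. 0 < f' x} = W"
    using assms(4,5) by (auto simp: is_rank_def Suc_le_eq)
  then show ?case using assms(1) by simp
next
  case (Suc i)
  show ?case
    unfolding rank_gt_Suc[OF assms(4)] rank_gt_Suc[OF assms(5)]
    by (rule flag_equiv_bots(2)[OF Suc]) (use assms in auto)
qed

text \<open>The element that witnesses a corank step lies higher in the order, hence has larger rank
  and survives a cut from below. Coranks are therefore unchanged by such cuts, and cuts from both
  sides can be combined.\<close>

lemma is_rank_dual_filter:
  assumes "is_rank (\<lambda>x y. r y x) V g" "is_rank r V f"
  shows "is_rank (\<lambda>x y. r y x) {x \<in> V. i < f x} g"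
  unfolding is_rank_def
proof (intro conjI ballI impI)
  fix x assume x: "x \<in> {x \<in> V. i < f x}" "1 < g x"
  then obtain y where "y \<in> V" "r x y" "g x = Suc (g y)"
    using assms(1) by (auto simp: is_rank_def)
  moreover have "f x < f y"
    using assms(2) x \<open>y \<in> V\<close> \<open>r x y\<close> by (auto simp: is_rank_def)
  ultimately show "\<exists>y\<in>{x \<in> V. i < f x}. r x y \<and> g x = Suc (g y)"
    using x by auto
qed (use assms(1) in \<open>auto simp: is_rank_def\<close>)

lemma flag_equiv_rank_corank:
  assumes "flag_equiv r V s W" "finite V" "finite W" "is_rank r V f" "is_rank s W f'"
    and "is_rank (\<lambda>x y. r y x) V g" "is_rank (\<lambda>x y. s y x) W g'"
  shows "flag_equiv r {x \<in> V. i < f x \<and> j < g x} s {x \<in> W. i < f' x \<and> j < g' x}"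
proof -
  let ?V = "{x \<in> V. i < f x}" and ?W = "{x \<in> W. i < f' x}"
  have fin: "finite ?V" "finite ?W" using assms by auto
  have "flag_equiv r ?V s ?W"
    by (rule flag_equiv_rank_gt[OF assms(1-5)])
  then have "flag_equiv (\<lambda>x y. r y x) ?V (\<lambda>x y. s y x) ?W"
    by (rule flag_equiv_dual) (fact fin)+
  then have "flag_equiv (\<lambda>x y. r y x) {x \<in> ?V. j < g x} (\<lambda>x y. s y x) {x \<in> ?W. j < g' x}"
    using fin is_rank_dual_filter[OF assms(6,4)] is_rank_dual_filter[OF assms(7,5)]
    by (rule flag_equiv_rank_gt)
  then have "flag_equiv (\<lambda>x y. (\<lambda>x y. r y x) y x) {x \<in> ?V. j < g x} (\<lambda>x y. (\<lambda>x y. s y x) y x) {x \<in> ?W. j < g' x}"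
    by (rule flag_equiv_dual) (use assms(2,3) in simp_all)
  moreover have "{x \<in> ?V. j < g x} = {x \<in> V. i < f x \<and> j < g x}" "{x \<in> ?W. j < g' x} = {x \<in> W. i < f' x \<and> j < g' x}"
    by auto
  ultimately show ?thesis by simp
qed

section \<open>Distribution of the numbers of elements below and above\<close>

text \<open>Absorption, \<open>k * (m choose k) = m * ((m - 1) choose (k - 1))\<close>, reduces the
  sum to an alternating row of binomial coefficients. The weights
  \<open>(-1) ^ (k + 1) * int k\<close> serve to pick out the ideals with a single maximal
  element.\<close>

lemma sum_signs_choose:
  assumes "1 \<le> m" "m \<le> c"
  shows "(\<Sum>k=1..c. (-1) ^ (k + 1) * int k * int (m choose k)) = (if m = 1 then 1 else 0)"
proof -
  have "(\<Sum>k=1..c. (-1) ^ (k + 1) * int k * int (m choose k)) =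
        (\<Sum>k=1..m. (-1) ^ (k + 1) * int k * int (m choose k))"
    using assms by (intro sum.mono_neutral_right) (auto simp: binomial_eq_0)
  also have "\<dots> = (\<Sum>i=0..m-1. (-1) ^ i * (int m * int ((m - 1) choose i)))"
  proof (rule sum.reindex_bij_witness[of _ Suc "\<lambda>k. k - 1"])
    fix k assume k: "k \<in> {1..m}"
    then have "k * (m choose k) = m * ((m - 1) choose (k - 1))"
      by (intro times_binomial_minus1_eq) auto
    then have "int k * int (m choose k) = int m * int ((m - 1) choose (k - 1))"
      by (metis of_nat_mult)
    moreover have "(-1) ^ (k + 1) = ((-1) ^ (k - 1) :: int)"
      using k by (cases k) auto
    ultimately show "(-1) ^ (k - 1) * (int m * int ((m - 1) choose (k - 1))) =
        (-1) ^ (k + 1) * int k * int (m choose k)"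
      by (simp add: mult.assoc)
  qed (use assms in auto)
  also have "\<dots> = int m * (\<Sum>i\<le>m-1. (-1) ^ i * int ((m - 1) choose i))"
    by (simp add: sum_distrib_left algebra_simps atMost_atLeast0)
  also have "\<dots> = (if m = 1 then 1 else 0)"
  proof (cases "m = 1")
    case False
    then have "(\<Sum>i\<le>m-1. (-1) ^ i * of_nat ((m - 1) choose i)) = (0::int)"
      using assms by (intro choose_alternating_sum) auto
    then show ?thesis using False by simp
  qed simp
  finally show ?thesis .
qed

context strict_order
begin

text \<open>A weak block followed by a strict block of size \<open>k\<close> amounts to an ideal of
  size \<open>c\<close> with \<open>k\<close> of its maximal elements marked.\<close>

lemma flags_tops:
  assumes "finite V" "k \<le> c" "c \<le> card V"
  shows "flags r V [(c - k, False), (k, True), (card V - c, False)] =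
         (\<Sum>J\<in>blocks r V c False. card (tops r J) choose k)"
proof -
  let ?A = "SIGMA I:blocks r V (c - k) False. blocks r (V - I) k True"
  let ?B = "SIGMA J:blocks r V c False. {K. K \<subseteq> tops r J \<and> card K = k}"
  have one: "flags r (V - I - K) [(card V - c, False)] = 1"
    if "I \<in> blocks r V (c - k) False" "K \<in> blocks r (V - I) k True" for I K
  proof -
    have "card (V - I - K) = card V - c"
      using card_Diff_block[OF _ that(1)] card_Diff_block[OF _ that(2)] assms by simp
    then show ?thesis
      using flags_whole[of "V - I - K" r] assms(1) by simp
  qed
  have "flags r V [(c - k, False), (k, True), (card V - c, False)] =
        (\<Sum>I\<in>blocks r V (c - k) False. \<Sum>K\<in>blocks r (V - I) k True. 1)"
    unfolding flags.simps(2)[of r V] flags.simps(2)[of r "V - I" k True for I]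
    by (intro sum.cong refl one)
  also have "\<dots> = card ?A"
    using assms(1) by (subst card_SigmaI) auto
  also have "card ?A = card ?B"
  proof (rule bij_betw_same_card[OF bij_betw_byWitness[where f = "\<lambda>(I, K). (I \<union> K, K)" and f' = "\<lambda>(J, K). (J - K, K)"]])
    show "\<forall>a\<in>?A. (\<lambda>(J, K). (J - K, K)) ((\<lambda>(I, K). (I \<union> K, K)) a) = a"
      by (auto dest: blocks_subset)
    show "\<forall>b\<in>?B. (\<lambda>(I, K). (I \<union> K, K)) ((\<lambda>(J, K). (J - K, K)) b) = b"
      by (auto simp: tops_def)
    show "(\<lambda>(I, K). (I \<union> K, K)) ` ?A \<subseteq> ?B"
    proof (rule image_subsetI)
      fix p assume "p \<in> ?A"
      then obtain I K where p: "p = (I, K)"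
        and I: "I \<in> blocks r V (c - k) False" and K: "K \<in> blocks r (V - I) k True" by blast
      have sub: "I \<subseteq> V" "K \<subseteq> V - I" using I K by (auto dest: blocks_subset)
      then have "finite I" "finite K" using assms(1) by (meson finite_subset finite_Diff)+
      then have "card (I \<union> K) = c"
        using sub I K assms by (subst card_Un_disjoint) (auto simp: blocks_def)
      moreover have "down_closed r V (I \<union> K)"
        using I K by (auto simp: blocks_def down_closed_def)
      moreover have "K \<subseteq> tops r (I \<union> K)"
        using I K sub by (auto simp: blocks_def down_closed_def unrelated_def tops_def)
      ultimately show "(\<lambda>(I, K). (I \<union> K, K)) p \<in> ?B"
        using K by (simp add: blocks_def p)
    qed
    show "(\<lambda>(J, K). (J - K, K)) ` ?B \<subseteq> ?A"
    proof (rule image_subsetI)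
      fix p assume "p \<in> ?B"
      then obtain J K where p: "p = (J, K)"
        and J: "J \<in> blocks r V c False" and K: "K \<subseteq> tops r J" "k = card K" by blast
      have sub: "J \<subseteq> V" "K \<subseteq> J" using J K by (auto dest: blocks_subset simp: tops_def)
      then have "finite J" "finite K" using assms(1) by (meson finite_subset)+
      then have "card (J - K) = c - card K"
        using sub J by (simp add: card_Diff_subset blocks_def)
      moreover have "down_closed r V (J - K)" "unrelated r K" "down_closed r (V - (J - K)) K"
        using J K by (auto simp: blocks_def down_closed_def tops_def unrelated_def) blast
      ultimately show "(\<lambda>(J, K). (J - K, K)) p \<in> ?A"
        using K(2) by (simp add: blocks_def p)
    qed
  qed
  also have "\<dots> = (\<Sum>J\<in>blocks r V c False. card {K. K \<subseteq> tops r J \<and> card K = k})"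
  proof (rule card_SigmaI)
    show "\<forall>J\<in>blocks r V c False. finite {K. K \<subseteq> tops r J \<and> card K = k}"
    proof
      fix J assume "J \<in> blocks r V c False"
      then have "finite J" using assms(1) by (auto dest: blocks_subset finite_subset)
      then show "finite {K. K \<subseteq> tops r J \<and> card K = k}"
        by (rule_tac finite_subset[of _ "Pow J"]) (auto simp: tops_def)
    qed
  qed (use assms in auto)
  also have "\<dots> = (\<Sum>J\<in>blocks r V c False. card (tops r J) choose k)"
  proof (rule sum.cong[OF refl])
    fix J assume "J \<in> blocks r V c False"
    then have "finite J" using assms(1) by (auto dest: blocks_subset finite_subset)
    then have "finite (tops r J)" by (simp add: tops_def)
    then show "card {K. K \<subseteq> tops r J \<and> card K = k} = card (tops r J) choose k"
      by (rule n_subsets)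
  qed
  finally show ?thesis .
qed

text \<open>Elements with \<open>c\<close> elements below them correspond to principal ideals of
  size \<open>Suc c\<close>, and an ideal is principal when it has exactly one maximal element.
  \<open>sum_signs_choose\<close> expresses that condition by the counts of
  \<open>flags_tops\<close>.\<close>

lemma card_below_eq:
  assumes "finite V" "c < card V"
  shows "int (card {x \<in> V. card {y \<in> V. r y x} = c}) =
         (\<Sum>k=1..Suc c. (-1) ^ (k + 1) * int k *
            int (flags r V [(Suc c - k, False), (k, True), (card V - Suc c, False)]))"
proof -
  let ?B = "blocks r V (Suc c) False"
  let ?D = "\<lambda>x. {y \<in> V. y = x \<or> r y x}"
  have cD: "card (?D x) = Suc (card {y \<in> V. r y x})" if "x \<in> V" for x
  proof -
    have "?D x = insert x {y \<in> V. r y x}" using that by auto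
    then show ?thesis using assms(1) irrefl by simp
  qed
  have tD: "tops r (?D x) = {x}" if "x \<in> V" for x
    using that irrefl asym by (auto simp: tops_def)
  have "bij_betw ?D {x \<in> V. card {y \<in> V. r y x} = c} {J \<in> ?B. card (tops r J) = 1}"
  proof (rule bij_betwI')
    fix x y assume "x \<in> {x \<in> V. card {y \<in> V. r y x} = c}" "y \<in> {x \<in> V. card {y \<in> V. r y x} = c}"
    then have xy: "x \<in> V" "y \<in> V" by auto
    show "(?D x = ?D y) = (x = y)"
    proof
      assume eq: "?D x = ?D y"
      have "{x} = {y}"
        using tD[OF xy(1)] tD[OF xy(2)] unfolding eq by (rule HOL.trans[OF sym])
      then show "x = y" by simp
    qed simp
  next
    fix x assume x: "x \<in> {x \<in> V. card {y \<in> V. r y x} = c}"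
    then have "down_closed r V (?D x)"
      using trans by (auto simp: down_closed_def)
    then show "?D x \<in> {J \<in> ?B. card (tops r J) = 1}"
      using x tD cD by (simp add: blocks_def)
  next
    fix J assume "J \<in> {J \<in> ?B. card (tops r J) = 1}"
    then have J: "down_closed r V J" "card J = Suc c" "card (tops r J) = 1"
      by (auto simp: blocks_def)
    then obtain x where x: "tops r J = {x}" by (auto simp: card_1_singleton_iff)
    then have xJ: "x \<in> J" by (auto simp: tops_def)
    have JV: "J \<subseteq> V" using J(1) by (simp add: down_closed_def)
    then have "finite J" using assms(1) finite_subset by blast
    have "J = ?D x"
    proof (intro equalityI subsetI)
      fix y assume y: "y \<in> J"
      then obtain m where "m \<in> tops r J" "m = y \<or> r y m"
        using ex_above_top[OF \<open>finite J\<close>] by blast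
      then show "y \<in> ?D x" using x y JV by auto
    next
      fix y assume "y \<in> ?D x"
      then show "y \<in> J" using xJ J(1) by (auto simp: down_closed_def)
    qed
    moreover have "x \<in> V" using xJ JV by auto
    moreover have "card {y \<in> V. r y x} = c"
      using cD[OF \<open>x \<in> V\<close>] \<open>J = ?D x\<close> J(2) by simp
    ultimately show "\<exists>x\<in>{x \<in> V. card {y \<in> V. r y x} = c}. J = ?D x" by blast
  qed
  then have "int (card {x \<in> V. card {y \<in> V. r y x} = c}) = int (card {J \<in> ?B. card (tops r J) = 1})"
    by (simp add: bij_betw_same_card)
  also have "\<dots> = (\<Sum>J\<in>?B. if card (tops r J) = 1 then 1 else 0)"
    using assms(1) by (simp flip: sum.inter_filter)
  also have "\<dots> = (\<Sum>J\<in>?B. \<Sum>k=1..Suc c. (-1) ^ (k + 1) * int k * int (card (tops r J) choose k))"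
  proof (rule sum.cong[OF refl])
    fix J assume J: "J \<in> ?B"
    then have cJ: "card J = Suc c"
      by (simp add: blocks_def)
    then have "finite J" "J \<noteq> {}"
      using card.infinite by fastforce+
    then have "tops r J \<noteq> {}" "finite (tops r J)" "card (tops r J) \<le> Suc c"
      using ex_above_top[of J] card_mono[of J "tops r J"] cJ by (auto simp: tops_def)
    then show "(if card (tops r J) = 1 then 1 else 0) =
        (\<Sum>k=1..Suc c. (-1) ^ (k + 1) * int k * int (card (tops r J) choose k))"
      by (intro sum_signs_choose[symmetric]) (auto simp: Suc_le_eq card_gt_0_iff)
  qed
  also have "\<dots> = (\<Sum>k=1..Suc c. (-1) ^ (k + 1) * int k * (\<Sum>J\<in>?B. int (card (tops r J) choose k)))"
    by (subst sum.swap) (simp add: sum_distrib_left)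
  also have "\<dots> = (\<Sum>k=1..Suc c. (-1) ^ (k + 1) * int k *
            int (flags r V [(Suc c - k, False), (k, True), (card V - Suc c, False)]))"
    using assms by (intro sum.cong refl) (simp only: flags_tops of_nat_sum atLeastAtMost_iff Suc_le_eq)
  finally show ?thesis .
qed

end

lemma flag_equiv_card_below:
  assumes "flag_equiv r V s W" "finite V" "finite W" "strict_order r" "strict_order s"
  shows "card {x \<in> V. card {y \<in> V. r y x} = c} = card {x \<in> W. card {y \<in> W. s y x} = c}"
proof (cases "c < card V")
  case True
  have "int (card {x \<in> V. card {y \<in> V. r y x} = c}) = int (card {x \<in> W. card {y \<in> W. s y x} = c})"
    using strict_order.card_below_eq[OF assms(4,2) True] strict_order.card_below_eq[OF assms(5,3), of c]
      True flag_equiv_card[OF assms(1-3)] assms(1)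
    by (simp add: flag_equiv_def del: flags.simps)
  then show ?thesis by simp
next
  case False
  have *: "{x \<in> U. card {y \<in> U. q y x} = c} = {}"
    if "strict_order q" "finite U" "card U \<le> c" for q :: "'z \<Rightarrow> 'z \<Rightarrow> bool" and U
  proof -
    have "card {y \<in> U. q y x} < card U" if "x \<in> U" for x
      using that \<open>finite U\<close> strict_order.irrefl[OF \<open>strict_order q\<close>, of x]
      by (intro psubset_card_mono) auto
    then have "card {y \<in> U. q y x} \<noteq> c" if "x \<in> U" for x
      using that \<open>card U \<le> c\<close> by (metis leD)
    then show ?thesis by blast
  qed
  have "card V \<le> c" "card W \<le> c"
    using False flag_equiv_card[OF assms(1-3)] by simp_all
  then show ?thesis
    by (simp only: *[OF assms(4,2)] *[OF assms(5,3)] card.empty)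
qed

lemma flag_equiv_card_above:
  assumes "flag_equiv r V s W" "finite V" "finite W" "strict_order r" "strict_order s"
  shows "card {x \<in> V. card {y \<in> V. r x y} = c} = card {x \<in> W. card {y \<in> W. s x y} = c}"
  using flag_equiv_card_below[OF flag_equiv_dual[OF assms(1-3)] assms(2,3)
      strict_order.dual[OF assms(4)] strict_order.dual[OF assms(5)]] .


section \<open>Maximum antichains, the lowest one, and the parts below and above it\<close>

text \<open>\<open>I\<close> is the union of the blocks read by \<open>u\<close>; what happens
  inside \<open>I\<close> and outside it is independent, hence the product.\<close>

lemma flags_append:
  assumes "finite V"
  shows "flags r V (u @ v) =
    (\<Sum>I\<in>blocks r V (sum_list (map fst u)) False. flags r I u * flags r (V - I) v)"
  using assms
proof (induction u arbitrary: V)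
  case (Cons a u)
  obtain k b where a: "a = (k, b)" by (cases a)
  let ?n = "sum_list (map fst u)"
  let ?S = "SIGMA I:blocks r V k b. blocks r (V - I) ?n False"
  let ?T = "SIGMA J:blocks r V (k + ?n) False. blocks r J k b"
  have "flags r V ((a # u) @ v) = (\<Sum>I\<in>blocks r V k b. \<Sum>K\<in>blocks r (V - I) ?n False.
          flags r K u * flags r (V - I - K) v)"
    using Cons by (simp add: a)
  also have "\<dots> = (\<Sum>(I, K)\<in>?S. flags r K u * flags r (V - I - K) v)"
    using Cons.prems by (subst sum.Sigma) auto
  also have "\<dots> = (\<Sum>(J, I)\<in>?T. flags r (J - I) u * flags r (V - J) v)"
  proof (rule sum.reindex_bij_witness[of _ "\<lambda>(J, I). (I, J - I)" "\<lambda>(I, K). (I \<union> K, I)"])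
    fix p assume "p \<in> ?S"
    then obtain I K where p: "p = (I, K)" and I: "I \<in> blocks r V k b"
      and K: "K \<in> blocks r (V - I) ?n False" by blast
    have sub: "I \<subseteq> V" "K \<subseteq> V - I" using blocks_subset I K by metis+
    then have "finite I" "finite K" using Cons.prems by (meson finite_subset finite_Diff)+
    then have "card (I \<union> K) = k + ?n"
      using sub I K by (subst card_Un_disjoint) (auto simp: blocks_def)
    moreover have "down_closed r V (I \<union> K)" "down_closed r (I \<union> K) I"
      using I K by (auto simp: blocks_def down_closed_def)
    ultimately show "(\<lambda>(I, K). (I \<union> K, I)) p \<in> ?T"
      using I by (simp add: p blocks_def)
    have eq: "I \<union> K - I = K" "V - (I \<union> K) = V - I - K" using sub by auto
    show "(\<lambda>(J, I). (I, J - I)) ((\<lambda>(I, K). (I \<union> K, I)) p) = p"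
      by (simp add: p eq)
    show "(case (\<lambda>(I, K). (I \<union> K, I)) p of (J, I) \<Rightarrow> flags r (J - I) u * flags r (V - J) v) =
          (case p of (I, K) \<Rightarrow> flags r K u * flags r (V - I - K) v)"
      by (simp add: p eq)
  next
    fix q assume "q \<in> ?T"
    then obtain J I where q: "q = (J, I)" and J: "J \<in> blocks r V (k + ?n) False"
      and I: "I \<in> blocks r J k b" by blast
    have sub: "J \<subseteq> V" "I \<subseteq> J" using blocks_subset I J by metis+
    then have fin: "finite J" "finite I" using Cons.prems by (meson finite_subset)+
    have "card (J - I) = ?n"
      using fin sub I J by (simp add: card_Diff_subset blocks_def)
    moreover have "down_closed r V I" "down_closed r (V - I) (J - I)"
      using I J by (auto simp: blocks_def down_closed_def)
    ultimately show "(\<lambda>(J, I). (I, J - I)) q \<in> ?S"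
      using I by (simp add: q blocks_def)
    have "I \<union> (J - I) = J" using sub by auto
    then show "(\<lambda>(I, K). (I \<union> K, I)) ((\<lambda>(J, I). (I, J - I)) q) = q"
      by (simp add: q)
  qed
  also have "\<dots> = (\<Sum>J\<in>blocks r V (k + ?n) False. \<Sum>I\<in>blocks r J k b. flags r (J - I) u * flags r (V - J) v)"
  proof (subst sum.Sigma)
    show "\<forall>J\<in>blocks r V (k + ?n) False. finite (blocks r J k b)"
      using Cons.prems by (meson blocks_subset finite_blocks finite_subset)
  qed (use Cons.prems in auto)
  finally show ?case by (simp add: a sum_distrib_right)
qed simp

definition below :: "('a \<Rightarrow> 'a \<Rightarrow> bool) \<Rightarrow> 'a set \<Rightarrow> 'a set \<Rightarrow> 'a set" where
  "below r V A = {x \<in> V. \<exists>a\<in>A. r x a}"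

definition above :: "('a \<Rightarrow> 'a \<Rightarrow> bool) \<Rightarrow> 'a set \<Rightarrow> 'a set \<Rightarrow> 'a set" where
  "above r V A = {x \<in> V. \<exists>a\<in>A. r a x}"

definition max_antichain :: "('a \<Rightarrow> 'a \<Rightarrow> bool) \<Rightarrow> 'a set \<Rightarrow> 'a set \<Rightarrow> bool" where
  "max_antichain r V A \<longleftrightarrow> A \<subseteq> V \<and> unrelated r A \<and> (\<forall>B. B \<subseteq> V \<longrightarrow> unrelated r B \<longrightarrow> card B \<le> card A)"

text \<open>Least by cardinality of the part below; the meet of two maximum antichains turns this
  into least by inclusion, see \<open>lowest_below_subset\<close>.\<close>

definition lowest :: "('a \<Rightarrow> 'a \<Rightarrow> bool) \<Rightarrow> 'a set \<Rightarrow> 'a set \<Rightarrow> bool" where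
  "lowest r V A \<longleftrightarrow> max_antichain r V A \<and>
     (\<forall>B. max_antichain r V B \<longrightarrow> card (below r V A) \<le> card (below r V B))"

lemma below_dual: "below (\<lambda>x y. r y x) V A = above r V A"
  and above_dual: "above (\<lambda>x y. r y x) V A = below r V A"
  by (auto simp: below_def above_def)

lemma unrelated_dual: "unrelated (\<lambda>x y. r y x) A = unrelated r A"
  by (auto simp: unrelated_def)

lemma max_antichain_dual: "max_antichain (\<lambda>x y. r y x) V A = max_antichain r V A"
  unfolding max_antichain_def unrelated_def by meson

lemma finite_below [simp]: "finite V \<Longrightarrow> finite (below r V A)"
  and finite_above [simp]: "finite V \<Longrightarrow> finite (above r V A)"
  by (simp_all add: below_def above_def)

lemma ex_max_antichain:
  assumes "finite V"
  shows "\<exists>A. max_antichain r V A"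
proof -
  let ?Q = "\<lambda>A. A \<subseteq> V \<and> unrelated r A"
  have empty: "?Q {}" by (auto simp: unrelated_def)
  have bound: "\<forall>A. ?Q A \<longrightarrow> card A < Suc (card V)"
    using assms by (simp add: card_mono less_Suc_eq_le)
  obtain A where "?Q A \<and> (\<forall>B. ?Q B \<longrightarrow> card B \<le> card A)"
    using ex_has_greatest_nat[of ?Q "{}" card "Suc (card V)", OF empty bound] by (rule exE)
  then show ?thesis
    unfolding max_antichain_def by (intro exI[of _ A]) simp
qed

lemma ex_lowest:
  assumes "finite V"
  shows "\<exists>A. lowest r V A"
proof -
  obtain A where "max_antichain r V A" using ex_max_antichain[OF assms] by blast
  then show ?thesis
    using ex_has_least_nat[of "max_antichain r V" A "\<lambda>A. card (below r V A)"]
    by (auto simp: lowest_def)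
qed

context strict_order
begin

lemma max_antichain_cover:
  assumes "max_antichain r V A" "finite V" "x \<in> V" "x \<notin> A"
  shows "x \<in> below r V A \<or> x \<in> above r V A"
proof (rule ccontr)
  assume "\<not> (x \<in> below r V A \<or> x \<in> above r V A)"
  then have "unrelated r (insert x A)"
    using assms irrefl unfolding max_antichain_def unrelated_def below_def above_def by auto
  moreover have "insert x A \<subseteq> V"
    using assms by (auto simp: max_antichain_def)
  ultimately have "card (insert x A) \<le> card A"
    using assms(1) by (auto simp: max_antichain_def)
  moreover have "finite A"
    using assms by (auto simp: max_antichain_def dest: finite_subset)
  ultimately show False
    using assms(4) by simp
qed

lemma unrelated_below_above:
  assumes "unrelated r A"
  shows "below r V A \<inter> above r V A = {}" "below r V A \<inter> A = {}" "above r V A \<inter> A = {}"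
  using assms trans unfolding unrelated_def below_def above_def by blast+

lemma down_closed_below: "down_closed r V (below r V A)"
  using trans unfolding down_closed_def below_def by blast

lemma max_antichain_split:
  assumes "max_antichain r V A" "finite V"
  shows "V = below r V A \<union> A \<union> above r V A"
  using max_antichain_cover[OF assms] assms(1)
  unfolding max_antichain_def below_def above_def by blast

lemma Diff_below: 
  assumes "max_antichain r V A" "finite V"
  shows "V - below r V A - A = above r V A"
proof -
  have "unrelated r A" using assms by (simp add: max_antichain_def)
  then show ?thesis
    using max_antichain_split[OF assms] unrelated_below_above[of A V] by blast
qed

lemma antichain_block:
  assumes "unrelated r A" "A \<subseteq> V"
  shows "A \<in> blocks r (V - below r V A) (card A) True"
  using assms unrelated_below_above(2)[OF assms(1), of V] irrefl
  unfolding blocks_def down_closed_def below_def by auto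

text \<open>Every element outside a maximum antichain is comparable to some element of it. So an
  ideal that is followed directly by a block of maximum size must be the whole part below that
  block.\<close>

lemma max_antichain_block:
  assumes "max_antichain r V B" "finite V" "down_closed r V I" "A \<in> blocks r (V - I) (card B) True"
  shows "max_antichain r V A" "I = below r V A"
proof -
  have A: "A \<subseteq> V - I" "unrelated r A" "card A = card B" "down_closed r (V - I) A"
    using assms(4) by (auto simp: blocks_def down_closed_def)
  then show mA: "max_antichain r V A"
    using assms(1) by (auto simp: max_antichain_def)
  show "I = below r V A"
  proof (intro equalityI subsetI)
    fix x assume x: "x \<in> I"
    then have xV: "x \<in> V" "x \<notin> A" using A assms(3) by (auto simp: down_closed_def)
    show "x \<in> below r V A"
    proof (rule ccontr)
      assume "x \<notin> below r V A"
      then have "x \<in> above r V A" using max_antichain_cover[OF mA assms(2) xV] by blast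
      then obtain a where "a \<in> A" "r a x" by (auto simp: above_def)
      then have "a \<in> I" using x A assms(3) by (auto simp: down_closed_def)
      then show False using \<open>a \<in> A\<close> A by auto
    qed
  next
    fix x assume "x \<in> below r V A"
    then obtain a where a: "x \<in> V" "a \<in> A" "r x a" by (auto simp: below_def)
    show "x \<in> I"
    proof (rule ccontr)
      assume "x \<notin> I"
      then have "x \<in> A" using a A(4) by (auto simp: down_closed_def)
      then show False using a A(2) by (auto simp: unrelated_def)
    qed
  qed
qed

text \<open>A maximum antichain can be recovered as the set of minimal elements of what is not below
  it.\<close>

lemma max_antichain_eqI:
  assumes "max_antichain r V A" "max_antichain r V B" "finite V" "below r V A = below r V B"
  shows "A = B"
proof -
  have *: "C = bots r (V - below r V C)" if C: "max_antichain r V C" for C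
  proof (rule card_subset_eq)
    show "finite (bots r (V - below r V C))" using assms by simp
    have c: "C \<subseteq> V" "unrelated r C" using C by (auto simp: max_antichain_def)
    show sub: "C \<subseteq> bots r (V - below r V C)"
      using c irrefl unfolding bots_def below_def unrelated_def by auto
    have "unrelated r (bots r (V - below r V C))" "bots r (V - below r V C) \<subseteq> V"
      by (auto simp: unrelated_def bots_def)
    then show "card C = card (bots r (V - below r V C))"
      using C sub assms(3) card_mono[of "bots r (V - below r V C)" C]
      by (auto simp: max_antichain_def intro!: le_antisym)
  qed
  show ?thesis using *[OF assms(1)] *[OF assms(2)] assms(4) by simp
qed

text \<open>The minimal and the maximal elements of \<open>A \<union> B\<close> form two antichains
  that cover \<open>A \<union> B\<close> and share \<open>A \<inter> B\<close>. Their sizes thus add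
  up to at least \<open>card A + card B\<close>, and as neither exceeds the maximum, both attain
  it.\<close>

lemma max_antichain_meet:
  assumes A: "max_antichain r V A" and B: "max_antichain r V B" and fin: "finite V"
  shows "max_antichain r V (bots r (A \<union> B))" "below r V (bots r (A \<union> B)) \<subseteq> below r V A \<inter> below r V B"
proof -
  let ?m = "bots r (A \<union> B)" and ?j = "tops r (A \<union> B)"
  have a: "A \<subseteq> V" "unrelated r A" "B \<subseteq> V" "unrelated r B" "card A = card B"
    using A B by (auto simp: max_antichain_def intro!: le_antisym)
  have finAB: "finite A" "finite B" using a fin finite_subset by blast+
  have un: "unrelated r ?m" "unrelated r ?j" "?m \<subseteq> V" "?j \<subseteq> V"
    using a by (auto simp: bots_def tops_def unrelated_def)
  then have le: "card ?m \<le> card A" "card ?j \<le> card A"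
    using A by (auto simp: max_antichain_def)
  \<comment> \<open>An element neither minimal nor maximal would sit in a chain of three elements,
    two of which belong to the same antichain.\<close>
  have "?m \<union> ?j = A \<union> B"
  proof (intro equalityI subsetI)
    fix x assume x: "x \<in> A \<union> B"
    show "x \<in> ?m \<union> ?j"
    proof (rule ccontr)
      assume "x \<notin> ?m \<union> ?j"
      then obtain y z where yz: "y \<in> A \<union> B" "z \<in> A \<union> B" "r y x" "r x z"
        using x by (auto simp: bots_def tops_def)
      then have "r y z" using trans by blast
      then show False using x yz a(2,4) unfolding unrelated_def by blast
    qed
  qed (auto simp: bots_def tops_def)
  moreover have "A \<inter> B \<subseteq> ?m \<inter> ?j"
    using a(2,4) unfolding unrelated_def bots_def tops_def by blast
  then have "card (A \<inter> B) \<le> card (?m \<inter> ?j)"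
    using finAB by (intro card_mono) (auto simp: bots_def)
  moreover have "card ?m + card ?j = card (?m \<union> ?j) + card (?m \<inter> ?j)"
    using finAB by (intro card_Un_Int) (auto simp: bots_def tops_def)
  moreover have "card A + card B = card (A \<union> B) + card (A \<inter> B)"
    using finAB by (rule card_Un_Int)
  ultimately have "card ?m = card A" using le a(5) by simp
  then show mm: "max_antichain r V ?m"
    using un A by (simp add: max_antichain_def)
  have half: "below r V ?m \<subseteq> below r V C"
    if C: "max_antichain r V C" "C \<subseteq> A \<union> B" for C
  proof
    fix z assume "z \<in> below r V ?m"
    then obtain x where x: "z \<in> V" "x \<in> ?m" "r z x" by (auto simp: below_def)
    show "z \<in> below r V C"
    proof (cases "x \<in> C")
      case True
      then show ?thesis using x by (auto simp: below_def)
    next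
      case False
      have "x \<notin> above r V C" using x(2) C(2) by (auto simp: bots_def above_def)
      then have "x \<in> below r V C"
        using max_antichain_cover[OF C(1) fin _ False] x(2) un(3) by blast
      then show ?thesis using x trans by (auto simp: below_def)
    qed
  qed
  show "below r V ?m \<subseteq> below r V A \<inter> below r V B"
    using half[OF A] half[OF B] by blast
qed

lemma lowest_below_subset:
  assumes "lowest r V A" "max_antichain r V B" "finite V"
  shows "below r V A \<subseteq> below r V B"
proof -
  have A: "max_antichain r V A" using assms(1) by (simp add: lowest_def)
  let ?m = "bots r (A \<union> B)"
  have m: "max_antichain r V ?m" "below r V ?m \<subseteq> below r V A" "below r V ?m \<subseteq> below r V B"
    using max_antichain_meet[OF A assms(2,3)] by auto
  then have "card (below r V A) \<le> card (below r V ?m)"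
    using assms(1) by (simp add: lowest_def)
  then have "below r V ?m = below r V A"
    using m(2) assms(3) by (meson card_seteq finite_below)
  then show ?thesis using m(3) by simp
qed

text \<open>The part below the lowest maximum antichain is the only ideal of its size that can
  precede a strict block of size \<open>card A\<close>. The sum over cuts therefore has one nonzero
  term, and the flag count factors.\<close>

lemma flags_lowest:
  assumes "lowest r V A" "finite V" "sum_list (map fst u) = card (below r V A)"
  shows "flags r V (u @ (card A, True) # u') = flags r (below r V A) u * flags r (above r V A) u'"
proof -
  have A: "max_antichain r V A" using assms(1) by (simp add: lowest_def)
  let ?D = "below r V A"
  have uniq: "B = A \<and> I = ?D" if I: "I \<in> blocks r V (card ?D) False"
    and B: "B \<in> blocks r (V - I) (card A) True" for I B
  proof -
    have dc: "down_closed r V I" "card I = card ?D" using I by (auto simp: blocks_def)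
    have mB: "max_antichain r V B" "I = below r V B"
      using max_antichain_block[OF A assms(2) dc(1) B] by auto
    have "?D = below r V B"
    proof (rule card_subset_eq)
      show "?D \<subseteq> below r V B" by (rule lowest_below_subset[OF assms(1) mB(1) assms(2)])
      show "card ?D = card (below r V B)" using dc(2) by (simp only: mB(2)[symmetric])
    qed (use assms(2) in simp)
    then show ?thesis
      using max_antichain_eqI[OF mB(1) A assms(2)] mB(2) by (metis (no_types))
  qed
  have D: "?D \<in> blocks r V (card ?D) False"
    using down_closed_below by (simp add: blocks_def)
  have AD: "blocks r (V - ?D) (card A) True = {A}"
    using uniq[OF D] antichain_block[of A V] A by (auto simp: max_antichain_def)
  have "flags r V (u @ (card A, True) # u') =
    (\<Sum>I\<in>blocks r V (card ?D) False. flags r I u * flags r (V - I) ((card A, True) # u'))"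
    using assms by (simp only: flags_append)
  also have "\<dots> = (\<Sum>I\<in>{?D}. flags r I u * flags r (V - I) ((card A, True) # u'))"
  proof (rule sum.mono_neutral_right)
    show "\<forall>I\<in>blocks r V (card ?D) False - {?D}. flags r I u * flags r (V - I) ((card A, True) # u') = 0"
    proof
      fix I assume I: "I \<in> blocks r V (card ?D) False - {?D}"
      then have "blocks r (V - I) (card A) True = {}"
        using uniq[of I] by blast
      then show "flags r I u * flags r (V - I) ((card A, True) # u') = 0" by simp
    qed
  qed (use assms D in auto)
  also have "\<dots> = flags r ?D u * flags r (above r V A) u'"
    using AD Diff_below[OF A assms(2)] by simp
  finally show ?thesis .
qed

text \<open>The flag through the part below \<open>A\<close>, \<open>A\<close> and the rest is a
  witness. Together with \<open>flags_antichain\<close>, its nonvanishing carries antichains from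
  one poset to a flag equivalent one.\<close>

lemma antichain_flags:
  assumes "finite V" "A \<subseteq> V" "unrelated r A"
  shows "flags r V [(card (below r V A), False), (card A, True),
           (card V - card (below r V A) - card A, False)] \<noteq> 0"
proof -
  let ?D = "below r V A"
  have D: "?D \<in> blocks r V (card ?D) False"
    using down_closed_below by (simp add: blocks_def)
  have A: "A \<in> blocks r (V - ?D) (card A) True"
    using antichain_block assms by blast
  have "card (V - ?D - A) = card V - card ?D - card A"
    using card_Diff_block[OF _ D] card_Diff_block[OF _ A] assms by simp
  then have "flags r (V - ?D - A) [(card V - card ?D - card A, False)] = 1"
    using flags_whole[of "V - ?D - A" r] assms by simp
  then have "0 < flags r (V - ?D) [(card A, True), (card V - card ?D - card A, False)]"
    unfolding flags.simps(2)[of r "V - ?D"]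
    using sum_pos2[OF finite_blocks A, of "\<lambda>I. flags r (V - ?D - I) [(card V - card ?D - card A, False)]"] assms
    by simp
  then have "0 < flags r V [(card ?D, False), (card A, True), (card V - card ?D - card A, False)]"
    unfolding flags.simps(2)[of r V]
    using sum_pos2[OF finite_blocks D, of "\<lambda>I. flags r (V - I) [(card A, True), (card V - card ?D - card A, False)]"] assms
    by simp
  then show ?thesis by simp
qed

end

lemma flags_antichain:
  assumes "flags r V [(i, False), (k, True), (j, False)] \<noteq> 0"
  shows "\<exists>A. A \<subseteq> V \<and> unrelated r A \<and> card A = k"
proof -
  obtain I where "flags r (V - I) [(k, True), (j, False)] \<noteq> 0"
    using assms unfolding flags.simps(2)[of r V] by (metis (no_types, lifting) sum.not_neutral_contains_not_neutral)
  then obtain A where "A \<in> blocks r (V - I) k True"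
    unfolding flags.simps(2)[of r "V - I"] by (metis (no_types, lifting) sum.not_neutral_contains_not_neutral)
  then show ?thesis by (auto simp: blocks_def down_closed_def)
qed

lemma flag_equiv_max_antichain:
  assumes eq: "flag_equiv r V s W" and fin: "finite V" "finite W" and so: "strict_order r" "strict_order s"
    and A: "max_antichain r V A" and B: "max_antichain s W B"
  shows "card A = card B"
proof (rule le_antisym)
  \<comment> \<open>Fresh type variables make the inequality available in both directions.\<close>
  have *: "card C \<le> card D" if "flag_equiv q U p T" "finite U" "strict_order q"
    "max_antichain q U C" "max_antichain p T D"
    for q :: "'c \<Rightarrow> 'c \<Rightarrow> bool" and p :: "'d \<Rightarrow> 'd \<Rightarrow> bool" and U T C D
  proof -
    interpret strict_order q by fact
    have C: "C \<subseteq> U" "unrelated q C" using that by (auto simp: max_antichain_def)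
    have "flags p T [(card (below q U C), False), (card C, True),
           (card U - card (below q U C) - card C, False)] \<noteq> 0"
      using antichain_flags[OF \<open>finite U\<close> C] that(1) by (metis flag_equiv_def)
    then obtain C' where "C' \<subseteq> T" "unrelated p C'" "card C' = card C"
      using flags_antichain by blast
    then show ?thesis using that(5) by (auto simp: max_antichain_def)
  qed
  show "card A \<le> card B" using *[OF eq fin(1) so(1) A B] .
  show "card B \<le> card A" using *[OF flag_equiv_sym[OF eq] fin(2) so(2) B A] .
qed

text \<open>The least size of an ideal that can precede a strict block of maximum size is visible in
  the flag data. Once the lower parts have the same size, \<open>flags_lowest\<close> applies with
  the same words on both sides, and a single weak block filling one part sets its factor to 1, which
  isolates the other.\<close>

lemma flag_equiv_lowest:
  assumes eq: "flag_equiv r V s W" and fin: "finite V" "finite W" and so: "strict_order r" "strict_order s"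
    and A: "lowest r V A" and B: "lowest s W B"
  shows "card (below r V A) = card (below s W B)"
    and "flag_equiv r (below r V A) s (below s W B)"
    and "flag_equiv r (above r V A) s (above s W B)"
proof -
  have mA: "max_antichain r V A" and mB: "max_antichain s W B"
    using A B by (auto simp: lowest_def)
  have cAB: "card A = card B"
    by (rule flag_equiv_max_antichain[OF eq fin so mA mB])
  have le: "card (below p T D) \<le> card (below q U C)"
    if "flag_equiv q U p T" "finite U" "finite T" "strict_order q" "strict_order p"
      "max_antichain q U C" "lowest p T D" "card C = card D"
    for q :: "'c \<Rightarrow> 'c \<Rightarrow> bool" and p :: "'d \<Rightarrow> 'd \<Rightarrow> bool" and U T C D
  proof -
    interpret q: strict_order q by fact
    interpret p: strict_order p by fact
    note prems = that
    let ?w = "[(card C, True), (card U - card (below q U C) - card C, False)]"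
    have C: "C \<subseteq> U" "unrelated q C" using that by (auto simp: max_antichain_def)
    have "flags p T ((card (below q U C), False) # ?w) \<noteq> 0"
      using q.antichain_flags[OF \<open>finite U\<close> C] that(1) by (metis flag_equiv_def)
    then obtain I where I: "I \<in> blocks p T (card (below q U C)) False" "flags p (T - I) ?w \<noteq> 0"
      unfolding flags.simps(2)[of p T] by (metis (no_types, lifting) sum.not_neutral_contains_not_neutral)
    then obtain F where F: "F \<in> blocks p (T - I) (card D) True"
      unfolding flags.simps(2)[of p "T - I"] prems(8)
      by (metis (no_types, lifting) sum.not_neutral_contains_not_neutral)
    have "max_antichain p T D" using that by (simp add: lowest_def)
    moreover have "down_closed p T I" "card I = card (below q U C)" using I by (auto simp: blocks_def)
    ultimately have "max_antichain p T F" "I = below p T F"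
      using p.max_antichain_block[OF _ that(3) _ F] by auto
    then show ?thesis
      using that(7) \<open>card I = _\<close> by (auto simp: lowest_def)
  qed
  show d: "card (below r V A) = card (below s W B)"
    using le[OF eq fin so mA B cAB] le[OF flag_equiv_sym[OF eq] fin(2,1) so(2,1) mB A cAB[symmetric]]
    by simp
  have cU: "card (above r V A) = card (above s W B)"
  proof -
    have "card V = card (below r V A) + card A + card (above r V A)"
      if "strict_order r" "finite V" "max_antichain r V A" for r :: "'c \<Rightarrow> 'c \<Rightarrow> bool" and V A
    proof -
      interpret strict_order r by fact
      have un: "unrelated r A" "finite A" using that by (auto simp: max_antichain_def dest: finite_subset)
      have "card (below r V A \<union> A \<union> above r V A) = card (below r V A \<union> A) + card (above r V A)"
        using that un unrelated_below_above[OF un(1), of V] by (intro card_Un_disjoint) auto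
      also have "card (below r V A \<union> A) = card (below r V A) + card A"
        using that un unrelated_below_above[OF un(1), of V] by (intro card_Un_disjoint) auto
      finally show ?thesis using max_antichain_split[OF that(3,2)] by simp
    qed
    from this[OF so(1) fin(1) mA] this[OF so(2) fin(2) mB] show ?thesis
      using flag_equiv_card[OF eq fin] d cAB by simp
  qed
  have prod: "flags r (below r V A) u * flags r (above r V A) u' =
        flags s (below s W B) u * flags s (above s W B) u'"
    if "sum_list (map fst u) = card (below r V A)" for u u'
    using strict_order.flags_lowest[OF so(1) A fin(1) that, of u']
      strict_order.flags_lowest[OF so(2) B fin(2), of u u'] that d eq cAB
    by (simp add: flag_equiv_def)
  show "flag_equiv r (below r V A) s (below s W B)"
    unfolding flag_equiv_def
  proof
    fix u
    show "flags r (below r V A) u = flags s (below s W B) u"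
    proof (cases "sum_list (map fst u) = card (below r V A)")
      case True
      have "flags r (above r V A) [(card (above r V A), False)] = 1"
        "flags s (above s W B) [(card (above r V A), False)] = 1"
        using flags_whole[of "above r V A" r] flags_whole[of "above s W B" s] fin cU by auto
      then show ?thesis using prod[OF True, of "[(card (above r V A), False)]"] by (simp only: mult_1_right)
    next
      case False
      then have "flags r (below r V A) u = 0" "flags s (below s W B) u = 0"
        using flags_empty_size[of "below r V A" r u] flags_empty_size[of "below s W B" s u] fin d by auto
      then show ?thesis by simp
    qed
  qed
  show "flag_equiv r (above r V A) s (above s W B)"
    unfolding flag_equiv_def
  proof
    fix u'
    let ?u = "[(card (below r V A), False)]"
    have "flags r (below r V A) ?u = 1" "flags s (below s W B) ?u = 1"
      using flags_whole[of "below r V A" r] flags_whole[of "below s W B" s] fin d by auto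
    then show "flags r (above r V A) u' = flags s (above s W B) u'"
      using prod[of ?u u'] by (simp only: mult_1_left) simp
  qed
qed


section \<open>Longest chains and the nearly hook shape\<close>

definition chain_in :: "('a \<Rightarrow> 'a \<Rightarrow> bool) \<Rightarrow> 'a set \<Rightarrow> 'a set \<Rightarrow> bool" where
  "chain_in r V C \<longleftrightarrow> C \<subseteq> V \<and> (\<forall>x\<in>C. \<forall>y\<in>C. x \<noteq> y \<longrightarrow> r x y \<or> r y x)"

definition longest_chain :: "('a \<Rightarrow> 'a \<Rightarrow> bool) \<Rightarrow> 'a set \<Rightarrow> nat \<Rightarrow> bool" where
  "longest_chain r V l \<longleftrightarrow> (\<exists>C. chain_in r V C \<and> card C = l) \<and> (\<forall>C. chain_in r V C \<longrightarrow> card C \<le> l)"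

context strict_order
begin

text \<open>Induction by removal of a maximal element: the ranks of the others do not depend on
  it.\<close>

lemma ex_rank:
  assumes "finite V"
  shows "\<exists>f. is_rank r V f"
  using assms
proof (induction "card V" arbitrary: V)
  case 0
  then show ?case by (auto simp: is_rank_def)
next
  case (Suc n)
  then obtain x where "x \<in> V" by fastforce
  then obtain m where "m \<in> tops r V"
    using ex_above_top[OF Suc.prems] by blast
  then have m: "m \<in> V" "\<And>y. y \<in> V \<Longrightarrow> \<not> r m y" by (auto simp: tops_def)
  let ?W = "V - {m}"
  have "n = card ?W" using Suc m by simp
  then obtain f where f: "is_rank r ?W f"
    using Suc.hyps(1)[of ?W] Suc.prems by blast
  let ?L = "{y \<in> ?W. r y m}"
  define g where "g = f(m := if ?L = {} then 1 else Suc (Max (f ` ?L)))"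
  have gm: "g m = (if ?L = {} then 1 else Suc (Max (f ` ?L)))" and g: "\<And>x. x \<noteq> m \<Longrightarrow> g x = f x"
    by (simp_all add: g_def)
  have fin: "finite (f ` ?L)" using Suc.prems by simp
  have "is_rank r V g"
    unfolding is_rank_def
  proof (intro conjI ballI impI)
    fix x assume x: "x \<in> V"
    show "1 \<le> g x"
      using f x by (cases "x = m") (auto simp: gm g is_rank_def)
    { fix y assume y: "y \<in> V" "r y x"
      then have ym: "y \<noteq> m" using m(2) x by auto
      show "g y < g x"
      proof (cases "x = m")
        case True
        then have yL: "y \<in> ?L" using y ym by auto
        then have "f y \<le> Max (f ` ?L)" using fin by (intro Max_ge) auto
        then show ?thesis using yL True gm g[OF ym] by auto
      next
        case False
        then show ?thesis using f x y ym g by (auto simp: is_rank_def)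
      qed }
    { assume gx: "1 < g x"
      show "\<exists>y\<in>V. r y x \<and> g x = Suc (g y)"
      proof (cases "x = m")
        case True
        then have "?L \<noteq> {}" using gx gm by (auto split: if_splits)
        moreover from this have "Max (f ` ?L) \<in> f ` ?L" using fin by (intro Max_in) auto
        then obtain y where "y \<in> ?L" "Max (f ` ?L) = f y" by blast
        ultimately show ?thesis using True gm g[of y] by (intro bexI[of _ y]) auto
      next
        case False
        then have "1 < f x" "x \<in> ?W" using gx g x by auto
        then obtain y where "y \<in> ?W" "r y x" "f x = Suc (f y)"
          using f unfolding is_rank_def by blast
        then show ?thesis using False g by auto
      qed }
  qed
  then show ?case by blast
qed

lemma rank_chain:
  assumes "is_rank r V f" "finite V" "x \<in> V"
  shows "\<exists>C. chain_in r V C \<and> card C = f x \<and> (\<forall>y\<in>C. y = x \<or> r y x)"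
  using assms(3)
proof (induction "f x" arbitrary: x)
  case 0
  then show ?case using assms(1) by (auto simp: is_rank_def)
next
  case (Suc n)
  show ?case
  proof (cases "n = 0")
    case True
    then show ?thesis
      using Suc by (intro exI[of _ "{x}"]) (auto simp: chain_in_def)
  next
    case False
    then have "1 < f x" using Suc by simp
    then obtain y where y: "y \<in> V" "r y x" "f x = Suc (f y)"
      using assms(1) Suc.prems unfolding is_rank_def by blast
    then obtain C where C: "chain_in r V C" "card C = f y" "\<forall>z\<in>C. z = y \<or> r z y"
      using Suc by (metis Suc_inject)
    have below: "\<forall>z\<in>C. r z x"
    proof
      fix z assume "z \<in> C"
      then have "z = y \<or> r z y" using C(3) by blast
      then show "r z x" using y(2) trans[of z y x] by blast
    qed
    have "x \<notin> C" using below irrefl by blast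
    moreover have "finite C" using C(1) assms(2) by (auto simp: chain_in_def dest: finite_subset)
    ultimately have "card (insert x C) = f x" using C(2) y(3) by simp
    moreover have "chain_in r V (insert x C)"
      using C(1) below Suc.prems by (auto simp: chain_in_def)
    ultimately show ?thesis using below by (intro exI[of _ "insert x C"]) auto
  qed
qed

lemma card_chain_le:
  assumes "is_rank r V f" "chain_in r V C" "\<forall>x\<in>C. f x \<le> h"
  shows "card C \<le> h"
proof -
  have "inj_on f C"
  proof (rule inj_onI)
    fix x y assume "x \<in> C" "y \<in> C" "f x = f y"
    then show "x = y"
      using assms(1,2) unfolding is_rank_def chain_in_def by (metis less_irrefl subsetD)
  qed
  moreover have "f ` C \<subseteq> {1..h}"
    using assms by (auto simp: is_rank_def chain_in_def subset_iff)
  ultimately have "card C \<le> card {1..h}"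
    by (metis card_image card_mono finite_atLeastAtMost)
  then show ?thesis by simp
qed

lemma longest_chain_rank:
  assumes "is_rank r V f" "finite V" "longest_chain r V l"
  shows "\<And>x. x \<in> V \<Longrightarrow> f x \<le> l" "0 < l \<Longrightarrow> \<exists>x\<in>V. f x = l"
proof -
  show le: "f x \<le> l" if "x \<in> V" for x
    using rank_chain[OF assms(1,2) that] assms(3) by (auto simp: longest_chain_def)
  assume "0 < l"
  obtain C where C: "chain_in r V C" "card C = l" using assms(3) by (auto simp: longest_chain_def)
  show "\<exists>x\<in>V. f x = l"
  proof (rule ccontr)
    assume "\<not> (\<exists>x\<in>V. f x = l)"
    then have "\<forall>x\<in>C. f x \<le> l - 1"
      using le C(1) by (metis One_nat_def Suc_pred \<open>0 < l\<close> chain_in_def le_SucE subsetD)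
    then show False
      using card_chain_le[OF assms(1) C(1), of "l - 1"] C(2) \<open>0 < l\<close> by simp
  qed
qed

lemma ex_longest_chain:
  assumes "finite V"
  shows "\<exists>l. longest_chain r V l"
proof -
  let ?P = "\<lambda>l. \<exists>C. chain_in r V C \<and> card C = l"
  have "?P 0" by (intro exI[of _ "{}"]) (simp add: chain_in_def)
  moreover have "\<forall>l. ?P l \<longrightarrow> l \<le> card V"
    using assms by (auto simp: chain_in_def card_mono)
  ultimately have "?P (Greatest ?P)" "\<forall>l. ?P l \<longrightarrow> l \<le> Greatest ?P"
    using GreatestI_nat[of ?P 0 "card V"] Greatest_le_nat[of ?P _ "card V"] by blast+
  then show ?thesis unfolding longest_chain_def by blast
qed

lemma chain_enum:
  assumes "finite C" "\<forall>x\<in>C. \<forall>y\<in>C. x \<noteq> y \<longrightarrow> r x y \<or> r y x"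
  shows "\<exists>e. bij_betw e {1..card C} C \<and>
    (\<forall>i\<in>{1..card C}. \<forall>j\<in>{1..card C}. r (e i) (e j) \<longleftrightarrow> i < j)"
  using assms
proof (induction "card C" arbitrary: C)
  case 0
  then show ?case by (auto simp: bij_betw_def)
next
  case (Suc n)
  then obtain x where "x \<in> C" by fastforce
  then obtain m where "m \<in> tops r C"
    using ex_above_top[OF Suc.prems(1)] by blast
  then have m: "m \<in> C" "\<forall>y\<in>C. \<not> r m y" by (auto simp: tops_def)
  have n: "n = card (C - {m})" using Suc m by simp
  then obtain e where e: "bij_betw e {1..n} (C - {m})"
    "\<forall>i\<in>{1..n}. \<forall>j\<in>{1..n}. r (e i) (e j) \<longleftrightarrow> i < j"
    using Suc.hyps(1)[of "C - {m}"] Suc.prems by auto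
  define e' where "e' = e(Suc n := m)"
  have e': "e' (Suc n) = m" "\<And>i. i \<in> {1..n} \<Longrightarrow> e' i = e i" by (auto simp: e'_def)
  have img: "{1..Suc n} = insert (Suc n) {1..n}" by auto
  have "bij_betw e' {1..n} (C - {m})"
    using e(1) bij_betw_cong[of "{1..n}" e' e, OF e'(2)] by simp
  then have bij: "bij_betw e' {1..Suc n} C"
    unfolding img using bij_betw_combine[of e' "{1..n}" "C - {m}" "{Suc n}" "{m}"] e' m(1)
    by (simp add: insert_absorb)
  have eC: "e i \<in> C - {m}" if "i \<in> {1..n}" for i
    using e(1) that by (auto simp: bij_betw_def)
  have top: "r (e i) m" if "i \<in> {1..n}" for i
    using eC[OF that] m Suc.prems(2) by auto
  have "r (e' i) (e' j) \<longleftrightarrow> i < j" if ij: "i \<in> {1..Suc n}" "j \<in> {1..Suc n}" for i j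
  proof -
    consider "i = Suc n" "j = Suc n" | "i = Suc n" "j \<in> {1..n}" | "i \<in> {1..n}" "j = Suc n" | "i \<in> {1..n}" "j \<in> {1..n}"
      using ij unfolding img by blast
    then show ?thesis
    proof cases
      case 1 then show ?thesis using irrefl by simp
    next
      case 2 then show ?thesis using m(2) eC[of j] e' by auto
    next
      case 3 then show ?thesis using top[of i] e' by auto
    next
      case 4 then show ?thesis using e(2) e' by auto
    qed
  qed
  then show ?case using bij Suc.hyps(2) by (intro exI[of _ e']) simp
qed

end

text \<open>The length of a longest chain is the largest rank, that is, the number of times a layer
  can be stripped before nothing is left.\<close>

lemma flag_equiv_longest_chain:
  assumes eq: "flag_equiv r V s W" and fin: "finite V" "finite W" and so: "strict_order r" "strict_order s"
    and l: "longest_chain r V l" and l': "longest_chain s W l'"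
  shows "l = l'"
proof -
  have le: "k \<le> k'"
    if "flag_equiv q U p T" "finite U" "finite T" "strict_order q" "strict_order p"
      "longest_chain q U k" "longest_chain p T k'"
    for q :: "'c \<Rightarrow> 'c \<Rightarrow> bool" and p :: "'d \<Rightarrow> 'd \<Rightarrow> bool" and U T k k'
  proof (cases "k = 0")
    case False
    note prems = that
    interpret q: strict_order q by fact
    interpret p: strict_order p by fact
    obtain f g where f: "is_rank q U f" and g: "is_rank p T g"
      using q.ex_rank[OF prems(2)] p.ex_rank[OF prems(3)] by blast
    obtain x where "x \<in> U" "f x = k"
      using q.longest_chain_rank(2)[OF f prems(2,6)] False by blast
    then have "x \<in> {x \<in> U. k - 1 < f x}" using False by auto
    then have ne: "{x \<in> U. k - 1 < f x} \<noteq> {}" by blast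
    have "finite {x \<in> U. k - 1 < f x}" using prems(2) by simp
    then have "0 < card {x \<in> U. k - 1 < f x}"
      using ne card_gt_0_iff by blast
    then have "0 < card {x \<in> T. k - 1 < g x}"
      using flag_equiv_card[OF flag_equiv_rank_gt[OF that(1-3) f g, of "k - 1"]] that by simp
    then obtain y where "y \<in> T" "k - 1 < g y"
      by (metis (mono_tags, lifting) card_gt_0_iff ex_in_conv mem_Collect_eq)
    then show ?thesis
      using p.longest_chain_rank(1)[OF g that(3,7), of y] by simp
  qed simp
  show ?thesis
    using le[OF eq fin so l l'] le[OF flag_equiv_sym[OF eq] fin(2,1) so(2,1) l' l] by simp
qed

lemma antichain_iff_unrelated:
  "antichain n P A \<longleftrightarrow> A \<subseteq> {1..n} \<and> unrelated (strict_part P) A"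
  by (auto simp: antichain_def unrelated_def strict_part_def)

lemma max_antichain_union_ge:
  assumes "\<forall>j<i. antichain n P (A j)"
  shows "card (\<Union>j<i. A j) \<le> max_antichain_union n P i"
  unfolding max_antichain_union_def
  by (rule Max_ge[OF finite_antichain_union_cards]) (use assms in blast)

lemma max_antichain_union_attained:
  "\<exists>A. (\<forall>j<i. antichain n P (A j)) \<and> card (\<Union>j<i. A j) = max_antichain_union n P i"
proof -
  let ?S = "{card (\<Union>j<i. A j) | A. \<forall>j<i. antichain n P (A j)}"
  have "card (\<Union>j<i. {}) \<in> ?S"
    by (rule CollectI, rule exI[of _ "\<lambda>_. {}"]) (simp add: antichain_def)
  then have "Max ?S \<in> ?S"
    by (intro Max_in finite_antichain_union_cards) blast
  then show ?thesis by (auto simp: max_antichain_union_def)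
qed

lemma max_antichain_union_le: "max_antichain_union n P i \<le> n"
proof -
  obtain A where A: "\<forall>j<i. antichain n P (A j)" "card (\<Union>j<i. A j) = max_antichain_union n P i"
    using max_antichain_union_attained by blast
  have "(\<Union>j<i. A j) \<subseteq> {1..n}" using A(1) by (auto simp: antichain_def)
  then have "card (\<Union>j<i. A j) \<le> card {1..n}" by (intro card_mono) auto
  then show ?thesis using A(2) by simp
qed

text \<open>Counting by rows, a row of length \<open>c\<close> contributes \<open>min i c\<close>;
  the \<open>k\<close> rows of length 1 enter with the first column.\<close>

lemma sum_conjugate_near_hook:
  assumes "2 \<le> l"
  shows "(\<Sum>j=1..i. conjugate_part (l # 2 # replicate k 1) j) = min i l + min i 2 + (if i = 0 then 0 else k)"
proof (induction i)
  case (Suc i)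
  have "conjugate_part (l # 2 # replicate k 1) (Suc i) =
        (if Suc i \<le> l then 1 else 0) + (if Suc i \<le> 2 then 1 else 0) + (if i = 0 then k else 0)"
    by (auto simp: conjugate_part_def filter_replicate)
  then show ?case using Suc assms by (auto simp: min_def)
qed simp

text \<open>The sums \<open>a i\<close> are evaluated at special places. For large \<open>i\<close>
  the value is \<open>n\<close>, and \<open>a 1\<close> is the size of a maximum antichain. Since
  \<open>a l = n\<close>, the poset is a union of \<open>l\<close> antichains and no chain is longer
  than \<open>l\<close>; conversely the rank levels give \<open>a l' = n\<close> for the length
  \<open>l'\<close> of a longest chain, which forces \<open>l \<le> l'\<close>.\<close>

lemma near_hook_shape:
  assumes P: "naturally_labeled n P" and shape: "has_shape n P (l # 2 # replicate k 1)"
  defines "r \<equiv> strict_part P"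
  shows "n = l + (k + 2)" "longest_chain r {1..n} l" "max_antichain r {1..n} A \<Longrightarrow> card A = k + 2"
proof -
  interpret strict_order r unfolding r_def by (rule strict_order_strict_part[OF P])
  have l: "2 \<le> l" using shape by (auto simp: has_shape_def is_partition_def)
  have a: "max_antichain_union n P i = min i l + min i 2 + (if i = 0 then 0 else k)" for i
    using shape sum_conjugate_near_hook[OF l] by (simp add: has_shape_def)
  show n: "n = l + (k + 2)"
  proof -
    let ?i = "n + l + 2"
    \<comment> \<open>The index exceeds \<open>n\<close>, \<open>l\<close> and 2 at once: singletons
      cover the ground set, and both minima in the formula are attained by \<open>l\<close> and
      2.\<close>
    let ?A = "\<lambda>j. if j < n then {Suc j} else {}"
    have "(\<Union>j<?i. ?A j) = {1..n}"
    proof (intro equalityI subsetI)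
      fix x assume "x \<in> {1..n}"
      then have "x \<in> ?A (x - 1)" "x - 1 < ?i" by auto
      then show "x \<in> (\<Union>j<?i. ?A j)" by blast
    qed (auto split: if_splits)
    then have "n \<le> max_antichain_union n P ?i"
      using max_antichain_union_ge[of ?i n P ?A] by (simp add: antichain_def)
    then show ?thesis
      using max_antichain_union_le[of n P ?i] a[of ?i] l by (simp add: min_def)
  qed
  have "card C \<le> l" if C: "chain_in r {1..n} C" for C
  proof -
    obtain A where A: "\<forall>j<l. antichain n P (A j)" "card (\<Union>j<l. A j) = n"
      using max_antichain_union_attained[of l n P] a[of l] n l by (auto simp: min_def)
    have "(\<Union>j<l. A j) = {1..n}"
      using A by (intro card_subset_eq) (auto simp: antichain_def)
    then have "\<forall>x\<in>C. \<exists>j. j < l \<and> x \<in> A j" using C unfolding chain_in_def by blast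
    then obtain j where j: "\<forall>x\<in>C. j x < l \<and> x \<in> A (j x)" by metis
    have "inj_on j C"
    proof (rule inj_onI)
      fix x y assume xy: "x \<in> C" "y \<in> C" "j x = j y"
      then have "x \<in> A (j x)" "y \<in> A (j x)" "j x < l" using j by auto
      then have "\<not> r x y" "\<not> r y x"
        using A(1) unfolding antichain_iff_unrelated unrelated_def r_def by blast+
      then show "x = y" using C xy unfolding chain_in_def by blast
    qed
    moreover have "j ` C \<subseteq> {..<l}" using j by auto
    ultimately show ?thesis by (metis card_image card_lessThan card_mono finite_lessThan)
  qed
  moreover obtain l' where l': "longest_chain r {1..n} l'"
    using ex_longest_chain[of "{1..n}"] by blast
  obtain f where f: "is_rank r {1..n} f" using ex_rank[of "{1..n}"] by blast
  have "l \<le> l'"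
  proof -
    let ?A = "\<lambda>j. {x \<in> {1..n}. f x = Suc j}"
    have anti: "\<forall>j<l'. antichain n P (?A j)"
    proof (intro allI impI)
      fix j
      have "\<not> r x y" if "x \<in> ?A j" "y \<in> ?A j" for x y
      proof
        assume "r x y"
        then have "f x < f y" using f that unfolding is_rank_def by blast
        then show False using that by simp
      qed
      then show "antichain n P (?A j)"
        unfolding antichain_iff_unrelated unrelated_def r_def[symmetric] by auto
    qed
    have "(\<Union>j<l'. ?A j) = {1..n}"
    proof (intro equalityI subsetI)
      fix x assume x: "x \<in> {1..n}"
      then have "1 \<le> f x" "f x \<le> l'"
        using f longest_chain_rank(1)[OF f _ l'] by (auto simp: is_rank_def)
      then have "x \<in> ?A (f x - 1)" "f x - 1 < l'" using x by auto
      then show "x \<in> (\<Union>j<l'. ?A j)" by blast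
    qed auto
    then have "n \<le> max_antichain_union n P l'"
      using max_antichain_union_ge[OF anti] by simp
    then show ?thesis using a[of l'] n l by (auto simp: min_def split: if_splits)
  qed
  ultimately show "longest_chain r {1..n} l"
    using l' unfolding longest_chain_def by (metis le_antisym)
  assume A: "max_antichain r {1..n} A"
  have "card A \<le> k + 2"
    using max_antichain_union_ge[of 1 n P "\<lambda>_. A"] A a[of 1] l
    by (simp add: lessThan_Suc antichain_iff_unrelated max_antichain_def r_def)
  moreover obtain B where "\<forall>j<(1::nat). antichain n P (B j)" "card (\<Union>j<(1::nat). B j) = k + 2"
    using max_antichain_union_attained[of 1 n P] a[of 1] l by auto
  then have "k + 2 \<le> card A"
    using A by (auto simp: lessThan_Suc antichain_iff_unrelated max_antichain_def r_def)
  ultimately show "card A = k + 2" by simp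
qed


section \<open>A coordinate model: two chains, an antichain and one extra element\<close>

text \<open>\<open>E\<close> stands for the chain below the antichain, \<open>Y\<close> for the
  antichain, \<open>U\<close> for the upper chain, both chains numbered upwards from 1, and
  \<open>X\<close> for the extra element of the upper part.\<close>

datatype 'y pt = E nat | Y 'y | U nat | X

text \<open>\<open>s y - 1\<close> elements \<open>E i\<close> lie below \<open>Y y\<close>, and
  \<open>t y\<close> of the \<open>U j\<close> are not above it; \<epsilon> marks the antichain
  elements below \<open>X\<close>. Likewise \<open>k\<close> elements \<open>E i\<close> and
  \<open>\<sigma> - 1\<close> elements \<open>U j\<close> lie below \<open>X\<close>, while \<tau>
  of the \<open>U j\<close> are not above it.\<close>

fun mlt :: "nat \<Rightarrow> nat \<Rightarrow> nat \<Rightarrow> ('y \<Rightarrow> nat) \<Rightarrow> ('y \<Rightarrow> nat) \<Rightarrow> ('y \<Rightarrow> bool) \<Rightarrow> 'y pt \<Rightarrow> 'y pt \<Rightarrow> bool" where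
  "mlt \<sigma> \<tau> k s t \<epsilon> (E i) (E j) \<longleftrightarrow> i < j"
| "mlt \<sigma> \<tau> k s t \<epsilon> (E i) (Y y) \<longleftrightarrow> i < s y"
| "mlt \<sigma> \<tau> k s t \<epsilon> (E i) (U j) \<longleftrightarrow> True"
| "mlt \<sigma> \<tau> k s t \<epsilon> (E i) X \<longleftrightarrow> i \<le> k"
| "mlt \<sigma> \<tau> k s t \<epsilon> (Y y) (U j) \<longleftrightarrow> t y < j"
| "mlt \<sigma> \<tau> k s t \<epsilon> (Y y) X \<longleftrightarrow> \<epsilon> y"
| "mlt \<sigma> \<tau> k s t \<epsilon> (U i) (U j) \<longleftrightarrow> i < j"
| "mlt \<sigma> \<tau> k s t \<epsilon> (U j) X \<longleftrightarrow> j < \<sigma>"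
| "mlt \<sigma> \<tau> k s t \<epsilon> X (U j) \<longleftrightarrow> \<tau> < j"
| "mlt \<sigma> \<tau> k s t \<epsilon> _ _ \<longleftrightarrow> False"

text \<open>The conditions from \<open>eps_t\<close> to \<open>sigma_k\<close> and
  \<open>sigma_tau\<close> are what transitivity demands, apart from the range of \<open>k\<close>;
  \<open>sigma_tau\<close> moreover keeps \<open>X\<close> from being comparable to all of the
  \<open>U j\<close>, except at the bottom. \<open>ex_y0\<close> supplies the middle of a chain with
  \<open>d + 1 + m\<close> elements, \<open>two\<close> reflects the choice of the antichain as the
  lowest, and \<open>fx_le0\<close>, which spells out the later \<open>fx\<close>, makes
  \<open>d + 1 + j\<close> the rank of \<open>U j\<close>.\<close>

locale model =
  fixes d m \<sigma> \<tau> k :: nat and Ys :: "'y set" and s t :: "'y \<Rightarrow> nat" and \<epsilon> :: "'y \<Rightarrow> bool"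
  assumes finY: "finite Ys"
    and s_ge: "y \<in> Ys \<Longrightarrow> 1 \<le> s y" and s_le: "y \<in> Ys \<Longrightarrow> s y \<le> d + 1" and t_le: "y \<in> Ys \<Longrightarrow> t y \<le> m"
    and eps_t: "y \<in> Ys \<Longrightarrow> \<epsilon> y \<Longrightarrow> t y \<le> \<tau>" and eps_s: "y \<in> Ys \<Longrightarrow> \<epsilon> y \<Longrightarrow> s y \<le> k + 1"
    and not_eps: "y \<in> Ys \<Longrightarrow> \<not> \<epsilon> y \<Longrightarrow> \<sigma> \<le> t y + 1"
    and k_le: "k \<le> d" and sigma_k: "1 < \<sigma> \<Longrightarrow> k = d"
    and sigma_ge: "1 \<le> \<sigma>" and tau_le: "\<tau> \<le> m" and sigma_tau: "\<sigma> \<le> \<tau> \<or> \<sigma> = 1 \<and> \<tau> = 0"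
    and ex_eps: "\<exists>y\<in>Ys. \<epsilon> y"
    and ex_y0: "(\<exists>y\<in>Ys. s y = d + 1 \<and> t y = 0) \<or> \<tau> = 0 \<and> k = d"
    and two: "1 \<le> d \<Longrightarrow> \<exists>y\<in>Ys. \<exists>y'\<in>Ys. y \<noteq> y' \<and> s y = d + 1 \<and> s y' = d + 1"
    and fx_le0: "(if 1 < \<sigma> then d + \<sigma> + 1 else if \<exists>y\<in>Ys. \<epsilon> y \<and> s y = k + 1 then k + 2 else k + 1)
      \<le> d + 1 + \<tau>"
begin

definition V :: "'y pt set" where
  "V = E ` {1..d} \<union> Y ` Ys \<union> U ` {1..m} \<union> {X}"

definition r :: "'y pt \<Rightarrow> 'y pt \<Rightarrow> bool" where
  "r a b \<longleftrightarrow> a \<in> V \<and> b \<in> V \<and> mlt \<sigma> \<tau> k s t \<epsilon> a b"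

text \<open>The rank of \<open>X\<close>. It is decided by the last \<open>U j\<close> below
  \<open>X\<close> if there is one, and otherwise by the \<open>k\<close> elements of the lower
  chain, with an antichain element possibly inserted between them and \<open>X\<close>.\<close>

definition fx :: nat where
  "fx = (if 1 < \<sigma> then d + \<sigma> + 1 else if \<exists>y\<in>Ys. \<epsilon> y \<and> s y = k + 1 then k + 2 else k + 1)"

lemma fx_le: "fx \<le> d + 1 + \<tau>"
  using fx_le0 by (simp add: fx_def)

lemma finV [simp]: "finite V"
  unfolding V_def using finY by (intro finite_UnI finite_imageI finite_insert[THEN iffD2] finite.emptyI) simp_all

lemma mem_V [simp]: "E i \<in> V \<longleftrightarrow> 1 \<le> i \<and> i \<le> d" "Y y \<in> V \<longleftrightarrow> y \<in> Ys"
  "U j \<in> V \<longleftrightarrow> 1 \<le> j \<and> j \<le> m" "X \<in> V"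
  by (auto simp: V_def)

lemma V_cases:
  assumes "p \<in> V"
  obtains i where "p = E i" "1 \<le> i" "i \<le> d" | y where "p = Y y" "y \<in> Ys"
    | j where "p = U j" "1 \<le> j" "j \<le> m" | "p = X"
  using assms by (auto simp: V_def)

lemma ball_V: "(\<forall>p\<in>V. Q p) \<longleftrightarrow> (\<forall>i\<in>{1..d}. Q (E i)) \<and> (\<forall>y\<in>Ys. Q (Y y)) \<and> (\<forall>j\<in>{1..m}. Q (U j)) \<and> Q X"
  by (auto simp: V_def)

lemma card_V: "card {p \<in> V. Q p} = card {i \<in> {1..d}. Q (E i)} + card {y \<in> Ys. Q (Y y)}
    + card {j \<in> {1..m}. Q (U j)} + of_bool (Q X)"
proof -
  let ?A = "(E :: nat \<Rightarrow> 'y pt) ` {i \<in> {1..d}. Q (E i)}" and ?B = "Y ` {y \<in> Ys. Q (Y y)}"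
    and ?C = "(U :: nat \<Rightarrow> 'y pt) ` {j \<in> {1..m}. Q (U j)}" and ?D = "if Q X then {X :: 'y pt} else {}"
  have fin: "finite ?A" "finite ?B" "finite ?C" "finite ?D" using finY by auto
  have "{p \<in> V. Q p} = ?A \<union> ?B \<union> ?C \<union> ?D"
    by (auto simp: V_def)
  moreover have dis: "(?A \<union> ?B \<union> ?C) \<inter> ?D = {}" "(?A \<union> ?B) \<inter> ?C = {}" "?A \<inter> ?B = {}"
    by auto
  moreover note card_Un_disjoint[OF finite_UnI[OF finite_UnI[OF fin(1,2)] fin(3)] fin(4) dis(1)]
    card_Un_disjoint[OF finite_UnI[OF fin(1,2)] fin(3) dis(2)] card_Un_disjoint[OF fin(1,2) dis(3)]
  moreover have "card ?A = card {i \<in> {1..d}. Q (E i)}" "card ?B = card {y \<in> Ys. Q (Y y)}"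
    "card ?C = card {j \<in> {1..m}. Q (U j)}"
    by (auto intro!: card_image inj_onI)
  moreover have "card ?D = of_bool (Q X)" by simp
  ultimately show ?thesis by (simp only:)
qed

lemma strict: "strict_order r"
proof
  show "\<not> r a a" for a by (cases a) (auto simp: r_def)
  fix a b c assume "r a b" "r b c"
  then have abc: "a \<in> V" "b \<in> V" "c \<in> V" and ab: "mlt \<sigma> \<tau> k s t \<epsilon> a b" and bc: "mlt \<sigma> \<tau> k s t \<epsilon> b c"
    by (auto simp: r_def)
  have st: "j < \<sigma> \<Longrightarrow> \<tau> < i \<Longrightarrow> j < i" for i j using sigma_tau by auto
  have "mlt \<sigma> \<tau> k s t \<epsilon> a c"
  proof (cases b)
    case (E i)
    then show ?thesis using ab bc by (cases a; cases c) auto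
  next
    case (Y y)
    then have y: "y \<in> Ys" using abc by simp
    show ?thesis
    proof (cases c)
      case X
      then show ?thesis using Y ab bc eps_s[OF y] by (cases a) auto
    qed (use Y ab bc in \<open>cases a; auto\<close>)+
  next
    case (U j)
    show ?thesis
    proof (cases c)
      case X
      have j: "1 \<le> j" "j < \<sigma>" using U X bc abc by auto
      show ?thesis
      proof (cases a)
        case (E i)
        then show ?thesis using X j sigma_k abc by auto
      next
        case (Y y)
        then show ?thesis using X U j ab not_eps[of y] abc by auto
      next
        case (U i)
        then show ?thesis using X \<open>b = U j\<close> j ab by auto
      next
        case pX: X
        then have "\<tau> < j" using U ab by auto
        then show ?thesis using j sigma_tau by auto
      qed
    qed (use U ab bc in \<open>cases a; auto\<close>)+
  next
    case X
    then obtain j where c: "c = U j" "\<tau> < j" using bc by (cases c) auto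
    show ?thesis
    proof (cases a)
      case (Y y)
      then show ?thesis using X c ab eps_t[of y] abc by auto
    next
      case (U i)
      then show ?thesis using X c ab st[of i j] by auto
    qed (use X c ab in auto)
  qed
  then show "r a c" using abc by (simp add: r_def)
qed

fun rk :: "'y pt \<Rightarrow> nat" where
  "rk (E i) = i" | "rk (Y y) = s y" | "rk (U j) = d + 1 + j" | "rk X = fx"

text \<open>\<open>X\<close> has corank one more than \<open>U (\<tau> + 1)\<close>. So an antichain
  element below \<open>X\<close> that meets the upper chain only at \<open>\<tau> + 1\<close>
  reaches one step higher through \<open>X\<close> than through the \<open>U j\<close>.\<close>

fun ck :: "'y pt \<Rightarrow> nat" where
  "ck (E i) = d + m + 2 - i" | "ck (Y y) = (if \<epsilon> y \<and> t y = \<tau> then m + 2 - \<tau> else m + 1 - t y)"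
| "ck (U j) = m + 1 - j" | "ck X = m + 1 - \<tau>"

lemma r_simps: "a \<in> V \<Longrightarrow> b \<in> V \<Longrightarrow> r a b = mlt \<sigma> \<tau> k s t \<epsilon> a b"
  by (simp add: r_def)

lemma fx_ge: "1 \<le> fx" "k < fx" using k_le by (auto simp: fx_def)

lemma eps_fx: "y \<in> Ys \<Longrightarrow> \<epsilon> y \<Longrightarrow> s y < fx"
  using eps_s[of y] k_le s_le[of y] by (auto simp: fx_def)

lemma is_rank: "is_rank r V rk"
proof -
  have mono: "rk b < rk a" if "a \<in> V" "b \<in> V" "mlt \<sigma> \<tau> k s t \<epsilon> b a" for a b
  proof (cases a)
    case pX: X
    show ?thesis
    proof (cases b)
      case (U j)
      then have "1 < \<sigma>" "j < \<sigma>" using pX that by auto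
      then show ?thesis using U pX by (simp add: fx_def)
    qed (use that pX fx_ge eps_fx in auto)
  next
    case (U j)
    then have j: "1 \<le> j" using that(1) by simp
    show ?thesis
    proof (cases b)
      case (Y y)
      then show ?thesis using that U j s_le[of y] by simp
    qed (use that U j fx_le in auto)
  qed (use that in \<open>cases b; auto\<close>)+
  have ex: "\<exists>b\<in>V. mlt \<sigma> \<tau> k s t \<epsilon> b a \<and> rk a = Suc (rk b)" if "a \<in> V" "1 < rk a" for a
    using that(1)
  proof (cases rule: V_cases)
    case (1 i)
    then show ?thesis using that by (intro bexI[of _ "E (i - 1)"]) auto
  next
    case (2 y)
    then show ?thesis using that s_le[of y] by (intro bexI[of _ "E (s y - 1)"]) auto
  next
    case (3 j)
    show ?thesis
    proof (cases "j = 1")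
      case True
      \<comment> \<open>\<open>U 1\<close> needs a predecessor of rank \<open>d + 1\<close>: an
        antichain element above all \<open>E i\<close> and below all \<open>U j\<close>, or
        \<open>X\<close> itself.\<close>
      show ?thesis
      proof (cases "\<exists>y\<in>Ys. s y = d + 1 \<and> t y = 0")
        case True
        then obtain y where "y \<in> Ys" "s y = d + 1" "t y = 0" by blast
        then show ?thesis using 3 \<open>j = 1\<close> by (intro bexI[of _ "Y y"]) auto
      next
        case False
        then have "\<tau> = 0" "k = d" using ex_y0 by auto
        then have "fx = d + 1" using fx_le fx_ge by simp
        then show ?thesis using 3 \<open>j = 1\<close> \<open>\<tau> = 0\<close> by (intro bexI[of _ X]) auto
      qed
    next
      case False
      then show ?thesis using 3 by (intro bexI[of _ "U (j - 1)"]) auto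
    qed
  next
    case 4
    show ?thesis
    proof (cases "1 < \<sigma>")
      case True
      then have "\<sigma> - 1 \<le> m" using sigma_tau tau_le by auto
      then show ?thesis using 4 True by (intro bexI[of _ "U (\<sigma> - 1)"]) (auto simp: fx_def)
    next
      case False
      show ?thesis
      proof (cases "\<exists>y\<in>Ys. \<epsilon> y \<and> s y = k + 1")
        case True
        then obtain y where "y \<in> Ys" "\<epsilon> y" "s y = k + 1" by blast
        then show ?thesis using 4 False by (intro bexI[of _ "Y y"]) (auto simp: fx_def)
      next
        case none: False
        then have "fx = k + 1" using False by (simp add: fx_def)
        then show ?thesis using 4 that k_le by (intro bexI[of _ "E k"]) auto
      qed
    qed
  qed
  show ?thesis
    unfolding is_rank_def
  proof (intro conjI ballI impI)
    fix a assume "a \<in> V"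
    then show "1 \<le> rk a" using s_ge fx_ge by (cases rule: V_cases) auto
  next
    fix a b assume "a \<in> V" "b \<in> V" "r b a"
    then show "rk b < rk a" using mono by (simp add: r_def)
  next
    fix a assume "a \<in> V" "1 < rk a"
    then show "\<exists>b\<in>V. r b a \<and> rk a = Suc (rk b)" using ex by (auto simp: r_def)
  qed
qed

text \<open>Keeps the corank of \<open>E d\<close> at \<open>m + 2\<close>. The value
  \<open>m + 2\<close> for an antichain element requires that it be below \<open>X\<close> with
  \<open>t y = \<tau> = 0\<close>; with \<open>s y = d + 1\<close> this would push the rank of
  \<open>X\<close> beyond the bound \<open>fx_le\<close>.\<close>

lemma ck_Y_le:
  assumes "y \<in> Ys"
  shows "ck (Y y) \<le> m + 2" "s y = d + 1 \<Longrightarrow> ck (Y y) \<le> m + 1"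
proof -
  show "ck (Y y) \<le> m + 2" by auto
  assume sy: "s y = d + 1"
  have "\<not> (\<epsilon> y \<and> t y = \<tau> \<and> \<tau> = 0)"
  proof
    assume a: "\<epsilon> y \<and> t y = \<tau> \<and> \<tau> = 0"
    then have "s y < fx" using eps_fx assms by blast
    then show False using fx_le sy a by simp
  qed
  then show "ck (Y y) \<le> m + 1" by auto
qed

lemma is_corank: "is_rank (\<lambda>a b. r b a) V ck"
proof -
  have mono: "ck b < ck a" if a: "a \<in> V" and b: "b \<in> V" and ab: "mlt \<sigma> \<tau> k s t \<epsilon> a b" for a b
    using a
  proof (cases rule: V_cases)
    case (1 i)
    note ai = this
    show ?thesis
      using b
    proof (cases rule: V_cases)
      case (2 y)
      have "i < s y" using ab ai 2 by simp
      show ?thesis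
      proof (cases "s y = d + 1")
        case True
        then show ?thesis using ck_Y_le(2)[OF 2(2)] ai 2 by simp
      next
        case False
        then have "i < d" using \<open>i < s y\<close> s_le[OF 2(2)] by simp
        then show ?thesis using ck_Y_le(1)[OF 2(2)] ai 2 by simp
      qed
    next
      case (1 j)
      then show ?thesis using ab ai by simp
    next
      case (3 j)
      then show ?thesis using ai by simp
    next
      case 4
      then show ?thesis using ai by simp
    qed
  next
    case (2 y)
    note ay = this
    show ?thesis
      using b
    proof (cases rule: V_cases)
      case (3 j)
      then show ?thesis using ab ay by (cases "\<epsilon> y \<and> t y = \<tau>") auto
    next
      case 4
      then show ?thesis using ab ay eps_t[OF ay(2)] tau_le by (cases "t y = \<tau>") simp_all
    qed (use ab ay in simp_all)
  next
    case (3 j)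
    note aj = this
    show ?thesis
      using b
    proof (cases rule: V_cases)
      case 4
      then show ?thesis using ab aj sigma_tau tau_le by auto
    qed (use ab aj in simp_all)
  next
    case 4
    note ax = this
    show ?thesis
      using b by (cases rule: V_cases) (use ab ax in simp_all)
  qed
  have ex: "\<exists>b\<in>V. mlt \<sigma> \<tau> k s t \<epsilon> a b \<and> ck a = Suc (ck b)" if "a \<in> V" "1 < ck a" for a
    using that(1)
  proof (cases rule: V_cases)
    case (1 i)
    show ?thesis
    proof (cases "i = d")
      case True
      show ?thesis
      proof (cases "\<exists>y\<in>Ys. s y = d + 1 \<and> t y = 0")
        case True
        then obtain y where y: "y \<in> Ys" "s y = d + 1" "t y = 0" by blast
        have "ck (Y y) = m + 1" using ck_Y_le(2)[OF y(1,2)] y(3) by (auto split: if_splits)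
        then show ?thesis using 1 \<open>i = d\<close> y by (intro bexI[of _ "Y y"]) auto
      next
        case False
        then have "\<tau> = 0" "k = d" using ex_y0 by auto
        have "ck X = m + 1 - \<tau>" by simp
        also have "\<dots> = m + 1" using \<open>\<tau> = 0\<close> by simp
        finally have "ck a = Suc (ck X)" using 1 \<open>i = d\<close> by simp
        moreover have "mlt \<sigma> \<tau> k s t \<epsilon> a X" using 1 \<open>k = d\<close> by simp
        ultimately show ?thesis by (intro bexI[of _ X]) auto
      qed
    next
      case False
      then show ?thesis using 1 by (intro bexI[of _ "E (Suc i)"]) auto
    qed
  next
    case (2 y)
    show ?thesis
    proof (cases "\<epsilon> y \<and> t y = \<tau>")
      case True
      then show ?thesis using 2 tau_le by (intro bexI[of _ X]) auto
    next
      case False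
      then show ?thesis using 2 that t_le[of y] by (intro bexI[of _ "U (Suc (t y))"]) auto
    qed
  next
    case (3 j)
    then show ?thesis using that by (intro bexI[of _ "U (Suc j)"]) auto
  next
    case 4
    then show ?thesis using that by (intro bexI[of _ "U (Suc \<tau>)"]) auto
  qed
  show ?thesis
    unfolding is_rank_def
  proof (intro conjI ballI impI)
    fix a assume "a \<in> V"
    then show "1 \<le> ck a"
    proof (cases rule: V_cases)
      case (2 y)
      then show ?thesis using t_le[of y] tau_le by auto
    qed (use tau_le in auto)
  next
    fix a b assume "a \<in> V" "b \<in> V" "r a b"
    then show "ck b < ck a" using mono by (simp add: r_def)
  next
    fix a assume "a \<in> V" "1 < ck a"
    then show "\<exists>b\<in>V. r a b \<and> ck a = Suc (ck b)" using ex by (auto simp: r_def)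
  qed
qed

text \<open>Only the cut from above matters here: an element above \<open>p\<close> has larger rank
  and survives every cut from below that \<open>p\<close> survives. The dual remark applies to
  \<open>dd\<close>.\<close>

definition uu :: "nat \<Rightarrow> 'y pt \<Rightarrow> nat" where
  "uu j p = card {q \<in> V. r p q \<and> j < ck q}"

definition dd :: "nat \<Rightarrow> 'y pt \<Rightarrow> nat" where
  "dd i p = card {q \<in> V. r q p \<and> i < rk q}"

lemma card_Ioc_nat: "card {j \<in> {1..n}. a < j \<and> j < b} = min (n + 1) b - (a + 1)" for a b n :: nat
proof -
  have "{j \<in> {1..n}. a < j \<and> j < b} = {a + 1..<min (n + 1) b}" by auto
  then show ?thesis by simp
qed

text \<open>The cut at corank \<open>m + 1 - \<tau>\<close> deletes \<open>X\<close> together with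
  every \<open>U l\<close> for \<open>l \<ge> \<tau>\<close>, so the second count does not see
  \<epsilon>.\<close>

lemma uu_Y:
  assumes "y \<in> Ys"
  shows "uu 0 (Y y) = m - t y + of_bool (\<epsilon> y)"
    and "1 \<le> \<tau> \<Longrightarrow> uu (m + 1 - \<tau>) (Y y) = \<tau> - 1 - t y"
proof -
  have *: "uu j (Y y) = card {l \<in> {1..m}. t y < l \<and> l < m + 1 - j} + of_bool (\<epsilon> y \<and> j < m + 1 - \<tau>)" for j
  proof -
    have "{l \<in> {1..m}. r (Y y) (U l) \<and> j < ck (U l)} = {l \<in> {1..m}. t y < l \<and> l < m + 1 - j}"
      using assms by (auto simp: r_simps)
    moreover have "(r (Y y) X \<and> j < ck X) = (\<epsilon> y \<and> j < m + 1 - \<tau>)" "{i \<in> {1..d}. r (Y y) (E i) \<and> j < ck (E i)} = {}"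
      "{y' \<in> Ys. r (Y y) (Y y') \<and> j < ck (Y y')} = {}"
      using assms by (auto simp: r_def)
    ultimately show ?thesis
      unfolding uu_def card_V by (simp only: card.empty add_0)
  qed
  show "uu 0 (Y y) = m - t y + of_bool (\<epsilon> y)"
    unfolding * card_Ioc_nat using tau_le by (simp add: less_Suc_eq_le)
  show "uu (m + 1 - \<tau>) (Y y) = \<tau> - 1 - t y" if "1 \<le> \<tau>"
    unfolding * card_Ioc_nat using tau_le that by simp
qed

lemma uu_U:
  assumes "1 \<le> j" "j \<le> m"
  shows "uu 0 (U j) = m - j + of_bool (j < \<sigma>)"
    and "1 \<le> \<tau> \<Longrightarrow> uu (m + 1 - \<tau>) (U j) = \<tau> - 1 - j"
proof -
  have *: "uu i (U j) = card {l \<in> {1..m}. j < l \<and> l < m + 1 - i} + of_bool (j < \<sigma> \<and> i < m + 1 - \<tau>)" for i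
  proof -
    have "{l \<in> {1..m}. r (U j) (U l) \<and> i < ck (U l)} = {l \<in> {1..m}. j < l \<and> l < m + 1 - i}"
      using assms by (auto simp: r_simps)
    moreover have "(r (U j) X \<and> i < ck X) = (j < \<sigma> \<and> i < m + 1 - \<tau>)" "{l \<in> {1..d}. r (U j) (E l) \<and> i < ck (E l)} = {}"
      "{y' \<in> Ys. r (U j) (Y y') \<and> i < ck (Y y')} = {}"
      using assms by (auto simp: r_def)
    ultimately show ?thesis
      unfolding uu_def card_V by (simp only: card.empty add_0)
  qed
  show "uu 0 (U j) = m - j + of_bool (j < \<sigma>)"
    unfolding * card_Ioc_nat using tau_le by (simp add: less_Suc_eq_le)
  show "uu (m + 1 - \<tau>) (U j) = \<tau> - 1 - j" if "1 \<le> \<tau>"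
    unfolding * card_Ioc_nat using tau_le that by simp
qed

lemma uu_X: "uu 0 X = m - \<tau>"
proof -
  have "{l \<in> {1..m}. r X (U l) \<and> 0 < ck (U l)} = {l \<in> {1..m}. \<tau> < l \<and> l < m + 1}"
    by (auto simp: r_simps)
  moreover have "{i \<in> {1..d}. r X (E i) \<and> 0 < ck (E i)} = {}" "{y' \<in> Ys. r X (Y y') \<and> 0 < ck (Y y')} = {}"
    "(r X X \<and> 0 < ck X) = False"
    by (auto simp: r_def)
  ultimately show ?thesis
    unfolding uu_def card_V by (simp only: card.empty add_0 card_Ioc_nat) simp
qed

text \<open>Bounds that keep the lower chain out of the later counts, which concern values up to
  \<open>m + 1\<close> and below \<tau>, respectively. The two antichain elements provided by
  \<open>two\<close> give the first one.\<close>

lemma uu_E: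
  assumes "1 \<le> i" "i \<le> d"
  shows "m + 2 \<le> uu 0 (E i)" and "1 \<le> \<tau> \<Longrightarrow> \<tau> \<le> uu (m + 1 - \<tau>) (E i)"
proof -
  have EU: "r (E i) (U l)" if "l \<in> {1..m}" for l
    using assms that by (auto simp: r_simps)
  have EY: "r (E i) (Y y)" if "y \<in> Ys" "s y = d + 1" for y
    using assms that by (auto simp: r_simps)
  obtain y y' where y: "y \<in> Ys" "y' \<in> Ys" "y \<noteq> y'" "s y = d + 1" "s y' = d + 1"
    using two assms by (metis le_trans)
  have "{y, y'} \<subseteq> {y \<in> Ys. r (E i) (Y y) \<and> 0 < ck (Y y)}"
    using y EY t_le tau_le by (auto simp: less_Suc_eq_le)
  then have "card {y, y'} \<le> card {y \<in> Ys. r (E i) (Y y) \<and> 0 < ck (Y y)}"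
    by (rule card_mono[rotated]) (use finY in simp)
  moreover have "{l \<in> {1..m}. r (E i) (U l) \<and> 0 < ck (U l)} = {1..m}"
    using EU by auto
  ultimately show "m + 2 \<le> uu 0 (E i)"
    unfolding uu_def card_V using y(3) by simp
  assume tau: "1 \<le> \<tau>"
  then obtain y0 where y0: "y0 \<in> Ys" "s y0 = d + 1" "t y0 = 0"
    using ex_y0 by auto
  then have "{y0} \<subseteq> {y \<in> Ys. r (E i) (Y y) \<and> m + 1 - \<tau> < ck (Y y)}"
    using EY tau tau_le by auto
  then have "card {y0} \<le> card {y \<in> Ys. r (E i) (Y y) \<and> m + 1 - \<tau> < ck (Y y)}"
    by (rule card_mono[rotated]) (use finY in simp)
  moreover have "{l \<in> {1..m}. r (E i) (U l) \<and> m + 1 - \<tau> < ck (U l)} = {l \<in> {1..m}. 0 < l \<and> l < \<tau>}"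
    using EU tau tau_le by auto
  moreover have "card {l \<in> {1..m}. 0 < l \<and> l < \<tau>} = \<tau> - 1"
    unfolding card_Ioc_nat using tau_le by simp
  ultimately have "card {l \<in> {1..m}. r (E i) (U l) \<and> m + 1 - \<tau> < ck (U l)} = \<tau> - 1"
    "1 \<le> card {y \<in> Ys. r (E i) (Y y) \<and> m + 1 - \<tau> < ck (Y y)}"
    by simp_all
  then show "\<tau> \<le> uu (m + 1 - \<tau>) (E i)"
    unfolding uu_def card_V using tau by linarith
qed

lemma dd_Y:
  assumes "y \<in> Ys"
  shows "dd i (Y y) = s y - 1 - i"
proof -
  have "{l \<in> {1..d}. r (E l) (Y y) \<and> i < rk (E l)} = {l \<in> {1..d}. i < l \<and> l < s y}"
    using assms by (auto simp: r_simps)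
  moreover have "{l \<in> {1..m}. r (U l) (Y y) \<and> i < rk (U l)} = {}" "{y' \<in> Ys. r (Y y') (Y y) \<and> i < rk (Y y')} = {}"
    "(r X (Y y) \<and> i < rk X) = False"
    by (auto simp: r_def)
  ultimately show ?thesis
    unfolding dd_def card_V using s_le[OF assms] by (simp only: card.empty add_0 card_Ioc_nat) simp
qed

lemma dd_X:
  assumes "i \<le> d + 1"
  shows "dd i X = (k - i) + card {y \<in> Ys. \<epsilon> y \<and> i < s y} + (\<sigma> - 1)"
proof -
  have "{l \<in> {1..d}. r (E l) X \<and> i < rk (E l)} = {l \<in> {1..d}. i < l \<and> l < k + 1}"
    by (auto simp: r_simps)
  moreover have "{y \<in> Ys. r (Y y) X \<and> i < rk (Y y)} = {y \<in> Ys. \<epsilon> y \<and> i < s y}"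
    by (auto simp: r_simps)
  moreover have "{l \<in> {1..m}. r (U l) X \<and> i < rk (U l)} = {l \<in> {1..m}. 0 < l \<and> l < \<sigma>}"
    using assms by (auto simp: r_simps)
  moreover have "\<sigma> \<le> m + 1" using sigma_tau tau_le by auto
  moreover have "(r X X \<and> i < rk X) = False" by (simp add: r_def)
  ultimately show ?thesis
    unfolding dd_def card_V using k_le by (simp only: card_Ioc_nat) simp
qed

text \<open>\<open>U \<tau>\<close> is the element of the upper chain with the same corank as
  \<open>X\<close>; their counts always occur together.\<close>

lemma dd_U:
  assumes "1 \<le> \<tau>" "i \<le> d + 1"
  shows "dd i (U \<tau>) = (d - i) + card {y \<in> Ys. i < s y \<and> t y < \<tau>} + (\<tau> - 1)"
proof -
  have U: "U \<tau> \<in> V" using assms tau_le by simp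
  have "{l \<in> {1..d}. r (E l) (U \<tau>) \<and> i < rk (E l)} = {l \<in> {1..d}. i < l \<and> l < d + 1}"
    using U by (auto simp: r_simps)
  moreover have "{y \<in> Ys. r (Y y) (U \<tau>) \<and> i < rk (Y y)} = {y \<in> Ys. i < s y \<and> t y < \<tau>}"
    using U by (auto simp: r_simps)
  moreover have "{l \<in> {1..m}. r (U l) (U \<tau>) \<and> i < rk (U l)} = {l \<in> {1..m}. 0 < l \<and> l < \<tau>}"
    using U assms by (auto simp: r_simps)
  moreover have "(r X (U \<tau>) \<and> i < rk X) = False" by (simp add: r_def)
  ultimately show ?thesis
    unfolding dd_def card_V using tau_le by (simp only: card_Ioc_nat) simp
qed

end


section \<open>Counting filters and adding a minimal element\<close>

lemma card_filters:
  assumes "finite W" "a \<le> card W"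
  shows "flags r W [(card W - a, False), (a, False)] = card (blocks (\<lambda>x y. r y x) W a False)"
proof -
  have "flags r (W - F) [(card W - a, False)] = 1" if F: "F \<in> blocks (\<lambda>x y. r y x) W a False" for F
  proof -
    have "card W - a = card (W - F)" using card_Diff_block[OF assms(1) F] by simp
    then show ?thesis using flags_whole[of "W - F" r] assms by (simp del: flags.simps)
  qed
  then have "(\<Sum>F\<in>blocks (\<lambda>x y. r y x) W a False. flags r (W - F) [(card W - a, False)]) =
        card (blocks (\<lambda>x y. r y x) W a False)"
    by simp
  then show ?thesis
    using flags_snoc[OF assms(1), of r "[(card W - a, False)]" a False] by (simp del: flags.simps)
qed

lemma flag_equiv_card_filters:
  assumes "flag_equiv r V s W" "finite V" "finite W"
  shows "card (blocks (\<lambda>x y. r y x) V a False) = card (blocks (\<lambda>x y. s y x) W a False)"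
proof (cases "a \<le> card V")
  case True
  then show ?thesis
    using card_filters[OF assms(2) True, of r] card_filters[OF assms(3), of a s] flag_equiv_card[OF assms] assms(1)
    by (simp add: flag_equiv_def del: flags.simps)
next
  case False
  have *: "blocks q T a False = {}" if "finite T" "card T < a" for q :: "'z \<Rightarrow> 'z \<Rightarrow> bool" and T
  proof -
    have "card I \<noteq> a" if "I \<subseteq> T" for I
      using card_mono[OF \<open>finite T\<close> that] \<open>card T < a\<close> by simp
    then show ?thesis by (auto simp: blocks_def down_closed_def)
  qed
  have "card V < a" "card W < a" using False flag_equiv_card[OF assms] by simp_all
  then show ?thesis by (simp only: *[OF assms(2)] *[OF assms(3)] card.empty)
qed

text \<open>A nonempty ideal must contain the element below everything, so the first nonempty block
  absorbs it.\<close>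

lemma flags_insert_bottom:
  assumes "finite R" "q \<notin> R" "\<forall>x\<in>R. r q x" "\<not> r q q" "\<forall>x\<in>R. \<not> r x q"
  shows "flags r (insert q R) ((Suc k, False) # w) = flags r R ((k, False) # w)"
    and "flags r (insert q R) ((Suc k, True) # w) = (if k = 0 then flags r R w else 0)"
proof -
  have qI: "q \<in> I" if "down_closed r (insert q R) I" "card I = Suc k" for I
  proof -
    note prems = that
    obtain x where "x \<in> I" using prems(2) by fastforce
    then show ?thesis
      using prems(1) assms(3) unfolding down_closed_def by (metis insert_iff subsetD)
  qed
  have "blocks r (insert q R) (Suc k) False = insert q ` blocks r R k False"
  proof (intro equalityI subsetI)
    fix I assume "I \<in> blocks r (insert q R) (Suc k) False"
    then have I: "down_closed r (insert q R) I" "card I = Suc k" by (auto simp: blocks_def)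
    then have q: "q \<in> I" by (rule qI)
    have "finite I" using I(2) card.infinite by fastforce
    then have "card (I - {q}) = k" using q I(2) by simp
    moreover have "down_closed r R (I - {q})"
      using I(1) assms(2) unfolding down_closed_def by auto
    ultimately have "I - {q} \<in> blocks r R k False" by (simp add: blocks_def)
    then show "I \<in> insert q ` blocks r R k False" using q by (metis image_eqI insert_Diff)
  next
    fix I assume "I \<in> insert q ` blocks r R k False"
    then obtain J where J: "I = insert q J" "down_closed r R J" "card J = k" by (auto simp: blocks_def)
    then have "J \<subseteq> R" by (simp add: down_closed_def)
    then have "finite J" "q \<notin> J" using assms(1,2) finite_subset by blast+
    then have "card I = Suc k" using J by simp
    moreover have "down_closed r (insert q R) I"
      using J assms(5) assms(4) unfolding down_closed_def by auto
    ultimately show "I \<in> blocks r (insert q R) (Suc k) False" by (simp add: blocks_def)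
  qed
  moreover have "inj_on (insert q) (blocks r R k False)"
  proof (rule inj_onI)
    fix I J assume "I \<in> blocks r R k False" "J \<in> blocks r R k False" "insert q I = insert q J"
    moreover have "q \<notin> I" "q \<notin> J" using calculation assms(2) blocks_subset by blast+
    ultimately show "I = J" by (simp add: insert_ident)
  qed
  moreover have "insert q R - insert q J = R - J" for J using assms(2) by auto
  ultimately show "flags r (insert q R) ((Suc k, False) # w) = flags r R ((k, False) # w)"
    by (simp add: sum.reindex)
  have "bots r (insert q R) = {q}"
    using assms(3,4,5) by (auto simp: bots_def)
  then have "blocks r (insert q R) (Suc k) True = (if k = 0 then {{q}} else {})"
    by (auto simp: blocks_True subset_singleton_iff)
  moreover have "insert q R - {q} = R" using assms(2) by auto
  ultimately show "flags r (insert q R) ((Suc k, True) # w) = (if k = 0 then flags r R w else 0)"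
    by simp
qed

lemma flag_equiv_insert_bottom:
  assumes "flag_equiv r R s T" "finite R" "finite T"
    and "q \<notin> R" "\<forall>x\<in>R. r q x" "\<not> r q q" "\<forall>x\<in>R. \<not> r x q"
    and "p \<notin> T" "\<forall>x\<in>T. s p x" "\<not> s p p" "\<forall>x\<in>T. \<not> s x p"
  shows "flags r (insert q R) w = flags s (insert p T) w"
proof (induction w)
  case (Cons a w)
  obtain k b where a: "a = (k, b)" by (cases a)
  show ?case
  proof (cases k)
    case 0
    then show ?thesis
      using Cons flags_drop_0[of "insert q R" r "[]" b w] flags_drop_0[of "insert p T" s "[]" b w] assms(2,3)
      by (simp add: a del: flags.simps)
  next
    case (Suc k')
    then show ?thesis
      using flags_insert_bottom[OF assms(2,4-7), of k' w] flags_insert_bottom[OF assms(3,8-11), of k' w] assms(1)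
      by (cases b) (simp_all add: a flag_equiv_def del: flags.simps)
  qed
qed simp

text \<open>The minimal elements are now those of \<open>R\<close> and \<open>q\<close>. A strict
  block that takes all but one of them leaves out either \<open>q\<close> or a minimal element of
  \<open>R\<close>, and the second contribution does not depend on \<open>q\<close>.\<close>

lemma flags_insert_minimal:
  assumes "finite R" "bots r R \<noteq> {}" "q \<notin> R" "\<forall>x\<in>R. \<not> r x q" "\<not> r q q" "\<forall>x\<in>bots r R. \<not> r q x"
  shows "flags r (insert q R) ((card (bots r R), True) # w) =
         flags r (insert q (R - bots r R)) w + flags r R ((card (bots r R) - 1, True) # w)"
proof -
  let ?M = "bots r R"
  have qM: "q \<notin> ?M" using assms(3) by (auto simp: bots_def)
  have bots: "bots r (insert q R) = insert q ?M"
    using assms(4,5,6) by (auto simp: bots_def)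
  have diff: "insert q R - insert q ?M = R - ?M" using assms(3) by auto
  have "flags r (insert q R) ((card ?M, True) # w) =
        (\<Sum>p\<in>insert q ?M. flags r (insert p (R - ?M)) w)"
    using flags_bots_but_one[of "insert q R" r w] assms(1) qM by (simp add: bots diff del: flags.simps)
  also have "\<dots> = flags r (insert q (R - ?M)) w + (\<Sum>p\<in>?M. flags r (insert p (R - ?M)) w)"
    using assms(1) qM by simp
  also have "(\<Sum>p\<in>?M. flags r (insert p (R - ?M)) w) = flags r R ((card ?M - 1, True) # w)"
    using flags_bots_but_one[OF assms(1,2), of w] by simp
  finally show ?thesis .
qed

text \<open>A filter that contains \<open>q\<close> is \<open>q\<close> together with a filter of
  \<open>R\<close> that contains everything above \<open>q\<close>.\<close>

lemma card_filters_insert: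
  assumes "finite R" "q \<notin> R" "\<forall>x\<in>R. \<not> r x q" "\<not> r q q"
  shows "card (blocks (\<lambda>x y. r y x) (insert q R) (Suc a) False) =
    card (blocks (\<lambda>x y. r y x) R (Suc a) False) +
    card {G \<in> blocks (\<lambda>x y. r y x) R a False. \<forall>x\<in>R. r q x \<longrightarrow> x \<in> G}"
proof -
  let ?b = "blocks (\<lambda>x y. r y x)"
  let ?N = "{G \<in> ?b R a False. \<forall>x\<in>R. r q x \<longrightarrow> x \<in> G}"
  have sub: "G \<subseteq> R" "finite G" "q \<notin> G" if "G \<in> ?b R c False" for G c
    using blocks_subset[OF that] assms(1,2) finite_subset by blast+
  have "?b (insert q R) (Suc a) False = ?b R (Suc a) False \<union> insert q ` ?N"
  proof (intro equalityI subsetI)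
    fix G assume G: "G \<in> ?b (insert q R) (Suc a) False"
    then have cG: "card G = Suc a" by (simp add: blocks_def)
    then have fG: "finite G" using card.infinite by fastforce
    show "G \<in> ?b R (Suc a) False \<union> insert q ` ?N"
    proof (cases "q \<in> G")
      case True
      have "G - {q} \<in> ?N"
        using G True assms(2,3,4) fG cG unfolding blocks_def down_closed_def by auto
      moreover have "G = insert q (G - {q})" using True by auto
      ultimately show ?thesis by (intro UnI2 image_eqI[of G "insert q" "G - {q}"])
    next
      case False
      then show ?thesis using G unfolding blocks_def down_closed_def by auto
    qed
  next
    fix G assume "G \<in> ?b R (Suc a) False \<union> insert q ` ?N"
    then consider "G \<in> ?b R (Suc a) False" | H where "G = insert q H" "H \<in> ?N" by blast
    then show "G \<in> ?b (insert q R) (Suc a) False"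
    proof cases
      case 1
      then show ?thesis using assms(3) unfolding blocks_def down_closed_def by auto
    next
      case 2
      then have "card G = Suc a" using sub[of H a] by (simp add: blocks_def)
      then show ?thesis using 2 assms(3,4) unfolding blocks_def down_closed_def by auto
    qed
  qed
  moreover have "?b R (Suc a) False \<inter> insert q ` ?N = {}"
    using sub(3)[of _ "Suc a"] by blast
  moreover have "card (insert q ` ?N) = card ?N"
  proof (rule card_image, rule inj_onI)
    fix G H assume "G \<in> ?N" "H \<in> ?N" "insert q G = insert q H"
    then show "G = H" using sub(3)[of G a] sub(3)[of H a] by (simp add: insert_ident)
  qed
  moreover have "finite (?b R (Suc a) False)" "finite (insert q ` ?N)"
    using assms(1) by auto
  ultimately show ?thesis by (simp add: card_Un_disjoint)
qed

section \<open>Truncations of the model at the height of \<open>X\<close> and their two-element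
  filters\<close>

lemma is_rank_corank_filter:
  assumes "is_rank r V f" "is_rank (\<lambda>x y. r y x) V g"
  shows "is_rank r {x \<in> V. j < g x} f"
  using is_rank_dual_filter[of "\<lambda>x y. r y x" V f g j] assms by simp

context model
begin

lemma card_above_layer:
  "card {x \<in> {p \<in> V. i < rk p \<and> j < ck p}. card {y \<in> {p \<in> V. i < rk p \<and> j < ck p}. r x y} = c} =
   card {x \<in> V. i < rk x \<and> j < ck x \<and> uu j x = c}"
proof -
  have "{y \<in> {p \<in> V. i < rk p \<and> j < ck p}. r x y} = {q \<in> V. r x q \<and> j < ck q}" if "x \<in> V" "i < rk x" for x
    using that is_rank unfolding is_rank_def by fastforce
  then show ?thesis
    unfolding uu_def by (intro arg_cong[of _ _ card]) auto
qed

lemma card_below_layer: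
  "card {x \<in> {p \<in> V. i < rk p \<and> j < ck p}. card {y \<in> {p \<in> V. i < rk p \<and> j < ck p}. r y x} = c} =
   card {x \<in> V. i < rk x \<and> j < ck x \<and> dd i x = c}"
proof -
  have "{y \<in> {p \<in> V. i < rk p \<and> j < ck p}. r y x} = {q \<in> V. r q x \<and> i < rk q}" if "x \<in> V" "j < ck x" for x
    using that is_corank unfolding is_rank_def by fastforce
  then show ?thesis
    unfolding dd_def by (intro arg_cong[of _ _ card]) auto
qed

text \<open>The cut at corank \<open>m - \<tau>\<close> is the deepest one that keeps
  \<open>X\<close>; the upper chain ends with \<open>U \<tau>\<close>, and both \<open>X\<close> and
  \<open>U \<tau>\<close> have become maximal.\<close>

definition lay :: "nat \<Rightarrow> 'y pt set" where
  "lay i = {p \<in> V. i < rk p \<and> m - \<tau> < ck p}"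

lemma finite_lay [simp]: "finite (lay i)"
  by (simp add: lay_def)

lemma mem_lay:
  "E l \<in> lay i \<longleftrightarrow> 1 \<le> l \<and> l \<le> d \<and> i < l"
  "Y y \<in> lay i \<longleftrightarrow> y \<in> Ys \<and> i < s y \<and> t y \<le> \<tau>"
  "U j \<in> lay i \<longleftrightarrow> 1 \<le> j \<and> j \<le> \<tau> \<and> i < d + 1 + j"
  "X \<in> lay i \<longleftrightarrow> i < fx"
proof -
  have "m - \<tau> < ck (Y y) \<longleftrightarrow> t y \<le> \<tau>" if "y \<in> Ys"
    using t_le[OF that] tau_le by auto
  then show "Y y \<in> lay i \<longleftrightarrow> y \<in> Ys \<and> i < s y \<and> t y \<le> \<tau>"
    by (auto simp: lay_def)
qed (use tau_le in \<open>auto simp: lay_def\<close>)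

lemma bots_lay: "bots r (lay i) = {p \<in> lay i. rk p = Suc i}"
proof -
  have "is_rank r {p \<in> V. m - \<tau> < ck p} rk"
    by (rule is_rank_corank_filter[OF is_rank is_corank])
  from bots_rank[OF this, of i]
  have "bots r {p \<in> {p \<in> V. m - \<tau> < ck p}. i < rk p} = {p \<in> {p \<in> V. m - \<tau> < ck p}. rk p = Suc i}" .
  moreover have "{p \<in> {p \<in> V. m - \<tau> < ck p}. i < rk p} = lay i"
    "{p \<in> {p \<in> V. m - \<tau> < ck p}. rk p = Suc i} = {p \<in> lay i. rk p = Suc i}"
    by (auto simp: lay_def)
  ultimately show ?thesis by simp
qed

lemma lay_Suc: "lay i - bots r (lay i) = lay (Suc i)"
  unfolding bots_lay by (auto simp: lay_def)

definition ylay :: "nat \<Rightarrow> 'y set" where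
  "ylay u = {y \<in> Ys. t y \<le> \<tau> \<and> s y = u}"

lemma finite_ylay [simp]: "finite (ylay u)"
  using finY by (simp add: ylay_def)

lemma bots_lay_eq:
  assumes "u \<le> d" "Suc u < fx"
  shows "bots r (lay u) = (if Suc u \<le> d then {E (Suc u)} else {}) \<union> Y ` ylay (Suc u)"
proof (intro equalityI subsetI)
  fix p assume "p \<in> bots r (lay u)"
  then have p: "p \<in> lay u" "rk p = Suc u" by (auto simp: bots_lay)
  then show "p \<in> (if Suc u \<le> d then {E (Suc u)} else {}) \<union> Y ` ylay (Suc u)"
    using assms by (cases p) (auto simp: mem_lay ylay_def)
next
  fix p assume "p \<in> (if Suc u \<le> d then {E (Suc u)} else {}) \<union> Y ` ylay (Suc u)"
  then show "p \<in> bots r (lay u)"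
    unfolding bots_lay by (auto simp: mem_lay ylay_def split: if_splits)
qed

lemma bots_lay_nonempty:
  assumes "u \<le> d" "1 \<le> \<tau>"
  shows "bots r (lay u) \<noteq> {}"
proof (cases "Suc u \<le> d")
  case True
  then have "E (Suc u) \<in> bots r (lay u)" unfolding bots_lay by (simp add: mem_lay)
  then show ?thesis by blast
next
  case False
  then have u: "u = d" using assms by simp
  obtain y where "y \<in> Ys" "s y = d + 1" "t y = 0" using ex_y0 assms by auto
  then have "Y y \<in> bots r (lay u)" unfolding bots_lay by (simp add: mem_lay u)
  then show ?thesis by blast
qed

lemma E_below_lay:
  assumes "1 \<le> u" "u \<le> k" "x \<in> lay u"
  shows "r (E u) x"
proof -
  have xV: "x \<in> V" "u < rk x" using assms(3) by (auto simp: lay_def)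
  have "u \<le> d" using assms k_le by simp
  from xV(1) show ?thesis
    by (cases rule: V_cases) (use assms xV \<open>u \<le> d\<close> in \<open>simp_all add: r_def\<close>)
qed

definition filt :: "nat \<Rightarrow> 'y pt set set" where
  "filt i = blocks (\<lambda>a b. r b a) (lay i) 2 False"

text \<open>The number of three-element filters that appear when \<open>Y y\<close> is put under
  \<open>lay i\<close>. Two-element filters only involve elements close to the top, so this number
  depends on \<open>t y\<close> and \<open>\<epsilon> y\<close> near \<tau>, exactly where the
  classes are still unresolved.\<close>

definition cnt :: "nat \<Rightarrow> 'y \<Rightarrow> nat" where
  "cnt i y = card {G \<in> filt i. \<forall>x\<in>lay i. r (Y y) x \<longrightarrow> x \<in> G}"

lemma finite_filt [simp]: "finite (filt i)"
  by (simp add: filt_def)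

lemma filt_iff: "G \<in> filt i \<longleftrightarrow> G \<subseteq> lay i \<and> card G = 2 \<and> (\<forall>x\<in>G. \<forall>y\<in>lay i. r x y \<longrightarrow> y \<in> G)"
  by (auto simp: filt_def blocks_def down_closed_def)

lemma lay_r: "a \<in> lay i \<Longrightarrow> b \<in> lay i \<Longrightarrow> r a b = mlt \<sigma> \<tau> k s t \<epsilon> a b"
  by (simp add: r_def lay_def)

lemma pair_filt:
  assumes "{a, b} \<subseteq> lay i" "a \<noteq> b" "\<forall>x\<in>lay i. r a x \<longrightarrow> x = b" "\<forall>x\<in>lay i. r b x \<longrightarrow> x = a"
  shows "{a, b} \<in> filt i"
  using assms by (simp add: filt_iff)

lemma card_filt_containing_pair:
  assumes "{a, b} \<in> filt i" "a \<noteq> b"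
  shows "card {G \<in> filt i. a \<in> G \<and> b \<in> G} = 1"
proof -
  have eq: "G = {a, b}" if "G \<in> filt i" "a \<in> G" "b \<in> G" for G
  proof -
    have "card G = 2" using that by (simp add: filt_iff)
    moreover from this have "finite G" using card.infinite by fastforce
    ultimately show ?thesis using that assms(2) card_subset_eq[of G "{a, b}"] by simp
  qed
  have "{G \<in> filt i. a \<in> G \<and> b \<in> G} = {{a, b}}"
  proof (intro equalityI subsetI)
    fix G assume "G \<in> {G \<in> filt i. a \<in> G \<and> b \<in> G}"
    then show "G \<in> {{a, b}}" using eq[of G] by simp
  next
    fix G assume "G \<in> {{a, b}}"
    then show "G \<in> {G \<in> filt i. a \<in> G \<and> b \<in> G}" using assms(1) by simp
  qed
  then show ?thesis by simp
qed

lemma no_filt_containing_three: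
  assumes "a \<noteq> b" "a \<noteq> c" "b \<noteq> c"
  shows "{G \<in> filt i. a \<in> G \<and> b \<in> G \<and> c \<in> G} = {}"
proof -
  have False if "G \<in> filt i" "a \<in> G" "b \<in> G" "c \<in> G" for G
  proof -
    have "card G = 2" using that by (simp add: filt_iff)
    moreover from this have "finite G" using card.infinite by fastforce
    ultimately have "card {a, b, c} \<le> 2" using that card_mono[of G "{a, b, c}"] by simp
    then show False using assms by simp
  qed
  then show ?thesis by blast
qed

lemma card_filt_containing:
  assumes "c \<in> lay i" "\<forall>x\<in>lay i. \<not> r c x"
  shows "card {G \<in> filt i. c \<in> G} = card {p \<in> V. p \<in> lay i \<and> p \<noteq> c \<and> (\<forall>q\<in>lay i. r p q \<longrightarrow> q = c)}"
proof -
  let ?S = "{p \<in> V. p \<in> lay i \<and> p \<noteq> c \<and> (\<forall>q\<in>lay i. r p q \<longrightarrow> q = c)}"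
  have "{G \<in> filt i. c \<in> G} = (\<lambda>p. {c, p}) ` ?S"
  proof (intro equalityI subsetI)
    fix G assume G: "G \<in> {G \<in> filt i. c \<in> G}"
    then have cG: "card G = 2" "c \<in> G" by (auto simp: filt_iff)
    then obtain p where p: "G = {c, p}" "p \<noteq> c"
      unfolding card_2_iff by (metis insert_commute insertE singletonD)
    have "q = c" if q: "q \<in> lay i" "r p q" for q
    proof -
      have "q \<in> G" using G p q unfolding filt_iff by blast
      moreover have "q \<noteq> p" using q strict_order.irrefl[OF strict] by blast
      ultimately show ?thesis using p by blast
    qed
    moreover have "p \<in> lay i" using G p by (auto simp: filt_iff)
    moreover from this have "p \<in> V" by (simp add: lay_def)
    ultimately have "p \<in> ?S" using p by blast
    then show "G \<in> (\<lambda>p. {c, p}) ` ?S" using p by blast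
  next
    fix G assume "G \<in> (\<lambda>p. {c, p}) ` ?S"
    then obtain p where p: "G = {c, p}" "p \<in> lay i" "p \<noteq> c" "\<forall>q\<in>lay i. r p q \<longrightarrow> q = c" by blast
    have "{c, p} \<in> filt i"
      by (rule pair_filt) (use p assms in auto)
    then show "G \<in> {G \<in> filt i. c \<in> G}" using p by simp
  qed
  moreover have "inj_on (\<lambda>p. {c, p}) ?S"
    by (auto simp: inj_on_def doubleton_eq_iff)
  ultimately show ?thesis by (simp add: card_image)
qed

text \<open>Keeps the lower chain out of the two-element filters that contain
  \<open>U \<tau>\<close> or \<open>X\<close>.\<close>

lemma E_above_two:
  assumes "E l \<in> lay i" "1 \<le> \<tau>"
  shows "\<exists>y. Y y \<in> lay i \<and> r (E l) (Y y)"
proof -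
  obtain y where y: "y \<in> Ys" "s y = d + 1" "t y = 0" using ex_y0 assms by auto
  have l: "1 \<le> l" "l \<le> d" "i < l" using assms(1) by (simp_all add: mem_lay)
  then have "Y y \<in> lay i" using y by (simp add: mem_lay)
  moreover have "r (E l) (Y y)" using y l by (simp add: r_def)
  ultimately show ?thesis by blast
qed

context
  fixes i :: nat
  assumes i: "i \<le> d + 1" "i < fx" and tau: "1 \<le> \<tau>"
begin

lemma st: "\<sigma> \<le> \<tau>"
  using sigma_tau tau by auto

lemma X_lay: "X \<in> lay i" and U_lay: "1 \<le> j \<Longrightarrow> j \<le> \<tau> \<Longrightarrow> U j \<in> lay i"
  using i by (simp_all add: mem_lay)

lemma top_U: "\<forall>x\<in>lay i. \<not> r (U \<tau>) x"
proof
  fix x assume x: "x \<in> lay i"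
  show "\<not> r (U \<tau>) x"
    using x st tau by (cases x) (auto simp: r_def mem_lay)
qed

lemma top_X: "\<forall>x\<in>lay i. \<not> r X x"
proof
  fix x assume x: "x \<in> lay i"
  show "\<not> r X x"
    using x by (cases x) (auto simp: r_def mem_lay)
qed

text \<open>The other member of the filter may have nothing above it but \<open>U \<tau>\<close>.
  This admits \<open>X\<close>, the element \<open>U (\<tau> - 1)\<close> if it is not below
  \<open>X\<close>, and the antichain elements not below \<open>X\<close> that reach at most
  \<open>U \<tau>\<close>.\<close>

lemma card_filt_U:
  "card {G \<in> filt i. U \<tau> \<in> G} =
     card {y \<in> Ys. i < s y \<and> t y \<le> \<tau> \<and> \<not> \<epsilon> y \<and> \<tau> - 1 \<le> t y} + 1 + of_bool (\<sigma> < \<tau>)"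
proof -
  let ?S = "\<lambda>p. p \<in> lay i \<and> p \<noteq> U \<tau> \<and> (\<forall>q\<in>lay i. r p q \<longrightarrow> q = U \<tau>)"
  have SE: "\<not> ?S (E l)" for l
    using E_above_two[of l i] tau by blast
  have SX: "of_bool (?S X) = (1::nat)" using X_lay top_X by simp
  have SY: "?S (Y y) \<longleftrightarrow> i < s y \<and> t y \<le> \<tau> \<and> \<not> \<epsilon> y \<and> \<tau> - 1 \<le> t y" if y: "y \<in> Ys" for y
  proof
    assume S: "?S (Y y)"
    then have "Y y \<in> lay i" by blast
    then have l: "i < s y" "t y \<le> \<tau>" by (auto simp: mem_lay)
    have "\<not> \<epsilon> y"
    proof
      assume "\<epsilon> y"
      then have "r (Y y) X" using y by (simp add: r_def)
      then show False using S X_lay by blast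
    qed
    moreover have "\<tau> - 1 \<le> t y"
    proof (rule ccontr)
      assume "\<not> \<tau> - 1 \<le> t y"
      then have "r (Y y) (U (\<tau> - 1))" "U (\<tau> - 1) \<in> lay i"
        using y tau_le U_lay[of "\<tau> - 1"] by (auto simp: r_def)
      then have "U (\<tau> - 1) = (U \<tau> :: 'y pt)" using S by blast
      then show False using tau by simp
    qed
    ultimately show "i < s y \<and> t y \<le> \<tau> \<and> \<not> \<epsilon> y \<and> \<tau> - 1 \<le> t y" using l by blast
  next
    assume a: "i < s y \<and> t y \<le> \<tau> \<and> \<not> \<epsilon> y \<and> \<tau> - 1 \<le> t y"
    have "q = U \<tau>" if "q \<in> lay i" "r (Y y) q" for q
      using that a y by (cases q) (auto simp: r_def mem_lay)
    then show "?S (Y y)" using a y by (auto simp: mem_lay)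
  qed
  have SU: "?S (U j) \<longleftrightarrow> j = \<tau> - 1 \<and> \<sigma> < \<tau>" if j: "1 \<le> j" "j \<le> m" for j
  proof
    assume S: "?S (U j)"
    then have jt: "j \<le> \<tau>" "j \<noteq> \<tau>" by (auto simp: mem_lay)
    have "j = \<tau> - 1"
    proof (rule ccontr)
      assume "j \<noteq> \<tau> - 1"
      then have "r (U j) (U (\<tau> - 1))" "U (\<tau> - 1) \<in> lay i"
        using jt j tau_le U_lay[of "\<tau> - 1"] by (auto simp: r_def)
      then have "U (\<tau> - 1) = (U \<tau> :: 'y pt)" using S by blast
      then show False using tau by simp
    qed
    moreover have "\<not> r (U j) X" using S X_lay by blast
    then have "\<sigma> \<le> j" using j by (simp add: r_def)
    ultimately show "j = \<tau> - 1 \<and> \<sigma> < \<tau>" using tau by auto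
  next
    assume a: "j = \<tau> - 1 \<and> \<sigma> < \<tau>"
    have "q = U \<tau>" if "q \<in> lay i" "r (U j) q" for q
      using that a j by (cases q) (auto simp: r_def mem_lay)
    then show "?S (U j)" using a j U_lay[of j] tau by auto
  qed
  have "{l \<in> {1..d}. ?S (E l)} = {}" using SE by blast
  moreover have "{y \<in> Ys. ?S (Y y)} = {y \<in> Ys. i < s y \<and> t y \<le> \<tau> \<and> \<not> \<epsilon> y \<and> \<tau> - 1 \<le> t y}"
    using SY by blast
  moreover have "{j \<in> {1..m}. ?S (U j)} = (if \<sigma> < \<tau> then {\<tau> - 1} else {})"
  proof -
    have "{j \<in> {1..m}. ?S (U j)} = {j \<in> {1..m}. j = \<tau> - 1 \<and> \<sigma> < \<tau>}"
      by (rule Collect_cong, rule conj_cong[OF refl]) (rule SU; simp)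
    also have "\<dots> = (if \<sigma> < \<tau> then {\<tau> - 1} else {})"
      using tau_le sigma_ge by auto
    finally show ?thesis .
  qed
  ultimately have "card {p \<in> V. ?S p} = card {y \<in> Ys. i < s y \<and> t y \<le> \<tau> \<and> \<not> \<epsilon> y \<and> \<tau> - 1 \<le> t y}
      + card (if \<sigma> < \<tau> then {\<tau> - 1} else {}) + 1"
    unfolding card_V by (simp only: card.empty add_0 SX)
  then show ?thesis
    using card_filt_containing[OF U_lay top_U] tau by simp
qed

text \<open>The other member may have nothing above it but \<open>X\<close>: this admits
  \<open>U \<tau>\<close> and the antichain elements that miss the truncated upper chain, whether
  below \<open>X\<close> or not.\<close>

lemma card_filt_X:
  "card {G \<in> filt i. X \<in> G} = card {y \<in> Ys. i < s y \<and> t y = \<tau>} + 1"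
proof -
  let ?S = "\<lambda>p. p \<in> lay i \<and> p \<noteq> X \<and> (\<forall>q\<in>lay i. r p q \<longrightarrow> q = X)"
  have SE: "\<not> ?S (E l)" for l
    using E_above_two[of l i] tau by blast
  have SY: "?S (Y y) \<longleftrightarrow> i < s y \<and> t y = \<tau>" if y: "y \<in> Ys" for y
  proof
    assume S: "?S (Y y)"
    then have "Y y \<in> lay i" by blast
    then have l: "i < s y" "t y \<le> \<tau>" by (auto simp: mem_lay)
    have "t y = \<tau>"
    proof (rule ccontr)
      assume "t y \<noteq> \<tau>"
      then have "r (Y y) (U \<tau>)" "U \<tau> \<in> lay i"
        using y l tau tau_le U_lay[of \<tau>] by (auto simp: r_def)
      then show False using S by blast
    qed
    then show "i < s y \<and> t y = \<tau>" using l by blast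
  next
    assume a: "i < s y \<and> t y = \<tau>"
    have "q = X" if "q \<in> lay i" "r (Y y) q" for q
      using that a y by (cases q) (auto simp: r_def mem_lay)
    then show "?S (Y y)" using a y by (auto simp: mem_lay)
  qed
  have SU: "?S (U j) \<longleftrightarrow> j = \<tau>" if j: "1 \<le> j" "j \<le> m" for j
  proof
    assume S: "?S (U j)"
    then have jt: "j \<le> \<tau>" by (auto simp: mem_lay)
    show "j = \<tau>"
    proof (rule ccontr)
      assume "j \<noteq> \<tau>"
      then have "r (U j) (U \<tau>)" "U \<tau> \<in> lay i"
        using jt j tau_le tau U_lay[of \<tau>] by (auto simp: r_def)
      then show False using S by blast
    qed
  next
    assume "j = \<tau>"
    then show "?S (U j)" using top_U U_lay[of \<tau>] tau by auto
  qed
  have "{l \<in> {1..d}. ?S (E l)} = {}" using SE by blast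
  moreover have "{y \<in> Ys. ?S (Y y)} = {y \<in> Ys. i < s y \<and> t y = \<tau>}"
    using SY by blast
  moreover have "{j \<in> {1..m}. ?S (U j)} = {\<tau>}"
  proof -
    have "{j \<in> {1..m}. ?S (U j)} = {j \<in> {1..m}. j = \<tau>}"
      by (rule Collect_cong, rule conj_cong[OF refl]) (rule SU; simp)
    also have "\<dots> = {\<tau>}" using tau_le tau by auto
    finally show ?thesis .
  qed
  ultimately have "card {p \<in> V. ?S p} = card {y \<in> Ys. i < s y \<and> t y = \<tau>} + card {\<tau>} + of_bool False"
    unfolding card_V by (simp only: card.empty add_0 simp_thms)
  then show ?thesis
    using card_filt_containing[OF X_lay top_X] by simp
qed

text \<open>Within the layer \<open>\<tau> - t y\<close> elements \<open>U j\<close>, and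
  \<open>X\<close> if \<open>\<epsilon> y\<close>, lie above \<open>Y y\<close>. With none every
  filter counts, with one the filters through it count, with two the pair itself is the only filter,
  and with more there is none.\<close>

lemma cnt_eq:
  assumes y: "y \<in> Ys" "t y \<le> \<tau>"
  shows "cnt i y = (if t y = \<tau> \<and> \<not> \<epsilon> y then card (filt i)
     else if t y = \<tau> \<and> \<epsilon> y then card {G \<in> filt i. X \<in> G}
     else if t y = \<tau> - 1 \<and> \<not> \<epsilon> y then card {G \<in> filt i. U \<tau> \<in> G}
     else of_bool (t y + 2 = \<tau> \<and> \<not> \<epsilon> y \<or> t y + 1 = \<tau> \<and> \<epsilon> y))"
proof -
  let ?F = "\<lambda>x. x \<in> lay i \<and> r (Y y) x"
  have FU: "?F (U j) \<longleftrightarrow> t y < j \<and> j \<le> \<tau>" for j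
    using y U_lay[of j] tau_le by (auto simp: r_def mem_lay)
  have FX: "?F X \<longleftrightarrow> \<epsilon> y" using y X_lay by (auto simp: r_def)
  have FE: "\<not> ?F (E l)" "\<not> ?F (Y y')" for l y' by (auto simp: r_def)
  have cnt: "cnt i y = card {G \<in> filt i. \<forall>x. ?F x \<longrightarrow> x \<in> G}"
    unfolding cnt_def by (intro arg_cong[of _ _ card]) blast
  have all: "(\<forall>x. ?F x \<longrightarrow> x \<in> G) \<longleftrightarrow> (\<forall>j. t y < j \<and> j \<le> \<tau> \<longrightarrow> U j \<in> G) \<and> (\<epsilon> y \<longrightarrow> X \<in> G)" for G
    by (metis FE FU FX pt.exhaust)
  consider "t y = \<tau>" "\<not> \<epsilon> y" | "t y = \<tau>" "\<epsilon> y" | "t y = \<tau> - 1" "t y < \<tau>" "\<not> \<epsilon> y"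
    | "t y + 2 = \<tau>" "\<not> \<epsilon> y" | "t y + 1 = \<tau>" "\<epsilon> y" | "t y + 3 \<le> \<tau>" "\<not> \<epsilon> y" | "t y + 2 \<le> \<tau>" "\<epsilon> y"
    using y(2) by linarith
  then show ?thesis
  proof cases
    case 1
    then have "(\<forall>x. ?F x \<longrightarrow> x \<in> G) \<longleftrightarrow> True" for G unfolding all by auto
    then show ?thesis unfolding cnt using 1 by simp
  next
    case 2
    then have "(\<forall>x. ?F x \<longrightarrow> x \<in> G) \<longleftrightarrow> X \<in> G" for G unfolding all by auto
    then show ?thesis unfolding cnt using 2 by simp
  next
    case 3
    then have "t y < j \<and> j \<le> \<tau> \<longleftrightarrow> j = \<tau>" for j by auto
    then have "(\<forall>x. ?F x \<longrightarrow> x \<in> G) \<longleftrightarrow> U \<tau> \<in> G" for G unfolding all using 3 by simp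
    then show ?thesis unfolding cnt using 3 by simp
  next
    case 4
    then have "t y < j \<and> j \<le> \<tau> \<longleftrightarrow> j = \<tau> \<or> j = \<tau> - 1" for j by auto
    then have *: "(\<forall>x. ?F x \<longrightarrow> x \<in> G) \<longleftrightarrow> U (\<tau> - 1) \<in> G \<and> U \<tau> \<in> G" for G unfolding all using 4 by auto
    have sg: "\<sigma> < \<tau>" using not_eps[OF y(1)] 4 by simp
    have "{U (\<tau> - 1), U \<tau>} \<in> filt i"
    proof (rule pair_filt)
      show "{U (\<tau> - 1), U \<tau>} \<subseteq> lay i" using U_lay[of "\<tau> - 1"] U_lay[of \<tau>] 4 by simp
      show "\<forall>x\<in>lay i. r (U (\<tau> - 1)) x \<longrightarrow> x = U \<tau>"
      proof (intro ballI impI)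
        fix x assume "x \<in> lay i" "r (U (\<tau> - 1)) x"
        then show "x = U \<tau>" using sg by (cases x) (auto simp: r_def mem_lay)
      qed
    qed (use top_U tau in auto)
    then have "card {G \<in> filt i. U (\<tau> - 1) \<in> G \<and> U \<tau> \<in> G} = 1"
      by (rule card_filt_containing_pair) (use tau in simp)
    then show ?thesis unfolding cnt * using 4 by simp
  next
    case 5
    then have "t y < j \<and> j \<le> \<tau> \<longleftrightarrow> j = \<tau>" for j by auto
    then have *: "(\<forall>x. ?F x \<longrightarrow> x \<in> G) \<longleftrightarrow> U \<tau> \<in> G \<and> X \<in> G" for G unfolding all using 5 by simp
    have "{U \<tau>, X} \<in> filt i"
      by (rule pair_filt) (use X_lay U_lay[of \<tau>] top_U top_X tau in auto)
    then have "card {G \<in> filt i. U \<tau> \<in> G \<and> X \<in> G} = 1"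
      by (rule card_filt_containing_pair) simp
    then show ?thesis unfolding cnt * using 5 by simp
  next
    case 6
    have "{G \<in> filt i. \<forall>x. ?F x \<longrightarrow> x \<in> G} \<subseteq> {G \<in> filt i. U \<tau> \<in> G \<and> U (\<tau> - 1) \<in> G \<and> U (\<tau> - 2) \<in> G}"
      unfolding all using 6 by auto
    also have "\<dots> = {}" by (rule no_filt_containing_three) (use 6 in auto)
    finally have "{G \<in> filt i. \<forall>x. ?F x \<longrightarrow> x \<in> G} = {}" by blast
    then show ?thesis unfolding cnt using 6 by simp
  next
    case 7
    have "{G \<in> filt i. \<forall>x. ?F x \<longrightarrow> x \<in> G} \<subseteq> {G \<in> filt i. U \<tau> \<in> G \<and> U (\<tau> - 1) \<in> G \<and> X \<in> G}"
      unfolding all using 7 by auto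
    also have "\<dots> = {}" by (rule no_filt_containing_three) (use 7 in auto)
    finally have "{G \<in> filt i. \<forall>x. ?F x \<longrightarrow> x \<in> G} = {}" by blast
    then show ?thesis unfolding cnt using 7 by simp
  qed
qed

end

end


section \<open>Class sizes of antichain elements and the counts they enter\<close>

lemma ex_bij_betw_fibres:
  assumes "finite S" "finite T" "\<And>c. card {x \<in> S. f x = c} = card {x \<in> T. g x = c}"
  shows "\<exists>h. bij_betw h S T \<and> (\<forall>x\<in>S. g (h x) = f x)"
proof -
  have "\<forall>c. \<exists>h. bij_betw h {x \<in> S. f x = c} {x \<in> T. g x = c}"
  proof
    fix c
    show "\<exists>h. bij_betw h {x \<in> S. f x = c} {x \<in> T. g x = c}"
      by (rule finite_same_card_bij[OF _ _ assms(3)]) (simp_all add: assms(1,2))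
  qed
  then obtain H where H: "\<And>c. bij_betw (H c) {x \<in> S. f x = c} {x \<in> T. g x = c}" by metis
  let ?h = "\<lambda>x. H (f x) x"
  have h: "?h x \<in> T \<and> g (?h x) = f x" if "x \<in> S" for x
    using bij_betwE[OF H[of "f x"]] that by simp
  have "inj_on ?h S"
  proof (rule inj_onI)
    fix x y assume xy: "x \<in> S" "y \<in> S" "?h x = ?h y"
    then have "f x = f y" using h by metis
    then show "x = y" using xy bij_betw_imp_inj_on[OF H[of "f x"]] by (simp add: inj_on_def)
  qed
  moreover have "T \<subseteq> ?h ` S"
  proof
    fix y assume y: "y \<in> T"
    then have "y \<in> H (g y) ` {x \<in> S. f x = g y}"
      using bij_betw_imp_surj_on[OF H[of "g y"]] by simp
    then obtain x where "x \<in> S" "f x = g y" "y = H (g y) x" by blast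
    then show "y \<in> ?h ` S" by (intro image_eqI[of _ _ x]) simp_all
  qed
  ultimately have "bij_betw ?h S T" using h by (auto simp: bij_betw_def)
  then show ?thesis using h by blast
qed

lemma sum_eq_of_card_fibres:
  fixes h :: "nat \<Rightarrow> 'c::comm_monoid_add"
  assumes "finite S" "finite T" "\<And>c. card {x \<in> S. f x = c} = card {x \<in> T. g x = c}"
  shows "(\<Sum>x\<in>S. h (f x)) = (\<Sum>x\<in>T. h (g x))"
proof -
  obtain e where e: "bij_betw e S T" "\<forall>x\<in>S. g (e x) = f x"
    using ex_bij_betw_fibres[OF assms] by blast
  then have "(\<Sum>x\<in>S. h (f x)) = (\<Sum>x\<in>S. h (g (e x)))" by simp
  also have "\<dots> = (\<Sum>x\<in>T. h (g x))" using e(1) by (rule sum.reindex_bij_betw)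
  finally show ?thesis .
qed

context model
begin

text \<open>For given \<open>d\<close>, \<open>m\<close>, \<sigma>, \<tau> and \<open>k\<close>, the
  class sizes \<open>zz\<close> and \<open>ee\<close> determine the model up to isomorphism, so the
  whole comparison aims at them.\<close>

definition zz :: "nat \<Rightarrow> nat \<Rightarrow> nat" where
  "zz u v = card {y \<in> Ys. s y = u \<and> t y = v \<and> \<not> \<epsilon> y}"

definition ee :: "nat \<Rightarrow> nat \<Rightarrow> nat" where
  "ee u v = card {y \<in> Ys. s y = u \<and> t y = v \<and> \<epsilon> y}"

lemma ee_0: "\<tau> < v \<Longrightarrow> ee u v = 0"
proof -
  assume "\<tau> < v"
  then have "{y \<in> Ys. s y = u \<and> t y = v \<and> \<epsilon> y} = {}" using eps_t by fastforce
  then show ?thesis by (simp only: ee_def card.empty)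
qed

lemma ee_fx: "fx \<le> u \<Longrightarrow> ee u v = 0"
proof -
  assume "fx \<le> u"
  then have "{y \<in> Ys. s y = u \<and> t y = v \<and> \<epsilon> y} = {}" using eps_fx by fastforce
  then show ?thesis by (simp only: ee_def card.empty)
qed

lemma zz_m: "m < v \<Longrightarrow> zz u v = 0"
proof -
  assume "m < v"
  then have "{y \<in> Ys. s y = u \<and> t y = v \<and> \<not> \<epsilon> y} = {}" using t_le by fastforce
  then show ?thesis by (simp only: zz_def card.empty)
qed

lemma zz_ee_s: "u = 0 \<or> d + 1 < u \<Longrightarrow> zz u v = 0 \<and> ee u v = 0"
proof -
  assume "u = 0 \<or> d + 1 < u"
  then have "{y \<in> Ys. s y = u \<and> t y = v \<and> b y} = {}" for b using s_le s_ge by fastforce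
  from this[of "\<lambda>y. \<not> \<epsilon> y"] this[of \<epsilon>] show ?thesis by (simp only: zz_def ee_def card.empty simp_thms)
qed

lemma card_s_split: "card {y \<in> Ys. i < s y \<and> Q y} = (\<Sum>u\<in>{i<..d + 1}. card {y \<in> Ys. s y = u \<and> Q y})"
proof -
  have "{y \<in> Ys. i < s y \<and> Q y} = (\<Union>u\<in>{i<..d + 1}. {y \<in> Ys. s y = u \<and> Q y})"
    using s_le by auto
  also have "card \<dots> = (\<Sum>u\<in>{i<..d + 1}. card {y \<in> Ys. s y = u \<and> Q y})"
    using finY by (subst card_UN_disjoint) auto
  finally show ?thesis .
qed

lemma card_t_split:
  "card {y \<in> Ys. s y = u \<and> t y < b \<and> \<not> \<epsilon> y} = (\<Sum>v<b. zz u v)"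
  "card {y \<in> Ys. s y = u \<and> t y < b \<and> \<epsilon> y} = (\<Sum>v<b. ee u v)"
proof -
  have *: "card {y \<in> Ys. s y = u \<and> t y < b \<and> Q y} = (\<Sum>v<b. card {y \<in> Ys. s y = u \<and> t y = v \<and> Q y})" for Q
  proof -
    have "{y \<in> Ys. s y = u \<and> t y < b \<and> Q y} = (\<Union>v\<in>{..<b}. {y \<in> Ys. s y = u \<and> t y = v \<and> Q y})" by auto
    also have "card \<dots> = (\<Sum>v<b. card {y \<in> Ys. s y = u \<and> t y = v \<and> Q y})"
      using finY by (subst card_UN_disjoint) auto
    finally show ?thesis .
  qed
  show "card {y \<in> Ys. s y = u \<and> t y < b \<and> \<not> \<epsilon> y} = (\<Sum>v<b. zz u v)"
    "card {y \<in> Ys. s y = u \<and> t y < b \<and> \<epsilon> y} = (\<Sum>v<b. ee u v)"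
    unfolding zz_def ee_def by (rule *)+
qed

lemma card_eps_split:
  "card {y \<in> Ys. Q y} = card {y \<in> Ys. Q y \<and> \<not> \<epsilon> y} + card {y \<in> Ys. Q y \<and> \<epsilon> y}"
proof -
  have "{y \<in> Ys. Q y} = {y \<in> Ys. Q y \<and> \<not> \<epsilon> y} \<union> {y \<in> Ys. Q y \<and> \<epsilon> y}" by auto
  also have "card \<dots> = card {y \<in> Ys. Q y \<and> \<not> \<epsilon> y} + card {y \<in> Ys. Q y \<and> \<epsilon> y}"
    using finY by (intro card_Un_disjoint) auto
  finally show ?thesis .
qed

text \<open>For values up to \<open>m + 1\<close> the lower chain does not contribute, by
  \<open>uu_E\<close>; what remains are antichain elements, a part common to all models with these
  parameters, and \<open>X\<close>.\<close>

lemma card_uu0: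
  assumes "i \<le> d + 1" "c \<le> m + 1"
  shows "card {x \<in> V. i < rk x \<and> 0 < ck x \<and> uu 0 x = c} =
    card {y \<in> Ys. i < s y \<and> m - t y + of_bool (\<epsilon> y) = c} + card {j \<in> {1..m}. m - j + of_bool (j < \<sigma>) = c}
    + of_bool (i < fx \<and> m - \<tau> = c)"
proof -
  have ck: "0 < ck x" if "x \<in> V" for x
    using is_corank that by (auto simp: is_rank_def Suc_le_eq)
  have "uu 0 (E l) \<noteq> c" if "l \<in> {1..d}" for l using uu_E(1)[of l] that assms(2) by auto
  then have "{l \<in> {1..d}. i < rk (E l) \<and> 0 < ck (E l) \<and> uu 0 (E l) = c} = {}" by blast
  moreover have "{y \<in> Ys. i < rk (Y y) \<and> 0 < ck (Y y) \<and> uu 0 (Y y) = c} =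
      {y \<in> Ys. i < s y \<and> m - t y + of_bool (\<epsilon> y) = c}"
  proof (rule Collect_cong, rule conj_cong[OF refl])
    fix y assume "y \<in> Ys"
    then show "(i < rk (Y y) \<and> 0 < ck (Y y) \<and> uu 0 (Y y) = c) = (i < s y \<and> m - t y + of_bool (\<epsilon> y) = c)"
      using ck[of "Y y"] uu_Y(1)[of y] by (simp del: ck.simps)
  qed
  moreover have "{j \<in> {1..m}. i < rk (U j) \<and> 0 < ck (U j) \<and> uu 0 (U j) = c} =
      {j \<in> {1..m}. m - j + of_bool (j < \<sigma>) = c}"
  proof (rule Collect_cong, rule conj_cong[OF refl])
    fix j assume "j \<in> {1..m}"
    then show "(i < rk (U j) \<and> 0 < ck (U j) \<and> uu 0 (U j) = c) = (m - j + of_bool (j < \<sigma>) = c)"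
      using ck[of "U j"] uu_U(1)[of j] assms(1) by (simp del: ck.simps)
  qed
  moreover have "(i < rk X \<and> 0 < ck X \<and> uu 0 X = c) = (i < fx \<and> m - \<tau> = c)"
    using ck[of X] uu_X by (simp del: ck.simps)
  ultimately show ?thesis
    unfolding card_V by (simp only: card.empty add_0)
qed

lemma card_uu_top:
  assumes "i \<le> d + 1" "1 \<le> c" "c + 1 \<le> \<tau>"
  shows "card {x \<in> V. i < rk x \<and> m + 1 - \<tau> < ck x \<and> uu (m + 1 - \<tau>) x = c} =
    card {y \<in> Ys. i < s y \<and> \<tau> - 1 - t y = c} + card {j \<in> {1..m}. \<tau> - 1 - j = c}"
proof -
  let ?j = "m + 1 - \<tau>"
  have tau: "1 \<le> \<tau>" using assms by simp
  have "uu ?j (E l) \<noteq> c" if "l \<in> {1..d}" for l using uu_E(2)[of l] that assms tau by auto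
  then have "{l \<in> {1..d}. i < rk (E l) \<and> ?j < ck (E l) \<and> uu ?j (E l) = c} = {}" by blast
  moreover have "(?j < ck (Y y) \<and> uu ?j (Y y) = c) = (\<tau> - 1 - t y = c)" if "y \<in> Ys" for y
    using uu_Y(2)[OF that tau] assms tau_le by auto
  then have "{y \<in> Ys. i < rk (Y y) \<and> ?j < ck (Y y) \<and> uu ?j (Y y) = c} = {y \<in> Ys. i < s y \<and> \<tau> - 1 - t y = c}"
    by (intro Collect_cong conj_cong refl) auto
  moreover have "(?j < ck (U l) \<and> uu ?j (U l) = c) = (\<tau> - 1 - l = c)" if "l \<in> {1..m}" for l
    using uu_U(2)[of l] that assms tau_le by auto
  then have "{l \<in> {1..m}. i < rk (U l) \<and> ?j < ck (U l) \<and> uu ?j (U l) = c} = {l \<in> {1..m}. \<tau> - 1 - l = c}"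
    using assms(1) by (intro Collect_cong conj_cong refl) auto
  moreover have "(i < rk X \<and> ?j < ck X \<and> uu ?j X = c) = False" by simp
  ultimately show ?thesis
    unfolding card_V by (simp only: card.empty add_0 of_bool_eq add_0_right)
qed

text \<open>The level of \<open>X\<close> from above. It is the difference of two consecutive cuts,
  so the distribution of \<open>dd i\<close> on it belongs to the flag data.\<close>

definition row :: "nat \<Rightarrow> 'y pt set" where
  "row i = {x \<in> V. i < rk x \<and> ck x = m + 1 - \<tau>}"

lemma row_eq:
  assumes "i \<le> d + 1"
  shows "row i = Y ` {y \<in> Ys. i < s y \<and> t y = \<tau> \<and> \<not> \<epsilon> y} \<union> (if 1 \<le> \<tau> then {U \<tau>} else {}) \<union> (if i < fx then {X} else {})"
    (is "_ = ?R")
proof (intro equalityI subsetI)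
  fix x assume x: "x \<in> row i"
  then have xV: "x \<in> V" "i < rk x" "ck x = m + 1 - \<tau>" by (auto simp: row_def)
  from xV(1) show "x \<in> ?R"
  proof (cases rule: V_cases)
    case (1 l)
    then show ?thesis using xV by simp
  next
    case (2 y)
    then have "t y = \<tau> \<and> \<not> \<epsilon> y" using xV(3) t_le[of y] tau_le by (auto split: if_splits)
    then show ?thesis using 2 xV by auto
  next
    case (3 j)
    then have "j = \<tau>" using xV(3) tau_le by auto
    then show ?thesis using 3 by auto
  next
    case 4
    then show ?thesis using xV by auto
  qed
next
  fix x assume "x \<in> ?R"
  then consider y where "x = Y y" "y \<in> Ys" "i < s y" "t y = \<tau>" "\<not> \<epsilon> y" | "1 \<le> \<tau>" "x = U \<tau>" | "x = X" "i < fx"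
    by (auto split: if_splits)
  then show "x \<in> row i"
    by cases (use assms tau_le in \<open>simp_all add: row_def\<close>)
qed

lemma finite_row [simp]: "finite (row i)" by (simp add: row_def)

text \<open>The weight \<open>h\<close> is kept general: the identity gives the relation between
  \<open>k\<close> and the rank of \<open>X\<close>, the square gives the second moment for the
  symmetric case.\<close>

lemma sum_row:
  fixes h :: "nat \<Rightarrow> nat"
  assumes "i \<le> d + 1"
  shows "(\<Sum>x\<in>row i. h (dd i x)) = (\<Sum>y | y \<in> Ys \<and> i < s y \<and> t y = \<tau> \<and> \<not> \<epsilon> y. h (s y - 1 - i))
     + (if 1 \<le> \<tau> then h (dd i (U \<tau>)) else 0) + (if i < fx then h (dd i X) else 0)"
proof -
  let ?A = "Y ` {y \<in> Ys. i < s y \<and> t y = \<tau> \<and> \<not> \<epsilon> y}"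
    and ?B = "if 1 \<le> \<tau> then {U \<tau> :: 'y pt} else {}" and ?C = "if i < fx then {X :: 'y pt} else {}"
  let ?g = "\<lambda>x. h (dd i x)"
  have 1: "sum ?g (?A \<union> ?B \<union> ?C) = sum ?g (?A \<union> ?B) + sum ?g ?C"
    by (rule sum.union_disjoint) (use finY in \<open>auto split: if_splits\<close>)
  have 2: "sum ?g (?A \<union> ?B) = sum ?g ?A + sum ?g ?B"
    by (rule sum.union_disjoint) (use finY in \<open>auto split: if_splits\<close>)
  have 3: "sum ?g ?A = (\<Sum>y | y \<in> Ys \<and> i < s y \<and> t y = \<tau> \<and> \<not> \<epsilon> y. h (dd i (Y y)))"
    by (subst sum.reindex) (simp_all add: inj_on_def)
  have 4: "(\<Sum>y | y \<in> Ys \<and> i < s y \<and> t y = \<tau> \<and> \<not> \<epsilon> y. h (dd i (Y y))) =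
      (\<Sum>y | y \<in> Ys \<and> i < s y \<and> t y = \<tau> \<and> \<not> \<epsilon> y. h (s y - 1 - i))"
    by (rule sum.cong) (simp_all add: dd_Y)
  have 5: "sum ?g ?B = (if 1 \<le> \<tau> then h (dd i (U \<tau>)) else 0)" "sum ?g ?C = (if i < fx then h (dd i X) else 0)"
    by simp_all
  show ?thesis unfolding row_eq[OF assms] 1 2 3 4 5 ..
qed

lemma card_row:
  "card {x \<in> row i. dd i x = c} + card {x \<in> V. i < rk x \<and> m + 1 - \<tau> < ck x \<and> dd i x = c} =
   card {x \<in> V. i < rk x \<and> m - \<tau> < ck x \<and> dd i x = c}"
proof -
  let ?A = "{x \<in> row i. dd i x = c}" and ?B = "{x \<in> V. i < rk x \<and> m + 1 - \<tau> < ck x \<and> dd i x = c}"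
  have *: "m - \<tau> < n \<longleftrightarrow> n = m + 1 - \<tau> \<or> m + 1 - \<tau> < n" for n using tau_le by linarith
  have eq: "{x \<in> V. i < rk x \<and> m - \<tau> < ck x \<and> dd i x = c} = ?A \<union> ?B"
  proof (rule set_eqI)
    fix x
    show "x \<in> {x \<in> V. i < rk x \<and> m - \<tau> < ck x \<and> dd i x = c} \<longleftrightarrow> x \<in> ?A \<union> ?B"
      unfolding mem_Collect_eq Un_iff row_def *[of "ck x"] by blast
  qed
  have "?A \<inter> ?B = {}" unfolding row_def by force
  then show ?thesis unfolding eq by (subst card_Un_disjoint) simp_all
qed

lemma sum_zz_weight:
  fixes h :: "nat \<Rightarrow> nat"
  shows   "(\<Sum>y | y \<in> Ys \<and> i < s y \<and> t y = \<tau> \<and> \<not> \<epsilon> y. h (s y - 1 - i)) = (\<Sum>u\<in>{i<..d + 1}. zz u \<tau> * h (u - 1 - i))"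
proof -
  let ?S = "{y. y \<in> Ys \<and> i < s y \<and> t y = \<tau> \<and> \<not> \<epsilon> y}"
  have fin: "finite ?S" using finY by simp
  have sub: "s ` ?S \<subseteq> {i<..d + 1}" using s_le by auto
  have 1: "(\<Sum>u\<in>{i<..d + 1}. \<Sum>y\<in>{y \<in> ?S. s y = u}. h (s y - 1 - i)) = (\<Sum>y\<in>?S. h (s y - 1 - i))"
    by (rule sum.group[OF fin _ sub]) simp
  have 2: "(\<Sum>y\<in>{y \<in> ?S. s y = u}. h (s y - 1 - i)) = zz u \<tau> * h (u - 1 - i)" if "u \<in> {i<..d + 1}" for u
  proof -
    have 3: "{y \<in> ?S. s y = u} = {y \<in> Ys. s y = u \<and> t y = \<tau> \<and> \<not> \<epsilon> y}"
      using that by auto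
    show ?thesis unfolding 3 by (simp add: zz_def)
  qed
  have 4: "(\<Sum>u\<in>{i<..d + 1}. \<Sum>y\<in>{y \<in> ?S. s y = u}. h (s y - 1 - i)) = (\<Sum>u\<in>{i<..d + 1}. zz u \<tau> * h (u - 1 - i))"
    using 2 by (rule sum.cong[OF refl])
  show ?thesis using 1 4 by (rule HOL.trans[OF sym])
qed

end


section \<open>Integer sequences determined up to a common sign\<close>

text \<open>Take the last \<open>i\<close> with a nonzero tail; the squares fix that tail up to a
  sign \<open>c\<close>. For \<open>u \<le> i\<close> the product relation can be divided by the
  tail and gives the same sign. Beyond \<open>i\<close> all tails vanish, so the entry at
  \<open>i + 1\<close> is the tail itself and later entries are zero.\<close>

lemma eq_or_opposite_of_tails:
  fixes \<delta> \<delta>' :: "nat \<Rightarrow> int"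
  assumes prod: "\<And>u i. 1 \<le> u \<Longrightarrow> u \<le> i \<Longrightarrow> i \<le> n \<Longrightarrow>
      \<delta> u * (\<Sum>j\<in>{i<..n}. \<delta> j) = \<delta>' u * (\<Sum>j\<in>{i<..n}. \<delta>' j)"
    and sq: "\<And>i. i \<le> n \<Longrightarrow> (\<Sum>j\<in>{i<..n}. \<delta> j)\<^sup>2 = (\<Sum>j\<in>{i<..n}. \<delta>' j)\<^sup>2"
  shows "(\<forall>u\<in>{1..n}. \<delta> u = \<delta>' u) \<or> (\<forall>u\<in>{1..n}. \<delta> u = - \<delta>' u)"
proof -
  define \<Delta> \<Delta>' where "\<Delta> i = (\<Sum>j\<in>{i<..n}. \<delta> j)" and "\<Delta>' i = (\<Sum>j\<in>{i<..n}. \<delta>' j)" for i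
  have step: "\<Delta> (u - 1) = \<delta> u + \<Delta> u" "\<Delta>' (u - 1) = \<delta>' u + \<Delta>' u" if "1 \<le> u" "u \<le> n" for u
  proof -
    have "{u - 1<..n} = insert u {u<..n}" using that by auto
    then show "\<Delta> (u - 1) = \<delta> u + \<Delta> u" "\<Delta>' (u - 1) = \<delta>' u + \<Delta>' u" by (simp_all add: \<Delta>_def \<Delta>'_def)
  qed
  have zero: "\<Delta> i = 0 \<longleftrightarrow> \<Delta>' i = 0" if "i \<le> n" for i
    using sq[OF that] by (simp add: \<Delta>_def \<Delta>'_def) (metis power_eq_0_iff zero_eq_power2)
  show ?thesis
  proof (cases "\<exists>i\<le>n. \<Delta> i \<noteq> 0")
    case False
    then have "\<delta> u = \<delta>' u" if "u \<in> {1..n}" for u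
      using step[of u] zero[of u] zero[of "u - 1"] that by auto
    then show ?thesis by blast
  next
    case True
    define i where "i = (GREATEST i. i \<le> n \<and> \<Delta> i \<noteq> 0)"
    have i: "i \<le> n" "\<Delta> i \<noteq> 0" and great: "\<And>j. j \<le> n \<Longrightarrow> \<Delta> j \<noteq> 0 \<Longrightarrow> j \<le> i"
      using True GreatestI_nat[of "\<lambda>i. i \<le> n \<and> \<Delta> i \<noteq> 0" _ n] Greatest_le_nat[of "\<lambda>i. i \<le> n \<and> \<Delta> i \<noteq> 0" _ n]
      unfolding i_def by blast+
    have "\<Delta> i = \<Delta>' i \<or> \<Delta> i = - \<Delta>' i"
      using sq[OF i(1)] by (simp add: \<Delta>_def \<Delta>'_def power2_eq_iff)
    then obtain c where c: "c = 1 \<or> c = - (1::int)" "\<Delta> i = c * \<Delta>' i"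
      by (metis mult_1 mult_minus1)
    have "\<delta> u = c * \<delta>' u" if u: "u \<in> {1..n}" for u
    proof (cases "u \<le> i")
      case True
      then have "\<delta> u * \<Delta> i = \<delta>' u * \<Delta>' i" using prod[of u i] u i by (simp add: \<Delta>_def \<Delta>'_def)
      moreover have "\<Delta>' i = c * \<Delta> i" using c by auto
      ultimately have "\<delta> u * \<Delta> i = (c * \<delta>' u) * \<Delta> i" by (simp add: mult.commute mult.left_commute)
      then show ?thesis using i(2) by simp
    next
      case False
      then have z: "\<Delta> u = 0" "\<Delta>' u = 0" using great[of u] zero[of u] u by auto
      show ?thesis
      proof (cases "u = Suc i")
        case True
        then show ?thesis using z step[of u] u c by simp
      next
        case False
        then have "\<not> u - 1 \<le> i" "u - 1 \<le> n" using u \<open>\<not> u \<le> i\<close> by auto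
        then have "\<Delta> (u - 1) = 0" "\<Delta>' (u - 1) = 0" using great[of "u - 1"] zero[of "u - 1"] by blast+
        then show ?thesis using z step[of u] u by simp
      qed
    qed
    then show ?thesis using c(1) by auto
  qed
qed

section \<open>Splitting the counts by rank\<close>

lemma mlt_map_pt:
  assumes "\<And>y. Y y = a \<or> Y y = b \<Longrightarrow> s' (g y) = s y \<and> t' (g y) = t y \<and> \<epsilon>' (g y) = \<epsilon> y"
  shows "mlt \<sigma> \<tau> k s' t' \<epsilon>' (map_pt g a) (map_pt g b) \<longleftrightarrow> mlt \<sigma> \<tau> k s t \<epsilon> a b"
  using assms by (cases a; cases b) auto

context model
begin

lemma card_s_Suc:
  "card {y \<in> Ys. i < s y \<and> Q y} = card {y \<in> Ys. s y = Suc i \<and> Q y} + card {y \<in> Ys. Suc i < s y \<and> Q y}"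
proof -
  have "{y \<in> Ys. i < s y \<and> Q y} = {y \<in> Ys. s y = Suc i \<and> Q y} \<union> {y \<in> Ys. Suc i < s y \<and> Q y}" by auto
  also have "card \<dots> = card {y \<in> Ys. s y = Suc i \<and> Q y} + card {y \<in> Ys. Suc i < s y \<and> Q y}"
    using finY by (intro card_Un_disjoint) auto
  finally show ?thesis .
qed

text \<open>The ambiguity at the heart of the proof: meeting the upper chain one step later is
  compensated by lying below \<open>X\<close>.\<close>

lemma card_uu0_fibre:
  assumes "v \<le> m"
  shows "card {y \<in> Ys. s y = u \<and> m - t y + of_bool (\<epsilon> y) = m - v} = zz u v + ee u (Suc v)"
proof -
  have "{y \<in> Ys. s y = u \<and> m - t y + of_bool (\<epsilon> y) = m - v} =
    {y \<in> Ys. s y = u \<and> t y = v \<and> \<not> \<epsilon> y} \<union> {y \<in> Ys. s y = u \<and> t y = Suc v \<and> \<epsilon> y}" (is "?L = ?A \<union> ?B")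
  proof (rule set_eqI)
    fix y
    have "m - t y + of_bool (\<epsilon> y) = m - v \<longleftrightarrow> t y = v \<and> \<not> \<epsilon> y \<or> t y = Suc v \<and> \<epsilon> y" if "y \<in> Ys"
      using t_le[OF that] assms by (cases "\<epsilon> y") auto
    then show "y \<in> ?L \<longleftrightarrow> y \<in> ?A \<union> ?B" by blast
  qed
  also have "card \<dots> = zz u v + ee u (Suc v)"
    unfolding zz_def ee_def using finY by (intro card_Un_disjoint) auto
  finally show ?thesis .
qed

text \<open>The extreme value is the one that is not ambiguous; it starts the alternation in
  \<open>low_eq\<close>.\<close>

lemma card_uu0_fibre_top:
  "card {y \<in> Ys. s y = u \<and> m - t y + of_bool (\<epsilon> y) = m + 1} = ee u 0"
proof -
  have "m - t y + of_bool (\<epsilon> y) = m + 1 \<longleftrightarrow> t y = 0 \<and> \<epsilon> y" if "y \<in> Ys" for y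
    using t_le[OF that] by (cases "\<epsilon> y") auto
  then have "{y \<in> Ys. s y = u \<and> m - t y + of_bool (\<epsilon> y) = m + 1} = {y \<in> Ys. s y = u \<and> t y = 0 \<and> \<epsilon> y}"
    by blast
  then show ?thesis by (simp add: ee_def)
qed

lemma card_uu_top_fibre:
  assumes "v + 2 \<le> \<tau>"
  shows "card {y \<in> Ys. s y = u \<and> \<tau> - 1 - t y = \<tau> - 1 - v} = zz u v + ee u v"
proof -
  have "\<tau> - 1 - t y = \<tau> - 1 - v \<longleftrightarrow> t y = v" for y
    using assms by auto
  then have "{y \<in> Ys. s y = u \<and> \<tau> - 1 - t y = \<tau> - 1 - v} =
    {y \<in> Ys. s y = u \<and> t y = v \<and> \<not> \<epsilon> y} \<union> {y \<in> Ys. s y = u \<and> t y = v \<and> \<epsilon> y}" by blast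
  also have "card \<dots> = zz u v + ee u v"
    unfolding zz_def ee_def using finY by (intro card_Un_disjoint) auto
  finally show ?thesis .
qed

lemma card_t_split_eps:
  "card {y \<in> Ys. i < s y \<and> t y < \<tau>} = (\<Sum>u\<in>{i<..d + 1}. (\<Sum>v<\<tau>. zz u v) + (\<Sum>v<\<tau>. ee u v))"
  "card {y \<in> Ys. \<epsilon> y \<and> i < s y} = (\<Sum>u\<in>{i<..d + 1}. (\<Sum>v<Suc \<tau>. ee u v))"
proof -
  have "card {y \<in> Ys. i < s y \<and> t y < \<tau>} = (\<Sum>u\<in>{i<..d + 1}. card {y \<in> Ys. s y = u \<and> t y < \<tau>})"
    by (rule card_s_split)
  also have "\<dots> = (\<Sum>u\<in>{i<..d + 1}. (\<Sum>v<\<tau>. zz u v) + (\<Sum>v<\<tau>. ee u v))"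
  proof (rule sum.cong[OF refl])
    fix u
    have "card {y \<in> Ys. s y = u \<and> t y < \<tau>} = card {y \<in> Ys. (s y = u \<and> t y < \<tau>) \<and> \<not> \<epsilon> y}
        + card {y \<in> Ys. (s y = u \<and> t y < \<tau>) \<and> \<epsilon> y}" by (rule card_eps_split)
    then show "card {y \<in> Ys. s y = u \<and> t y < \<tau>} = (\<Sum>v<\<tau>. zz u v) + (\<Sum>v<\<tau>. ee u v)"
      by (simp only: conj_assoc card_t_split)
  qed
  finally show "card {y \<in> Ys. i < s y \<and> t y < \<tau>} = (\<Sum>u\<in>{i<..d + 1}. (\<Sum>v<\<tau>. zz u v) + (\<Sum>v<\<tau>. ee u v))" .
  have "{y \<in> Ys. \<epsilon> y \<and> i < s y} = {y \<in> Ys. i < s y \<and> t y < Suc \<tau> \<and> \<epsilon> y}"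
    using eps_t by (auto simp: less_Suc_eq_le)
  then have "card {y \<in> Ys. \<epsilon> y \<and> i < s y} = (\<Sum>u\<in>{i<..d + 1}. card {y \<in> Ys. s y = u \<and> t y < Suc \<tau> \<and> \<epsilon> y})"
    by (simp only: card_s_split)
  then show "card {y \<in> Ys. \<epsilon> y \<and> i < s y} = (\<Sum>u\<in>{i<..d + 1}. (\<Sum>v<Suc \<tau>. ee u v))"
    by (simp only: card_t_split)
qed

text \<open>\<open>U \<tau>\<close> has more than \<open>d\<close> elements below it, since an
  antichain element from \<open>ex_y0\<close> joins the lower chain; hence it does not interfere for
  \<open>c \<le> d\<close>.\<close>

lemma card_row0:
  assumes "c \<le> d"
  shows "card {x \<in> row 0. dd 0 x = c} = zz (Suc c) \<tau> + of_bool (dd 0 X = c)"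
proof -
  have UX: "dd 0 (U \<tau>) \<noteq> c" if "1 \<le> \<tau>"
  proof -
    obtain y where "y \<in> Ys" "s y = d + 1" "t y = 0" using ex_y0 \<open>1 \<le> \<tau>\<close> by auto
    then have "{y} \<subseteq> {y \<in> Ys. 0 < s y \<and> t y < \<tau>}" using that by auto
    then have "card {y} \<le> card {y \<in> Ys. 0 < s y \<and> t y < \<tau>}" by (rule card_mono[rotated]) (use finY in simp)
    then show ?thesis using dd_U[OF that, of 0] assms by simp
  qed
  have "{x \<in> row 0. dd 0 x = c} = Y ` {y \<in> Ys. s y = Suc c \<and> t y = \<tau> \<and> \<not> \<epsilon> y} \<union> (if dd 0 X = c then {X} else {})"
    (is "?L = ?R")
  proof (intro equalityI subsetI)
    fix x assume "x \<in> ?L"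
    then have x: "x \<in> row 0" "dd 0 x = c" by auto
    from x(1) consider y where "x = Y y" "y \<in> Ys" "0 < s y" "t y = \<tau>" "\<not> \<epsilon> y" | "1 \<le> \<tau>" "x = U \<tau>" | "x = X"
      unfolding row_eq[of 0, simplified] by (auto split: if_splits)
    then show "x \<in> ?R"
    proof cases
      case 1
      then show ?thesis using x(2) dd_Y[of y 0] by auto
    next
      case 2
      then show ?thesis using x(2) UX by simp
    next
      case 3
      then show ?thesis using x(2) by simp
    qed
  next
    fix x assume "x \<in> ?R"
    then consider y where "x = Y y" "y \<in> Ys" "s y = Suc c" "t y = \<tau>" "\<not> \<epsilon> y" | "x = X" "dd 0 X = c"
      by (auto split: if_splits)
    then show "x \<in> ?L"
    proof cases
      case 1
      then show ?thesis using dd_Y[of y 0] row_eq[of 0] by auto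
    next
      case 2
      then show ?thesis using fx_ge row_eq[of 0] by simp
    qed
  qed
  moreover have "card ?R = card (Y ` {y \<in> Ys. s y = Suc c \<and> t y = \<tau> \<and> \<not> \<epsilon> y}) + of_bool (dd 0 X = c)"
    by (subst card_Un_disjoint) (use finY in auto)
  moreover have "card (Y ` {y \<in> Ys. s y = Suc c \<and> t y = \<tau> \<and> \<not> \<epsilon> y}) = zz (Suc c) \<tau>"
    unfolding zz_def by (rule card_image) (simp add: inj_on_def)
  ultimately show ?thesis by simp
qed

lemma card_eps_pos: "1 \<le> card {y \<in> Ys. \<epsilon> y \<and> 0 < s y}"
proof -
  obtain y where "y \<in> Ys" "\<epsilon> y" using ex_eps by blast
  then have "{y} \<subseteq> {y \<in> Ys. \<epsilon> y \<and> 0 < s y}" using s_ge[of y] by auto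
  then have "card {y} \<le> card {y \<in> Ys. \<epsilon> y \<and> 0 < s y}" by (rule card_mono[rotated]) (use finY in simp)
  then show ?thesis by simp
qed

lemma card_top_rank: "card {p \<in> V. d + 1 < rk p} = m + of_bool (d + 1 < fx)"
proof -
  have "{l \<in> {1..d}. d + 1 < rk (E l)} = {}" "{y \<in> Ys. d + 1 < rk (Y y)} = {}"
    "{j \<in> {1..m}. d + 1 < rk (U j)} = {1..m}" "(d + 1 < rk X) = (d + 1 < fx)"
    using s_le by fastforce+
  then show ?thesis unfolding card_V by (simp only: card.empty add_0 card_atLeastAtMost)
qed

end


section \<open>Two flag equivalent models: settled classes, the rank of \<open>X\<close> and
  \<open>k\<close>\<close>

text \<open>\<sigma> and \<tau> are shared because the part above the antichain already determines
  them; \<open>k\<close> is not known to agree at this point.\<close>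

locale two_models =
  A: model d m \<sigma> \<tau> k Ys s t \<epsilon> + B: model d m \<sigma> \<tau> k' Ys' s' t' \<epsilon>'
  for d m \<sigma> \<tau> k :: nat and Ys :: "'y set" and s t :: "'y \<Rightarrow> nat" and \<epsilon> :: "'y \<Rightarrow> bool"
    and k' :: nat and Ys' :: "'z set" and s' t' :: "'z \<Rightarrow> nat" and \<epsilon>' :: "'z \<Rightarrow> bool" +
  assumes equiv: "flag_equiv A.r A.V B.r B.V"
begin

lemma swap: "two_models d m \<sigma> \<tau> k' Ys' s' t' \<epsilon>' k Ys s t \<epsilon>"
  by (rule two_models.intro[OF B.model_axioms A.model_axioms two_models_axioms.intro[OF flag_equiv_sym[OF equiv]]])

lemma equiv_layer: "flag_equiv A.r {p \<in> A.V. i < A.rk p \<and> j < A.ck p} B.r {p \<in> B.V. i < B.rk p \<and> j < B.ck p}"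
  by (rule flag_equiv_rank_corank[OF equiv A.finV B.finV A.is_rank B.is_rank A.is_corank B.is_corank])

lemma equiv_lay: "flag_equiv A.r (A.lay i) B.r (B.lay i)"
  unfolding A.lay_def B.lay_def by (rule equiv_layer)

lemma uu_eq:
  "card {x \<in> A.V. i < A.rk x \<and> j < A.ck x \<and> A.uu j x = c} = card {x \<in> B.V. i < B.rk x \<and> j < B.ck x \<and> B.uu j x = c}"
proof -
  have "finite {p \<in> A.V. i < A.rk p \<and> j < A.ck p}" "finite {p \<in> B.V. i < B.rk p \<and> j < B.ck p}" by simp_all
  from flag_equiv_card_above[OF equiv_layer this A.strict B.strict, of c]
  show ?thesis unfolding A.card_above_layer B.card_above_layer .
qed

lemma dd_eq:
  "card {x \<in> A.V. i < A.rk x \<and> j < A.ck x \<and> A.dd i x = c} = card {x \<in> B.V. i < B.rk x \<and> j < B.ck x \<and> B.dd i x = c}"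
proof -
  have "finite {p \<in> A.V. i < A.rk p \<and> j < A.ck p}" "finite {p \<in> B.V. i < B.rk p \<and> j < B.ck p}" by simp_all
  from flag_equiv_card_below[OF equiv_layer this A.strict B.strict, of c]
  show ?thesis unfolding A.card_below_layer B.card_below_layer .
qed

lemma top_fx: "d + 1 < A.fx \<longleftrightarrow> d + 1 < B.fx"
proof -
  have "card {p \<in> A.V. d + 1 < A.rk p} = card {p \<in> B.V. d + 1 < B.rk p}"
    by (rule flag_equiv_card[OF flag_equiv_rank_gt[OF equiv A.finV B.finV A.is_rank B.is_rank]]) simp_all
  then show ?thesis unfolding A.card_top_rank B.card_top_rank by (cases "d + 1 < A.fx"; cases "d + 1 < B.fx") simp_all
qed

lemma uu0_fibre:
  assumes "1 \<le> u" "u \<le> d + 1" "c \<le> m + 1"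
  shows "card {y \<in> Ys. s y = u \<and> m - t y + of_bool (\<epsilon> y) = c} + of_bool (A.fx = u \<and> m - \<tau> = c) =
    card {y \<in> Ys'. s' y = u \<and> m - t' y + of_bool (\<epsilon>' y) = c} + of_bool (B.fx = u \<and> m - \<tau> = c)"
proof -
  have *: "card {y \<in> Ys. i < s y \<and> m - t y + of_bool (\<epsilon> y) = c} + of_bool (i < A.fx \<and> m - \<tau> = c) =
    card {y \<in> Ys'. i < s' y \<and> m - t' y + of_bool (\<epsilon>' y) = c} + of_bool (i < B.fx \<and> m - \<tau> = c)"
    if "i \<le> d + 1" for i
    using uu_eq[of i 0 c] unfolding A.card_uu0[OF that assms(3)] B.card_uu0[OF that assms(3)] by linarith
  obtain i where i: "u = Suc i" using assms(1) by (cases u) auto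
  have sp: "(of_bool (i < f \<and> q) :: nat) = of_bool (f = Suc i \<and> q) + of_bool (Suc i < f \<and> q)" for f q
    by (cases "f = Suc i") auto
  show ?thesis
    using *[of i] *[of "Suc i"] assms(2)
      A.card_s_Suc[of i "\<lambda>y. m - t y + of_bool (\<epsilon> y) = c"] B.card_s_Suc[of i "\<lambda>y. m - t' y + of_bool (\<epsilon>' y) = c"]
      sp[of A.fx "m - \<tau> = c"] sp[of B.fx "m - \<tau> = c"]
    unfolding i by linarith
qed

lemma N1:
  assumes "1 \<le> u" "u \<le> d + 1" "v \<le> m"
  shows "A.zz u v + A.ee u (Suc v) + of_bool (A.fx = u \<and> v = \<tau>) =
    B.zz u v + B.ee u (Suc v) + of_bool (B.fx = u \<and> v = \<tau>)"
proof -
  have "m - \<tau> = m - v \<longleftrightarrow> v = \<tau>" using assms A.tau_le by auto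
  then show ?thesis
    using uu0_fibre[OF assms(1,2), of "m - v"]
    unfolding A.card_uu0_fibre[OF assms(3)] B.card_uu0_fibre[OF assms(3)] by simp
qed

lemma N0: "1 \<le> u \<Longrightarrow> u \<le> d + 1 \<Longrightarrow> A.ee u 0 = B.ee u 0"
proof -
  assume u: "1 \<le> u" "u \<le> d + 1"
  have ne: "(m - \<tau> = m + 1) = False" by simp
  show "A.ee u 0 = B.ee u 0"
    using uu0_fibre[OF u, of "m + 1"] unfolding A.card_uu0_fibre_top B.card_uu0_fibre_top ne by simp
qed

lemma N2:
  assumes "1 \<le> u" "u \<le> d + 1" "v + 2 \<le> \<tau>"
  shows "A.zz u v + A.ee u v = B.zz u v + B.ee u v"
proof -
  let ?c = "\<tau> - 1 - v"
  have c: "1 \<le> ?c" "?c + 1 \<le> \<tau>" using assms by auto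
  have *: "card {y \<in> Ys. i < s y \<and> \<tau> - 1 - t y = ?c} = card {y \<in> Ys'. i < s' y \<and> \<tau> - 1 - t' y = ?c}"
    if "i \<le> d + 1" for i
    using uu_eq[of i "m + 1 - \<tau>" ?c] unfolding A.card_uu_top[OF that c] B.card_uu_top[OF that c] by linarith
  obtain i where i: "u = Suc i" using assms(1) by (cases u) auto
  have "card {y \<in> Ys. s y = u \<and> \<tau> - 1 - t y = ?c} = card {y \<in> Ys'. s' y = u \<and> \<tau> - 1 - t' y = ?c}"
    using *[of i] *[of "Suc i"] assms(2)
      A.card_s_Suc[of i "\<lambda>y. \<tau> - 1 - t y = ?c"] B.card_s_Suc[of i "\<lambda>y. \<tau> - 1 - t' y = ?c"]
    unfolding i by linarith
  then show ?thesis unfolding A.card_uu_top_fibre[OF assms(3)] B.card_uu_top_fibre[OF assms(3)] .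
qed

text \<open>Two relations alternate: \<open>N2\<close> yields \<open>zz u v\<close> from
  \<open>ee u v\<close>, and \<open>N1\<close> yields \<open>ee u (Suc v)\<close> from
  \<open>zz u v\<close>, starting with \<open>N0\<close>. \<open>N2\<close> is available for
  \<open>v + 2 \<le> \<tau>\<close> only, so \<open>zz u (\<tau> - 1)\<close> and
  \<open>ee u \<tau>\<close> stay open.\<close>

lemma low_eq:
  assumes "1 \<le> u" "u \<le> d + 1"
  shows "(v < \<tau> \<longrightarrow> A.ee u v = B.ee u v) \<and> (v + 2 \<le> \<tau> \<longrightarrow> A.zz u v = B.zz u v)"
proof (induction v)
  case 0
  show ?case using N0[OF assms] N2[OF assms, of 0] by auto
next
  case (Suc v)
  have "A.ee u (Suc v) = B.ee u (Suc v)" if "Suc v < \<tau>"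
    using N1[OF assms, of v] Suc that A.tau_le by auto
  then show ?case using N2[OF assms, of "Suc v"] by auto
qed

lemma ee_low: "v < \<tau> \<Longrightarrow> A.ee u v = B.ee u v"
  using low_eq[of u v] A.zz_ee_s[of u v] B.zz_ee_s[of u v] by (cases "1 \<le> u \<and> u \<le> d + 1") auto

lemma zz_low: "v + 2 \<le> \<tau> \<Longrightarrow> A.zz u v = B.zz u v"
  using low_eq[of u v] A.zz_ee_s[of u v] B.zz_ee_s[of u v] by (cases "1 \<le> u \<and> u \<le> d + 1") auto

lemma ee_high: "\<tau> < v \<Longrightarrow> A.ee u v = B.ee u v"
  using A.ee_0 B.ee_0 by simp

lemma ee_tau0: "\<tau> = 0 \<Longrightarrow> A.ee u v = B.ee u v"
  using N0[of u] A.zz_ee_s[of u v] B.zz_ee_s[of u v] ee_high[of v u]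
  by (cases "1 \<le> u \<and> u \<le> d + 1"; cases v) auto

lemma zz_high:
  assumes "\<tau> < v"
  shows "A.zz u v = B.zz u v"
proof (cases "1 \<le> u \<and> u \<le> d + 1 \<and> v \<le> m")
  case True
  then show ?thesis using N1[of u v] assms A.ee_0[of "Suc v" u] B.ee_0[of "Suc v" u] by auto
next
  case False
  then show ?thesis using A.zz_ee_s[of u v] B.zz_ee_s[of u v] A.zz_m[of v u] B.zz_m[of v u] by fastforce
qed

lemma zz_tau:
  assumes "1 \<le> u" "u \<le> d + 1"
  shows "A.zz u \<tau> + of_bool (A.fx = u) = B.zz u \<tau> + of_bool (B.fx = u)"
  using N1[OF assms A.tau_le] A.ee_0[of "Suc \<tau>" u] B.ee_0[of "Suc \<tau>" u] by simp

text \<open>All that \<open>N1\<close> says about the two open classes.\<close>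

lemma T_eq:
  assumes "1 \<le> \<tau>"
  shows "A.zz u (\<tau> - 1) + A.ee u \<tau> = B.zz u (\<tau> - 1) + B.ee u \<tau>"
proof (cases "1 \<le> u \<and> u \<le> d + 1")
  case True
  moreover have "(\<tau> - 1 = \<tau>) = False" "Suc (\<tau> - 1) = \<tau>" "\<tau> - 1 \<le> m" using assms A.tau_le by auto
  ultimately show ?thesis using N1[of u "\<tau> - 1"] by (simp only: simp_thms of_bool_eq add_0_right)
next
  case False
  then show ?thesis using A.zz_ee_s[of u] B.zz_ee_s[of u] by (metis Suc_eq_plus1 less_one not_le)
qed

lemma card_row_eq:
  assumes "i \<le> d + 1"
  shows "card {x \<in> A.row i. A.dd i x = c} = card {x \<in> B.row i. B.dd i x = c}"
  using A.card_row[of i c] B.card_row[of i c] dd_eq[of i "m - \<tau>" c] dd_eq[of i "m + 1 - \<tau>" c] by linarith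

lemma sum_row_eq:
  fixes h :: "nat \<Rightarrow> nat"
  assumes "i \<le> d + 1"
  shows "(\<Sum>x\<in>A.row i. h (A.dd i x)) = (\<Sum>x\<in>B.row i. h (B.dd i x))"
  by (rule sum_eq_of_card_fibres[OF A.finite_row B.finite_row card_row_eq[OF assms]])

text \<open>In the sum of the two counts the open classes enter only through
  \<open>zz u (\<tau> - 1) + ee u \<tau>\<close>, one through \<open>U \<tau>\<close> and the other
  through \<open>X\<close>. What is left is the contribution of \<open>k\<close>, moved across to
  avoid subtraction.\<close>

lemma dd_pair:
  assumes "i \<le> d + 1"
  shows "(if 1 \<le> \<tau> then A.dd i (U \<tau>) else 0) + A.dd i X + (k' - i) =
    (if 1 \<le> \<tau> then B.dd i (U \<tau>) else 0) + B.dd i X + (k - i)"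
proof (cases "1 \<le> \<tau>")
  case True
  then obtain w where w: "\<tau> = Suc w" by (cases \<tau>) auto
  have key: "((\<Sum>v<\<tau>. A.zz u v) + (\<Sum>v<\<tau>. A.ee u v)) + (\<Sum>v<Suc \<tau>. A.ee u v) =
    ((\<Sum>v<\<tau>. B.zz u v) + (\<Sum>v<\<tau>. B.ee u v)) + (\<Sum>v<Suc \<tau>. B.ee u v)" for u
  proof -
    have "(\<Sum>v<w. A.zz u v) = (\<Sum>v<w. B.zz u v)"
      by (rule sum.cong[OF refl], rule zz_low) (simp add: w)
    moreover have "(\<Sum>v<\<tau>. A.ee u v) = (\<Sum>v<\<tau>. B.ee u v)"
      by (rule sum.cong[OF refl], rule ee_low) simp
    moreover have "A.zz u w + A.ee u \<tau> = B.zz u w + B.ee u \<tau>" using T_eq[OF True, of u] w by simp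
    moreover have "(\<Sum>v<\<tau>. A.zz u v) = (\<Sum>v<w. A.zz u v) + A.zz u w"
      "(\<Sum>v<\<tau>. B.zz u v) = (\<Sum>v<w. B.zz u v) + B.zz u w"
      "(\<Sum>v<Suc \<tau>. A.ee u v) = (\<Sum>v<\<tau>. A.ee u v) + A.ee u \<tau>"
      "(\<Sum>v<Suc \<tau>. B.ee u v) = (\<Sum>v<\<tau>. B.ee u v) + B.ee u \<tau>"
      unfolding w by simp_all
    ultimately show ?thesis by linarith
  qed
  have sum2: "sum f I + sum g I = sum f' I + sum g' I" if "\<And>u. f u + g u = f' u + g' u"
    for f g f' g' :: "nat \<Rightarrow> nat" and I
    unfolding sum.distrib[of f g I, symmetric] sum.distrib[of f' g' I, symmetric] using that by simp
  have "card {y \<in> Ys. i < s y \<and> t y < \<tau>} + card {y \<in> Ys. \<epsilon> y \<and> i < s y} =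
    card {y \<in> Ys'. i < s' y \<and> t' y < \<tau>} + card {y \<in> Ys'. \<epsilon>' y \<and> i < s' y}"
    unfolding A.card_t_split_eps B.card_t_split_eps by (rule sum2) (rule key)
  then show ?thesis
    unfolding if_P[OF True] A.dd_U[OF True assms] B.dd_U[OF True assms] A.dd_X[OF assms] B.dd_X[OF assms] by linarith
next
  case False
  then have "card {y \<in> Ys. \<epsilon> y \<and> i < s y} = card {y \<in> Ys'. \<epsilon>' y \<and> i < s' y}"
    unfolding A.card_t_split_eps B.card_t_split_eps using ee_tau0 by simp
  then show ?thesis using False A.dd_X[OF assms] B.dd_X[OF assms] by simp
qed

text \<open>Compares the first moments of \<open>dd i\<close> on the row of \<open>X\<close>. The
  classes with \<open>t = \<tau>\<close> not below \<open>X\<close> differ by one element at the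
  rank of \<open>X\<close>, by \<open>zz_tau\<close>, and \<open>dd_pair\<close> controls the other
  terms; a shift of this rank must therefore be matched by a shift of \<open>k\<close>.\<close>

lemma low_fx_balance:
  assumes "i \<le> d + 1" "A.fx \<le> d + 1" "B.fx \<le> d + 1"
  shows "(k - i) + (B.fx - 1 - i) = (k' - i) + (A.fx - 1 - i)"
proof -
  have sigma: "\<sigma> = 1" using assms(2) A.sigma_ge by (auto simp: A.fx_def split: if_splits)
  have X: "(if i < A.fx then A.dd i X else 0) = A.dd i X" "(if i < B.fx then B.dd i X else 0) = B.dd i X"
  proof -
    have "A.dd i X = 0" if "A.fx \<le> i"
    proof -
      have "{y \<in> Ys. \<epsilon> y \<and> i < s y} = {}" using A.eps_fx that by fastforce
      then show ?thesis unfolding A.dd_X[OF assms(1)] using sigma A.fx_ge that by (simp only: card.empty, (simp)?)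
    qed
    moreover have "B.dd i X = 0" if "B.fx \<le> i"
    proof -
      have "{y \<in> Ys'. \<epsilon>' y \<and> i < s' y} = {}" using B.eps_fx that by fastforce
      then show ?thesis unfolding B.dd_X[OF assms(1)] using sigma B.fx_ge that by (simp only: card.empty, (simp)?)
    qed
    ultimately show "(if i < A.fx then A.dd i X else 0) = A.dd i X" "(if i < B.fx then B.dd i X else 0) = B.dd i X"
      by auto
  qed
  have delta: "(\<Sum>u\<in>{i<..d + 1}. of_bool (f = u) * (u - 1 - i)) = f - 1 - i" if "f \<le> d + 1" for f :: nat
  proof -
    have "(\<Sum>u\<in>{i<..d + 1}. of_bool (f = u) * (u - 1 - i)) = (\<Sum>u\<in>{i<..d + 1}. if u = f then f - 1 - i else 0)"
      by (intro sum.cong) auto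
    also have "\<dots> = f - 1 - i" using that by (subst sum.delta) auto
    finally show ?thesis .
  qed
  have "(\<Sum>u\<in>{i<..d + 1}. (A.zz u \<tau> + of_bool (A.fx = u)) * (u - 1 - i)) =
        (\<Sum>u\<in>{i<..d + 1}. (B.zz u \<tau> + of_bool (B.fx = u)) * (u - 1 - i))"
    by (rule sum.cong[OF refl]) (subst zz_tau, auto)
  then have "(\<Sum>u\<in>{i<..d + 1}. A.zz u \<tau> * (u - 1 - i)) + (A.fx - 1 - i) =
        (\<Sum>u\<in>{i<..d + 1}. B.zz u \<tau> * (u - 1 - i)) + (B.fx - 1 - i)"
    unfolding add_mult_distrib sum.distrib delta[OF assms(2)] delta[OF assms(3)] .
  moreover have "(\<Sum>u\<in>{i<..d + 1}. A.zz u \<tau> * (u - 1 - i)) + (if 1 \<le> \<tau> then A.dd i (U \<tau>) else 0) + A.dd i X =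
        (\<Sum>u\<in>{i<..d + 1}. B.zz u \<tau> * (u - 1 - i)) + (if 1 \<le> \<tau> then B.dd i (U \<tau>) else 0) + B.dd i X"
    using sum_row_eq[OF assms(1), of "\<lambda>x. x"]
    unfolding A.sum_row[OF assms(1), where h = "\<lambda>x. x"] B.sum_row[OF assms(1), where h = "\<lambda>x. x"] A.sum_zz_weight[where h = "\<lambda>x. x"] B.sum_zz_weight[where h = "\<lambda>x. x"] X .
  ultimately show ?thesis using dd_pair[OF assms(1)] by linarith
qed

lemma low_fx_not_less:
  assumes "A.fx \<le> d + 1" "B.fx \<le> d + 1"
  shows "\<not> A.fx < B.fx"
proof
  assume less: "A.fx < B.fx"
  have AB: "A.fx = k + 1 \<or> A.fx = k + 2" "B.fx = k' + 1 \<or> B.fx = k' + 2"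
    using assms by (auto simp: A.fx_def B.fx_def split: if_splits)
  have b0: "k + (B.fx - 1) = k' + (A.fx - 1)" using low_fx_balance[of 0] assms by simp
  show False
  proof (cases "A.fx = k + 2")
    case True
    then have "B.fx = k' + 2" using AB b0 by auto
    \<comment> \<open>At this index the left side is \<open>B.fx - A.fx\<close> and the right side
      is one less, because \<open>k = A.fx - 2\<close> falls below the cut.\<close>
    then show False using low_fx_balance[of "A.fx - 1"] True less assms by auto
  next
    case False
    then have A: "A.fx = k + 1" and B: "B.fx = k' + 1" using AB b0 by auto
    have "k \<le> d" using A assms by simp
    \<comment> \<open>Here the balance holds for every \<open>i\<close>, so a finer count is taken:
      elements of the row with exactly \<open>k\<close> elements below them. Some antichain element
      lies below \<open>X\<close>, hence \<open>X\<close> itself is not among them in either model,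
      and the resulting equality contradicts \<open>zz_tau\<close> at rank
      \<open>k + 1\<close>.\<close>
    have "k < A.dd 0 X" "k < B.dd 0 X"
      using A.dd_X[of 0] B.dd_X[of 0] A.card_eps_pos less A B by simp_all
    then have "A.zz (Suc k) \<tau> = B.zz (Suc k) \<tau>"
      using card_row_eq[of 0 k] A.card_row0[OF \<open>k \<le> d\<close>] B.card_row0[OF \<open>k \<le> d\<close>] by simp
    then show False using zz_tau[of "Suc k"] A less \<open>k \<le> d\<close> by simp
  qed
qed

end

context two_models
begin

lemma fx_eq: "B.fx = A.fx"
proof (cases "d + 1 < A.fx")
  case True
  then have "d + 1 < B.fx" using top_fx by simp
  then show ?thesis using True A.k_le B.k_le by (auto simp: A.fx_def B.fx_def split: if_splits)
next
  case False
  then have "A.fx \<le> d + 1" "B.fx \<le> d + 1" using top_fx by auto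
  then show ?thesis
    using low_fx_not_less two_models.low_fx_not_less[OF swap] by fastforce
qed

lemma k_top: "d + 1 < A.fx \<Longrightarrow> k = d"
  using A.k_le A.sigma_k by (auto simp: A.fx_def split: if_splits)

lemma k_eq: "k' = k"
proof (cases "d + 1 < A.fx")
  case True
  then show ?thesis using k_top two_models.k_top[OF swap] fx_eq by simp
next
  case False
  then show ?thesis using low_fx_balance[of 0] fx_eq by simp
qed

lemma zz_tau_eq: "A.zz u \<tau> = B.zz u \<tau>"
  using zz_tau[of u] fx_eq A.zz_ee_s[of u \<tau>] B.zz_ee_s[of u \<tau>] by (cases "1 \<le> u \<and> u \<le> d + 1") auto

lemma zz_other: "v + 1 \<noteq> \<tau> \<Longrightarrow> A.zz u v = B.zz u v"
  using zz_low[of v u] zz_high[of v u] zz_tau_eq[of u] by (cases "v = \<tau>"; cases "v < \<tau>") auto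

lemma ee_other: "v \<noteq> \<tau> \<Longrightarrow> A.ee u v = B.ee u v"
  using ee_low[of v u] ee_high[of v u] by (cases "v < \<tau>") auto

end


section \<open>Putting one antichain element back under a truncation\<close>

lemma bij_betw_map_pt:
  assumes "bij_betw h S T"
  shows "bij_betw (map_pt h) (E ` I \<union> Y ` S \<union> U ` J \<union> (if b then {X} else {}))
    (E ` I \<union> Y ` T \<union> U ` J \<union> (if b then {X} else {}))"
proof -
  have inj: "x = y" if "x \<in> S" "y \<in> S" "h x = h y" for x y
    using that assms by (meson bij_betw_imp_inj_on inj_onD)
  have "inj_on (map_pt h) (E ` I \<union> Y ` S \<union> U ` J \<union> (if b then {X} else {}))"
  proof (rule inj_onI)
    fix p q assume "p \<in> E ` I \<union> Y ` S \<union> U ` J \<union> (if b then {X} else {})"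
      "q \<in> E ` I \<union> Y ` S \<union> U ` J \<union> (if b then {X} else {})" "map_pt h p = map_pt h q"
    then show "p = q" by (cases p; cases q) (auto split: if_splits intro: inj)
  qed
  moreover have "map_pt h ` (E ` I \<union> Y ` S \<union> U ` J \<union> (if b then {X} else {})) =
    E ` I \<union> Y ` (h ` S) \<union> U ` J \<union> (if b then {X} else {})"
    by (cases b) (simp_all add: image_Un image_image)
  ultimately show ?thesis
    using bij_betw_imp_surj_on[OF assms] by (simp add: bij_betw_def)
qed

context model
begin

lemma lay_eq:
  assumes "u \<le> d + 1"
  shows "lay u = E ` {u<..d} \<union> Y ` {y \<in> Ys. u < s y \<and> t y \<le> \<tau>} \<union> U ` {1..\<tau>} \<union> (if u < fx then {X} else {})"
proof (rule set_eqI)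
  fix x
  show "x \<in> lay u \<longleftrightarrow> x \<in> E ` {u<..d} \<union> Y ` {y \<in> Ys. u < s y \<and> t y \<le> \<tau>} \<union> U ` {1..\<tau>} \<union> (if u < fx then {X} else {})"
    using assms by (cases x) (auto simp: mem_lay)
qed

lemma lay_V: "lay u \<subseteq> V"
  by (auto simp: lay_def)

lemma sum_bots_lay:
  fixes h :: "'y pt \<Rightarrow> nat"
  assumes "u \<le> d" "Suc u < fx"
  shows "(\<Sum>p\<in>bots r (lay u). h p) = (if Suc u \<le> d then h (E (Suc u)) else 0) + (\<Sum>y\<in>ylay (Suc u). h (Y y))"
proof -
  have 1: "sum h ((if Suc u \<le> d then {E (Suc u)} else {}) \<union> Y ` ylay (Suc u)) =
    sum h (if Suc u \<le> d then {E (Suc u)} else {}) + sum h (Y ` ylay (Suc u))"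
    by (rule sum.union_disjoint) (auto split: if_splits)
  have 2: "sum h (Y ` ylay (Suc u)) = (\<Sum>y\<in>ylay (Suc u). h (Y y))"
    by (subst sum.reindex) (simp_all add: inj_on_def)
  show ?thesis unfolding bots_lay_eq[OF assms] 1 2 by simp
qed

lemma flags_insert_Y_lay:
  assumes "y \<in> ylay u" "u \<le> i" "i \<le> d" "Suc i < fx" "1 \<le> \<tau>"
  shows "flags r (insert (Y y) (lay i)) ((card (bots r (lay i)), True) # w) =
    flags r (insert (Y y) (lay (Suc i))) w + flags r (lay i) ((card (bots r (lay i)) - 1, True) # w)"
proof -
  have sy: "s y = u" using assms(1) by (simp add: ylay_def)
  have 1: "Y y \<notin> lay i" using sy assms(2) by (simp add: mem_lay)
  have 2: "\<forall>x\<in>lay i. \<not> r x (Y y)"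
  proof
    fix x assume "x \<in> lay i"
    then show "\<not> r x (Y y)" using sy assms(2) by (cases x) (auto simp: r_def mem_lay)
  qed
  have 3: "\<not> r (Y y) (Y y)" by (simp add: r_def)
  have 4: "\<forall>x\<in>bots r (lay i). \<not> r (Y y) x"
    unfolding bots_lay_eq[OF assms(3,4)] by (auto simp: r_def)
  show ?thesis
    using flags_insert_minimal[OF finite_lay bots_lay_nonempty[OF assms(3,5)] 1 2 3 4, of w] unfolding lay_Suc .
qed

text \<open>The last block of size 3 is a three-element filter; the filters that avoid
  \<open>Y y\<close> contribute the same amount for all \<open>y\<close>.\<close>

lemma flags_Y_lay_filters:
  assumes "y \<in> ylay u" "u \<le> i" "i \<le> d + 1" "i < fx" "1 \<le> \<tau>"
  shows "flags r (insert (Y y) (lay i)) [(card (lay i) - 2, False), (3, False)] =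
    card (blocks (\<lambda>x y. r y x) (lay i) 3 False) + cnt i y"
proof -
  have sy: "s y = u" using assms(1) by (simp add: ylay_def)
  have 1: "Y y \<notin> lay i" using sy assms(2) by (simp add: mem_lay)
  have 2: "\<forall>x\<in>lay i. \<not> r x (Y y)"
  proof
    fix x assume "x \<in> lay i"
    then show "\<not> r x (Y y)" using sy assms(2) by (cases x) (auto simp: r_def mem_lay)
  qed
  have 3: "\<not> r (Y y) (Y y)" by (simp add: r_def)
  have "{U \<tau>, X} \<subseteq> lay i" using assms by (simp add: mem_lay)
  then have "card {U \<tau> :: 'y pt, X} \<le> card (lay i)" by (rule card_mono[rotated]) simp
  then have "2 \<le> card (lay i)" by simp
  then have n: "3 \<le> card (insert (Y y) (lay i))" "card (insert (Y y) (lay i)) - 3 = card (lay i) - 2"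
    using 1 by simp_all
  have "Suc 2 = (3::nat)" by simp
  then show ?thesis
    using card_filters[OF _ n(1), of r] card_filters_insert[of "lay i" "Y y" r 2, OF finite_lay 1 2 3]
    unfolding n(2) cnt_def filt_def by (simp del: flags.simps)
qed

lemma sum_ylay:
  assumes "v \<le> \<tau>"
  shows "(\<Sum>y\<in>ylay u. of_bool (t y = v \<and> \<not> \<epsilon> y) * c) = zz u v * c"
    and "(\<Sum>y\<in>ylay u. of_bool (t y = v \<and> \<epsilon> y) * c) = ee u v * c"
proof -
  have *: "(\<Sum>y\<in>ylay u. of_bool (Q y) * c) = card {y \<in> ylay u. Q y} * c" for Q
  proof -
    have "card {y \<in> ylay u. Q y} = (\<Sum>y\<in>{y \<in> ylay u. Q y}. 1)" by simp
    also have "\<dots> = (\<Sum>y\<in>ylay u. if Q y then 1 else 0)" by (rule sum.inter_filter) simp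
    also have "\<dots> = (\<Sum>y\<in>ylay u. of_bool (Q y))" by (rule sum.cong) auto
    finally show ?thesis by (simp only: sum_distrib_right)
  qed
  have "{y \<in> ylay u. t y = v \<and> \<not> \<epsilon> y} = {y \<in> Ys. s y = u \<and> t y = v \<and> \<not> \<epsilon> y}"
    "{y \<in> ylay u. t y = v \<and> \<epsilon> y} = {y \<in> Ys. s y = u \<and> t y = v \<and> \<epsilon> y}"
    using assms unfolding ylay_def by blast+
  then show "(\<Sum>y\<in>ylay u. of_bool (t y = v \<and> \<not> \<epsilon> y) * c) = zz u v * c"
    "(\<Sum>y\<in>ylay u. of_bool (t y = v \<and> \<epsilon> y) * c) = ee u v * c"
    unfolding * zz_def ee_def by simp_all
qed

lemma sum_cnt:
  assumes "i \<le> d + 1" "i < fx" "1 \<le> \<tau>"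
  shows "(\<Sum>y\<in>ylay u. cnt i y) = zz u \<tau> * card (filt i) + ee u \<tau> * card {G \<in> filt i. X \<in> G}
    + zz u (\<tau> - 1) * card {G \<in> filt i. U \<tau> \<in> G} + zz u (\<tau> - 2) * of_bool (2 \<le> \<tau>) + ee u (\<tau> - 1) * 1"
proof -
  have "cnt i y = of_bool (t y = \<tau> \<and> \<not> \<epsilon> y) * card (filt i)
      + of_bool (t y = \<tau> \<and> \<epsilon> y) * card {G \<in> filt i. X \<in> G}
      + of_bool (t y = \<tau> - 1 \<and> \<not> \<epsilon> y) * card {G \<in> filt i. U \<tau> \<in> G}
      + of_bool (t y = \<tau> - 2 \<and> \<not> \<epsilon> y) * of_bool (2 \<le> \<tau>) + of_bool (t y = \<tau> - 1 \<and> \<epsilon> y) * 1"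
    if "y \<in> ylay u" for y
  proof -
    have y: "y \<in> Ys" "t y \<le> \<tau>" using that by (simp_all add: ylay_def)
    consider "t y = \<tau>" | "t y + 1 = \<tau>" | "t y + 2 = \<tau>" | "t y + 2 < \<tau>" using y(2) by linarith
    then show ?thesis
      unfolding cnt_eq[OF assms y] by cases (use assms(3) in \<open>cases "\<epsilon> y"; auto\<close>)+
  qed
  then have "(\<Sum>y\<in>ylay u. cnt i y) = (\<Sum>y\<in>ylay u. of_bool (t y = \<tau> \<and> \<not> \<epsilon> y) * card (filt i)
      + of_bool (t y = \<tau> \<and> \<epsilon> y) * card {G \<in> filt i. X \<in> G}
      + of_bool (t y = \<tau> - 1 \<and> \<not> \<epsilon> y) * card {G \<in> filt i. U \<tau> \<in> G}
      + of_bool (t y = \<tau> - 2 \<and> \<not> \<epsilon> y) * of_bool (2 \<le> \<tau>) + of_bool (t y = \<tau> - 1 \<and> \<epsilon> y) * 1)"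
    by (rule sum.cong[OF refl])
  also have "\<dots> = zz u \<tau> * card (filt i) + ee u \<tau> * card {G \<in> filt i. X \<in> G}
    + zz u (\<tau> - 1) * card {G \<in> filt i. U \<tau> \<in> G} + zz u (\<tau> - 2) * of_bool (2 \<le> \<tau>) + ee u (\<tau> - 1) * 1"
    unfolding sum.distrib by (simp only: sum_ylay diff_le_self order_refl)
  finally show ?thesis .
qed

text \<open>\<alpha> and \<beta> collect the two open classes over all ranks above \<open>i\<close>;
  \<zeta> collects a class that is known to agree.\<close>

definition \<alpha> :: "nat \<Rightarrow> nat" where
  "\<alpha> i = (\<Sum>u\<in>{i<..d + 1}. zz u (\<tau> - 1))"

definition \<beta> :: "nat \<Rightarrow> nat" where
  "\<beta> i = (\<Sum>u\<in>{i<..d + 1}. ee u \<tau>)"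

definition \<zeta> :: "nat \<Rightarrow> nat" where
  "\<zeta> i = (\<Sum>u\<in>{i<..d + 1}. zz u \<tau>)"

lemma card_filt_U_sum:
  assumes "i \<le> d + 1" "i < fx" "1 \<le> \<tau>"
  shows "card {G \<in> filt i. U \<tau> \<in> G} = \<alpha> i + \<zeta> i + 1 + of_bool (\<sigma> < \<tau>)"
proof -
  have "card {y \<in> Ys. s y = u \<and> t y \<le> \<tau> \<and> \<not> \<epsilon> y \<and> \<tau> - 1 \<le> t y} = zz u (\<tau> - 1) + zz u \<tau>" for u
  proof -
    have "t y \<le> \<tau> \<and> \<tau> - 1 \<le> t y \<longleftrightarrow> t y = \<tau> - 1 \<or> t y = \<tau>" for y by auto
    then have eq: "{y \<in> Ys. s y = u \<and> t y \<le> \<tau> \<and> \<not> \<epsilon> y \<and> \<tau> - 1 \<le> t y} =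
      {y \<in> Ys. s y = u \<and> t y = \<tau> - 1 \<and> \<not> \<epsilon> y} \<union> {y \<in> Ys. s y = u \<and> t y = \<tau> \<and> \<not> \<epsilon> y}" by blast
    have "{y \<in> Ys. s y = u \<and> t y = \<tau> - 1 \<and> \<not> \<epsilon> y} \<inter> {y \<in> Ys. s y = u \<and> t y = \<tau> \<and> \<not> \<epsilon> y} = {}"
      using assms(3) by force
    then show ?thesis unfolding eq zz_def using finY by (subst card_Un_disjoint) simp_all
  qed
  then show ?thesis
    unfolding card_filt_U[OF assms] card_s_split \<alpha>_def \<zeta>_def by (simp add: sum.distrib)
qed

lemma card_filt_X_sum:
  assumes "i \<le> d + 1" "i < fx" "1 \<le> \<tau>"
  shows "card {G \<in> filt i. X \<in> G} = \<zeta> i + \<beta> i + 1"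
proof -
  have "card {y \<in> Ys. s y = u \<and> t y = \<tau>} = zz u \<tau> + ee u \<tau>" for u
    using card_eps_split[of "\<lambda>y. s y = u \<and> t y = \<tau>"] unfolding zz_def ee_def conj_assoc .
  then show ?thesis
    unfolding card_filt_X[OF assms] card_s_split \<beta>_def \<zeta>_def by (simp add: sum.distrib)
qed

end

context two_models
begin

lemma card_bots_lay_eq: "card (bots A.r (A.lay i)) = card (bots B.r (B.lay i))"
  by (rule flag_equiv_bots(1)[OF equiv_lay A.finite_lay B.finite_lay])

lemma card_lay_eq: "card (A.lay i) = card (B.lay i)"
  by (rule flag_equiv_card[OF equiv_lay A.finite_lay B.finite_lay])

lemma flags_lay_eq: "flags A.r (A.lay i) w = flags B.r (B.lay i) w"
  using equiv_lay by (simp add: flag_equiv_def del: flags.simps)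

lemma card_ylay:
  assumes "1 \<le> u" "u \<le> d + 1" "u < A.fx"
  shows "card (A.ylay u) = card (B.ylay u)"
proof -
  obtain i where i: "u = Suc i" using assms(1) by (cases u) auto
  have b: "i \<le> d" "Suc i < A.fx" "Suc i < B.fx" using assms i fx_eq by auto
  have "(\<Sum>p\<in>bots A.r (A.lay i). 1) = (\<Sum>p\<in>bots B.r (B.lay i). 1::nat)"
    using card_bots_lay_eq[of i] by simp
  then show ?thesis
    unfolding A.sum_bots_lay[OF b(1,2)] B.sum_bots_lay[OF b(1,3)] i by simp
qed

lemma zz_high_s: "A.fx \<le> a \<Longrightarrow> A.zz a b = B.zz a b"
proof -
  assume a: "A.fx \<le> a"
  show ?thesis
  proof (cases "b + 1 = \<tau>")
    case True
    then have "1 \<le> \<tau>" "\<tau> - 1 = b" by auto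
    then show ?thesis using T_eq[of a] A.ee_fx[OF a] B.ee_fx[of a] a fx_eq by simp
  next
    case False
    then show ?thesis by (rule zz_other)
  qed
qed

text \<open>If \<open>u \<le> k\<close>, then \<open>E u\<close> lies below the whole layer and
  \<open>flag_equiv_insert_bottom\<close> applies. Otherwise \<open>u = k + 1\<close> and
  \<open>X\<close> has rank \<open>Suc u\<close>; no antichain element of the layer is below
  \<open>X\<close>, the remaining classes agree by \<open>zz_high_s\<close>, and the two posets are
  even isomorphic.\<close>

lemma flags_insert_E_lay:
  assumes u: "1 \<le> u" "u \<le> d" "u < A.fx"
  shows "flags A.r (insert (E u) (A.lay u)) w = flags B.r (insert (E u) (B.lay u)) w"
proof (cases "u \<le> k")
  case True
  then have uk': "u \<le> k'" using k_eq by simp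
  have A: "\<forall>x\<in>A.lay u. A.r (E u) x" "\<forall>x\<in>B.lay u. B.r (E u) x"
    using A.E_below_lay[OF u(1) True] B.E_below_lay[OF u(1) uk'] by blast+
  have n: "E u \<notin> A.lay u" "E u \<notin> B.lay u" by (simp_all add: A.mem_lay B.mem_lay)
  have i: "\<not> A.r (E u) (E u)" "\<not> B.r (E u) (E u)" by (simp_all add: A.r_def B.r_def)
  have as: "\<forall>x\<in>A.lay u. \<not> A.r x (E u)" "\<forall>x\<in>B.lay u. \<not> B.r x (E u)"
    using A strict_order.asym[OF A.strict] strict_order.asym[OF B.strict] by blast+
  show ?thesis
    by (rule flag_equiv_insert_bottom[OF equiv_lay A.finite_lay B.finite_lay n(1) A(1) i(1) as(1) n(2) A(2) i(2) as(2)])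
next
  case False
  then have fx: "A.fx \<le> d + 1" using k_top u by force
  then have ufx: "A.fx = Suc u" using u False by (auto simp: A.fx_def split: if_splits)
  let ?S = "{y \<in> Ys. u < s y \<and> t y \<le> \<tau>}" and ?T = "{y \<in> Ys'. u < s' y \<and> t' y \<le> \<tau>}"
  have eA: "\<not> \<epsilon> y" if "y \<in> ?S" for y using A.eps_fx[of y] that ufx by auto
  have eB: "\<not> \<epsilon>' y" if "y \<in> ?T" for y using B.eps_fx[of y] that ufx fx_eq by auto
  have card: "card {y \<in> ?S. (s y, t y) = c} = card {y \<in> ?T. (s' y, t' y) = c}" for c
  proof -
    obtain a b where c: "c = (a, b)" by (cases c)
    show ?thesis
    proof (cases "u < a \<and> b \<le> \<tau>")
      case True
      have "{y \<in> ?S. (s y, t y) = c} = {y \<in> Ys. s y = a \<and> t y = b \<and> \<not> \<epsilon> y}"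
        using True eA unfolding c by fastforce
      moreover have "{y \<in> ?T. (s' y, t' y) = c} = {y \<in> Ys'. s' y = a \<and> t' y = b \<and> \<not> \<epsilon>' y}"
        using True eB unfolding c by fastforce
      ultimately show ?thesis
        using zz_high_s[of a b] True ufx unfolding A.zz_def B.zz_def by simp
    next
      case False
      then have "{y \<in> ?S. (s y, t y) = c} = {}" "{y \<in> ?T. (s' y, t' y) = c} = {}"
        unfolding c by blast+
      then show ?thesis by (simp only: card.empty)
    qed
  qed
  have "finite ?S" "finite ?T" using A.finY B.finY by simp_all
  then obtain h where h: "bij_betw h ?S ?T" and hs: "\<forall>y\<in>?S. (s' (h y), t' (h y)) = (s y, t y)"
    using ex_bij_betw_fibres[OF _ _ card] by blast
  let ?A = "E ` insert u {u<..d} \<union> Y ` ?S \<union> U ` {1..\<tau>} \<union> (if True then {X} else {})"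
  let ?B = "E ` insert u {u<..d} \<union> Y ` ?T \<union> U ` {1..\<tau>} \<union> (if True then {X} else {})"
  have A: "insert (E u) (A.lay u) = ?A" and B: "insert (E u) (B.lay u) = ?B"
    unfolding A.lay_eq[OF le_trans[OF u(2) le_add1]] B.lay_eq[OF le_trans[OF u(2) le_add1]] using u(3) fx_eq by (simp_all add: insert_commute)
  have bij: "bij_betw (map_pt h) (insert (E u) (A.lay u)) (insert (E u) (B.lay u))"
    unfolding A B by (rule bij_betw_map_pt[OF h])
  have AV: "insert (E u) (A.lay u) \<subseteq> A.V" and BV: "insert (E u) (B.lay u) \<subseteq> B.V"
    using A.lay_V B.lay_V u by simp_all
  show ?thesis
  proof (rule flags_bij[OF bij])
    fix x y assume xy: "x \<in> insert (E u) (A.lay u)" "y \<in> insert (E u) (A.lay u)"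
    have V: "x \<in> A.V" "y \<in> A.V" "map_pt h x \<in> B.V" "map_pt h y \<in> B.V"
      using AV BV xy bij_betwE[OF bij] by blast+
    have "mlt \<sigma> \<tau> k' s' t' \<epsilon>' (map_pt h x) (map_pt h y) \<longleftrightarrow> mlt \<sigma> \<tau> k s t \<epsilon> x y"
      unfolding k_eq
    proof (rule mlt_map_pt)
      fix z assume "Y z = x \<or> Y z = y"
      then have "Y z \<in> insert (E u) (A.lay u)" using xy by blast
      then have z: "z \<in> ?S" by (simp add: A.mem_lay)
      then have "h z \<in> ?T" using bij_betwE[OF h] by blast
      then show "s' (h z) = s z \<and> t' (h z) = t z \<and> \<epsilon>' (h z) = \<epsilon> z"
        using hs z eA[OF z] eB[of "h z"] by simp
    qed
    then show "A.r x y \<longleftrightarrow> B.r (map_pt h x) (map_pt h y)"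
      unfolding A.r_simps[OF V(1,2)] B.r_simps[OF V(3,4)] by blast
  qed
qed

text \<open>Stripping all but one minimal element of \<open>lay i\<close> gives a sum over all
  minimal elements; the summand of the lower chain is common to both models and can be
  subtracted.\<close>

lemma FM_base:
  assumes "1 \<le> \<tau>" "i \<le> d" "Suc i < A.fx"
  shows "(\<Sum>y\<in>A.ylay (Suc i). flags A.r (insert (Y y) (A.lay (Suc i))) w) =
         (\<Sum>y\<in>B.ylay (Suc i). flags B.r (insert (Y y) (B.lay (Suc i))) w)"
proof -
  have fxB: "Suc i < B.fx" using assms fx_eq by simp
  have "flags A.r (A.lay i) ((card (bots A.r (A.lay i)) - 1, True) # w) =
        flags B.r (B.lay i) ((card (bots B.r (B.lay i)) - 1, True) # w)"
    unfolding card_bots_lay_eq by (rule flags_lay_eq)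
  then show ?thesis
    unfolding flags_bots_but_one[OF A.finite_lay A.bots_lay_nonempty[OF assms(2,1)]]
      flags_bots_but_one[OF B.finite_lay B.bots_lay_nonempty[OF assms(2,1)]] A.lay_Suc B.lay_Suc
      A.sum_bots_lay[OF assms(2,3)] B.sum_bots_lay[OF assms(2) fxB]
    using flags_insert_E_lay[of "Suc i" w] assms(3) by (cases "Suc i \<le> d") (simp_all del: flags.simps)
qed

text \<open>An antichain element of rank \<open>u\<close> once put back stays minimal while further
  layers are stripped above it. Each step changes its count by an amount that does not depend on the
  element, and the number of such elements agrees.\<close>

lemma FM:
  assumes "1 \<le> \<tau>" "1 \<le> u" "u \<le> i" "i \<le> d + 1" "i < A.fx"
  shows "(\<Sum>y\<in>A.ylay u. flags A.r (insert (Y y) (A.lay i)) w) = (\<Sum>y\<in>B.ylay u. flags B.r (insert (Y y) (B.lay i)) w)"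
  using assms(3-5)
proof (induction i arbitrary: w rule: dec_induct)
  case base
  then show ?case using FM_base[of "u - 1"] assms(1,2) by simp
next
  case (step i)
  then have b: "i \<le> d" "Suc i < A.fx" "Suc i < B.fx" using fx_eq by auto
  let ?c = "card (bots B.r (B.lay i))"
  have "(\<Sum>y\<in>A.ylay u. flags A.r (insert (Y y) (A.lay i)) ((?c, True) # w)) =
    (\<Sum>y\<in>B.ylay u. flags B.r (insert (Y y) (B.lay i)) ((?c, True) # w))"
    using step.IH[of "(?c, True) # w"] b by (simp del: flags.simps)
  moreover have "(\<Sum>y\<in>A.ylay u. flags A.r (insert (Y y) (A.lay i)) ((?c, True) # w)) =
    (\<Sum>y\<in>A.ylay u. flags A.r (insert (Y y) (A.lay (Suc i))) w + flags A.r (A.lay i) ((?c - 1, True) # w))"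
    using A.flags_insert_Y_lay[OF _ step.hyps(1) b(1,2) assms(1), of _ w] card_bots_lay_eq[of i]
    by (intro sum.cong refl) (simp del: flags.simps)
  moreover have "(\<Sum>y\<in>B.ylay u. flags B.r (insert (Y y) (B.lay i)) ((?c, True) # w)) =
    (\<Sum>y\<in>B.ylay u. flags B.r (insert (Y y) (B.lay (Suc i))) w + flags B.r (B.lay i) ((?c - 1, True) # w))"
    using B.flags_insert_Y_lay[OF _ step.hyps(1) b(1,3) assms(1), of _ w]
    by (intro sum.cong refl) (simp del: flags.simps)
  moreover have "card (A.ylay u) = card (B.ylay u)"
    by (rule card_ylay) (use assms(2) step in auto)
  ultimately show ?case
    using flags_lay_eq[of i "(?c - 1, True) # w"] by (simp add: sum.distrib del: flags.simps)
qed

lemma sum_cnt_eq: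
  assumes "1 \<le> \<tau>" "1 \<le> u" "u \<le> i" "i \<le> d + 1" "i < A.fx"
  shows "(\<Sum>y\<in>A.ylay u. A.cnt i y) = (\<Sum>y\<in>B.ylay u. B.cnt i y)"
proof -
  have fxB: "i < B.fx" using assms fx_eq by simp
  let ?w = "[(card (B.lay i) - 2, False), (3, False)]"
  have "(\<Sum>y\<in>A.ylay u. flags A.r (insert (Y y) (A.lay i)) ?w) =
    (\<Sum>y\<in>A.ylay u. card (blocks (\<lambda>x y. A.r y x) (A.lay i) 3 False) + A.cnt i y)"
    using A.flags_Y_lay_filters[OF _ assms(3-5,1)] unfolding card_lay_eq by (rule sum.cong[OF refl])
  moreover have "(\<Sum>y\<in>B.ylay u. flags B.r (insert (Y y) (B.lay i)) ?w) =
    (\<Sum>y\<in>B.ylay u. card (blocks (\<lambda>x y. B.r y x) (B.lay i) 3 False) + B.cnt i y)"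
    using B.flags_Y_lay_filters[OF _ assms(3,4) fxB assms(1)] by (rule sum.cong[OF refl])
  moreover have "card (A.ylay u) = card (B.ylay u)"
    by (rule card_ylay) (use assms in auto)
  moreover note FM[OF assms, of ?w]
    flag_equiv_card_filters[OF equiv_lay[of i] A.finite_lay B.finite_lay, of 3]
  ultimately show ?thesis by (simp add: sum.distrib del: flags.simps)
qed

lemma \<zeta>_eq: "A.\<zeta> i = B.\<zeta> i"
  unfolding A.\<zeta>_def B.\<zeta>_def zz_tau_eq ..

lemma \<alpha>\<beta>_eq:
  assumes "1 \<le> \<tau>"
  shows "A.\<alpha> i + A.\<beta> i = B.\<alpha> i + B.\<beta> i"
  unfolding A.\<alpha>_def B.\<alpha>_def A.\<beta>_def B.\<beta>_def sum.distrib[symmetric] T_eq[OF assms] ..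

text \<open>The relation that goes beyond sums. In \<open>sum_cnt\<close>, the element put back
  gives a factor \<open>zz u (\<tau> - 1)\<close> or \<open>ee u \<tau>\<close>, and its partners in
  the filter give a second one. The terms with \<zeta> and the constants multiply the known sum
  \<open>zz u (\<tau> - 1) + ee u \<tau>\<close> and cancel; the rest pairs each open class with its
  own tail.\<close>

lemma weight_eq:
  assumes "1 \<le> \<tau>" "1 \<le> u" "u \<le> i" "i \<le> d + 1" "i < A.fx"
  shows "A.zz u (\<tau> - 1) * (A.\<alpha> i + of_bool (\<sigma> < \<tau>)) + A.ee u \<tau> * A.\<beta> i =
    B.zz u (\<tau> - 1) * (B.\<alpha> i + of_bool (\<sigma> < \<tau>)) + B.ee u \<tau> * B.\<beta> i"
proof -
  have fxB: "i < B.fx" using assms fx_eq by simp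
  let ?g = "of_bool (\<sigma> < \<tau>) :: nat"
  have filt: "card (A.filt i) = card (B.filt i)"
    unfolding A.filt_def B.filt_def by (rule flag_equiv_card_filters[OF equiv_lay A.finite_lay B.finite_lay])
  have z2: "A.zz u (\<tau> - 2) * of_bool (2 \<le> \<tau>) = B.zz u (\<tau> - 2) * of_bool (2 \<le> \<tau>)"
    using zz_low[of "\<tau> - 2" u] by (cases "2 \<le> \<tau>") simp_all
  have e1: "A.ee u (\<tau> - 1) = B.ee u (\<tau> - 1)" using ee_low[of "\<tau> - 1" u] assms(1) by simp
  have "A.ee u \<tau> * (B.\<zeta> i + A.\<beta> i + 1) + A.zz u (\<tau> - 1) * (A.\<alpha> i + B.\<zeta> i + 1 + ?g) =
    B.ee u \<tau> * (B.\<zeta> i + B.\<beta> i + 1) + B.zz u (\<tau> - 1) * (B.\<alpha> i + B.\<zeta> i + 1 + ?g)"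
    using sum_cnt_eq[OF assms]
    unfolding A.sum_cnt[OF assms(4,5,1)] B.sum_cnt[OF assms(4) fxB assms(1)]
      A.card_filt_U_sum[OF assms(4,5,1)] B.card_filt_U_sum[OF assms(4) fxB assms(1)]
      A.card_filt_X_sum[OF assms(4,5,1)] B.card_filt_X_sum[OF assms(4) fxB assms(1)]
      filt z2 e1 zz_tau_eq \<zeta>_eq by linarith
  moreover have "(A.zz u (\<tau> - 1) + A.ee u \<tau>) * (B.\<zeta> i + 1) = (B.zz u (\<tau> - 1) + B.ee u \<tau>) * (B.\<zeta> i + 1)"
    unfolding T_eq[OF assms(1)] ..
  ultimately show ?thesis by (simp add: algebra_simps)
qed

lemma zz_eq_imp:
  assumes "1 \<le> \<tau>" "\<And>u. A.zz u (\<tau> - 1) = B.zz u (\<tau> - 1)"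
  shows "A.zz u v = B.zz u v \<and> A.ee u v = B.ee u v"
proof -
  have "A.ee u \<tau> = B.ee u \<tau>" using T_eq[OF assms(1), of u] assms(2)[of u] by simp
  then have "A.ee u v = B.ee u v" using ee_other[of v u] by (cases "v = \<tau>") simp_all
  moreover have "A.zz u v = B.zz u v"
  proof (cases "v + 1 = \<tau>")
    case True
    then have "v = \<tau> - 1" by simp
    then show ?thesis using assms(2) by simp
  next
    case False
    then show ?thesis by (rule zz_other)
  qed
  ultimately show ?thesis by simp
qed

text \<open>With a cut beyond all antichain elements that lie below \<open>X\<close>, the tail
  \<beta> vanishes and \<alpha> agrees. \<open>weight_eq\<close> becomes linear in
  \<open>zz u (\<tau> - 1)\<close>, with a common positive factor.\<close>

lemma zz_eq_untwinned:
  assumes "1 \<le> \<tau>" "A.fx \<le> d + 1 \<or> \<sigma> < \<tau>"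
  shows "A.zz u (\<tau> - 1) = B.zz u (\<tau> - 1)"
proof -
  \<comment> \<open>The largest cut that keeps \<open>X\<close>, as long as antichain elements can
    survive it.\<close>
  define i where "i = min (d + 1) (A.fx - 1)"
  have i: "i \<le> d + 1" "i < A.fx" using A.fx_ge by (auto simp: i_def)
  have high: "A.fx \<le> v" if "i < v" "v \<le> d + 1" for v
    using that by (auto simp: i_def min_def split: if_splits)
  have \<beta>: "A.\<beta> i = 0" "B.\<beta> i = 0"
    unfolding A.\<beta>_def B.\<beta>_def using high A.ee_fx B.ee_fx fx_eq by simp_all
  then have \<alpha>: "A.\<alpha> i = B.\<alpha> i" using \<alpha>\<beta>_eq[OF assms(1), of i] by simp
  \<comment> \<open>If \<open>\<sigma> < \<tau>\<close> fails, then
    \<open>\<sigma> = \<tau> = 1\<close> and \<open>X\<close> has rank at most \<open>d + 1\<close>.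
    The antichain element of \<open>ex_y0\<close> with \<open>s y = d + 1\<close> and
    \<open>t y = 0\<close> cannot be below \<open>X\<close> and is counted by \<alpha>.\<close>
  have pos: "B.\<alpha> i + of_bool (\<sigma> < \<tau>) > 0"
  proof (cases "\<sigma> < \<tau>")
    case False
    then have fx: "A.fx \<le> d + 1" using assms(2) by simp
    then have "\<sigma> = 1" using A.sigma_ge by (auto simp: A.fx_def split: if_splits)
    then have tau: "\<tau> = 1" using False assms(1) by simp
    obtain y where y: "y \<in> Ys" "s y = d + 1" "t y = 0" using A.ex_y0 tau by auto
    then have "\<not> \<epsilon> y" using A.eps_fx[of y] fx by auto
    then have "{y} \<subseteq> {y \<in> Ys. s y = d + 1 \<and> t y = \<tau> - 1 \<and> \<not> \<epsilon> y}" using y tau by simp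
    then have "card {y} \<le> A.zz (d + 1) (\<tau> - 1)"
      unfolding A.zz_def by (rule card_mono[rotated]) (use A.finY in simp)
    also have "\<dots> \<le> A.\<alpha> i"
      unfolding A.\<alpha>_def by (rule member_le_sum) (use fx A.fx_ge in \<open>auto simp: i_def\<close>)
    finally show ?thesis using \<alpha> by simp
  qed simp
  show ?thesis
  proof (cases "1 \<le> u \<and> u \<le> i")
    case True
    then have "A.zz u (\<tau> - 1) * (B.\<alpha> i + of_bool (\<sigma> < \<tau>)) = B.zz u (\<tau> - 1) * (B.\<alpha> i + of_bool (\<sigma> < \<tau>))"
      using weight_eq[OF assms(1), of u i] i unfolding \<beta> \<alpha> by simp
    then show ?thesis using pos by auto
  next
    case False
    show ?thesis
    proof (cases "u = 0 \<or> d + 1 < u")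
      case True
      then show ?thesis using A.zz_ee_s B.zz_ee_s by simp
    next
      case in_range: False
      then have "A.fx \<le> u" using False high[of u] by auto
      then show ?thesis by (rule zz_high_s)
    qed
  qed
qed

end


section \<open>The symmetric case: \<open>X\<close> and \<open>U \<tau>\<close> as twins\<close>

context model
begin

text \<open>For \<open>\<sigma> = \<tau>\<close> an antichain element not below \<open>X\<close> has
  \<open>t y \<ge> \<tau> - 1\<close>. The counts of \<open>U \<tau>\<close> and \<open>X\<close>
  thus have a common part and differ by exchanging \<alpha> and \<beta>.\<close>

lemma dd_pair_twin:
  assumes "1 \<le> \<tau>" "\<sigma> = \<tau>" "k = d" "i \<le> d + 1"
  shows "dd i (U \<tau>) = (d - i) + (\<Sum>u\<in>{i<..d + 1}. \<Sum>v<\<tau>. ee u v) + (\<tau> - 1) + \<alpha> i"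
    and "dd i X = (d - i) + (\<Sum>u\<in>{i<..d + 1}. \<Sum>v<\<tau>. ee u v) + (\<tau> - 1) + \<beta> i"
proof -
  have "(\<Sum>v<\<tau>. zz u v) = zz u (\<tau> - 1)" for u
  proof -
    have "zz u v = 0" if "v \<in> {..<\<tau>} - {\<tau> - 1}" for v
    proof -
      have "\<not> (t y = v \<and> \<not> \<epsilon> y)" if "y \<in> Ys" for y
      proof
        assume a: "t y = v \<and> \<not> \<epsilon> y"
        have "\<tau> \<le> v + 1" using not_eps[OF that] a assms(2) by simp
        moreover have "v < \<tau>" "v \<noteq> \<tau> - 1" using \<open>v \<in> {..<\<tau>} - {\<tau> - 1}\<close> by simp_all
        ultimately show False by linarith
      qed
      then have "{y \<in> Ys. s y = u \<and> t y = v \<and> \<not> \<epsilon> y} = {}" by blast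
      then show ?thesis by (simp only: zz_def card.empty)
    qed
    then have "(\<Sum>v\<in>{..<\<tau>} - {\<tau> - 1}. zz u v) = 0" by simp
    moreover have "(\<Sum>v<\<tau>. zz u v) = zz u (\<tau> - 1) + (\<Sum>v\<in>{..<\<tau>} - {\<tau> - 1}. zz u v)"
      by (rule sum.remove) (use assms(1) in auto)
    ultimately show ?thesis by simp
  qed
  then show "dd i (U \<tau>) = (d - i) + (\<Sum>u\<in>{i<..d + 1}. \<Sum>v<\<tau>. ee u v) + (\<tau> - 1) + \<alpha> i"
    unfolding dd_U[OF assms(1,4)] card_t_split_eps \<alpha>_def sum.distrib by simp
  show "dd i X = (d - i) + (\<Sum>u\<in>{i<..d + 1}. \<Sum>v<\<tau>. ee u v) + (\<tau> - 1) + \<beta> i"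
    unfolding dd_X[OF assms(4)] card_t_split_eps \<beta>_def sum.lessThan_Suc sum.distrib using assms(2,3) by simp
qed

end

context two_models
begin

text \<open>The sum of squares of \<open>dd i\<close> over the row of \<open>X\<close> belongs to
  the flag data. As the antichain elements of the row contribute equally, the second moment of the
  pair \<open>U \<tau>\<close>, \<open>X\<close> is known; so is its sum, hence the square of its
  difference.\<close>

lemma twin_square:
  assumes "1 \<le> \<tau>" "\<sigma> = \<tau>" "d + 1 < A.fx" "i \<le> d + 1"
  shows "(int (A.\<alpha> i) - int (A.\<beta> i))\<^sup>2 = (int (B.\<alpha> i) - int (B.\<beta> i))\<^sup>2"
proof -
  have k: "k = d" "k' = d" using k_top[OF assms(3)] k_eq by simp_all
  have fx: "i < A.fx" "i < B.fx" using assms fx_eq by simp_all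
  define P where "P = (d - i) + (\<Sum>u\<in>{i<..d + 1}. \<Sum>v<\<tau>. A.ee u v) + (\<tau> - 1)"
  have "(\<Sum>v<\<tau>. A.ee u v) = (\<Sum>v<\<tau>. B.ee u v)" for u
    by (rule sum.cong[OF refl], rule ee_low) simp
  then have P: "P = (d - i) + (\<Sum>u\<in>{i<..d + 1}. \<Sum>v<\<tau>. B.ee u v) + (\<tau> - 1)" by (simp add: P_def)
  have A: "A.dd i (U \<tau>) = P + A.\<alpha> i" "A.dd i X = P + A.\<beta> i"
    unfolding P_def by (rule A.dd_pair_twin[OF assms(1,2) k(1) assms(4)])+
  have B: "B.dd i (U \<tau>) = P + B.\<alpha> i" "B.dd i X = P + B.\<beta> i"
    unfolding P by (rule B.dd_pair_twin[OF assms(1,2) k(2) assms(4)])+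
  have sq: "(P + A.\<alpha> i)\<^sup>2 + (P + A.\<beta> i)\<^sup>2 = (P + B.\<alpha> i)\<^sup>2 + (P + B.\<beta> i)\<^sup>2"
    using sum_row_eq[OF assms(4), of "\<lambda>c. c\<^sup>2"]
    unfolding A.sum_row[OF assms(4), where h = "\<lambda>c. c\<^sup>2"] B.sum_row[OF assms(4), where h = "\<lambda>c. c\<^sup>2"]
      A.sum_zz_weight[where h = "\<lambda>c. c\<^sup>2"] B.sum_zz_weight[where h = "\<lambda>c. c\<^sup>2"] zz_tau_eq
      if_P[OF assms(1)] if_P[OF fx(1)] if_P[OF fx(2)] A B by linarith
  let ?a = "int (A.\<alpha> i)" and ?b = "int (A.\<beta> i)" and ?a' = "int (B.\<alpha> i)" and ?b' = "int (B.\<beta> i)"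
  have "int ((P + A.\<alpha> i)\<^sup>2 + (P + A.\<beta> i)\<^sup>2) = int ((P + B.\<alpha> i)\<^sup>2 + (P + B.\<beta> i)\<^sup>2)" unfolding sq ..
  then have 1: "(int P + ?a)\<^sup>2 + (int P + ?b)\<^sup>2 = (int P + ?a')\<^sup>2 + (int P + ?b')\<^sup>2" by simp
  have ab: "?b' = ?a + ?b - ?a'" using \<alpha>\<beta>_eq[OF assms(1), of i] by linarith
  \<comment> \<open>An instance of \<open>(a - b)^2 = 2 * (a^2 + b^2) - (a + b)^2\<close>; the shift
    by \<open>P\<close> cancels because \<open>?a + ?b = ?a' + ?b'\<close>.\<close>
  have "(?a - ?b)\<^sup>2 - (?a' - ?b')\<^sup>2 =
    2 * ((int P + ?a)\<^sup>2 + (int P + ?b)\<^sup>2 - ((int P + ?a')\<^sup>2 + (int P + ?b')\<^sup>2))"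
    unfolding ab by (simp add: power2_eq_square algebra_simps)
  then show ?thesis using 1 by simp
qed

text \<open>For the differences \<open>zz u (\<tau> - 1) - ee u \<tau>\<close>,
  \<open>weight_eq\<close> gives the products with tails and \<open>twin_square\<close> the squares
  of tails, so they agree up to one common sign. With the known sums, the negative sign means that
  the two classes are exchanged at every rank.\<close>

lemma twin:
  assumes "1 \<le> \<tau>" "\<sigma> = \<tau>" "d + 1 < A.fx"
  shows "(\<forall>u. A.zz u (\<tau> - 1) = B.zz u (\<tau> - 1)) \<or>
    (\<forall>u. A.zz u (\<tau> - 1) = B.ee u \<tau> \<and> A.ee u \<tau> = B.zz u (\<tau> - 1))"
proof -
  define \<delta> \<delta>' where "\<delta> u = int (A.zz u (\<tau> - 1)) - int (A.ee u \<tau>)"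
    and "\<delta>' u = int (B.zz u (\<tau> - 1)) - int (B.ee u \<tau>)" for u
  have sums: "(\<Sum>u\<in>{i<..d + 1}. \<delta> u) = int (A.\<alpha> i) - int (A.\<beta> i)"
    "(\<Sum>u\<in>{i<..d + 1}. \<delta>' u) = int (B.\<alpha> i) - int (B.\<beta> i)" for i
    unfolding \<delta>_def \<delta>'_def A.\<alpha>_def A.\<beta>_def B.\<alpha>_def B.\<beta>_def by (simp_all add: sum_subtractf)
  have prod: "\<delta> u * (\<Sum>u\<in>{i<..d + 1}. \<delta> u) = \<delta>' u * (\<Sum>u\<in>{i<..d + 1}. \<delta>' u)"
    if u: "1 \<le> u" "u \<le> i" "i \<le> d + 1" for u i
  proof -
    define a b p q a' b' p' q' where d: "a = int (A.zz u (\<tau> - 1))" "b = int (A.ee u \<tau>)" "p = int (A.\<alpha> i)" "q = int (A.\<beta> i)"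
      "a' = int (B.zz u (\<tau> - 1))" "b' = int (B.ee u \<tau>)" "p' = int (B.\<alpha> i)" "q' = int (B.\<beta> i)"
    have "A.zz u (\<tau> - 1) * A.\<alpha> i + A.ee u \<tau> * A.\<beta> i = B.zz u (\<tau> - 1) * B.\<alpha> i + B.ee u \<tau> * B.\<beta> i"
      using weight_eq[OF assms(1) u] u assms(2,3) by simp
    then have 1: "a * p + b * q = a' * p' + b' * q'"
      unfolding d of_nat_mult[symmetric] of_nat_add[symmetric] by simp
    have 2: "a + b = a' + b'" "p + q = p' + q'"
      using T_eq[OF assms(1), of u] \<alpha>\<beta>_eq[OF assms(1), of i] unfolding d by linarith+
    \<comment> \<open>Polarisation: the sums \<open>a + b\<close> and \<open>p + q\<close> agree, so
      the mixed expression \<open>a * p + b * q\<close> determines the product of the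
      differences.\<close>
    have "(a - b) * (p - q) = 2 * (a * p + b * q) - (a + b) * (p + q)" by (simp add: algebra_simps)
    also have "\<dots> = 2 * (a' * p' + b' * q') - (a' + b') * (p' + q')" unfolding 1 2 ..
    also have "\<dots> = (a' - b') * (p' - q')" by (simp add: algebra_simps)
    finally show ?thesis unfolding sums unfolding \<delta>_def \<delta>'_def d .
  qed
  have sq: "(\<Sum>u\<in>{i<..d + 1}. \<delta> u)\<^sup>2 = (\<Sum>u\<in>{i<..d + 1}. \<delta>' u)\<^sup>2" if "i \<le> d + 1" for i
    unfolding sums by (rule twin_square[OF assms that])
  have out: "A.zz u v = 0 \<and> A.ee u v = 0 \<and> B.zz u v = 0 \<and> B.ee u v = 0" if "u \<notin> {1..d + 1}" for u v
    using A.zz_ee_s[of u v] B.zz_ee_s[of u v] that by auto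
  have "(\<forall>u\<in>{1..d + 1}. \<delta> u = \<delta>' u) \<or> (\<forall>u\<in>{1..d + 1}. \<delta> u = - \<delta>' u)"
    using prod sq by (rule eq_or_opposite_of_tails)
  then show ?thesis
  proof
    assume eq: "\<forall>u\<in>{1..d + 1}. \<delta> u = \<delta>' u"
    have "A.zz u (\<tau> - 1) = B.zz u (\<tau> - 1)" for u
    proof (cases "u \<in> {1..d + 1}")
      case True
      then have "\<delta> u = \<delta>' u" using eq by blast
      then show ?thesis using T_eq[OF assms(1), of u] unfolding \<delta>_def \<delta>'_def by linarith
    qed (use out in simp)
    then show ?thesis by blast
  next
    assume eq: "\<forall>u\<in>{1..d + 1}. \<delta> u = - \<delta>' u"
    have "A.zz u (\<tau> - 1) = B.ee u \<tau> \<and> A.ee u \<tau> = B.zz u (\<tau> - 1)" for u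
    proof (cases "u \<in> {1..d + 1}")
      case True
      then have "\<delta> u = - \<delta>' u" using eq by blast
      then show ?thesis using T_eq[OF assms(1), of u] unfolding \<delta>_def \<delta>'_def by linarith
    qed (use out in simp)
    then show ?thesis by blast
  qed
qed

lemma comparison:
  "(\<forall>u v. A.zz u v = B.zz u v \<and> A.ee u v = B.ee u v) \<or>
   1 \<le> \<tau> \<and> \<sigma> = \<tau> \<and> k = d \<and> (\<forall>u. A.zz u (\<tau> - 1) = B.ee u \<tau> \<and> A.ee u \<tau> = B.zz u (\<tau> - 1))"
proof (cases "\<tau> = 0")
  case True
  then show ?thesis using ee_tau0 zz_other by simp
next
  case False
  then have tau: "1 \<le> \<tau>" by simp
  show ?thesis
  proof (cases "A.fx \<le> d + 1 \<or> \<sigma> < \<tau>")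
    case True
    then show ?thesis using zz_eq_imp[OF tau zz_eq_untwinned[OF tau True]] by blast
  next
    case False
    then have "\<sigma> = \<tau>" "d + 1 < A.fx" using A.sigma_tau tau by auto
    from twin[OF tau this] show ?thesis
    proof
      assume "\<forall>u. A.zz u (\<tau> - 1) = B.zz u (\<tau> - 1)"
      then show ?thesis using zz_eq_imp[OF tau] by simp
    next
      assume "\<forall>u. A.zz u (\<tau> - 1) = B.ee u \<tau> \<and> A.ee u \<tau> = B.zz u (\<tau> - 1)"
      then show ?thesis using tau \<open>\<sigma> = \<tau>\<close> k_top[OF \<open>d + 1 < A.fx\<close>] by simp
    qed
  qed
qed

section \<open>Isomorphisms between models\<close>

lemma V_map:
  assumes "bij_betw h Ys Ys'"
  shows "bij_betw (map_pt h) A.V B.V"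
proof -
  have V: "A.V = E ` {1..d} \<union> Y ` Ys \<union> U ` {1..m} \<union> (if True then {X} else {})"
    "B.V = E ` {1..d} \<union> Y ` Ys' \<union> U ` {1..m} \<union> (if True then {X} else {})"
    unfolding A.V_def B.V_def by simp_all
  show ?thesis unfolding V by (rule bij_betw_map_pt[OF assms])
qed

lemma iso_plain:
  assumes eq: "\<And>u v. A.zz u v = B.zz u v \<and> A.ee u v = B.ee u v"
  shows "\<exists>f. bij_betw f A.V B.V \<and> (\<forall>x\<in>A.V. \<forall>y\<in>A.V. A.r x y \<longleftrightarrow> B.r (f x) (f y))"
proof -
  have card: "card {y \<in> Ys. (s y, t y, \<epsilon> y) = c} = card {y \<in> Ys'. (s' y, t' y, \<epsilon>' y) = c}" for c
  proof -
    obtain u v b where c: "c = (u, v, b)" by (cases c)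
    show ?thesis using eq[of u v] unfolding A.zz_def B.zz_def A.ee_def B.ee_def c by (cases b) simp_all
  qed
  obtain h where h: "bij_betw h Ys Ys'" "\<forall>y\<in>Ys. (s' (h y), t' (h y), \<epsilon>' (h y)) = (s y, t y, \<epsilon> y)"
    using ex_bij_betw_fibres[OF A.finY B.finY card] by blast
  note bij = V_map[OF h(1)]
  have "A.r x y \<longleftrightarrow> B.r (map_pt h x) (map_pt h y)" if xy: "x \<in> A.V" "y \<in> A.V" for x y
  proof -
    have V: "map_pt h x \<in> B.V" "map_pt h y \<in> B.V" using xy bij_betwE[OF bij] by blast+
    have "mlt \<sigma> \<tau> k' s' t' \<epsilon>' (map_pt h x) (map_pt h y) \<longleftrightarrow> mlt \<sigma> \<tau> k s t \<epsilon> x y"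
      unfolding k_eq
    proof (rule mlt_map_pt)
      fix z assume "Y z = x \<or> Y z = y"
      then have "Y z \<in> A.V" using xy by blast
      then show "s' (h z) = s z \<and> t' (h z) = t z \<and> \<epsilon>' (h z) = \<epsilon> z" using h(2) by simp
    qed
    then show ?thesis unfolding A.r_simps[OF xy] B.r_simps[OF V] by blast
  qed
  then show ?thesis using bij by blast
qed

text \<open>The twins have the same relations to both chains. Exchanging them turns an antichain
  element with \<open>t y = \<tau> - 1\<close> not below \<open>X\<close> into one with
  \<open>t y = \<tau>\<close> below \<open>X\<close>, and conversely, while every other class keeps
  its coordinates. The isomorphism composes this transposition with a bijection of
  antichains.\<close>

lemma iso_twin:
  assumes tau: "1 \<le> \<tau>" and st: "\<sigma> = \<tau>" and kd: "k = d"
    and eq: "\<And>u. A.zz u (\<tau> - 1) = B.ee u \<tau> \<and> A.ee u \<tau> = B.zz u (\<tau> - 1)"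
  shows "\<exists>f. bij_betw f A.V B.V \<and> (\<forall>x\<in>A.V. \<forall>y\<in>A.V. A.r x y \<longleftrightarrow> B.r (f x) (f y))"
proof -
  \<comment> \<open>The coordinates of \<open>y\<close> after the exchange of \<open>X\<close> and
    \<open>U \<tau>\<close>.\<close>
  define g where "g y = (if t y = \<tau> - 1 \<and> \<not> \<epsilon> y then (s y, \<tau>, True)
    else if t y = \<tau> \<and> \<epsilon> y then (s y, \<tau> - 1, False) else (s y, t y, \<epsilon> y))" for y
  have ne: "\<tau> \<noteq> \<tau> - 1" "\<tau> - 1 \<noteq> \<tau>" using tau by simp_all
  have card: "card {y \<in> Ys. g y = c} = card {y \<in> Ys'. (s' y, t' y, \<epsilon>' y) = c}" for c
  proof -
    obtain u v b where c: "c = (u, v, b)" by (cases c)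
    have B: "card {y \<in> Ys'. (s' y, t' y, \<epsilon>' y) = c} = (if b then B.ee u v else B.zz u v)"
      unfolding B.zz_def B.ee_def c by (cases b) simp_all
    have gT: "g y = (u, v, True) \<longleftrightarrow> s y = u \<and> (if v = \<tau> then t y = \<tau> - 1 \<and> \<not> \<epsilon> y else t y = v \<and> \<epsilon> y)" for y
      using ne unfolding g_def by (cases "v = \<tau>") auto
    have gF: "g y = (u, v, False) \<longleftrightarrow> s y = u \<and> (if v = \<tau> - 1 then t y = \<tau> \<and> \<epsilon> y else t y = v \<and> \<not> \<epsilon> y)" for y
      using ne unfolding g_def by (cases "v = \<tau> - 1") auto
    have "card {y \<in> Ys. g y = (u, v, True)} = (if v = \<tau> then A.zz u (\<tau> - 1) else A.ee u v)"
      unfolding gT A.zz_def A.ee_def by (cases "v = \<tau>") simp_all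
    moreover have "card {y \<in> Ys. g y = (u, v, False)} = (if v = \<tau> - 1 then A.ee u \<tau> else A.zz u v)"
      unfolding gF A.zz_def A.ee_def by (cases "v = \<tau> - 1") simp_all
    moreover have "A.ee u v = B.ee u v" if "v \<noteq> \<tau>" using ee_other[OF that] .
    moreover have "A.zz u v = B.zz u v" if "v \<noteq> \<tau> - 1" using zz_other[of v u] that tau by auto
    ultimately show ?thesis unfolding B using eq[of u] unfolding c by (cases b) auto
  qed
  obtain h where h: "bij_betw h Ys Ys'" "\<forall>y\<in>Ys. (s' (h y), t' (h y), \<epsilon>' (h y)) = g y"
    using ex_bij_betw_fibres[OF A.finY B.finY card] by blast
  define w :: "'z pt \<Rightarrow> 'z pt" where "w p = (if p = X then U \<tau> else if p = U \<tau> then X else p)" for p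
  have wV: "w p \<in> B.V" if "p \<in> B.V" for p
    using that tau A.tau_le by (auto simp: w_def)
  have ww: "w (w p) = p" for p by (simp add: w_def)
  have wbij: "bij_betw w B.V B.V"
    by (rule bij_betw_byWitness[where f' = w]) (use ww wV in auto)
  have bij: "bij_betw (w \<circ> map_pt h) A.V B.V"
    by (rule bij_betw_trans[OF V_map[OF h(1)] wbij])
  have "A.r x y \<longleftrightarrow> B.r ((w \<circ> map_pt h) x) ((w \<circ> map_pt h) y)" if xy: "x \<in> A.V" "y \<in> A.V" for x y
  proof -
    have V: "(w \<circ> map_pt h) x \<in> B.V" "(w \<circ> map_pt h) y \<in> B.V" using xy bij_betwE[OF bij] by blast+
    have hy: "s' (h z) = s z" "t' (h z) = (if t z = \<tau> - 1 \<and> \<not> \<epsilon> z then \<tau> else if t z = \<tau> \<and> \<epsilon> z then \<tau> - 1 else t z)"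
      "\<epsilon>' (h z) = (if t z = \<tau> - 1 \<and> \<not> \<epsilon> z then True else if t z = \<tau> \<and> \<epsilon> z then False else \<epsilon> z)"
      "\<not> \<epsilon> z \<Longrightarrow> \<tau> \<le> t z + 1" "\<epsilon> z \<Longrightarrow> t z \<le> \<tau>" if "z \<in> Ys" for z
      using h(2) that A.not_eps[of z] A.eps_t[of z] st by (auto simp: g_def split: if_splits)
    have "mlt \<sigma> \<tau> k' s' t' \<epsilon>' ((w \<circ> map_pt h) x) ((w \<circ> map_pt h) y) \<longleftrightarrow> mlt \<sigma> \<tau> k s t \<epsilon> x y"
      using xy(1)
    proof (cases rule: A.V_cases)
      case (1 i)
      note xE = this
      show ?thesis
        using xy(2) by (cases rule: A.V_cases) (use xE kd k_eq hy in \<open>auto simp: w_def\<close>)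
    next
      case (2 z)
      note xY = this
      show ?thesis
        using xy(2)
      proof (cases rule: A.V_cases)
        case (3 j)
        show ?thesis
        proof (cases "j = \<tau>")
          case True
          then show ?thesis using xY 3 hy(2-5)[OF xY(2)] tau by (auto simp: w_def)
        next
          case False
          then show ?thesis using xY 3 hy(2-5)[OF xY(2)] tau by (auto simp: w_def)
        qed
      next
        case 4
        then show ?thesis using xY hy(2-5)[OF xY(2)] tau by (auto simp: w_def)
      qed (use xY in \<open>simp_all add: w_def\<close>)
    next
      case (3 j)
      note xU = this
      show ?thesis
        using xy(2) by (cases rule: A.V_cases) (use xU st in \<open>auto simp: w_def\<close>)
    next
      case 4
      note xX = this
      show ?thesis
        using xy(2) by (cases rule: A.V_cases) (use xX st in \<open>auto simp: w_def\<close>)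
    qed
    then show ?thesis unfolding A.r_simps[OF xy] B.r_simps[OF V] by blast
  qed
  then show ?thesis using bij by blast
qed

theorem iso: "\<exists>f. bij_betw f A.V B.V \<and> (\<forall>x\<in>A.V. \<forall>y\<in>A.V. A.r x y \<longleftrightarrow> B.r (f x) (f y))"
  using comparison
proof
  assume "\<forall>u v. A.zz u v = B.zz u v \<and> A.ee u v = B.ee u v"
  then have "A.zz u v = B.zz u v \<and> A.ee u v = B.ee u v" for u v by blast
  then show ?thesis by (rule iso_plain)
next
  assume tw: "1 \<le> \<tau> \<and> \<sigma> = \<tau> \<and> k = d \<and> (\<forall>u. A.zz u (\<tau> - 1) = B.ee u \<tau> \<and> A.ee u \<tau> = B.zz u (\<tau> - 1))"
  then have "A.zz u (\<tau> - 1) = B.ee u \<tau> \<and> A.ee u \<tau> = B.zz u (\<tau> - 1)" for u by blast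
  moreover from tw have "1 \<le> \<tau>" "\<sigma> = \<tau>" "k = d" by blast+
  ultimately show ?thesis using iso_twin by blast
qed

end


section \<open>Coordinates for a poset of nearly hook shape\<close>

lemma ex_initial_segment:
  fixes n :: nat
  assumes "\<And>i j. 1 \<le> i \<Longrightarrow> i \<le> j \<Longrightarrow> j \<le> n \<Longrightarrow> Q j \<Longrightarrow> Q i"
  shows "\<exists>c\<le>n. \<forall>i\<in>{1..n}. Q i \<longleftrightarrow> i \<le> c"
  using assms
proof (induction n)
  case (Suc n)
  show ?case
  proof (cases "Q (Suc n)")
    case True
    then have "Q i \<longleftrightarrow> i \<le> Suc n" if "i \<in> {1..Suc n}" for i
      using Suc.prems[of i "Suc n"] that by auto
    then show ?thesis by blast
  next
    case False
    have "\<exists>c\<le>n. \<forall>i\<in>{1..n}. Q i \<longleftrightarrow> i \<le> c"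
    proof (rule Suc.IH)
      fix i j :: nat assume "1 \<le> i" "i \<le> j" "j \<le> n" "Q j"
      then show "Q i" using Suc.prems[of i j] by simp
    qed
    then obtain c where c: "c \<le> n" "\<forall>i\<in>{1..n}. Q i \<longleftrightarrow> i \<le> c" by blast
    then have "Q i \<longleftrightarrow> i \<le> c" if "i \<in> {1..Suc n}" for i
      using that False by (cases "i = Suc n") auto
    then show ?thesis using c(1) le_SucI by blast
  qed
qed simp

lemma ex_final_segment:
  fixes n :: nat
  assumes "\<And>i j. 1 \<le> i \<Longrightarrow> i \<le> j \<Longrightarrow> j \<le> n \<Longrightarrow> Q i \<Longrightarrow> Q j"
  shows "\<exists>c\<le>n. \<forall>i\<in>{1..n}. Q i \<longleftrightarrow> c < i"
proof -
  have "\<exists>c\<le>n. \<forall>i\<in>{1..n}. \<not> Q i \<longleftrightarrow> i \<le> c"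
    by (rule ex_initial_segment) (use assms in blast)
  then show ?thesis by (metis not_le)
qed

text \<open>The equation \<open>card W = l + card A\<close> is how the nearly hook shape enters:
  outside the antichain there are exactly as many elements as in a longest chain.\<close>

locale lowest_antichain = strict_order r for r :: "'a \<Rightarrow> 'a \<Rightarrow> bool" +
  fixes W A :: "'a set" and l :: nat
  assumes fin: "finite W" and low: "lowest r W A" and len: "longest_chain r W l" and len_pos: "1 \<le> l"
    and card_W: "card W = l + card A"
begin

abbreviation "D \<equiv> below r W A"
abbreviation "H \<equiv> above r W A"

lemma maxA: "max_antichain r W A"
  using low by (simp add: lowest_def)

lemma unrel: "a \<in> A \<Longrightarrow> b \<in> A \<Longrightarrow> \<not> r a b"
  using maxA by (auto simp: max_antichain_def unrelated_def)

lemma A_sub: "A \<subseteq> W"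
  using maxA by (simp add: max_antichain_def)

lemma finA [simp]: "finite A"
  using A_sub fin finite_subset by blast

lemma split: "W = D \<union> A \<union> H" "D \<inter> H = {}" "D \<inter> A = {}" "H \<inter> A = {}"
proof -
  have u: "unrelated r A" using maxA by (simp add: max_antichain_def)
  show "W = D \<union> A \<union> H" by (rule max_antichain_split[OF maxA fin])
  show "D \<inter> H = {}" "D \<inter> A = {}" "H \<inter> A = {}" by (rule unrelated_below_above[OF u])+
qed

lemma cases_W: "p \<in> W \<Longrightarrow> p \<in> D \<or> p \<in> A \<or> p \<in> H"
proof -
  assume "p \<in> W"
  then have "p \<in> D \<union> A \<union> H" unfolding split(1)[symmetric] .
  then show ?thesis by blast
qed

lemma finDH [simp]: "finite D" "finite H"
  using fin by simp_all

lemma cardDH: "card D + card H = l"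
proof -
  have "card (D \<union> A \<union> H) = card (D \<union> A) + card H"
    by (rule card_Un_disjoint) (use split(2-4) in auto)
  also have "card (D \<union> A) = card D + card A"
    by (rule card_Un_disjoint) (use split(2-4) in auto)
  finally show ?thesis using card_W unfolding split(1)[symmetric] by simp
qed

lemma D_down: "p \<in> D \<Longrightarrow> q \<in> W \<Longrightarrow> r q p \<Longrightarrow> q \<in> D"
proof -
  assume p: "p \<in> D" "q \<in> W" "r q p"
  then obtain a where "a \<in> A" "r p a" by (auto simp: below_def)
  then show "q \<in> D" using p local.trans[of q p a] by (auto simp: below_def)
qed

lemma H_up: "p \<in> H \<Longrightarrow> q \<in> W \<Longrightarrow> r p q \<Longrightarrow> q \<in> H"
proof -
  assume p: "p \<in> H" "q \<in> W" "r p q"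
  then obtain a where "a \<in> A" "r a p" by (auto simp: above_def)
  then show "q \<in> H" using p local.trans[of a p q] by (auto simp: above_def)
qed

lemma below_A: "a \<in> A \<Longrightarrow> q \<in> W \<Longrightarrow> r q a \<Longrightarrow> q \<in> D"
  unfolding below_def by blast

lemma above_A: "a \<in> A \<Longrightarrow> q \<in> W \<Longrightarrow> r a q \<Longrightarrow> q \<in> H"
  unfolding above_def by blast

lemma not_down:
  "p \<in> D \<Longrightarrow> q \<in> A \<Longrightarrow> \<not> r q p" "p \<in> D \<Longrightarrow> q \<in> H \<Longrightarrow> \<not> r q p" "p \<in> A \<Longrightarrow> q \<in> H \<Longrightarrow> \<not> r q p"
proof -
  have W: "D \<subseteq> W" "H \<subseteq> W" by (auto simp: below_def above_def)
  show "\<not> r q p" if "p \<in> D" "q \<in> A" using D_down[of p q] that split(2-4) A_sub by blast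
  show "\<not> r q p" if "p \<in> D" "q \<in> H" using D_down[of p q] that split(2-4) W by blast
  show "\<not> r q p" if "p \<in> A" "q \<in> H" using below_A[of p q] that split(2-4) W by blast
qed

lemma chain_le: "chain_in r W Z \<Longrightarrow> card Z \<le> l"
  using len by (simp add: longest_chain_def)

text \<open>If \<open>y\<close> were the only element of \<open>A\<close> above \<open>e\<close>,
  replacing \<open>y\<close> by \<open>e\<close> would give another maximum antichain, with fewer
  elements below it.\<close>

lemma two_above:
  assumes e: "e \<in> D"
  shows "\<exists>y\<in>A. \<exists>y'\<in>A. y \<noteq> y' \<and> r e y \<and> r e y'"
proof (rule ccontr)
  assume no: "\<not> ?thesis"
  obtain y where y: "y \<in> A" "r e y" using e by (auto simp: below_def)
  then have only: "a = y" if "a \<in> A" "r e a" for a using no that by blast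
  let ?B = "insert e (A - {y})"
  have eW: "e \<in> W" "e \<notin> A" using e split(3) by (simp add: below_def, blast)
  have "unrelated r ?B"
    unfolding unrelated_def using unrel irrefl only not_down(1)[OF e] by blast
  moreover have "card ?B = Suc (card (A - {y}))" by (rule card_insert_disjoint) (use eW in simp_all)
  then have "card ?B = card A" unfolding card_Suc_Diff1[OF finA y(1)] .
  moreover have "?B \<subseteq> W" using eW A_sub by blast
  ultimately have "max_antichain r W ?B" using maxA by (simp add: max_antichain_def)
  then have "card D \<le> card (below r W ?B)" using low by (simp add: lowest_def)
  moreover have "below r W ?B \<subseteq> D - {e}"
  proof
    fix p assume "p \<in> below r W ?B"
    then obtain b where b: "p \<in> W" "b \<in> ?B" "r p b" by (auto simp: below_def)
    then have "p \<in> D" using D_down[OF e] below_A by blast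
    moreover have "p \<noteq> e" using b only irrefl by blast
    ultimately show "p \<in> D - {e}" by blast
  qed
  then have "card (below r W ?B) \<le> card (D - {e})" by (rule card_mono[rotated]) simp
  moreover have "card (D - {e}) < card D" by (rule card_Diff1_less) (use e in simp_all)
  ultimately show False by simp
qed

text \<open>\<open>D\<close>, \<open>y\<close> and \<open>H\<close> would form a chain with
  \<open>l + 1\<close> elements. This is the source of all conditions that exclude degenerate
  positions of the extra element.\<close>

lemma no_long_chain:
  assumes "y \<in> A" "\<forall>p\<in>D. r p y" "\<forall>p\<in>H. r y p"
    and D: "\<forall>p\<in>D. \<forall>q\<in>D. p \<noteq> q \<longrightarrow> r p q \<or> r q p" and H: "\<forall>p\<in>H. \<forall>q\<in>H. p \<noteq> q \<longrightarrow> r p q \<or> r q p"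
  shows False
proof -
  have DH: "r p q" if "p \<in> D" "q \<in> H" for p q using assms(2,3) that local.trans by blast
  have "chain_in r W (insert y (D \<union> H))"
    unfolding chain_in_def
  proof (intro conjI ballI impI)
    show "insert y (D \<union> H) \<subseteq> W" using assms(1) A_sub by (auto simp: below_def above_def)
    fix p q assume "p \<in> insert y (D \<union> H)" "q \<in> insert y (D \<union> H)" "p \<noteq> q"
    then show "r p q \<or> r q p" using assms(2,3) D H DH by blast
  qed
  then have "card (insert y (D \<union> H)) \<le> l" by (rule chain_le)
  moreover have "card (D \<union> H) = l" using cardDH split(2) by (simp add: card_Un_disjoint)
  moreover have "y \<notin> D \<union> H" using assms(1) split(2-4) by blast
  ultimately show False by simp
qed

text \<open>A longest chain that contains \<open>D\<close> has \<open>card H\<close> further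
  elements, at most one of them in \<open>A\<close>. If it avoids \<open>A\<close>, it contains
  \<open>H\<close>, and the bottom of \<open>H\<close> is taken as the extra element; if it meets
  \<open>A\<close>, it misses exactly one element of \<open>H\<close>.\<close>

lemma special_element:
  assumes C: "chain_in r W C" "card C = l" "D \<subseteq> C"
  shows "\<exists>x\<in>H. (\<forall>p\<in>H - {x}. \<forall>q\<in>H - {x}. p \<noteq> q \<longrightarrow> r p q \<or> r q p) \<and> (\<forall>p\<in>D. \<forall>q\<in>H - {x}. r p q) \<and>
    ((\<exists>c\<in>A. (\<forall>p\<in>D. r p c) \<and> (\<forall>q\<in>H - {x}. r c q)) \<or> (\<forall>p\<in>D. r p x) \<and> (\<forall>q\<in>H - {x}. r x q))"
proof -
  have CW: "C \<subseteq> W" and comp: "\<And>p q. p \<in> C \<Longrightarrow> q \<in> C \<Longrightarrow> p \<noteq> q \<Longrightarrow> r p q \<or> r q p"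
    using C(1) by (auto simp: chain_in_def)
  have finC: "finite C" using CW fin finite_subset by blast
  have DH: "r p q" if "p \<in> D" "q \<in> H" "q \<in> C" for p q
    using comp[of p q] that C(3) not_down(2)[of p q] split(2) by blast
  have cardC: "card (C \<inter> A) + card (C \<inter> H) = card H"
  proof -
    have "C = D \<union> (C \<inter> A) \<union> (C \<inter> H)" using CW C(3) cases_W by blast
    then have "card C = card (D \<union> (C \<inter> A) \<union> (C \<inter> H))" by simp
    also have "\<dots> = card (D \<union> (C \<inter> A)) + card (C \<inter> H)"
      by (rule card_Un_disjoint) (use split(2-4) finC in auto)
    also have "card (D \<union> (C \<inter> A)) = card D + card (C \<inter> A)"
      by (rule card_Un_disjoint) (use split(2-4) finC in auto)
    finally show ?thesis using C(2) cardDH by simp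
  qed
  show ?thesis
  proof (cases "C \<inter> A = {}")
    case True
    then have "card (C \<inter> H) = card H" using cardC by simp
    then have "C \<inter> H = H" by (intro card_subset_eq) auto
    then have HC: "H \<subseteq> C" by blast
    \<comment> \<open>Otherwise \<open>D\<close> is itself a longest chain, and an antichain element
      above its top would prolong it.\<close>
    have "H \<noteq> {}"
    proof
      assume H: "H = {}"
      have D: "D \<noteq> {}" using cardDH len_pos H by auto
      have "\<exists>e\<in>tops r D. e = e \<or> r e e" using ex_above_top[of D] D by auto
      then obtain e where e: "e \<in> D" "\<forall>q\<in>D. \<not> r e q" by (auto simp: tops_def)
      obtain y where y: "y \<in> A" "r e y" using e(1) by (auto simp: below_def)
      have "r p e \<or> p = e" if "p \<in> D" for p using comp[of p e] that e C(3) by blast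
      then have "\<forall>p\<in>D. r p y" using y local.trans by blast
      then show False
        using no_long_chain[OF y(1)] comp C(3) H by blast
    qed
    then have "\<exists>x\<in>bots r H. True" using ex_below_bot[of H] by auto
    then obtain x where x: "x \<in> H" "\<forall>q\<in>H. \<not> r q x" by (auto simp: bots_def)
    have "r x q" if "q \<in> H - {x}" for q using comp[of x q] that x HC by blast
    moreover have "r p q" if "p \<in> D" "q \<in> H" for p q using DH that HC by blast
    moreover have "r p q \<or> r q p" if "p \<in> H" "q \<in> H" "p \<noteq> q" for p q using comp that HC by blast
    ultimately show ?thesis using x(1) by blast
  next
    case False
    then obtain c where c: "c \<in> C" "c \<in> A" by blast
    have "C \<inter> A = {c}" using c comp unrel by blast
    then have card: "card H = Suc (card (C \<inter> H))" using cardC by simp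
    then have "card (H - C) = 1"
      using card_Diff_subset_Int[of H C] by (simp add: Int_commute)
    then obtain x where x: "H - C = {x}" by (meson card_1_singletonE)
    have q: "q \<in> C \<and> q \<in> H" if "q \<in> H - {x}" for q using that x by blast
    have "r p c" if "p \<in> D" for p using comp[of p c] that c C(3) not_down(1)[of p c] split(3) by blast
    moreover have "r c q" if "q \<in> H - {x}" for q
      using comp[of c q] q[OF that] c not_down(3)[of c q] split(4) by blast
    moreover have "r p q" if "p \<in> D" "q \<in> H - {x}" for p q using DH that q by blast
    moreover have "r p q' \<or> r q' p" if "p \<in> H - {x}" "q' \<in> H - {x}" "p \<noteq> q'" for p q'
      using comp q that by blast
    moreover have "x \<in> H" using x by blast
    ultimately show ?thesis using c(2) by blast
  qed
qed

end

text \<open>\<open>e\<close> and \<open>v\<close> list the two chains upwards. \<open>mid\<close>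
  records how the long chain passes from \<open>D\<close> to \<open>H - {x}\<close>, through an
  antichain element or through \<open>x\<close>; the remaining parameters are those of
  \<open>model\<close>.\<close>

locale enumerated = lowest_antichain r W A l for r :: "'a \<Rightarrow> 'a \<Rightarrow> bool" and W A :: "'a set" and l :: nat +
  fixes d m :: nat and e v :: "nat \<Rightarrow> 'a" and x :: 'a and \<sigma> \<tau> k :: nat and s t :: "'a \<Rightarrow> nat"
  assumes e: "bij_betw e {1..d} D" and ee: "\<And>i j. i \<in> {1..d} \<Longrightarrow> j \<in> {1..d} \<Longrightarrow> r (e i) (e j) \<longleftrightarrow> i < j"
    and v: "bij_betw v {1..m} (H - {x})" and vv: "\<And>i j. i \<in> {1..m} \<Longrightarrow> j \<in> {1..m} \<Longrightarrow> r (v i) (v j) \<longleftrightarrow> i < j"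
    and x: "x \<in> H" and ev: "\<And>i j. i \<in> {1..d} \<Longrightarrow> j \<in> {1..m} \<Longrightarrow> r (e i) (v j)"
    and mid: "(\<exists>c\<in>A. (\<forall>i\<in>{1..d}. r (e i) c) \<and> (\<forall>j\<in>{1..m}. r c (v j))) \<or>
      (\<forall>i\<in>{1..d}. r (e i) x) \<and> (\<forall>j\<in>{1..m}. r x (v j))"
    and sy: "\<And>y i. y \<in> A \<Longrightarrow> i \<in> {1..d} \<Longrightarrow> r (e i) y \<longleftrightarrow> i < s y" and s_range: "\<And>y. y \<in> A \<Longrightarrow> 1 \<le> s y \<and> s y \<le> d + 1"
    and ty: "\<And>y j. y \<in> A \<Longrightarrow> j \<in> {1..m} \<Longrightarrow> r y (v j) \<longleftrightarrow> t y < j" and t_range: "\<And>y. y \<in> A \<Longrightarrow> t y \<le> m"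
    and kx: "\<And>i. i \<in> {1..d} \<Longrightarrow> r (e i) x \<longleftrightarrow> i \<le> k" and k_range: "k \<le> d"
    and sx: "\<And>j. j \<in> {1..m} \<Longrightarrow> r (v j) x \<longleftrightarrow> j < \<sigma>" and sig_range: "1 \<le> \<sigma>" "\<sigma> \<le> m + 1"
    and tx: "\<And>j. j \<in> {1..m} \<Longrightarrow> r x (v j) \<longleftrightarrow> \<tau> < j" and tau_range: "\<tau> \<le> m"
begin

lemma eD: "i \<in> {1..d} \<Longrightarrow> e i \<in> D" and vH: "j \<in> {1..m} \<Longrightarrow> v j \<in> H \<and> v j \<noteq> x"
  using bij_betwE[OF e] bij_betwE[OF v] by blast+

lemma eD_ex: "p \<in> D \<Longrightarrow> \<exists>i\<in>{1..d}. p = e i" and vH_ex: "p \<in> H \<Longrightarrow> p \<noteq> x \<Longrightarrow> \<exists>j\<in>{1..m}. p = v j"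
  using bij_betw_imp_surj_on[OF e] bij_betw_imp_surj_on[OF v] by blast+

lemma inW: "i \<in> {1..d} \<Longrightarrow> e i \<in> W" "j \<in> {1..m} \<Longrightarrow> v j \<in> W" "x \<in> W" "y \<in> A \<Longrightarrow> y \<in> W"
  using eD vH x A_sub by (auto simp: below_def above_def)

lemma D_chain: "\<forall>p\<in>D. \<forall>q\<in>D. p \<noteq> q \<longrightarrow> r p q \<or> r q p"
proof (intro ballI impI)
  fix p q assume pq: "p \<in> D" "q \<in> D" "p \<noteq> q"
  then obtain i j where "p = e i" "q = e j" "i \<in> {1..d}" "j \<in> {1..d}" using eD_ex by blast
  then show "r p q \<or> r q p" using ee[of i j] ee[of j i] pq(3) by (cases i j rule: linorder_cases) auto
qed

lemma sigma_le: "\<sigma> \<le> \<tau> + 1"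
proof (rule ccontr)
  assume "\<not> \<sigma> \<le> \<tau> + 1"
  then have j: "\<tau> + 1 \<in> {1..m}" "\<tau> + 1 < \<sigma>" using sig_range by auto
  then have "r x (v (\<tau> + 1))" "r (v (\<tau> + 1)) x" using tx sx by auto
  then show False using asym by blast
qed

lemma H_chain:
  assumes "\<sigma> = \<tau> + 1"
  shows "\<forall>p\<in>H. \<forall>q\<in>H. p \<noteq> q \<longrightarrow> r p q \<or> r q p"
proof -
  have xv: "r x (v j) \<or> r (v j) x" if "j \<in> {1..m}" for j using tx[OF that] sx[OF that] assms by auto
  show ?thesis
  proof (intro ballI impI)
    fix p q assume pq: "p \<in> H" "q \<in> H" "p \<noteq> q"
    show "r p q \<or> r q p"
    proof (cases "p = x \<or> q = x")
      case True
      then show ?thesis using xv vH_ex pq by metis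
    next
      case False
      then obtain i j where "p = v i" "q = v j" "i \<in> {1..m}" "j \<in> {1..m}" using vH_ex pq by blast
      then show ?thesis using vv[of i j] vv[of j i] pq(3) by (cases i j rule: linorder_cases) auto
    qed
  qed
qed

text \<open>\<open>\<sigma> = \<tau> + 1\<close> would make \<open>x\<close> comparable to all of
  the upper chain, so \<open>H\<close> would be a chain. If moreover \<open>1 \<le> \<tau>\<close>,
  then \<open>x\<close> is above \<open>v 1\<close>, the middle element must lie in \<open>A\<close>
  and below all of \<open>H\<close>, and the chain through it is too long.\<close>

lemma sigma_tau: "\<sigma> \<le> \<tau> \<or> \<sigma> = 1 \<and> \<tau> = 0"
proof (rule ccontr)
  assume "\<not> ?thesis"
  then have st: "\<sigma> = \<tau> + 1" "1 \<le> \<tau>" using sigma_le sig_range by auto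
  then have one: "1 \<in> {1..m}" using tau_range by auto
  have vx: "r (v 1) x" using sx[OF one] st by simp
  then have "\<not> (\<forall>j\<in>{1..m}. r x (v j))" using one asym by blast
  then obtain c where c: "c \<in> A" "\<forall>i\<in>{1..d}. r (e i) c" "\<forall>j\<in>{1..m}. r c (v j)" using mid by blast
  then have "r c x" using one vx local.trans by blast
  then have "\<forall>p\<in>H. r c p" using c(3) vH_ex by metis
  moreover have "\<forall>p\<in>D. r p c" using c(2) eD_ex by metis
  ultimately show False using no_long_chain[OF c(1)] D_chain H_chain[OF st(1)] by blast
qed

lemma model: "model d m \<sigma> \<tau> k A s t (\<lambda>y. r y x)"
proof
  show "finite A" by simp
  show "1 \<le> s y" "s y \<le> d + 1" "t y \<le> m" if "y \<in> A" for y using s_range t_range that by simp_all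
  show "t y \<le> \<tau>" if y: "y \<in> A" "r y x" for y
  proof (rule ccontr)
    assume "\<not> t y \<le> \<tau>"
    then have t: "t y \<in> {1..m}" "\<tau> < t y" using t_range[OF y(1)] by auto
    then have "r y (v (t y))" using tx y(2) local.trans by blast
    then show False using ty[OF y(1) t(1)] by simp
  qed
  show "s y \<le> k + 1" if y: "y \<in> A" "r y x" for y
  proof (rule ccontr)
    assume "\<not> s y \<le> k + 1"
    then have k: "k + 1 \<in> {1..d}" "k + 1 < s y" using s_range[OF y(1)] by auto
    then have "r (e (k + 1)) x" using sy[OF y(1) k(1)] y(2) local.trans by blast
    then show False using kx[OF k(1)] by simp
  qed
  show "\<sigma> \<le> t y + 1" if y: "y \<in> A" "\<not> r y x" for y
  proof (rule ccontr)
    assume "\<not> \<sigma> \<le> t y + 1"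
    then have t: "t y + 1 \<in> {1..m}" "t y + 1 < \<sigma>" using sig_range by auto
    then have "r y x" using ty[OF y(1) t(1)] sx[OF t(1)] local.trans by (metis less_add_one)
    then show False using y(2) by simp
  qed
  show "k \<le> d" by (rule k_range)
  show "k = d" if "1 < \<sigma>"
  proof (cases "d = 0")
    case False
    then have "1 \<in> {1..m}" "d \<in> {1..d}" using that sig_range by auto
    then have "r (e d) x" using ev sx that local.trans by blast
    then show ?thesis using kx[of d] False k_range by simp
  qed (use k_range in simp)
  show "1 \<le> \<sigma>" "\<tau> \<le> m" using sig_range tau_range by simp_all
  show "\<sigma> \<le> \<tau> \<or> \<sigma> = 1 \<and> \<tau> = 0" by (rule sigma_tau)
  show "\<exists>y\<in>A. r y x" using x by (auto simp: above_def)
  show "(\<exists>y\<in>A. s y = d + 1 \<and> t y = 0) \<or> \<tau> = 0 \<and> k = d"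
    using mid
  proof
    assume "\<exists>c\<in>A. (\<forall>i\<in>{1..d}. r (e i) c) \<and> (\<forall>j\<in>{1..m}. r c (v j))"
    then obtain c where c: "c \<in> A" "\<forall>i\<in>{1..d}. r (e i) c" "\<forall>j\<in>{1..m}. r c (v j)" by blast
    have "s c = d + 1"
    proof (cases "d = 0")
      case False
      then have "d < s c" using c sy[OF c(1), of d] by simp
      then show ?thesis using s_range[OF c(1)] by simp
    qed (use s_range[OF c(1)] in simp)
    moreover have "t c = 0"
    proof (rule ccontr)
      assume "t c \<noteq> 0"
      then have "t c \<in> {1..m}" using t_range[OF c(1)] by simp
      then show False using c(3) ty[OF c(1)] by blast
    qed
    ultimately show ?thesis using c(1) by blast
  next
    assume xx: "(\<forall>i\<in>{1..d}. r (e i) x) \<and> (\<forall>j\<in>{1..m}. r x (v j))"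
    have "\<tau> = 0"
    proof (rule ccontr)
      assume "\<tau> \<noteq> 0"
      then have "\<tau> \<in> {1..m}" using tau_range by simp
      then show False using xx tx by blast
    qed
    moreover have "k = d"
    proof (cases "d = 0")
      case False
      then show ?thesis using xx kx[of d] k_range by simp
    qed (use k_range in simp)
    ultimately show ?thesis by simp
  qed
  show "\<exists>y\<in>A. \<exists>y'\<in>A. y \<noteq> y' \<and> s y = d + 1 \<and> s y' = d + 1" if d: "1 \<le> d"
  proof -
    have dd: "d \<in> {1..d}" using d by simp
    obtain y y' where y: "y \<in> A" "y' \<in> A" "y \<noteq> y'" "r (e d) y" "r (e d) y'"
      using two_above[OF eD[OF dd]] by blast
    have "s y = d + 1" "s y' = d + 1"
      using sy[OF y(1) dd] sy[OF y(2) dd] y s_range[OF y(1)] s_range[OF y(2)] by auto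
    then show ?thesis using y by blast
  qed
  show "(if 1 < \<sigma> then d + \<sigma> + 1 else if \<exists>y\<in>A. r y x \<and> s y = k + 1 then k + 2 else k + 1) \<le> d + 1 + \<tau>"
  proof (cases "1 < \<sigma>")
    case True
    then show ?thesis using sigma_tau by auto
  next
    case False
    show ?thesis
    proof (cases "\<exists>y\<in>A. r y x \<and> s y = k + 1")
      case True
      then obtain y where y: "y \<in> A" "r y x" "s y = k + 1" by blast
      \<comment> \<open>Otherwise \<open>y\<close> lies above all of \<open>D\<close> and, through
        \<open>x\<close>, below all of \<open>H\<close>, which \<open>no_long_chain\<close>
        forbids.\<close>
      have "k < d \<or> 1 \<le> \<tau>"
      proof (rule ccontr)
        assume "\<not> (k < d \<or> 1 \<le> \<tau>)"
        then have kd: "k = d" "\<tau> = 0" using k_range by auto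
        then have "\<sigma> = \<tau> + 1" using False sig_range by simp
        note H = H_chain[OF this]
        have "\<forall>p\<in>D. r p y"
        proof
          fix p assume "p \<in> D"
          then obtain i where i: "i \<in> {1..d}" "p = e i" using eD_ex by blast
          then show "r p y" using sy[OF y(1) i(1)] y(3) kd by simp
        qed
        moreover have "\<forall>p\<in>H. r y p"
        proof
          fix p assume p: "p \<in> H"
          show "r y p"
          proof (cases "p = x")
            case False
            then obtain j where j: "j \<in> {1..m}" "p = v j" using vH_ex p by blast
            then have "r x p" using tx[OF j(1)] kd by simp
            then show ?thesis by (rule local.trans[OF y(2)])
          qed (use y in simp)
        qed
        ultimately show False using no_long_chain[OF y(1)] D_chain H by blast
      qed
      then show ?thesis using True False k_range by auto
    next
      case none: False
      show ?thesis unfolding if_not_P[OF False] if_not_P[OF none] using k_range by simp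
    qed
  qed
qed

fun \<phi> :: "'a pt \<Rightarrow> 'a" where
  "\<phi> (E i) = e i" | "\<phi> (Y y) = y" | "\<phi> (U j) = v j" | "\<phi> X = x"

interpretation M: model d m \<sigma> \<tau> k A s t "\<lambda>y. r y x"
  by (rule model)

lemma card_D: "card D = d" and card_H: "card H = Suc m"
proof -
  show "card D = d" using bij_betw_same_card[OF e] by simp
  have "card (H - {x}) = m" using bij_betw_same_card[OF v] by simp
  moreover have "Suc (card (H - {x})) = card H" by (rule card_Suc_Diff1[OF finDH(2) x])
  ultimately show "card H = Suc m" by simp
qed

lemma \<phi>_bij: "bij_betw \<phi> M.V W"
proof -
  have sub: "\<phi> p \<in> W" if "p \<in> M.V" for p
    using that
  proof (cases rule: M.V_cases)
    case (1 i)
    then show ?thesis using inW(1)[of i] by simp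
  next
    case (2 y)
    then show ?thesis using inW(4)[of y] by simp
  next
    case (3 j)
    then show ?thesis using inW(2)[of j] by simp
  next
    case 4
    then show ?thesis using inW(3) by simp
  qed
  have sup: "\<exists>p\<in>M.V. w = \<phi> p" if "w \<in> W" for w
  proof -
    from cases_W[OF that] consider "w \<in> D" | "w \<in> A" | "w \<in> H" by blast
    then show ?thesis
    proof cases
      case 1
      then obtain i where "i \<in> {1..d}" "w = e i" using eD_ex by blast
      then show ?thesis by (intro bexI[of _ "E i"]) simp_all
    next
      case 2
      then show ?thesis by (intro bexI[of _ "Y w"]) simp_all
    next
      case 3
      show ?thesis
      proof (cases "w = x")
        case True
        then show ?thesis by (intro bexI[of _ X]) simp_all
      next
        case False
        then obtain j where "j \<in> {1..m}" "w = v j" using vH_ex 3 by blast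
        then show ?thesis by (intro bexI[of _ "U j"]) simp_all
      qed
    qed
  qed
  have img: "\<phi> ` M.V = W"
  proof (rule set_eqI)
    fix w show "w \<in> \<phi> ` M.V \<longleftrightarrow> w \<in> W" using sub sup by (metis imageE imageI)
  qed
  \<comment> \<open>Surjectivity is already known, so equality of the cardinalities gives
    injectivity.\<close>
  have "card M.V = d + card A + m + 1"
    using M.card_V[of "\<lambda>_. True", unfolded simp_thms Collect_mem_eq] by simp
  also have "\<dots> = card W" using card_W cardDH card_D card_H by simp
  finally have "card (\<phi> ` M.V) = card M.V" unfolding img by simp
  then have "inj_on \<phi> M.V" by (rule eq_card_imp_inj_on[OF M.finV])
  then show ?thesis unfolding bij_betw_def using img by blast
qed

lemma \<phi>_rel:
  assumes "p \<in> M.V" "q \<in> M.V"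
  shows "M.r p q \<longleftrightarrow> r (\<phi> p) (\<phi> q)"
proof -
  have n1: "\<not> r y (e i)" if "y \<in> A" "i \<in> {1..d}" for y i using not_down(1) eD that by blast
  have n2: "\<not> r (v j) (e i)" if "j \<in> {1..m}" "i \<in> {1..d}" for i j using not_down(2) eD vH that by blast
  have n3: "\<not> r x (e i)" if "i \<in> {1..d}" for i using not_down(2) eD x that by blast
  have n4: "\<not> r (v j) y" if "y \<in> A" "j \<in> {1..m}" for y j using not_down(3) vH that by blast
  have n5: "\<not> r x y" if "y \<in> A" for y using not_down(3) x that by blast
  show ?thesis
    using assms(1)
  proof (cases rule: M.V_cases)
    case (1 i)
    note p = this
    show ?thesis using assms(2) by (cases rule: M.V_cases) (use p ee ev sy kx M.r_simps[OF assms] in simp_all)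
  next
    case (2 y)
    note p = this
    show ?thesis using assms(2) by (cases rule: M.V_cases) (use p n1 unrel ty M.r_simps[OF assms] in simp_all)
  next
    case (3 j)
    note p = this
    show ?thesis using assms(2) by (cases rule: M.V_cases) (use p n2 n4 vv sx M.r_simps[OF assms] in simp_all)
  next
    case 4
    note p = this
    show ?thesis using assms(2) by (cases rule: M.V_cases) (use p n3 n5 tx irrefl M.r_simps[OF assms] in simp_all)
  qed
qed

text \<open>Inside \<open>H\<close>, the element \<open>v j\<close> has \<open>j - 1\<close>
  elements below it, and \<open>x\<close> in addition if \<open>\<tau> < j\<close>. These values run
  through \<open>0, ..., m\<close> and skip \<tau> only; \<open>x\<close> contributes
  \<open>\<sigma> - 1\<close>.\<close>

lemma card_below_H:
  "card {p \<in> H. card {q \<in> H. r q p} = c} = of_bool (c \<le> m \<and> c \<noteq> \<tau>) + of_bool (\<sigma> = Suc c)"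
proof -
  have vinj: "inj_on v {1..m}" using v by (simp add: bij_betw_def)
  have Hx: "H = insert x (v ` {1..m})" using bij_betw_imp_surj_on[OF v] x by blast
  have xn: "x \<notin> v ` {1..m}" using vH by blast
  have bx: "card {q \<in> H. r q x} = \<sigma> - 1"
  proof -
    have "{q \<in> H. r q x} = v ` {1..<\<sigma>}"
    proof (intro equalityI subsetI)
      fix q assume "q \<in> {q \<in> H. r q x}"
      then have q: "q \<in> H" "r q x" by simp_all
      then have "q \<noteq> x" using irrefl by blast
      then obtain j where "j \<in> {1..m}" "q = v j" using vH_ex q by blast
      then show "q \<in> v ` {1..<\<sigma>}" using sx[of j] q by auto
    next
      fix q assume "q \<in> v ` {1..<\<sigma>}"
      then obtain j where "j \<in> {1..<\<sigma>}" "q = v j" by blast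
      moreover from this have "j \<in> {1..m}" using sig_range by auto
      ultimately show "q \<in> {q \<in> H. r q x}" using sx[of j] vH[of j] by auto
    qed
    moreover have "inj_on v {1..<\<sigma>}" by (rule inj_on_subset[OF vinj]) (use sig_range in auto)
    ultimately show ?thesis by (simp add: card_image)
  qed
  have bv: "card {q \<in> H. r q (v j)} = j - 1 + of_bool (\<tau> < j)" if j: "j \<in> {1..m}" for j
  proof -
    have "{q \<in> H. r q (v j)} = v ` {1..<j} \<union> (if \<tau> < j then {x} else {})"
    proof (intro equalityI subsetI)
      fix q assume "q \<in> {q \<in> H. r q (v j)}"
      then have q: "q \<in> H" "r q (v j)" by simp_all
      show "q \<in> v ` {1..<j} \<union> (if \<tau> < j then {x} else {})"
      proof (cases "q = x")
        case True
        then show ?thesis using tx[OF j] q by simp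
      next
        case False
        then obtain i where "i \<in> {1..m}" "q = v i" using vH_ex q by blast
        then show ?thesis using vv[of i j] j q by auto
      qed
    next
      fix q assume "q \<in> v ` {1..<j} \<union> (if \<tau> < j then {x} else {})"
      then consider i where "i \<in> {1..<j}" "q = v i" | "q = x" "\<tau> < j" by (auto split: if_splits)
      then show "q \<in> {q \<in> H. r q (v j)}"
      proof cases
        case 1
        then have "i \<in> {1..m}" using j by auto
        then show ?thesis using vv[of i j] 1 j vH[of i] by auto
      next
        case 2
        then show ?thesis using tx[OF j] x by simp
      qed
    qed
    moreover have "inj_on v {1..<j}" by (rule inj_on_subset[OF vinj]) (use j in auto)
    moreover have "x \<notin> v ` {1..<j}" using xn j by auto
    ultimately show ?thesis by (simp add: card_image)
  qed
  \<comment> \<open>The value \<open>c\<close> comes from \<open>j = Suc c\<close> if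
    \<open>c < \<tau>\<close> and from \<open>j = c\<close> if \<open>\<tau> < c\<close>.\<close>
  have idx: "{j \<in> {1..m}. j - 1 + of_bool (\<tau> < j) = c} = (if c \<le> m \<and> c \<noteq> \<tau> then {if \<tau> < c then c else Suc c} else {})"
    using tau_range by (auto simp: of_bool_def split: if_splits)
  have eq: "{p \<in> H. card {q \<in> H. r q p} = c} =
    v ` {j \<in> {1..m}. j - 1 + of_bool (\<tau> < j) = c} \<union> (if \<sigma> = Suc c then {x} else {})"
  proof (intro equalityI subsetI)
    fix p assume "p \<in> {p \<in> H. card {q \<in> H. r q p} = c}"
    then have p: "p \<in> H" "card {q \<in> H. r q p} = c" by simp_all
    show "p \<in> v ` {j \<in> {1..m}. j - 1 + of_bool (\<tau> < j) = c} \<union> (if \<sigma> = Suc c then {x} else {})"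
    proof (cases "p = x")
      case True
      then have "\<sigma> = Suc c" using p(2) bx sig_range by simp
      then show ?thesis using True by simp
    next
      case False
      then obtain j where j: "j \<in> {1..m}" "p = v j" using vH_ex p by blast
      then have "j - 1 + of_bool (\<tau> < j) = c" using bv[OF j(1)] p(2) by simp
      then show ?thesis using j by blast
    qed
  next
    fix p assume "p \<in> v ` {j \<in> {1..m}. j - 1 + of_bool (\<tau> < j) = c} \<union> (if \<sigma> = Suc c then {x} else {})"
    then consider j where "j \<in> {1..m}" "j - 1 + of_bool (\<tau> < j) = c" "p = v j" | "p = x" "\<sigma> = Suc c"
      by (auto split: if_splits)
    then show "p \<in> {p \<in> H. card {q \<in> H. r q p} = c}"
    proof cases
      case 1
      then show ?thesis using bv[OF 1(1)] vH[OF 1(1)] by simp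
    next
      case 2
      then show ?thesis using bx x by simp
    qed
  qed
  have "card (v ` {j \<in> {1..m}. j - 1 + of_bool (\<tau> < j) = c}) = of_bool (c \<le> m \<and> c \<noteq> \<tau>)"
  proof -
    have "card (v ` {j \<in> {1..m}. j - 1 + of_bool (\<tau> < j) = c}) = card {j \<in> {1..m}. j - 1 + of_bool (\<tau> < j) = c}"
      by (rule card_image, rule inj_on_subset[OF vinj]) blast
    then show ?thesis unfolding idx by simp
  qed
  moreover have "v ` {j \<in> {1..m}. j - 1 + of_bool (\<tau> < j) = c} \<inter> (if \<sigma> = Suc c then {x} else {}) = {}"
    using xn by auto
  ultimately show ?thesis
    unfolding eq by (subst card_Un_disjoint) auto
qed

end


section \<open>Longest chains through the lower part, and the dual case\<close>

context lowest_antichain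
begin

definition through_below :: bool where
  "through_below \<longleftrightarrow> (\<exists>C. chain_in r W C \<and> card C = l \<and> D \<subseteq> C)"

lemma ex_enumerated:
  assumes "through_below"
  shows "\<exists>m e v x \<sigma> \<tau> k s t. enumerated r W A l (card D) m e v x \<sigma> \<tau> k s t \<and> card D + m + 1 = l"
proof -
  obtain C where C: "chain_in r W C" "card C = l" "D \<subseteq> C" using assms through_below_def by blast
  have compD: "\<forall>p\<in>D. \<forall>q\<in>D. p \<noteq> q \<longrightarrow> r p q \<or> r q p" using C(1,3) unfolding chain_in_def by blast
  obtain x where x: "x \<in> H" and compH: "\<forall>p\<in>H - {x}. \<forall>q\<in>H - {x}. p \<noteq> q \<longrightarrow> r p q \<or> r q p"
    and DH: "\<forall>p\<in>D. \<forall>q\<in>H - {x}. r p q"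
    and mid: "(\<exists>c\<in>A. (\<forall>p\<in>D. r p c) \<and> (\<forall>q\<in>H - {x}. r c q)) \<or> (\<forall>p\<in>D. r p x) \<and> (\<forall>q\<in>H - {x}. r x q)"
    using special_element[OF C] by blast
  define d m where "d = card D" and "m = card (H - {x})"
  have "Suc (card (H - {x})) = card H" by (rule card_Suc_Diff1[OF finDH(2) x])
  then have l: "d + m + 1 = l" using cardDH by (simp add: d_def m_def)
  obtain e where e: "bij_betw e {1..d} D" and ee: "\<forall>i\<in>{1..d}. \<forall>j\<in>{1..d}. r (e i) (e j) \<longleftrightarrow> i < j"
    using chain_enum[OF finDH(1) compD] unfolding d_def by blast
  have finHx: "finite (H - {x})" by simp
  obtain v where v: "bij_betw v {1..m} (H - {x})" and vv: "\<forall>i\<in>{1..m}. \<forall>j\<in>{1..m}. r (v i) (v j) \<longleftrightarrow> i < j"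
    using chain_enum[OF finHx compH] unfolding m_def by blast
  have eD: "e i \<in> D" if "i \<in> {1..d}" for i using bij_betwE[OF e] that by blast
  have vH: "v j \<in> H - {x}" if "j \<in> {1..m}" for j using bij_betwE[OF v] that by blast
  have e_mono: "r (e i) y" if "1 \<le> i" "i \<le> j" "j \<le> d" "r (e j) y" for i j y
  proof (cases "i = j")
    case False
    then have "r (e i) (e j)" using ee that by simp
    then show ?thesis using that(4) by (rule local.trans)
  qed (use that in simp)
  have v_mono: "r y (v j)" if "1 \<le> i" "i \<le> j" "j \<le> m" "r y (v i)" for i j y
  proof (cases "i = j")
    case False
    then have "r (v i) (v j)" using vv that by simp
    then show ?thesis by (rule local.trans[OF that(4)])
  qed (use that in simp)
  have v_down: "r (v i) y" if "1 \<le> i" "i \<le> j" "j \<le> m" "r (v j) y" for i j y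
  proof (cases "i = j")
    case False
    then have "r (v i) (v j)" using vv that by simp
    then show ?thesis using that(4) by (rule local.trans)
  qed (use that in simp)
  have "\<exists>c\<le>d. \<forall>i\<in>{1..d}. r (e i) y \<longleftrightarrow> i \<le> c" for y
    by (rule ex_initial_segment) (rule e_mono)
  then obtain s where s: "s y \<le> d" "\<forall>i\<in>{1..d}. r (e i) y \<longleftrightarrow> i \<le> s y" for y by metis
  have "\<exists>c\<le>m. \<forall>j\<in>{1..m}. r y (v j) \<longleftrightarrow> c < j" for y
    by (rule ex_final_segment) (rule v_mono)
  then obtain t where t: "t y \<le> m" "\<forall>j\<in>{1..m}. r y (v j) \<longleftrightarrow> t y < j" for y by metis
  have "\<exists>c\<le>m. \<forall>j\<in>{1..m}. r (v j) x \<longleftrightarrow> j \<le> c"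
    by (rule ex_initial_segment) (rule v_down)
  then obtain c where c: "c \<le> m" "\<forall>j\<in>{1..m}. r (v j) x \<longleftrightarrow> j \<le> c" by blast
  \<comment> \<open>The functions \<open>s\<close> and \<open>t\<close> are defined on all elements,
    so \<open>s x\<close> and \<open>t x\<close> serve as \<open>k\<close> and \<tau>. The
    successors convert the closed bounds of initial segments into the strict bounds of the
    model.\<close>
  have "enumerated r W A l d m e v x (Suc c) (t x) (s x) (\<lambda>y. Suc (s y)) t"
  proof (intro enumerated.intro lowest_antichain_axioms enumerated_axioms.intro)
    show "bij_betw e {1..d} D" "bij_betw v {1..m} (H - {x})" "x \<in> H" by (rule e v x)+
    show "r (e i) (e j) \<longleftrightarrow> i < j" if "i \<in> {1..d}" "j \<in> {1..d}" for i j using ee that by blast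
    show "r (v i) (v j) \<longleftrightarrow> i < j" if "i \<in> {1..m}" "j \<in> {1..m}" for i j using vv that by blast
    show "r (e i) (v j)" if "i \<in> {1..d}" "j \<in> {1..m}" for i j using DH eD vH that by blast
    show "(\<exists>c\<in>A. (\<forall>i\<in>{1..d}. r (e i) c) \<and> (\<forall>j\<in>{1..m}. r c (v j))) \<or>
      (\<forall>i\<in>{1..d}. r (e i) x) \<and> (\<forall>j\<in>{1..m}. r x (v j))"
      using mid eD vH by blast
    show "r (e i) y \<longleftrightarrow> i < Suc (s y)" if "i \<in> {1..d}" for y i using s(2) that by (simp add: less_Suc_eq_le)
    show "1 \<le> Suc (s y) \<and> Suc (s y) \<le> d + 1" for y using s(1) by simp
    show "r y (v j) \<longleftrightarrow> t y < j" if "j \<in> {1..m}" for y j using t(2) that by blast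
    show "t y \<le> m" for y by (rule t(1))
    show "r (e i) x \<longleftrightarrow> i \<le> s x" if "i \<in> {1..d}" for i using s(2) that by blast
    show "s x \<le> d" by (rule s(1))
    show "r (v j) x \<longleftrightarrow> j < Suc c" if "j \<in> {1..m}" for j using c(2) that by (simp add: less_Suc_eq_le)
    show "1 \<le> Suc c" "Suc c \<le> m + 1" using c(1) by simp_all
    show "r x (v j) \<longleftrightarrow> t x < j" if "j \<in> {1..m}" for j using t(2) that by blast
    show "t x \<le> m" by (rule t(1))
  qed
  then show ?thesis using l unfolding d_def by blast
qed

text \<open>Everything above an element outside \<open>D\<close> lies in \<open>H\<close>. When
  \<open>H\<close> is a chain, these elements together with \<open>p\<close> form the longest chain
  upwards from \<open>p\<close>.\<close>

lemma corank_outside: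
  assumes g: "is_rank (\<lambda>x y. r y x) W g" and H: "\<forall>p\<in>H. \<forall>q\<in>H. p \<noteq> q \<longrightarrow> r p q \<or> r q p"
    and p: "p \<in> W" "p \<notin> D"
  shows "g p = Suc (card {q \<in> W. r p q})"
proof (rule antisym)
  let ?S = "{q \<in> W. r p q}"
  have finS: "finite ?S" using fin by simp
  have pS: "p \<notin> ?S" using irrefl by blast
  have SH: "q \<in> H" if "q \<in> ?S" for q
    using cases_W[OF p(1)] p(2) above_A[of p q] H_up[of p q] that by blast
  obtain C where C: "chain_in (\<lambda>x y. r y x) W C" "card C = g p" "\<forall>y\<in>C. y = p \<or> r p y"
    using strict_order.rank_chain[OF dual g fin p(1)] by blast
  have "C \<subseteq> insert p ?S" using C(1,3) by (auto simp: chain_in_def)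
  then have "card C \<le> card (insert p ?S)" by (rule card_mono[rotated]) (use finS in simp)
  then show "g p \<le> Suc (card ?S)" using C(2) pS finS by simp
  have "chain_in (\<lambda>x y. r y x) W (insert p ?S)"
    unfolding chain_in_def
  proof (intro conjI ballI impI)
    show "insert p ?S \<subseteq> W" using p by blast
    fix a b assume "a \<in> insert p ?S" "b \<in> insert p ?S" "a \<noteq> b"
    then show "r b a \<or> r a b" using SH H by blast
  qed
  moreover have "\<forall>a\<in>insert p ?S. g a \<le> g p" using g p(1) by (auto simp: is_rank_def intro: less_imp_le)
  ultimately have "card (insert p ?S) \<le> g p" by (rule strict_order.card_chain_le[OF dual g])
  then show "Suc (card ?S) \<le> g p" using pS finS by simp
qed

text \<open>The two counts differ only at the top \<open>e\<close> of \<open>D\<close>. When a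
  longest chain contains \<open>D\<close>, the corank of \<open>e\<close> exceeds
  \<open>card H\<close> while more than \<open>card H\<close> elements lie above \<open>e\<close>,
  so \<open>e\<close> belongs to the second set only. Otherwise the second set is contained in the
  first. Both counts can be read off the flag data.\<close>

lemma through_below_iff_count:
  assumes f: "is_rank r W f" and g: "is_rank (\<lambda>x y. r y x) W g"
    and compD: "\<forall>p\<in>D. \<forall>q\<in>D. p \<noteq> q \<longrightarrow> r p q \<or> r q p" and compH: "\<forall>p\<in>H. \<forall>q\<in>H. p \<noteq> q \<longrightarrow> r p q \<or> r q p"
    and ne: "D \<noteq> {}"
  shows "through_below \<longleftrightarrow>
    card {p \<in> W. f p = card D \<and> card {q \<in> W. r p q} = card H} < card {p \<in> W. f p = card D \<and> card H < g p}"
proof -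
  let ?u = "\<lambda>p. card {q \<in> W. r p q}"
  have DW: "D \<subseteq> W" by (auto simp: below_def)
  obtain p0 where "p0 \<in> D" using ne by blast
  then obtain e where "e \<in> tops r D" using ex_above_top[OF finDH(1)] by blast
  then have e: "e \<in> D" "\<forall>q\<in>D. \<not> r e q" by (auto simp: tops_def)
  have eW: "e \<in> W" using e(1) DW by blast
  have below_e: "r p e" if "p \<in> D" "p \<noteq> e" for p using compD that e by blast
  have mono: "f p < f q" if "p \<in> W" "q \<in> W" "r p q" for p q using f that by (simp add: is_rank_def)
  have gmono: "g q < g p" if "p \<in> W" "q \<in> W" "r p q" for p q using g that by (simp add: is_rank_def)
  have fe: "f e = card D"
  proof (rule antisym)
    obtain C where C: "chain_in r W C" "card C = f e" "\<forall>y\<in>C. y = e \<or> r y e"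
      using rank_chain[OF f fin eW] by blast
    have "C \<subseteq> D"
    proof
      fix q assume q: "q \<in> C"
      then have "q \<in> W" by (rule subsetD[OF conjunct1[OF C(1)[unfolded chain_in_def]]])
      moreover have "q = e \<or> r q e" using C(3) q by (rule bspec)
      ultimately show "q \<in> D" using e(1) D_down[OF e(1), of q] by (elim disjE) simp_all
    qed
    then have "card C \<le> card D" by (rule card_mono[rotated]) simp
    then show "f e \<le> card D" using C(2) by simp
    have "chain_in r W D" using DW compD by (simp add: chain_in_def)
    moreover have "\<forall>p\<in>D. f p \<le> f e"
    proof
      fix p assume p: "p \<in> D"
      show "f p \<le> f e"
      proof (cases "p = e")
        case False
        then show ?thesis using mono[OF subsetD[OF DW p] eW below_e[OF p]] by simp
      qed simp
    qed
    ultimately show "card D \<le> f e" by (rule card_chain_le[OF f])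
  qed
  have fD: "f p \<noteq> card D" if "p \<in> D" "p \<noteq> e" for p
    using mono[OF subsetD[OF DW that(1)] eW below_e[OF that]] fe by simp
  \<comment> \<open>The other elements of \<open>D\<close> have smaller rank than \<open>e\<close>.
    Outside \<open>D\<close>, \<open>corank_outside\<close> applies, and at most
    \<open>card H\<close> elements lie above.\<close>
  have other: "f p = card D \<and> card H < g p \<longleftrightarrow> f p = card D \<and> ?u p = card H" if "p \<in> W" "p \<noteq> e" for p
  proof (cases "p \<in> D")
    case True
    then show ?thesis using fD that by blast
  next
    case False
    have "{q \<in> W. r p q} \<subseteq> H"
      using cases_W[OF that(1)] False above_A[of p] H_up[of p] by blast
    then have le: "?u p \<le> card H" by (rule card_mono[rotated]) simp
    have "card H < Suc (?u p) \<longleftrightarrow> ?u p = card H"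
    proof
      assume "card H < Suc (?u p)"
      then show "?u p = card H" using le by linarith
    next
      assume "?u p = card H"
      then show "card H < Suc (?u p)" by linarith
    qed
    then show ?thesis unfolding corank_outside[OF g compH that(1) False] by (simp only:)
  qed
  \<comment> \<open>A longest chain through \<open>D\<close> is \<open>D\<close> without
    \<open>e\<close>, followed by a chain upwards from \<open>e\<close> with
    \<open>card H + 1\<close> elements.\<close>
  have up: "through_below \<longleftrightarrow> card H < g e"
  proof
    assume through_below
    then obtain C where C: "chain_in r W C" "card C = l" "D \<subseteq> C" using through_below_def by blast
    let ?Z = "C - (D - {e})"
    have finC: "finite C" by (rule finite_subset[OF conjunct1[OF C(1)[unfolded chain_in_def]] fin])
    have "chain_in (\<lambda>x y. r y x) W ?Z" using C(1) unfolding chain_in_def by blast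
    moreover have "\<forall>q\<in>?Z. g q \<le> g e"
    proof
      fix q assume q: "q \<in> ?Z"
      then have qC: "q \<in> C" by blast
      then have qW: "q \<in> W" by (rule subsetD[OF conjunct1[OF C(1)[unfolded chain_in_def]]])
      show "g q \<le> g e"
      proof (cases "q = e")
        case False
        then have "q \<notin> D" using q by blast
        then have "\<not> r q e" using D_down[OF e(1) qW] by blast
        moreover have "r e q \<or> r q e"
          using C(1) subsetD[OF C(3) e(1)] qC False unfolding chain_in_def by blast
        ultimately have "r e q" by blast
        then show ?thesis using gmono[OF eW qW] by simp
      qed simp
    qed
    ultimately have "card ?Z \<le> g e" by (rule strict_order.card_chain_le[OF dual g])
    moreover have "card ?Z = card C - card (D - {e})"
      by (rule card_Diff_subset) (use C(3) in auto)
    moreover have "Suc (card (D - {e})) = card D" by (rule card_Suc_Diff1[OF finDH(1) e(1)])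
    ultimately show "card H < g e" using C(2) cardDH by linarith
  next
    assume ge: "card H < g e"
    obtain C where C: "chain_in (\<lambda>x y. r y x) W C" "card C = g e" "\<forall>y\<in>C. y = e \<or> r e y"
      using strict_order.rank_chain[OF dual g fin eW] by blast
    have finC: "finite C" by (rule finite_subset[OF conjunct1[OF C(1)[unfolded chain_in_def]] fin])
    have DC: "r p q" if pq: "p \<in> D - {e}" "q \<in> C" for p q
    proof -
      have pe: "r p e" by (rule below_e) (use pq(1) in simp_all)
      show ?thesis
      proof (cases "q = e")
        case True
        then show ?thesis using pe by simp
      next
        case False
        then have "r e q" using bspec[OF C(3) pq(2)] by simp
        then show ?thesis by (rule local.trans[OF pe])
      qed
    qed
    have chain: "chain_in r W (D \<union> C)"
      unfolding chain_in_def
    proof (intro conjI ballI impI)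
      show "D \<union> C \<subseteq> W" using C(1) DW by (simp add: chain_in_def)
      fix p q assume pq: "p \<in> D \<union> C" "q \<in> D \<union> C" "p \<noteq> q"
      have CC: "r p q \<or> r q p" if "p \<in> C" "q \<in> C"
        using C(1) that pq(3) unfolding chain_in_def by blast
      have DD: "r p q \<or> r q p" if "p \<in> D" "q \<in> D" using compD that pq(3) by blast
      have eD': "e \<in> D" by (rule e(1))
      have mix: "r p q \<or> r q p" if "p \<in> D" "q \<in> C"
      proof (cases "p = e")
        case True
        then show ?thesis using bspec[OF C(3) that(2)] pq(3) by simp
      next
        case False
        then show ?thesis using DC[of p q] that by simp
      qed
      have mix': "r p q \<or> r q p" if "p \<in> C" "q \<in> D"
      proof (cases "q = e")
        case True
        then show ?thesis using bspec[OF C(3) that(1)] pq(3) by simp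
      next
        case False
        then show ?thesis using DC[of q p] that by simp
      qed
      from pq(1,2) show "r p q \<or> r q p" using CC DD mix mix' by (elim UnE) simp_all
    qed
    have "(D - {e}) \<inter> C = {}" using DC irrefl by blast
    then have "card ((D - {e}) \<union> C) = card (D - {e}) + card C" by (rule card_Un_disjoint[rotated 2]) (use finC in simp_all)
    moreover have "card ((D - {e}) \<union> C) \<le> card (D \<union> C)" by (rule card_mono) (use finC in auto)
    moreover have "Suc (card (D - {e})) = card D" by (rule card_Suc_Diff1[OF finDH(1) e(1)])
    ultimately have "l \<le> card (D \<union> C)" using C(2) ge cardDH by linarith
    then have "card (D \<union> C) = l" using chain_le[OF chain] by simp
    then show through_below unfolding through_below_def using chain by blast
  qed
  \<comment> \<open>Of the two antichain elements above \<open>e\<close> given by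
    \<open>two_above\<close>, one lies outside the chain upwards from \<open>e\<close> and adds to
    the count.\<close>
  have ue: "card H < ?u e" if gH: "card H < g e"
  proof -
    obtain C where C: "chain_in (\<lambda>x y. r y x) W C" "card C = g e" "\<forall>y\<in>C. y = e \<or> r e y"
      using strict_order.rank_chain[OF dual g fin eW] by blast
    obtain y y' where y: "y \<in> A" "y' \<in> A" "y \<noteq> y'" "r e y" "r e y'" using two_above[OF e(1)] by blast
    have finC: "finite C" by (rule finite_subset[OF conjunct1[OF C(1)[unfolded chain_in_def]] fin])
    have "\<not> (y \<in> C \<and> y' \<in> C)"
    proof
      assume "y \<in> C \<and> y' \<in> C"
      then have "r y y' \<or> r y' y" using C(1) y(3) unfolding chain_in_def by blast
      then show False using unrel y(1,2) by blast
    qed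
    then obtain z where z: "z \<in> A" "r e z" "z \<notin> C" using y by blast
    have "insert z (C - {e}) \<subseteq> {q \<in> W. r e q}"
    proof
      fix q assume "q \<in> insert z (C - {e})"
      then consider "q = z" | "q \<in> C" "q \<noteq> e" by blast
      then show "q \<in> {q \<in> W. r e q}"
      proof cases
        case 1
        then show ?thesis using z subsetD[OF A_sub z(1)] by simp
      next
        case 2
        have "q \<in> W" using 2(1) by (rule subsetD[OF conjunct1[OF C(1)[unfolded chain_in_def]]])
        then show ?thesis using bspec[OF C(3) 2(1)] 2(2) by simp
      qed
    qed
    then have "card (insert z (C - {e})) \<le> ?u e" by (rule card_mono[rotated]) (use fin in simp)
    moreover have "card (insert z (C - {e})) = Suc (card (C - {e}))"
      by (rule card_insert_disjoint) (use finC z in simp_all)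
    moreover have "card C - 1 \<le> card (C - {e})" using diff_card_le_card_Diff[of "{e}" C] by simp
    ultimately show ?thesis using gH C(2) by linarith
  qed
  let ?M = "{p \<in> W. f p = card D \<and> ?u p = card H}" and ?N = "{p \<in> W. f p = card D \<and> card H < g p}"
  show ?thesis
  proof (cases "card H < g e")
    case True
    have "?N = insert e ?M"
    proof (rule set_eqI)
      fix p
      show "p \<in> ?N \<longleftrightarrow> p \<in> insert e ?M"
      proof (cases "p = e")
        case eq: True
        show ?thesis unfolding eq using True fe eW by simp
      next
        case False
        then show ?thesis using other[of p] unfolding mem_Collect_eq insert_iff by blast
      qed
    qed
    moreover have "e \<notin> ?M" using ue[OF True] by simp
    ultimately have "card ?N = Suc (card ?M)" using fin by simp
    then show ?thesis using up True by simp
  next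
    case False
    have "?N \<subseteq> ?M"
    proof
      fix p assume p: "p \<in> ?N"
      then have "p \<noteq> e" using False by blast
      then show "p \<in> ?M" using other[of p] p unfolding mem_Collect_eq by blast
    qed
    then have "card ?N \<le> card ?M" by (rule card_mono[rotated]) (use fin in simp)
    then show ?thesis using up False by simp
  qed
qed

text \<open>Such a chain loses at least one element of \<open>D\<close> and can gain at most one
  from \<open>A\<close>; to reach length \<open>l = card D + card H\<close> it must take all of
  \<open>H\<close>.\<close>

lemma not_through_below:
  assumes C: "chain_in r W C" "card C = l" and n: "\<not> D \<subseteq> C"
  shows "H \<subseteq> C"
proof -
  have CW: "C \<subseteq> W" using C(1) by (simp add: chain_in_def)
  have finC: "finite C" using CW fin finite_subset by blast
  have split_C: "C \<inter> D \<union> C \<inter> A \<union> C \<inter> H = C"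
  proof (intro equalityI subsetI)
    fix q assume "q \<in> C"
    then show "q \<in> C \<inter> D \<union> C \<inter> A \<union> C \<inter> H" using CW cases_W[of q] by blast
  qed blast
  have "card C \<le> card (C \<inter> D \<union> C \<inter> A) + card (C \<inter> H)"
    using card_Un_le[of "C \<inter> D \<union> C \<inter> A" "C \<inter> H"] unfolding split_C .
  moreover have "card (C \<inter> D \<union> C \<inter> A) \<le> card (C \<inter> D) + card (C \<inter> A)" by (rule card_Un_le)
  moreover have "card (C \<inter> D) < card D" by (rule psubset_card_mono[OF finDH(1)]) (use n in blast)
  moreover have "card (C \<inter> A) \<le> Suc 0"
  proof -
    have "\<forall>a\<in>C \<inter> A. \<forall>b\<in>C \<inter> A. a = b"
    proof (intro ballI, rule ccontr)
      fix a b assume ab: "a \<in> C \<inter> A" "b \<in> C \<inter> A" "a \<noteq> b"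
      then have "r a b \<or> r b a" using C(1) unfolding chain_in_def by blast
      then show False using unrel ab by blast
    qed
    then show ?thesis by (rule iffD2[OF card_le_Suc0_iff_eq[OF finite_Int[OF disjI1[OF finC]]]])
  qed
  ultimately have "card H \<le> card (C \<inter> H)" using C(2) cardDH by linarith
  then have "C \<inter> H = H" by (intro card_seteq[OF finDH(2)]) simp_all
  then show ?thesis by blast
qed

text \<open>A longest chain now contains \<open>H\<close>. The lowest maximum antichain of the
  reversed order may differ from \<open>A\<close>, but the part below it in that order is contained
  in \<open>H\<close>, hence in the chain.\<close>

lemma dual_through_below:
  assumes "\<not> through_below"
  shows "\<exists>A'. lowest_antichain (\<lambda>x y. r y x) W A' l \<and> lowest_antichain.through_below (\<lambda>x y. r y x) W A' l"
proof -
  obtain C where C: "chain_in r W C" "card C = l" using len by (auto simp: longest_chain_def)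
  have HC: "H \<subseteq> C" 
  proof (rule not_through_below[OF C])
    show "\<not> D \<subseteq> C"
    proof
      assume "D \<subseteq> C"
      then have "\<exists>C. chain_in r W C \<and> card C = l \<and> D \<subseteq> C" using C by (intro exI[of _ C] conjI)
      then show False using assms unfolding through_below_def by (rule notE[rotated])
    qed
  qed
  obtain A' where A': "lowest (\<lambda>x y. r y x) W A'" using ex_lowest[OF fin, of "\<lambda>x y. r y x"] by blast
  then have "max_antichain (\<lambda>x y. r y x) W A'" unfolding lowest_def by (rule conjunct1)
  then have mA': "max_antichain r W A'" by (rule iffD1[OF max_antichain_dual[of r W A']])
  have mA: "max_antichain (\<lambda>x y. r y x) W A" by (rule iffD2[OF max_antichain_dual[of r W A] maxA])
  have cA: "card A' = card A"
  proof (rule le_antisym)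
    show "card A' \<le> card A" "card A \<le> card A'" using mA' maxA unfolding max_antichain_def by blast+
  qed
  have ch: "chain_in (\<lambda>x y. r y x) W Z \<longleftrightarrow> chain_in r W Z" for Z
    unfolding chain_in_def by blast
  have LA: "lowest_antichain (\<lambda>x y. r y x) W A' l"
  proof (intro lowest_antichain.intro lowest_antichain_axioms.intro)
    show "strict_order (\<lambda>x y. r y x)" by (rule dual)
    show "finite W" by (rule fin)
    show "lowest (\<lambda>x y. r y x) W A'" by (rule A')
    show "longest_chain (\<lambda>x y. r y x) W l" using len unfolding longest_chain_def ch .
    show "1 \<le> l" by (rule len_pos)
    show "card W = l + card A'" using card_W cA by simp
  qed
  have "below (\<lambda>x y. r y x) W A' \<subseteq> below (\<lambda>x y. r y x) W A"
    by (rule strict_order.lowest_below_subset[OF dual A' mA fin])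
  then have "below (\<lambda>x y. r y x) W A' \<subseteq> C" using HC unfolding below_dual[of r W A] by (rule order_trans)
  moreover have "chain_in (\<lambda>x y. r y x) W C" using C(1) unfolding ch .
  ultimately have "lowest_antichain.through_below (\<lambda>x y. r y x) W A' l"
    unfolding lowest_antichain.through_below_def[OF LA] using C(2) by (intro exI[of _ C] conjI)
  then show ?thesis using LA by blast
qed

end

section \<open>Transfer between flag equivalent posets and the final isomorphism\<close>

text \<open>The data is the multiset \<open>{0, ..., m}\<close> with \<tau> removed and
  \<open>\<sigma> - 1\<close> added. It determines both parameters unless the two operations cancel,
  which the last hypotheses allow for \<open>\<tau> = 0\<close> only.\<close>

lemma sigma_tau_unique:
  fixes m \<sigma> \<tau> \<sigma>' \<tau>' :: nat
  assumes eq: "\<And>c. of_bool (c \<le> m \<and> c \<noteq> \<tau>) + of_bool (\<sigma> = Suc c) =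
      (of_bool (c \<le> m \<and> c \<noteq> \<tau>') + of_bool (\<sigma>' = Suc c) :: nat)"
    and "\<tau> \<le> m" "\<tau>' \<le> m" "1 \<le> \<sigma>" "1 \<le> \<sigma>'" "\<sigma> \<le> \<tau> \<or> \<sigma> = 1 \<and> \<tau> = 0" "\<sigma>' \<le> \<tau>' \<or> \<sigma>' = 1 \<and> \<tau>' = 0"
  shows "\<sigma> = \<sigma>' \<and> \<tau> = \<tau>'"
proof -
  have "\<tau> = \<tau>'"
  proof (rule ccontr)
    assume ne: "\<tau> \<noteq> \<tau>'"
    have "\<sigma> = Suc \<tau>"
    proof (rule ccontr)
      assume n: "\<sigma> \<noteq> Suc \<tau>"
      have "of_bool (\<tau> \<le> m \<and> \<tau> \<noteq> \<tau>') = (1::nat)" using ne assms(2) by simp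
      moreover have "of_bool (\<tau> \<le> m \<and> \<tau> \<noteq> \<tau>) = (0::nat)" "of_bool (\<sigma> = Suc \<tau>) = (0::nat)" using n by simp_all
      ultimately show False using eq[of \<tau>] by linarith
    qed
    moreover have "\<sigma>' = Suc \<tau>'"
    proof (rule ccontr)
      assume n: "\<sigma>' \<noteq> Suc \<tau>'"
      have "of_bool (\<tau>' \<le> m \<and> \<tau>' \<noteq> \<tau>) = (1::nat)" using ne assms(3) by simp
      moreover have "of_bool (\<tau>' \<le> m \<and> \<tau>' \<noteq> \<tau>') = (0::nat)" "of_bool (\<sigma>' = Suc \<tau>') = (0::nat)" using n by simp_all
      ultimately show False using eq[of \<tau>'] by linarith
    qed
    ultimately show False using assms(6,7) ne by linarith
  qed
  moreover have "\<sigma> = \<sigma>'"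
  proof (rule ccontr)
    assume n: "\<sigma> \<noteq> \<sigma>'"
    have s: "Suc (\<sigma> - 1) = \<sigma>" using assms(4) by simp
    have "of_bool (\<sigma> = Suc (\<sigma> - 1)) = (1::nat)" "of_bool (\<sigma>' = Suc (\<sigma> - 1)) = (0::nat)"
      unfolding s using n by simp_all
    then show False using eq[of "\<sigma> - 1"] unfolding \<open>\<tau> = \<tau>'\<close> by linarith
  qed
  ultimately show ?thesis by simp
qed

lemma iso_through_below:
  assumes P: "lowest_antichain r W A l" and Q: "lowest_antichain s W' A' l" and eq: "flag_equiv r W s W'"
    and uP: "lowest_antichain.through_below r W A l" and uQ: "lowest_antichain.through_below s W' A' l"
  shows "\<exists>f. bij_betw f W W' \<and> (\<forall>x\<in>W. \<forall>y\<in>W. r x y \<longleftrightarrow> s (f x) (f y))"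
proof -
  interpret P: lowest_antichain r W A l by (rule P)
  interpret Q: lowest_antichain s W' A' l by (rule Q)
  have soP: "strict_order r" and soQ: "strict_order s" by unfold_locales
  note low = flag_equiv_lowest[OF eq P.fin Q.fin soP soQ P.low Q.low]
  obtain m e v x \<sigma> \<tau> k st t where EP: "enumerated r W A l (card P.D) m e v x \<sigma> \<tau> k st t" and m: "card P.D + m + 1 = l"
    using P.ex_enumerated[OF uP] by blast
  obtain m' e' v' x' \<sigma>' \<tau>' k' st' t' where EQ: "enumerated s W' A' l (card P.D) m' e' v' x' \<sigma>' \<tau>' k' st' t'"
    and m': "card P.D + m' + 1 = l"
    using Q.ex_enumerated[OF uQ] unfolding low(1) by blast
  have mm: "m' = m" using m m' by simp
  let ?d = "card P.D"
  \<comment> \<open>The upper parts are flag equivalent on their own, so the distribution of the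
    numbers of elements below, taken inside them, agrees.\<close>
  have "\<sigma> = \<sigma>' \<and> \<tau> = \<tau>'"
  proof (rule sigma_tau_unique)
    show "of_bool (c \<le> m \<and> c \<noteq> \<tau>) + of_bool (\<sigma> = Suc c) =
      (of_bool (c \<le> m \<and> c \<noteq> \<tau>') + of_bool (\<sigma>' = Suc c) :: nat)" for c
      using flag_equiv_card_below[OF low(3) P.finDH(2) Q.finDH(2) soP soQ, of c]
      unfolding enumerated.card_below_H[OF EP] enumerated.card_below_H[OF EQ] mm .
    show "\<tau> \<le> m" "1 \<le> \<sigma>" by (rule enumerated.tau_range[OF EP] enumerated.sig_range(1)[OF EP])+
    show "\<tau>' \<le> m" "1 \<le> \<sigma>'" using enumerated.tau_range[OF EQ] enumerated.sig_range(1)[OF EQ] mm by simp_all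
    show "\<sigma> \<le> \<tau> \<or> \<sigma> = 1 \<and> \<tau> = 0" by (rule enumerated.sigma_tau[OF EP])
    show "\<sigma>' \<le> \<tau>' \<or> \<sigma>' = 1 \<and> \<tau>' = 0" by (rule enumerated.sigma_tau[OF EQ])
  qed
  then have EQ2: "enumerated s W' A' l ?d m e' v' x' \<sigma> \<tau> k' st' t'" using EQ mm by simp
  let ?V = "model.V ?d m A" and ?V' = "model.V ?d m A'"
  let ?r = "model.r ?d m \<sigma> \<tau> k A st t (\<lambda>y. r y x)" and ?s = "model.r ?d m \<sigma> \<tau> k' A' st' t' (\<lambda>y. s y x')"
  let ?p = "enumerated.\<phi> e v x" and ?q = "enumerated.\<phi> e' v' x'"
  note bp = enumerated.\<phi>_bij[OF EP] and bq = enumerated.\<phi>_bij[OF EQ2]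
  note rp = enumerated.\<phi>_rel[OF EP] and rq = enumerated.\<phi>_rel[OF EQ2]
  have "flags ?r ?V w = flags ?s ?V' w" for w
  proof -
    have "flags ?r ?V w = flags r W w" by (rule flags_bij[of ?p ?V W ?r r, OF bp rp])
    moreover have "flags ?s ?V' w = flags s W' w" by (rule flags_bij[of ?q ?V' W' ?s s, OF bq rq])
    ultimately show ?thesis using eq by (simp add: flag_equiv_def)
  qed
  then have fe: "flag_equiv ?r ?V ?s ?V'" by (simp add: flag_equiv_def)
  have tm: "two_models ?d m \<sigma> \<tau> k A st t (\<lambda>y. r y x) k' A' st' t' (\<lambda>y. s y x')"
    by (rule two_models.intro[OF enumerated.model[OF EP] enumerated.model[OF EQ2] two_models_axioms.intro[OF fe]])
  obtain f where f: "bij_betw f ?V ?V'" and fr: "\<forall>a\<in>?V. \<forall>b\<in>?V. ?r a b \<longleftrightarrow> ?s (f a) (f b)"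
    using two_models.iso[OF tm] by blast
  let ?i = "inv_into ?V ?p"
  have bi: "bij_betw ?i W ?V" by (rule bij_betw_inv_into[OF bp])
  have bij: "bij_betw (?q \<circ> (f \<circ> ?i)) W W'"
    by (rule bij_betw_trans[OF bij_betw_trans[OF bi f] bq])
  have "r a b \<longleftrightarrow> s ((?q \<circ> (f \<circ> ?i)) a) ((?q \<circ> (f \<circ> ?i)) b)" if ab: "a \<in> W" "b \<in> W" for a b
  proof -
    have i: "?i a \<in> ?V" "?i b \<in> ?V" using bij_betwE[OF bi] ab by blast+
    have fi: "f (?i a) \<in> ?V'" "f (?i b) \<in> ?V'" using bij_betwE[OF f] i by blast+
    have pi: "?p (?i a) = a" "?p (?i b) = b" using bij_betw_inv_into_right[OF bp] ab by blast+
    have "r a b \<longleftrightarrow> ?r (?i a) (?i b)" using rp[OF i] unfolding pi by blast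
    also have "\<dots> \<longleftrightarrow> ?s (f (?i a)) (f (?i b))" using fr i by blast
    also have "\<dots> \<longleftrightarrow> s (?q (f (?i a))) (?q (f (?i b)))" by (rule rq[OF fi])
    finally show ?thesis by simp
  qed
  then show ?thesis using bij by blast
qed

text \<open>Being a chain means that a longest chain has as many elements as the whole set, and both
  numbers are flag invariants.\<close>

lemma flag_equiv_chain:
  assumes eq: "flag_equiv r S s T" and fin: "finite S" "finite T" and so: "strict_order r" "strict_order s"
    and S: "\<forall>p\<in>S. \<forall>q\<in>S. p \<noteq> q \<longrightarrow> r p q \<or> r q p"
  shows "\<forall>p\<in>T. \<forall>q\<in>T. p \<noteq> q \<longrightarrow> s p q \<or> s q p"
proof -
  have "longest_chain r S (card S)"
    using S fin(1) by (auto simp: longest_chain_def chain_in_def intro: card_mono)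
  moreover obtain l' where l': "longest_chain s T l'" using strict_order.ex_longest_chain[OF so(2) fin(2)] by blast
  ultimately have "l' = card S" using flag_equiv_longest_chain[OF eq fin so] by metis
  then have "l' = card T" using flag_equiv_card[OF eq fin] by simp
  then obtain C where C: "chain_in s T C" "card C = card T" using l' by (auto simp: longest_chain_def)
  then have "C = T" using fin(2) by (simp add: card_subset_eq chain_in_def)
  then show ?thesis using C(1) by (simp add: chain_in_def)
qed

lemma card_rank_split:
  assumes "finite T"
  shows "card {p \<in> T. n < h p \<and> R p} = card {p \<in> T. h p = Suc n \<and> R p} + card {p \<in> T. Suc n < h p \<and> R p}"
proof -
  have "n < h p \<longleftrightarrow> h p = Suc n \<or> Suc n < h p" for p by auto
  then have eq: "{p \<in> T. n < h p \<and> R p} = {p \<in> T. h p = Suc n \<and> R p} \<union> {p \<in> T. Suc n < h p \<and> R p}" by blast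
  have "{p \<in> T. h p = Suc n \<and> R p} \<inter> {p \<in> T. Suc n < h p \<and> R p} = {}" by force
  then show ?thesis unfolding eq using assms by (subst card_Un_disjoint) simp_all
qed

lemma card_above_rank_layer:
  assumes "is_rank b T h"
  shows "card {p \<in> {p \<in> T. i < h p}. card {q \<in> {p \<in> T. i < h p}. b p q} = c} =
    card {p \<in> T. i < h p \<and> card {q \<in> T. b p q} = c}"
proof -
  have *: "{q \<in> {p \<in> T. i < h p}. b p q} = {q \<in> T. b p q}" if "p \<in> T" "i < h p" for p
    using assms that unfolding is_rank_def by fastforce
  have "{p \<in> {p \<in> T. i < h p}. card {q \<in> {p \<in> T. i < h p}. b p q} = c} =
    {p \<in> T. i < h p \<and> card {q \<in> T. b p q} = c}"
  proof (rule set_eqI)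
    fix p
    show "p \<in> {p \<in> {p \<in> T. i < h p}. card {q \<in> {p \<in> T. i < h p}. b p q} = c} \<longleftrightarrow>
      p \<in> {p \<in> T. i < h p \<and> card {q \<in> T. b p q} = c}"
    proof (cases "p \<in> T \<and> i < h p")
      case True
      then show ?thesis using *[of p] by simp
    next
      case False
      then show ?thesis by blast
    qed
  qed
  then show ?thesis by (simp only:)
qed

text \<open>Suppose the property holds on one side only. Then \<open>D\<close> is a chain there and
  \<open>H\<close> is a chain on the other side; by flag equivalence of the parts, both are chains
  on both sides. This puts \<open>through_below_iff_count\<close> at disposal twice, with equal
  counts.\<close>

lemma through_below_transfer:
  assumes P: "lowest_antichain r W A l" and Q: "lowest_antichain s W' A' l" and eq: "flag_equiv r W s W'"
    and uP: "lowest_antichain.through_below r W A l"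
  shows "lowest_antichain.through_below s W' A' l"
proof (rule ccontr)
  interpret P: lowest_antichain r W A l by (rule P)
  interpret Q: lowest_antichain s W' A' l by (rule Q)
  have soP: "strict_order r" and soQ: "strict_order s" by unfold_locales
  note low = flag_equiv_lowest[OF eq P.fin Q.fin soP soQ P.low Q.low]
  assume nQ: "\<not> Q.through_below"
  obtain C' where C': "chain_in s W' C'" "card C' = l" using Q.len by (auto simp: longest_chain_def)
  have nD: "\<not> Q.D \<subseteq> C'"
  proof
    assume "Q.D \<subseteq> C'"
    then have "\<exists>C. chain_in s W' C \<and> card C = l \<and> Q.D \<subseteq> C" using C' by (intro exI[of _ C'] conjI)
    then show False using nQ unfolding Q.through_below_def by (rule notE[rotated])
  qed
  then have "Q.H \<subseteq> C'" by (rule Q.not_through_below[OF C'])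
  then have QH: "\<forall>p\<in>Q.H. \<forall>q\<in>Q.H. p \<noteq> q \<longrightarrow> s p q \<or> s q p" using C'(1) unfolding chain_in_def by blast
  obtain C where C: "chain_in r W C" "P.D \<subseteq> C" using uP unfolding P.through_below_def by blast
  then have PD: "\<forall>p\<in>P.D. \<forall>q\<in>P.D. p \<noteq> q \<longrightarrow> r p q \<or> r q p" unfolding chain_in_def by blast
  have QD: "\<forall>p\<in>Q.D. \<forall>q\<in>Q.D. p \<noteq> q \<longrightarrow> s p q \<or> s q p"
    by (rule flag_equiv_chain[OF low(2) P.finDH(1) Q.finDH(1) soP soQ PD])
  have PH: "\<forall>p\<in>P.H. \<forall>q\<in>P.H. p \<noteq> q \<longrightarrow> r p q \<or> r q p"
    by (rule flag_equiv_chain[OF flag_equiv_sym[OF low(3)] Q.finDH(2) P.finDH(2) soQ soP QH])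
  have cD: "card P.D = card Q.D" by (rule low(1))
  have cH: "card P.H = card Q.H" by (rule flag_equiv_card[OF low(3) P.finDH(2) Q.finDH(2)])
  have neQ: "Q.D \<noteq> {}" using nD by blast
  then have pos: "0 < card Q.D" by (simp add: card_gt_0_iff)
  have neP: "P.D \<noteq> {}"
  proof
    assume "P.D = {}"
    then have "card P.D = 0" by (simp only: card.empty)
    then show False using pos cD by simp
  qed
  obtain f where f: "is_rank r W f" using P.ex_rank[OF P.fin] by (elim exE)
  obtain f' where f': "is_rank s W' f'" using Q.ex_rank[OF Q.fin] by (elim exE)
  obtain g where g: "is_rank (\<lambda>x y. r y x) W g" using strict_order.ex_rank[OF P.dual P.fin] by (elim exE)
  obtain g' where g': "is_rank (\<lambda>x y. s y x) W' g'" using strict_order.ex_rank[OF Q.dual Q.fin] by (elim exE)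
  obtain n where n: "card Q.D = Suc n" using pos by (cases "card Q.D") auto
  let ?h = "card Q.H"
  \<comment> \<open>Counts at rank exactly \<open>Suc n\<close> are differences of counts over two
    consecutive cuts.\<close>
  have N1: "card {p \<in> W. f p = Suc n \<and> ?h < g p} = card {p \<in> W'. f' p = Suc n \<and> ?h < g' p}"
  proof -
    have "card {p \<in> W. i < f p \<and> ?h < g p} = card {p \<in> W'. i < f' p \<and> ?h < g' p}" for i
      by (rule flag_equiv_card[OF flag_equiv_rank_corank[OF eq P.fin Q.fin f f' g g']]) (use P.fin Q.fin in simp_all)
    from this[of n] this[of "Suc n"] show ?thesis
      using card_rank_split[OF P.fin, of n f "\<lambda>p. ?h < g p"] card_rank_split[OF Q.fin, of n f' "\<lambda>p. ?h < g' p"]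
      by linarith
  qed
  have N2: "card {p \<in> W. f p = Suc n \<and> card {q \<in> W. r p q} = ?h} =
    card {p \<in> W'. f' p = Suc n \<and> card {q \<in> W'. s p q} = ?h}"
  proof -
    have "card {p \<in> W. i < f p \<and> card {q \<in> W. r p q} = ?h} = card {p \<in> W'. i < f' p \<and> card {q \<in> W'. s p q} = ?h}" for i
    proof -
      have "finite {p \<in> W. i < f p}" "finite {p \<in> W'. i < f' p}" using P.fin Q.fin by simp_all
      from flag_equiv_card_above[OF flag_equiv_rank_gt[OF eq P.fin Q.fin f f'] this soP soQ, of ?h]
      show ?thesis unfolding card_above_rank_layer[OF f] card_above_rank_layer[OF f'] .
    qed
    from this[of n] this[of "Suc n"] show ?thesis
      using card_rank_split[OF P.fin, of n f "\<lambda>p. card {q \<in> W. r p q} = ?h"]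
        card_rank_split[OF Q.fin, of n f' "\<lambda>p. card {q \<in> W'. s p q} = ?h"]
      by linarith
  qed
  have "card {p \<in> W. f p = Suc n \<and> card {q \<in> W. r p q} = ?h} < card {p \<in> W. f p = Suc n \<and> ?h < g p}"
    using iffD1[OF P.through_below_iff_count[OF f g PD PH neP] uP] unfolding cD cH n .
  then have "Q.through_below"
    unfolding N1 N2 by (intro iffD2[OF Q.through_below_iff_count[OF f' g' QD QH neQ, unfolded n]])
  then show False using nQ by (rule notE[rotated])
qed

text \<open>The distinction between the poset and its dual is itself invariant, so both posets can
  be reversed simultaneously; an isomorphism of the reversed orders is one of the original
  orders.\<close>

lemma iso_lowest_antichain:
  assumes P: "lowest_antichain r W A l" and Q: "lowest_antichain s W' A' l" and eq: "flag_equiv r W s W'"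
  shows "\<exists>f. bij_betw f W W' \<and> (\<forall>x\<in>W. \<forall>y\<in>W. r x y \<longleftrightarrow> s (f x) (f y))"
proof (cases "lowest_antichain.through_below r W A l")
  case True
  then have "lowest_antichain.through_below s W' A' l" by (rule through_below_transfer[OF P Q eq])
  then show ?thesis by (rule iso_through_below[OF P Q eq True])
next
  case False
  then have nQ: "\<not> lowest_antichain.through_below s W' A' l"
    using through_below_transfer[OF Q P flag_equiv_sym[OF eq]] by (rule contrapos_nn)
  obtain B' where B': "lowest_antichain (\<lambda>x y. s y x) W' B' l" "lowest_antichain.through_below (\<lambda>x y. s y x) W' B' l"
    using lowest_antichain.dual_through_below[OF Q nQ] by (elim exE conjE)
  obtain B where B: "lowest_antichain (\<lambda>x y. r y x) W B l" "lowest_antichain.through_below (\<lambda>x y. r y x) W B l"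
    using lowest_antichain.dual_through_below[OF P False] by (elim exE conjE)
  have "flag_equiv (\<lambda>x y. r y x) W (\<lambda>x y. s y x) W'"
    by (rule flag_equiv_dual[OF eq lowest_antichain.fin[OF P] lowest_antichain.fin[OF Q]])
  from iso_through_below[OF B(1) B'(1) this B(2) B'(2)] show ?thesis by blast
qed

theorem theorem4p13:
  fixes n m l k :: nat and P Q :: "(nat \<times> nat) set"
  assumes "naturally_labeled n P"
    and "has_shape n P (l # 2 # replicate k 1)"
    and "naturally_labeled m Q"
    and "K_gf m Q = K_gf n P"
  shows "poset_isomorphic m Q n P"
proof -
  let ?r = "strict_part P" and ?s = "strict_part Q"
  have soP: "strict_order ?r" and soQ: "strict_order ?s"
    using strict_order_strict_part assms(1,3) by blast+
  have eq: "flag_equiv ?s {1..m} ?r {1..n}"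
    by (rule K_gf_eq_flag_equiv[OF assms(3,1,4)])
  note shape = near_hook_shape[OF assms(1,2)]
  have fin: "finite {1..m}" "finite {1..n}" by simp_all
  have mn: "m = n" using flag_equiv_card[OF eq fin] by simp
  obtain l' where l': "longest_chain ?s {1..m} l'" using strict_order.ex_longest_chain[OF soQ fin(1)] by blast
  have ll: "l' = l" by (rule flag_equiv_longest_chain[OF eq fin soQ soP l' shape(2)])
  obtain A where A: "lowest ?r {1..n} A" using ex_lowest[OF fin(2), of ?r] by blast
  obtain B where B: "lowest ?s {1..m} B" using ex_lowest[OF fin(1), of ?s] by blast
  have mA: "max_antichain ?r {1..n} A" and mB: "max_antichain ?s {1..m} B"
    using A B by (simp_all add: lowest_def)
  have cA: "card A = k + 2" by (rule shape(3)[OF mA])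
  have cB: "card B = card A" by (rule flag_equiv_max_antichain[OF eq fin soQ soP mB mA])
  have l: "1 \<le> l" using assms(2) by (auto simp: has_shape_def is_partition_def)
  have LP: "lowest_antichain ?r {1..n} A l"
    by (intro lowest_antichain.intro lowest_antichain_axioms.intro soP fin A shape(2) l) (use cA shape(1) in simp)
  have LQ: "lowest_antichain ?s {1..m} B l"
    by (intro lowest_antichain.intro lowest_antichain_axioms.intro soQ fin B l'[unfolded ll] l) (use cA cB shape(1) mn in simp)
  obtain f where f: "bij_betw f {1..m} {1..n}" and fr: "\<forall>x\<in>{1..m}. \<forall>y\<in>{1..m}. ?s x y \<longleftrightarrow> ?r (f x) (f y)"
    using iso_lowest_antichain[OF LQ LP eq] by blast
  \<comment> \<open>\<open>strict_part\<close> forgets the diagonal; reflexivity of both orders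
    restores it.\<close>
  have reflP: "refl_on {1..n} P" and reflQ: "refl_on {1..m} Q"
    using assms(1,3) unfolding naturally_labeled_def partial_order_on_def preorder_on_def by blast+
  have "(x, y) \<in> Q \<longleftrightarrow> (f x, f y) \<in> P" if xy: "x \<in> {1..m}" "y \<in> {1..m}" for x y
  proof (cases "x = y")
    case True
    have "f x \<in> {1..n}" using bij_betwE[OF f] xy by blast
    then show ?thesis
      using True xy refl_onD[OF reflP] refl_onD[OF reflQ] by simp
  next
    case False
    then have "f x \<noteq> f y" using f xy by (meson bij_betw_imp_inj_on inj_onD)
    then show ?thesis using fr xy False unfolding strict_part_def by blast
  qed
  then show ?thesis using f unfolding poset_isomorphic_def by blast
qed

end
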